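(* Suppose that $0<\lambda<1-(1+m)(c/2)$, that $\frac{\mu+1}{\mu}\phi_d>\bar\phi_1$, and that $$y<\frac{\mu+1}{\mu}\,a_0\Big(\frac{\mu}{\mu-1}x\Big)\qquad\text{for both }(x,y)=(\phi_0^*,\phi_1^* )\text{ and }(x,y)=(0,\bar\phi_1).$$ Then the boundary function $\gamma(\cdot)$ of the stopping region $\Gamma=\{(x,y)\in\mathbb R_+^2:\gamma(x)\le y\}$ is continuously differentiable on its support $[0,\xi]$. The exit boundary $\partial\Gamma^x$ is not empty. The value function $v(\cdot,\cdot)$ is continuously differentiable on $\mathbb R_+^2\setminus\partial\Gamma^x$, but not differentiable on $\partial\Gamma^x$.
   Context: Fix constants $\lambda>0$, $\mu>1$, $c>0$, $m\in(-1,1)$; $\mathbb R_+=[0,\infty)$. On a probability space $(\Omega,\mathcal H,\mathbb P_0)$ let $N$ be a homogeneous Poisson process with rate $\mu$ and jump times $0=\sigma_0<\sigma_1<\sigma_2<\cdots$; $\mathbb F$ is the right-continuous enlargement with $\mathbb P_0$-null sets of its natural filtration, and $\mathcal S$ is the collection of all $\mathbb F$-stopping times. For $\phi_0,\phi_1\in\mathbb R$ let $x(t,\phi_0)$, $y(t,\phi_1)$, $t\in\mathbb R$, be the solutions of $$\frac{d}{dt}x(t,\phi_0)=(\lambda+1)x(t,\phi_0)+\frac{\lambda(1-m)}{\sqrt2},\ x(0,\phi_0)=\phi_0;\qquad \frac{d}{dt}y(t,\phi_1)=(\lambda-1)y(t,\phi_1)+\frac{\lambda(1+m)}{\sqrt2},\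 y(0,\phi_1)=\phi_1,$$ and let $S(\phi_0,\phi_1)=\big((1-\frac1\mu)\phi_0,(1+\frac1\mu)\phi_1\big)$. The process $\widetilde\Phi=(\widetilde\Phi^{(0)},\widetilde\Phi^{(1)})$ in $\mathbb R_+^2$ started at $(\phi_0,\phi_1)$ satisfies $\widetilde\Phi_0=(\phi_0,\phi_1)$, $\widetilde\Phi_t=\big(x(t-\sigma_n,\widetilde\Phi^{(0)}_{\sigma_n}),y(t-\sigma_n,\widetilde\Phi^{(1)}_{\sigma_n})\big)$ for $\sigma_n\le t<\sigma_{n+1}$, $n\ge0$, and $\widetilde\Phi_{\sigma_n}=S(\widetilde\Phi_{\sigma_n-})$ for $n\ge1$. $\mathbb E_0^{\phi_0,\phi_1}$ is the $\mathbb P_0$-expectation when $\widetilde\Phi_0=(\phi_0,\phi_1)$. With $g(\phi_0,\phi_1)=\phi_0+\phi_1-\frac{\lambda}{c}\sqrt2$, the value function is $$v(\phi_0,\phi_1)=\inf_{\tau\in\mathcal S}\mathbb E_0^{\phi_0,\phi_1}\Big[\int_0^\tau e^{-\lambda t}g(\widetilde\Phi_t)\,dt\Big],\qquad(\phi_0,\phi_1)\in\mathbb R_+^2.$$ The optimal stopping region is $\Gamma=\{(x,y)\in\mathbb R_+^2:v(x,y)=0\}$ and $\mathbf C=\mathbb R_+^2\setminus\Gamma$. The boundary function is $\gamma(x)=\inf\{y\in\mathbb R_+:(x,y)\in\Gamma\}$, $x\in\mathbb R_+$, with support $[0,\xi]$, $\xi=\inf\{x\in\mathbb R_+:\gamma(x)=0\}$.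 The exit boundary of $\Gamma$ is $$\partial\Gamma^x=\{(\phi_0,\phi_1)\in\Gamma:\ \text{there is }\delta>0\text{ with }(x(t,\phi_0),y(t,\phi_1))\in\mathbf C\text{ for all }t\in(0,\delta]\}.$$ Further notation: $\phi_d=\frac{\lambda(1+m)}{(1-\lambda)\sqrt2}$; the function $a_0:\mathbb R_+\to\mathbb R_+$ is $a_0(x)=-x+\frac{\lambda}{c}\sqrt2$ for $x\in[0,\frac{\lambda}{c}\sqrt2)$ and $a_0(x)=0$ for other $x\in\mathbb R_+$ (the boundary function of the region $\{(x,y)\in\mathbb R_+^2:g(x,y)<0\}$); $$(\phi_0^*,\phi_1^* )=\Big(\frac{\lambda}{\sqrt2}\Big(\frac{1-\lambda}{c}-1\Big),\ \frac{\lambda}{\sqrt2}\Big(\frac{1+\lambda}{c}+1\Big)\Big)$$ is the intersection of the straight lines $(\lambda+1)x+(\lambda-1)y+\lambda\sqrt2=0$ and $y=a_0(x)$; and $$\bar\phi_1=-\frac{\lambda(1+m)}{\sqrt2(\lambda-1)}+\Big[\phi_1^*+\frac{\lambda(1+m)}{\sqrt2(\lambda-1)}\Big]\Big[1+\phi_0^*\frac{\sqrt2(\lambda+1)}{\lambda(1-m)}\Big]^{-(\lambda-1)/(\lambda+1)},$$ so that $(0,\bar\phi_1)$ is the initial point on the $y$-axis of the curve $t\mapsto(x(t,0),y(t,\bar\phi_1))$, $t\in\mathbb R_+$, which passes through $(\phi_0^*,\phi_1^* )$.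
   Formalization: The exit boundary is claimed non-empty only when φ_0^*>0; in the borderline case φ_0^*=0 (c=1−λ), which the hypotheses allow (e.g. λ=c=1/2, μ=2, m=9/10), the exit boundary is empty, so the claim as printed fails there. *)

theory Defs
  imports "HOL-Probability.Probability"
begin

definition poisson_process ::
  "'a measure \<Rightarrow> real \<Rightarrow> (real \<Rightarrow> 'a \<Rightarrow> nat) \<Rightarrow> (nat \<Rightarrow> 'a \<Rightarrow> real) \<Rightarrow> bool"
where
  \<comment> \<open>\<open>N\<close> is a homogeneous Poisson process with rate \<open>mu\<close> on \<open>M\<close> with jump times
    \<open>0 = \<sigma> 0 < \<sigma> 1 < \<dots>\<close>. Times are real; only \<open>N t\<close> with \<open>t \<ge> 0\<close> matters.
    The last clause makes all paths counting paths, so natural subtraction never truncates.\<close>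
  "poisson_process M mu N \<sigma> \<longleftrightarrow>
     prob_space M \<and>
     (\<forall>t\<ge>0. N t \<in> measurable M (count_space UNIV)) \<and>
     (\<forall>s t. 0 \<le> s \<and> s < t \<longrightarrow>
        distr M (count_space UNIV) (\<lambda>\<omega>. N t \<omega> - N s \<omega>) = measure_pmf (poisson_pmf (mu * (t - s)))) \<and>
     (\<forall>n (t :: nat \<Rightarrow> real). 0 \<le> t 0 \<and> mono t \<longrightarrow>
        prob_space.indep_vars M (\<lambda>_. count_space UNIV) (\<lambda>i \<omega>. N (t (Suc i)) \<omega> - N (t i) \<omega>) {..<n}) \<and>
     (\<forall>\<omega>\<in>space M. \<sigma> 0 \<omega> = 0 \<and> strict_mono (\<lambda>n. \<sigma> n \<omega>) \<and>
        filterlim (\<lambda>n. \<sigma> n \<omega>) at_top sequentially \<and>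
        (\<forall>t\<ge>0. N t \<omega> = card {n. 1 \<le> n \<and> \<sigma> n \<omega> \<le> t}))"

text \<open>Filtrations are indexed by \<open>[0,\<infinity>]\<close> (type \<^typ>\<open>ennreal\<close>), so that
  \<^const>\<open>stopping_time\<close> covers stopping times with the value \<open>\<infinity>\<close>. The null sets
  added are those of the completed measure, i.e. all subsets of measurable null sets.\<close>

definition augmented_filtration :: "'a measure \<Rightarrow> (real \<Rightarrow> 'a \<Rightarrow> nat) \<Rightarrow> ennreal \<Rightarrow> 'a measure" where
  "augmented_filtration M N s =
     sigma (space M) ({N u -` B \<inter> space M | u B. 0 \<le> u \<and> ennreal u \<le> s} \<union> null_sets (completion M))"

text \<open>The index \<open>\<infinity>\<close> is inserted only so that the intersection is not empty at \<open>t = \<infinity>\<close>.\<close>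

definition usual_filtration :: "'a measure \<Rightarrow> (real \<Rightarrow> 'a \<Rightarrow> nat) \<Rightarrow> ennreal \<Rightarrow> 'a measure" where
  "usual_filtration M N t =
     sigma (space M) (\<Inter>s\<in>insert \<infinity> {t<..}. sets (augmented_filtration M N s))"

definition stopping_times :: "'a measure \<Rightarrow> (real \<Rightarrow> 'a \<Rightarrow> nat) \<Rightarrow> ('a \<Rightarrow> ennreal) set" where
  "stopping_times M N = {\<tau>. stopping_time (usual_filtration M N) \<tau>}"

definition affine_ode_sol :: "real \<Rightarrow> real \<Rightarrow> real \<Rightarrow> real \<Rightarrow> real" where
  "affine_ode_sol a b \<phi> =
     (THE f. f 0 = \<phi> \<and> (\<forall>t. (f has_real_derivative a * f t + b) (at t)))"

lemma affine_ode_sol_unique: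
  assumes f: "f 0 = \<phi>" "\<And>t. (f has_real_derivative a * f t + b) (at t)"
    and h: "h 0 = \<phi>" "\<And>t. (h has_real_derivative a * h t + b) (at t)"
  shows "f = (h :: real \<Rightarrow> real)"
proof
  fix t
  have "((\<lambda>t. (f t - h t) * exp (- a * t)) has_real_derivative 0) (at s)" for s
    by (auto intro!: derivative_eq_intros f(2) h(2) simp: algebra_simps)
  then have "(f t - h t) * exp (- a * t) = (f 0 - h 0) * exp (- a * 0)"
    using DERIV_isconst_all [of "\<lambda>t. (f t - h t) * exp (- a * t)" t 0] by simp
  then show "f t = h t"
    using f(1) h(1) by simp
qed

lemma affine_ode_sol_eq:
  "affine_ode_sol a b \<phi> t = (if a = 0 then \<phi> + b * t else - b / a + (\<phi> + b / a) * exp (a * t))"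
proof -
  let ?f = "\<lambda>t. if a = 0 then \<phi> + b * t else - b / a + (\<phi> + b / a) * exp (a * t)"
  have f0: "?f 0 = \<phi>"
    by simp
  have f: "(?f has_real_derivative a * ?f s + b) (at s)" for s
    by (cases "a = 0") (auto intro!: derivative_eq_intros simp: field_simps)
  have "affine_ode_sol a b \<phi> = ?f"
    unfolding affine_ode_sol_def
  proof (rule the_equality)
    show "?f 0 = \<phi> \<and> (\<forall>t. (?f has_real_derivative a * ?f t + b) (at t))"
      using f0 f by blast
  next
    fix h :: "real \<Rightarrow> real"
    assume h: "h 0 = \<phi> \<and> (\<forall>t. (h has_real_derivative a * h t + b) (at t))"
    show "h = ?f"
      by (rule affine_ode_sol_unique [where f = h and h = ?f and a = a and b = b,
            OF conjunct1 [OF h] spec [OF conjunct2 [OF h]] f0 f])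
  qed
  then show ?thesis
    by simp
qed

definition x_flow :: "real \<Rightarrow> real \<Rightarrow> real \<Rightarrow> real \<Rightarrow> real" where
  "x_flow lam m t \<phi>0 = affine_ode_sol (lam + 1) (lam * (1 - m) / sqrt 2) \<phi>0 t"

definition y_flow :: "real \<Rightarrow> real \<Rightarrow> real \<Rightarrow> real \<Rightarrow> real" where
  "y_flow lam m t \<phi>1 = affine_ode_sol (lam - 1) (lam * (1 + m) / sqrt 2) \<phi>1 t"

definition flow :: "real \<Rightarrow> real \<Rightarrow> real \<Rightarrow> real \<times> real \<Rightarrow> real \<times> real" where
  "flow lam m t p = (x_flow lam m t (fst p), y_flow lam m t (snd p))"

definition jump_map :: "real \<Rightarrow> real \<times> real \<Rightarrow> real \<times> real" where
  "jump_map mu p = ((1 - 1 / mu) * fst p, (1 + 1 / mu) * snd p)"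

primrec Phi_at_jump ::
  "(nat \<Rightarrow> 'a \<Rightarrow> real) \<Rightarrow> real \<Rightarrow> real \<Rightarrow> real \<Rightarrow> real \<times> real \<Rightarrow> 'a \<Rightarrow> nat \<Rightarrow> real \<times> real"
where
  "Phi_at_jump \<sigma> lam mu m p \<omega> 0 = p"
| "Phi_at_jump \<sigma> lam mu m p \<omega> (Suc n) =
     jump_map mu (flow lam m (\<sigma> (Suc n) \<omega> - \<sigma> n \<omega>) (Phi_at_jump \<sigma> lam mu m p \<omega> n))"

text \<open>\<open>N t \<omega>\<close> is the index \<open>n\<close> with \<open>\<sigma> n \<omega> \<le> t < \<sigma> (n+1) \<omega>\<close>.\<close>

definition Phi ::
  "(real \<Rightarrow> 'a \<Rightarrow> nat) \<Rightarrow> (nat \<Rightarrow> 'a \<Rightarrow> real) \<Rightarrow> real \<Rightarrow> real \<Rightarrow> real \<Rightarrow> real \<times> real \<Rightarrow> real \<Rightarrow> 'a \<Rightarrow> real \<times> real"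
where
  "Phi N \<sigma> lam mu m p t \<omega> =
     (let n = N t \<omega> in flow lam m (t - \<sigma> n \<omega>) (Phi_at_jump \<sigma> lam mu m p \<omega> n))"

text \<open>The integral of a function whose negative part has finite integral, with values in
  \<open>(-\<infinity>,\<infinity>]\<close>. The Bochner integral would return \<open>0\<close> where the value is \<open>\<infinity>\<close>, which does
  occur below, e.g. for \<open>\<tau> = \<infinity>\<close>.\<close>

definition ext_integral :: "'a measure \<Rightarrow> ('a \<Rightarrow> ereal) \<Rightarrow> ereal" where
  "ext_integral M f =
     enn2ereal (\<integral>\<^sup>+ x. e2ennreal (f x) \<partial>M) - enn2ereal (\<integral>\<^sup>+ x. e2ennreal (- f x) \<partial>M)"

definition running_cost :: "real \<Rightarrow> real \<Rightarrow> real \<times> real \<Rightarrow> real" where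
  "running_cost lam c p = fst p + snd p - lam / c * sqrt 2"

definition expected_cost ::
  "'a measure \<Rightarrow> (real \<Rightarrow> 'a \<Rightarrow> nat) \<Rightarrow> (nat \<Rightarrow> 'a \<Rightarrow> real) \<Rightarrow> real \<Rightarrow> real \<Rightarrow> real \<Rightarrow> real
    \<Rightarrow> real \<times> real \<Rightarrow> ('a \<Rightarrow> ennreal) \<Rightarrow> ereal"
where
  "expected_cost M N \<sigma> lam mu c m p \<tau> =
     ext_integral (completion M) (\<lambda>\<omega>.
       ext_integral lborel (\<lambda>t. ereal (indicator {t. 0 \<le> t \<and> ennreal t < \<tau> \<omega>} t *
         (exp (- lam * t) * running_cost lam c (Phi N \<sigma> lam mu m p t \<omega>)))))"

text \<open>The infimum lies in \<open>[- sqrt 2 / c, 0]\<close>, since the running cost is at least \<open>- lam / c * sqrt 2\<close>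
  and \<open>\<tau> = 0\<close> is admissible; so the conversion to \<^typ>\<open>real\<close> loses nothing.\<close>

definition value_function ::
  "'a measure \<Rightarrow> (real \<Rightarrow> 'a \<Rightarrow> nat) \<Rightarrow> (nat \<Rightarrow> 'a \<Rightarrow> real) \<Rightarrow> real \<Rightarrow> real \<Rightarrow> real \<Rightarrow> real
    \<Rightarrow> real \<times> real \<Rightarrow> real"
where
  "value_function M N \<sigma> lam mu c m p =
     real_of_ereal (INF \<tau>\<in>stopping_times M N. expected_cost M N \<sigma> lam mu c m p \<tau>)"

definition quadrant :: "(real \<times> real) set" where
  "quadrant = {0..} \<times> {0..}"

definition stopping_region :: "(real \<times> real \<Rightarrow> real) \<Rightarrow> (real \<times> real) set" where
  "stopping_region v = {p \<in> quadrant. v p = 0}"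

definition boundary_function :: "(real \<times> real) set \<Rightarrow> real \<Rightarrow> real" where
  "boundary_function \<Gamma> x = Inf {y. 0 \<le> y \<and> (x, y) \<in> \<Gamma>}"

definition support_end :: "(real \<Rightarrow> real) \<Rightarrow> real" where
  "support_end \<gamma> = Inf {x. 0 \<le> x \<and> \<gamma> x = 0}"

definition exit_boundary :: "real \<Rightarrow> real \<Rightarrow> (real \<times> real) set \<Rightarrow> (real \<times> real) set" where
  "exit_boundary lam m \<Gamma> =
     {p \<in> \<Gamma>. \<exists>\<delta>>0. \<forall>t\<in>{0<..\<delta>}. flow lam m t p \<in> quadrant - \<Gamma>}"

text \<open>\<open>f\<close>, regarded as a function on \<open>D\<close>, is continuously differentiable on \<open>A \<subseteq> D\<close>. The derivatives
  are taken within \<open>D\<close>, hence one-sided at boundary points of \<open>D\<close> that belong to \<open>D\<close>.\<close>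

definition continuously_differentiable_on ::
  "('a::real_normed_vector \<Rightarrow> 'b::real_normed_vector) \<Rightarrow> 'a set \<Rightarrow> 'a set \<Rightarrow> bool"
where
  "continuously_differentiable_on f D A \<longleftrightarrow>
     (\<exists>f' :: 'a \<Rightarrow> 'a \<Rightarrow>\<^sub>L 'b. continuous_on A f' \<and>
        (\<forall>x\<in>A. (f has_derivative blinfun_apply (f' x)) (at x within D)))"

definition phi_d :: "real \<Rightarrow> real \<Rightarrow> real" where
  "phi_d lam m = lam * (1 + m) / ((1 - lam) * sqrt 2)"

text \<open>\<open>a_0\<close> is a function on \<open>[0,\<infinity>)\<close>. Its value \<open>0\<close> at negative arguments matters: it makes an
  inequality \<open>y < r * a_0 lam c x\<close> with \<open>y > 0\<close> imply that \<open>x\<close> lies in the domain.\<close>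

definition a_0 :: "real \<Rightarrow> real \<Rightarrow> real \<Rightarrow> real" where
  "a_0 lam c x = (if 0 \<le> x \<and> x < lam / c * sqrt 2 then - x + lam / c * sqrt 2 else 0)"

text \<open>If \<open>lam = 1 - c\<close> then \<open>phi0_star lam c = 0\<close>, the deterministic path through
  \<open>(phi0_star, phi1_star)\<close> starts at that very point, and the exit boundary is empty. For
  \<open>lam > 1 - c\<close> the point lies outside the quadrant.\<close>

definition phi0_star :: "real \<Rightarrow> real \<Rightarrow> real" where
  "phi0_star lam c = lam / sqrt 2 * ((1 - lam) / c - 1)"

definition phi1_star :: "real \<Rightarrow> real \<Rightarrow> real" where
  "phi1_star lam c = lam / sqrt 2 * ((1 + lam) / c + 1)"

definition phi1_bar :: "real \<Rightarrow> real \<Rightarrow> real \<Rightarrow> real" where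
  "phi1_bar lam c m =
     - (lam * (1 + m) / (sqrt 2 * (lam - 1))) +
     (phi1_star lam c + lam * (1 + m) / (sqrt 2 * (lam - 1))) *
     (1 + phi0_star lam c * (sqrt 2 * (lam + 1) / (lam * (1 - m)))) powr (- (lam - 1) / (lam + 1))"

end

theory Submission
  imports Defs
begin

text \<open>Before the first jump the path is deterministic, so the value function is the fixed point \<open>val\<close> of
  \<open>w p = (INF t. F t p)\<close>, where \<open>F t p\<close> is the discounted integral of \<open>G = g + mu * w \<circ> S\<close> along the flow up to
  time \<open>t\<close>; that the fixed point is the value of the stopping problem follows by discretising time, the error
  of a step of length \<open>h\<close> being of order \<open>h\<^sup>2\<close>.

  Above the level \<open>phi_d\<close> a jump leads into the stopping region, so there \<open>G\<close> is the running cost \<open>g\<close>, which is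
  convex along the flow; below it \<open>G\<close> increases along the flow. Hence the minimiser of \<open>F t p\<close> over \<open>t\<close> is unique
  unless \<open>val p = 0\<close> and the minimum is also attained at some \<open>t > 0\<close>, and these exceptional points are exactly the exit boundary.
  The inequalities assumed at the two points keep the preimage of the exit boundary under the jump map in
  \<open>{g < 0}\<close>, and a path of the flow meets that preimage at most once. Therefore Danskin's theorem propagates strict
  differentiability of \<open>val\<close> from \<open>{y > phi1_bar}\<close>, where \<open>val\<close> vanishes, down to the whole quadrant
  without the exit boundary. At a point \<open>p\<close> of the exit boundary \<open>val\<close> vanishes on \<open>p + quadrant\<close>, so a derivative would
  be \<open>0\<close>, but \<open>val\<close> decreases at rate at least \<open>g p > 0\<close> along the flow.

  The boundary function is a maximum of affine functions with a unique maximiser as long as it exceeds \<open>phi_d\<close>,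
  and it solves \<open>G (x, \<gamma> x) = 0\<close> to the right of \<open>phi0_star\<close>; these ranges overlap and cover the support.\<close>

section \<open>The dynamic programming equation\<close>

text \<open>The running cost is unbounded and jumps stretch the second coordinate. Two devices make
  the estimates uniform: the Lipschitz constants of \<open>val\<close> come from the fixed point
  operator, and points of large weight are treated apart, where \<open>val\<close> vanishes and a
  one-sided bound suffices. Over a grid of mesh \<open>h\<close> up to time \<open>K\<close> the
  errors then add up to order \<open>K * h\<close>; what lies beyond \<open>K\<close> is discounted.

  The derivative of \<open>val\<close> at \<open>p\<close> involves the derivatives at the jump
  images of the whole path from \<open>p\<close>, and one of these images may lie on the exit
  boundary, where there is no derivative. A notion attached to single points is therefore needed
  that tolerates an exceptional time and still yields a continuous derivative; strict
  differentiability, phrased with two moving sequences, does both.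

  The path of the flow from \<open>(0, phi1_bar)\<close> is the one that touches the line
  \<open>g = 0\<close> at \<open>(phi0_star, phi1_star)\<close>: the exit points lie below it, and a
  linear inequality at the two ends of this arc extends to the whole arc by convexity.\<close>

lemma quadrant_iff: "p \<in> quadrant \<longleftrightarrow> 0 \<le> fst p \<and> 0 \<le> snd p"
  by (cases p) (auto simp: quadrant_def)

text \<open>The l1 metric suits maps that scale the two coordinates by separate factors, as the flow
  and the jump map do.\<close>

definition d1 :: "real \<times> real \<Rightarrow> real \<times> real \<Rightarrow> real" where
  "d1 a b = \<bar>fst a - fst b\<bar> + \<bar>snd a - snd b\<bar>"

locale poisson_disorder =
  fixes lam mu c m :: real
  assumes lam_pos: "0 < lam" and lam_lt_1: "lam < 1" and mu_gt_1: "1 < mu" and c_pos: "0 < c"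
    and m_gt: "-1 < m" and m_lt: "m < 1"
begin

abbreviation "fl \<equiv> flow lam m"
abbreviation "S \<equiv> jump_map mu"
abbreviation "g \<equiv> running_cost lam c"

definition "drift0 = lam * (1 - m) / sqrt 2"
definition "cost_shift = lam / c * sqrt 2"
text \<open>Equal to \<open>cost_shift / lam\<close>, the discounted total of the largest possible
  rate of gain, since \<open>g\<close> is at least \<open>- cost_shift\<close> on the
  quadrant.\<close>

definition "bound = sqrt 2 / c"
text \<open>A value function is at least \<open>- bound\<close>. As the first coordinate grows at least at speed \<open>drift0\<close>,
  the cost rate \<open>dyn_cost\<close> below is nonnegative after the time \<open>horizon\<close>, wherever the flow starts.\<close>

definition "horizon = (lam + mu) * bound / drift0"

lemma drift0_pos: "0 < drift0"
  using lam_pos m_lt by (simp add: drift0_def)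

lemma cost_shift_pos: "0 < cost_shift"
  using lam_pos c_pos by (simp add: cost_shift_def)

lemma bound_pos: "0 < bound"
  using c_pos by (simp add: bound_def)

lemma cost_shift_eq: "cost_shift = lam * bound"
  by (simp add: cost_shift_def bound_def)

lemma horizon_pos: "0 < horizon"
  using drift0_pos bound_pos lam_pos mu_gt_1 by (simp add: horizon_def)

lemma phi_d_pos: "0 < phi_d lam m"
  using lam_pos lam_lt_1 m_gt by (simp add: phi_d_def)

lemma fst_flow: "fst (fl t p) = (fst p + drift0 / (lam + 1)) * exp ((lam + 1) * t) - drift0 / (lam + 1)"
  using lam_pos by (simp add: flow_def x_flow_def affine_ode_sol_eq drift0_def)

text \<open>\<open>phi_d\<close> is the rest point of the second equation and attracts because
  \<open>lam < 1\<close>; the first coordinate is repelled from a negative rest point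
  instead.\<close>

lemma snd_flow: "snd (fl t p) = phi_d lam m + (snd p - phi_d lam m) * exp (- ((1 - lam) * t))"
proof -
  have "lam * (1 + m) / sqrt 2 / (lam - 1) = - phi_d lam m"
    using lam_lt_1 by (simp add: phi_d_def divide_simps) (simp add: algebra_simps)
  moreover have "(lam - 1) * t = - ((1 - lam) * t)" by (simp add: algebra_simps)
  ultimately show ?thesis
    using lam_lt_1 by (simp add: flow_def y_flow_def affine_ode_sol_eq)
qed

lemma fst_flow_diff: "fst (fl t p) - fst (fl t q) = exp ((lam + 1) * t) * (fst p - fst q)"
  by (simp add: fst_flow algebra_simps)

lemma snd_flow_diff: "snd (fl t p) - snd (fl t q) = exp (- ((1 - lam) * t)) * (snd p - snd q)"
  by (simp add: snd_flow algebra_simps)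

lemma flow_0 [simp]: "fl 0 p = p"
  by (simp add: prod_eq_iff fst_flow snd_flow)

lemma flow_flow: "fl s (fl t p) = fl (t + s) p"
  by (simp add: prod_eq_iff fst_flow snd_flow mult.assoc mult_exp_exp) (simp add: algebra_simps)

lemma flow_mono: "p \<le> q \<Longrightarrow> fl t p \<le> fl t q"
  by (auto simp: less_eq_prod_def fst_flow snd_flow intro!: mult_right_mono)

text \<open>From \<open>1 + x <= exp x\<close>. The speed is bounded below independently of the
  starting point, which is what makes \<open>horizon\<close> uniform.\<close>

lemma fst_flow_ge:
  assumes "p \<in> quadrant" "0 \<le> t"
  shows "fst p + drift0 * t \<le> fst (fl t p)"
proof -
  have "fst p + drift0 * t \<le> (fst p + drift0 / (lam + 1)) * (1 + (lam + 1) * t) - drift0 / (lam + 1)"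
  proof -
    have "(fst p + drift0 / (lam + 1)) * (1 + (lam + 1) * t) - drift0 / (lam + 1)
        = fst p + drift0 * t + fst p * ((lam + 1) * t)"
    proof -
      define k where "k = drift0 / (lam + 1)"
      then have "drift0 = k * (lam + 1)" using lam_pos by simp
      then show ?thesis unfolding k_def[symmetric] by (simp add: algebra_simps)
    qed
    then show ?thesis using assms lam_pos by (simp add: quadrant_iff)
  qed
  also have "\<dots> \<le> fst (fl t p)"
    using assms lam_pos drift0_pos exp_ge_add_one_self[of "(lam + 1) * t"]
    by (auto simp: fst_flow quadrant_iff intro!: mult_left_mono)
  finally show ?thesis .
qed

lemma snd_flow_ge_min:
  assumes "0 \<le> t"
  shows "min (snd p) (phi_d lam m) \<le> snd (fl t p)"
proof -
  have e: "0 < exp (- ((1 - lam) * t))" "exp (- ((1 - lam) * t)) \<le> 1"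
    using assms lam_lt_1 by auto
  show ?thesis
  proof (cases "snd p \<le> phi_d lam m")
    case True
    then have "(phi_d lam m - snd p) * exp (- ((1 - lam) * t)) \<le> phi_d lam m - snd p"
      using e by (simp add: mult_left_le)
    then show ?thesis by (auto simp: snd_flow algebra_simps)
  next
    case False
    then have "0 \<le> (snd p - phi_d lam m) * exp (- ((1 - lam) * t))" using e by simp
    then show ?thesis by (auto simp: snd_flow)
  qed
qed

lemma snd_flow_le_max:
  assumes "0 \<le> t"
  shows "snd (fl t p) \<le> max (snd p) (phi_d lam m)"
proof -
  have e: "0 < exp (- ((1 - lam) * t))" "exp (- ((1 - lam) * t)) \<le> 1"
    using assms lam_lt_1 by auto
  show ?thesis
  proof (cases "snd p \<le> phi_d lam m")
    case True
    then have "(snd p - phi_d lam m) * exp (- ((1 - lam) * t)) \<le> 0"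
      using e by (simp add: mult_le_0_iff)
    then show ?thesis by (auto simp: snd_flow)
  next
    case False
    then have "(snd p - phi_d lam m) * exp (- ((1 - lam) * t)) \<le> snd p - phi_d lam m"
      using e by (simp add: mult_left_le)
    then show ?thesis by (auto simp: snd_flow)
  qed
qed

lemma flow_in_quadrant: "p \<in> quadrant \<Longrightarrow> 0 \<le> t \<Longrightarrow> fl t p \<in> quadrant"
  using fst_flow_ge[of p t] snd_flow_ge_min[of t p] phi_d_pos drift0_pos
  by (auto simp: quadrant_iff min_def split: if_splits intro: order_trans[rotated])

lemma fst_jump: "fst (S p) = (1 - 1 / mu) * fst p"
  and snd_jump: "snd (S p) = (1 + 1 / mu) * snd p"
  by (simp_all add: jump_map_def)

lemma jump_in_quadrant: "p \<in> quadrant \<Longrightarrow> S p \<in> quadrant"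
  using mu_gt_1 by (simp add: quadrant_iff fst_jump snd_jump divide_simps)

lemma jump_mono: "p \<le> q \<Longrightarrow> S p \<le> S q"
  using mu_gt_1 by (auto simp: less_eq_prod_def fst_jump snd_jump intro!: mult_left_mono)

lemma continuous_on_fst_flow: "continuous_on U (\<lambda>u. fst (fl u p))"
  and continuous_on_snd_flow: "continuous_on U (\<lambda>u. snd (fl u p))"
  by (auto simp: fst_flow snd_flow intro!: continuous_intros)

lemma continuous_on_flow: "continuous_on U (\<lambda>u. fl u p)"
  using continuous_on_Pair[OF continuous_on_fst_flow[of U p] continuous_on_snd_flow[of U p]] by simp

lemma continuous_on_flow_pair: "continuous_on U (\<lambda>(u, p). fl u p)"
proof -
  have "continuous_on U (\<lambda>z. (fst (fl (fst z) (snd z)), snd (fl (fst z) (snd z))))"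
    by (auto simp: fst_flow snd_flow intro!: continuous_intros)
  then show ?thesis by (simp add: split_beta)
qed

lemma continuous_on_jump: "continuous_on U S"
  by (auto simp: jump_map_def[abs_def] intro!: continuous_intros)

text \<open>The value function solves \<open>w p = (INF t. path_cost w t p)\<close>: until the first jump, which occurs at
  rate \<open>mu\<close>, the path is deterministic, and after it the cost to go is \<open>w\<close> at the image under \<open>jump_map\<close>.\<close>

definition dyn_cost :: "(real \<times> real \<Rightarrow> real) \<Rightarrow> real \<times> real \<Rightarrow> real" where
  "dyn_cost w p = g p + mu * w (S p)"

definition path_cost :: "(real \<times> real \<Rightarrow> real) \<Rightarrow> real \<Rightarrow> real \<times> real \<Rightarrow> real" where
  "path_cost w t p = integral {0..t} (\<lambda>u. exp (- ((lam + mu) * u)) * dyn_cost w (fl u p))"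

text \<open>The Lipschitz constants are chosen to be reproduced by the fixed point operator:
  \<open>1 + (mu - 1) * L0 = exp ((mu - 1) * horizon)\<close>, and likewise for \<open>L1\<close>.\<close>

definition L0 :: real where "L0 = (exp ((mu - 1) * horizon) - 1) / (mu - 1)"
definition L1 :: real where "L1 = (exp ((mu + 1) * horizon) - 1) / (mu + 1)"

text \<open>Properties that the fixed point operator preserves without loss in the constants and
  that survive pointwise limits. The Lipschitz bound also supplies the continuity behind every
  integral below.\<close>

definition admissible :: "(real \<times> real \<Rightarrow> real) \<Rightarrow> bool" where
  "admissible w \<longleftrightarrow>
     (\<forall>p\<in>quadrant. - bound \<le> w p \<and> w p \<le> 0) \<and>
     (\<forall>p\<in>quadrant. \<forall>q\<in>quadrant. p \<le> q \<longrightarrow> w p \<le> w q) \<and>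
     (\<forall>p\<in>quadrant. \<forall>q\<in>quadrant. \<bar>w p - w q\<bar> \<le> L0 * \<bar>fst p - fst q\<bar> + L1 * \<bar>snd p - snd q\<bar>)"

lemma g_eq: "g p = fst p + snd p - cost_shift"
  by (simp add: running_cost_def cost_shift_def)

lemma L0_nonneg: "0 \<le> L0" and L1_nonneg: "0 \<le> L1"
  using mu_gt_1 horizon_pos by (auto simp: L0_def L1_def)

end

section \<open>The cost along the flow for an admissible function\<close>

locale admissible_fun = poisson_disorder +
  fixes w :: "real \<times> real \<Rightarrow> real"
  assumes adm: "admissible w"
begin

lemma w_ge: "p \<in> quadrant \<Longrightarrow> - bound \<le> w p" and w_le_0: "p \<in> quadrant \<Longrightarrow> w p \<le> 0"
  and w_mono: "p \<in> quadrant \<Longrightarrow> q \<in> quadrant \<Longrightarrow> p \<le> q \<Longrightarrow> w p \<le> w q"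
  and w_lipschitz: "p \<in> quadrant \<Longrightarrow> q \<in> quadrant \<Longrightarrow>
    \<bar>w p - w q\<bar> \<le> L0 * \<bar>fst p - fst q\<bar> + L1 * \<bar>snd p - snd q\<bar>"
  using adm by (auto simp: admissible_def)

lemma continuous_on_w: "continuous_on quadrant w"
proof (unfold continuous_on_def, intro ballI)
  fix p :: "real \<times> real" assume p: "p \<in> quadrant"
  have "((\<lambda>q. L0 * \<bar>fst p - fst q\<bar> + L1 * \<bar>snd p - snd q\<bar>) \<longlongrightarrow> L0 * \<bar>fst p - fst p\<bar> + L1 * \<bar>snd p - snd p\<bar>) (at p within quadrant)"
    by (intro tendsto_intros)
  then have "((\<lambda>q. L0 * \<bar>fst p - fst q\<bar> + L1 * \<bar>snd p - snd q\<bar>) \<longlongrightarrow> 0) (at p within quadrant)" by simp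
  then have "((\<lambda>q. w p - w q) \<longlongrightarrow> 0) (at p within quadrant)"
    by (rule Lim_null_comparison[rotated])
       (use w_lipschitz[OF p] in \<open>auto simp: eventually_at_filter intro!: always_eventually\<close>)
  from tendsto_diff[OF tendsto_const[of "w p"] this] show "(w \<longlongrightarrow> w p) (at p within quadrant)" by simp
qed

abbreviation "G \<equiv> dyn_cost w"
abbreviation "F \<equiv> path_cost w"

lemma continuous_on_G: "continuous_on quadrant G"
  unfolding dyn_cost_def[abs_def] running_cost_def[abs_def]
  by (intro continuous_intros continuous_on_compose2[OF continuous_on_w continuous_on_jump] jump_in_quadrant)
     (auto intro: jump_in_quadrant)

lemma continuous_on_G_flow:
  assumes "p \<in> quadrant" "U \<subseteq> {0..}"
  shows "continuous_on U (\<lambda>u. G (fl u p))"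
  by (rule continuous_on_compose2[OF continuous_on_G continuous_on_flow])
     (use assms flow_in_quadrant in blast)

lemma continuous_on_integrand:
  assumes "p \<in> quadrant" "U \<subseteq> {0..}"
  shows "continuous_on U (\<lambda>u. exp (- ((lam + mu) * u)) * G (fl u p))"
  by (intro continuous_intros continuous_on_G_flow assms)

lemma integrand_integrable:
  assumes "p \<in> quadrant" "0 \<le> s"
  shows "(\<lambda>u. exp (- ((lam + mu) * u)) * G (fl u p)) integrable_on {s..t}"
  by (intro integrable_continuous_interval continuous_on_integrand) (use assms in auto)

lemma path_cost_0 [simp]: "F 0 p = 0"
  by (simp add: path_cost_def)

lemma path_cost_split:
  assumes "p \<in> quadrant" "0 \<le> s" "s \<le> t"
  shows "F t p = F s p + integral {s..t} (\<lambda>u. exp (- ((lam + mu) * u)) * G (fl u p))"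
  unfolding path_cost_def
  by (rule Henstock_Kurzweil_Integration.integral_combine[symmetric]) (use assms in \<open>auto intro: integrand_integrable\<close>)

lemma path_cost_add:
  assumes p: "p \<in> quadrant" and "0 \<le> s" "0 \<le> t"
  shows "F (s + t) p = F s p + exp (- ((lam + mu) * s)) * F t (fl s p)"
proof -
  let ?f = "\<lambda>u. exp (- ((lam + mu) * u)) * G (fl u p)"
  have "integral {s..s + t} ?f = integral {0..t} (\<lambda>u. ?f (u + s))"
    using integral_shift_Icc_real[of 0 t ?f s] by (simp add: add.commute comp_def)
  also have "\<dots> = exp (- ((lam + mu) * s)) * F t (fl s p)"
    unfolding path_cost_def
    by (subst integral_mult_right[symmetric])
       (auto intro!: integral_cong simp: flow_flow mult.assoc[symmetric] mult_exp_exp add.commute,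
        simp add: algebra_simps)
  finally show ?thesis
    using path_cost_split[of p s "s + t"] assms by simp
qed

lemma continuous_on_path_cost:
  assumes "p \<in> quadrant"
  shows "continuous_on {0..t} (\<lambda>t. F t p)"
  unfolding path_cost_def
  by (rule indefinite_integral_continuous_1) (use assms integrand_integrable in auto)

lemma path_cost_has_derivative:
  assumes "p \<in> quadrant" "0 \<le> t" "t \<le> b"
  shows "((\<lambda>t. F t p) has_real_derivative exp (- ((lam + mu) * t)) * G (fl t p)) (at t within {0..b})"
  unfolding path_cost_def
  by (rule integral_has_real_derivative[OF continuous_on_integrand]) (use assms in auto)

text \<open>In the first coordinate the flow contributes \<open>exp ((lam + 1) * u)\<close> and the
  jump term the factor \<open>1 + (mu - 1) * L0 = exp ((mu - 1) * horizon)\<close>. After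
  discounting, \<open>exp ((mu - 1) * (horizon - u))\<close> remains, whose integral over
  \<open>{0..horizon}\<close> is \<open>L0\<close> again; the second coordinate works alike with
  \<open>mu + 1\<close> and \<open>L1\<close>.\<close>

lemma path_cost_lipschitz:
  assumes p: "p \<in> quadrant" and q: "q \<in> quadrant" and t: "0 \<le> t" "t \<le> horizon"
  shows "\<bar>F t p - F t q\<bar> \<le> L0 * \<bar>fst p - fst q\<bar> + L1 * \<bar>snd p - snd q\<bar>"
proof -
  \<comment> \<open>Within this proof \<open>d1\<close> is a number, the distance of the second
    coordinates, and hides the metric of that name.\<close>
  define d0 where "d0 = \<bar>fst p - fst q\<bar>"
  define d1 where "d1 = \<bar>snd p - snd q\<bar>"
  define h where "h u = exp ((mu - 1) * (horizon - u)) * d0 + exp ((mu + 1) * (horizon - u)) * d1" for u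
  let ?f = "\<lambda>p u. exp (- ((lam + mu) * u)) * G (fl u p)"
  have d: "0 \<le> d0" "0 \<le> d1" by (auto simp: d0_def d1_def)
  have hint: "(h has_integral L0 * d0 + L1 * d1) {0..horizon}"
  proof -
    define e0 e1 where "e0 = d0 / (mu - 1)" and "e1 = d1 / (mu + 1)"
    have e: "d0 = e0 * (mu - 1)" "d1 = e1 * (mu + 1)" using mu_gt_1 by (auto simp: e0_def e1_def)
    define H where "H u = - exp ((mu - 1) * (horizon - u)) * e0 - exp ((mu + 1) * (horizon - u)) * e1" for u
    have "(h has_integral H horizon - H 0) {0..horizon}"
      by (rule fundamental_theorem_of_calculus)
         (use mu_gt_1 horizon_pos in \<open>auto simp: H_def h_def e simp flip: has_real_derivative_iff_has_vector_derivative
           intro!: derivative_eq_intros simp: algebra_simps\<close>)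
    moreover have "H horizon - H 0 = L0 * d0 + L1 * d1"
    proof -
      have "L0 * d0 = (exp ((mu - 1) * horizon) - 1) * e0" "L1 * d1 = (exp ((mu + 1) * horizon) - 1) * e1"
        by (simp_all add: L0_def L1_def e0_def e1_def)
      then show ?thesis by (simp add: H_def algebra_simps)
    qed
    ultimately show ?thesis by simp
  qed
  have hcont: "continuous_on U h" for U by (auto simp: h_def[abs_def] intro!: continuous_intros)
  have le: "\<bar>?f p u - ?f q u\<bar> \<le> h u" if u: "u \<in> {0..t}" for u
  proof -
    have e0: "1 + (mu - 1) * L0 = exp ((mu - 1) * horizon)" using mu_gt_1 by (simp add: L0_def)
    have e1: "1 + (mu + 1) * L1 = exp ((mu + 1) * horizon)" using mu_gt_1 by (simp add: L1_def)
    have "\<bar>w (S (fl u p)) - w (S (fl u q))\<bar>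
        \<le> L0 * \<bar>fst (S (fl u p)) - fst (S (fl u q))\<bar> + L1 * \<bar>snd (S (fl u p)) - snd (S (fl u q))\<bar>"
      using u p q by (intro w_lipschitz jump_in_quadrant flow_in_quadrant) auto
    also have "fst (S (fl u p)) - fst (S (fl u q)) = (1 - 1 / mu) * (exp ((lam + 1) * u) * (fst p - fst q))"
      by (simp only: fst_jump right_diff_distrib[symmetric] fst_flow_diff)
    also have "snd (S (fl u p)) - snd (S (fl u q)) = (1 + 1 / mu) * (exp (- ((1 - lam) * u)) * (snd p - snd q))"
      by (simp only: snd_jump right_diff_distrib[symmetric] snd_flow_diff)
    finally have "mu * \<bar>w (S (fl u p)) - w (S (fl u q))\<bar>
        \<le> mu * (L0 * ((1 - 1 / mu) * (exp ((lam + 1) * u) * d0)) + L1 * ((1 + 1 / mu) * (exp (- ((1 - lam) * u)) * d1)))"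
      using mu_gt_1 by (simp add: abs_mult d0_def d1_def)
    also have "\<dots> = L0 * ((mu - 1) * (exp ((lam + 1) * u) * d0)) + L1 * ((mu + 1) * (exp (- ((1 - lam) * u)) * d1))"
      using mu_gt_1 by (simp add: field_simps)
    finally have 1: "mu * \<bar>w (S (fl u p)) - w (S (fl u q))\<bar>
       \<le> L0 * ((mu - 1) * (exp ((lam + 1) * u) * d0)) + L1 * ((mu + 1) * (exp (- ((1 - lam) * u)) * d1))" .
    have "g (fl u p) - g (fl u q) = (fst (fl u p) - fst (fl u q)) + (snd (fl u p) - snd (fl u q))"
      by (simp add: g_eq)
    then have "\<bar>g (fl u p) - g (fl u q)\<bar> \<le> exp ((lam + 1) * u) * d0 + exp (- ((1 - lam) * u)) * d1"
      by (simp add: fst_flow_diff snd_flow_diff d0_def d1_def)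
         (metis abs_triangle_ineq abs_mult abs_exp_cancel)
    moreover have "\<bar>G (fl u p) - G (fl u q)\<bar> \<le> \<bar>g (fl u p) - g (fl u q)\<bar> + mu * \<bar>w (S (fl u p)) - w (S (fl u q))\<bar>"
    proof -
      have "G (fl u p) - G (fl u q) = (g (fl u p) - g (fl u q)) + mu * (w (S (fl u p)) - w (S (fl u q)))"
        by (simp add: dyn_cost_def algebra_simps)
      then show ?thesis using mu_gt_1 abs_triangle_ineq abs_mult by (metis abs_of_pos order_less_trans zero_less_one)
    qed
    ultimately have "\<bar>G (fl u p) - G (fl u q)\<bar> \<le> (1 + (mu - 1) * L0) * (exp ((lam + 1) * u) * d0)
        + (1 + (mu + 1) * L1) * (exp (- ((1 - lam) * u)) * d1)"
      using 1 by (simp add: algebra_simps)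
    then have "\<bar>?f p u - ?f q u\<bar> \<le> exp (- ((lam + mu) * u)) *
       (exp ((mu - 1) * horizon) * (exp ((lam + 1) * u) * d0) + exp ((mu + 1) * horizon) * (exp (- ((1 - lam) * u)) * d1))"
      by (simp add: e0 e1 abs_mult flip: right_diff_distrib)
    also have "\<dots> = h u"
      by (simp add: h_def distrib_left mult.assoc[symmetric] mult_exp_exp)
         (simp add: algebra_simps)
    finally show ?thesis .
  qed
  have "\<bar>F t p - F t q\<bar> = norm (integral {0..t} (\<lambda>u. ?f p u - ?f q u))"
    unfolding path_cost_def
    by (subst Henstock_Kurzweil_Integration.integral_diff) (use p q integrand_integrable in auto)
  also have "\<dots> \<le> integral {0..t} h"
    by (rule integral_norm_bound_integral)
       (use le p q hcont in \<open>auto intro!: integrable_continuous_interval continuous_on_diff continuous_on_integrand\<close>)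
  also have "\<dots> \<le> integral {0..horizon} h"
    by (rule integral_subset_le)
       (use t hcont d in \<open>auto intro!: integrable_continuous_interval simp: h_def\<close>)
  also have "\<dots> = L0 * d0 + L1 * d1" using hint by (rule integral_unique)
  finally show ?thesis by (simp add: d0_def d1_def)
qed

lemma G_ge: "p \<in> quadrant \<Longrightarrow> fst p + snd p - (lam + mu) * bound \<le> G p"
  using w_ge[OF jump_in_quadrant, of p] mu_gt_1 mult_left_mono[of "-bound" "w (S p)" mu]
  by (simp add: dyn_cost_def g_eq cost_shift_eq algebra_simps)

lemma G_mono: "p \<in> quadrant \<Longrightarrow> q \<in> quadrant \<Longrightarrow> p \<le> q \<Longrightarrow> G p \<le> G q"
  using w_mono[OF jump_in_quadrant jump_in_quadrant jump_mono, of p q] mu_gt_1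
  by (auto simp: dyn_cost_def g_eq less_eq_prod_def intro!: add_mono mult_left_mono)

lemma path_cost_mono:
  assumes "p \<in> quadrant" "q \<in> quadrant" "p \<le> q"
  shows "F t p \<le> F t q"
  unfolding path_cost_def
  by (rule integral_le) (use assms in \<open>auto intro!: integrand_integrable G_mono flow_in_quadrant flow_mono\<close>)

text \<open>\<open>G\<close> is at least \<open>- ((lam + mu) * bound)\<close>, and this constant
  discounted at rate \<open>lam + mu\<close> over all time gives \<open>- bound\<close>.\<close>

lemma path_cost_ge:
  assumes "p \<in> quadrant" "0 \<le> t"
  shows "- bound \<le> F t p"
proof -
  let ?H = "\<lambda>u. exp (- ((lam + mu) * u)) * bound"
  have "((\<lambda>u. - (exp (- ((lam + mu) * u)) * ((lam + mu) * bound))) has_integral ?H t - ?H 0) {0..t}"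
    by (rule fundamental_theorem_of_calculus)
       (use assms in \<open>auto simp flip: has_real_derivative_iff_has_vector_derivative
           intro!: derivative_eq_intros simp: algebra_simps\<close>)
  then have "?H t - ?H 0 \<le> F t p"
    unfolding path_cost_def
  proof (rule has_integral_le[OF _ integrable_integral])
    show "(\<lambda>u. exp (- ((lam + mu) * u)) * G (fl u p)) integrable_on {0..t}"
      using assms by (intro integrand_integrable) auto
  next
    fix u assume u: "u \<in> {0..t}"
    then have "fl u p \<in> quadrant" using assms by (auto intro: flow_in_quadrant)
    then have "- ((lam + mu) * bound) \<le> G (fl u p)" using G_ge[of "fl u p"] by (simp add: quadrant_iff)
    then show "- (exp (- ((lam + mu) * u)) * ((lam + mu) * bound)) \<le> exp (- ((lam + mu) * u)) * G (fl u p)"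
      by (metis exp_ge_zero mult_left_mono mult_minus_right)
  qed
  moreover have "0 \<le> ?H t" using bound_pos by simp
  ultimately show ?thesis by simp
qed

lemma G_flow_nonneg_after_horizon:
  assumes "p \<in> quadrant" "horizon \<le> u"
  shows "0 \<le> G (fl u p)"
proof -
  have "(lam + mu) * bound = drift0 * horizon" using drift0_pos by (simp add: horizon_def)
  also have "\<dots> \<le> drift0 * u" using assms drift0_pos by simp
  also have "\<dots> \<le> fst (fl u p)" using fst_flow_ge[of p u] assms horizon_pos by (auto simp: quadrant_iff)
  finally show ?thesis
    using G_ge[OF flow_in_quadrant[of p u]] flow_in_quadrant[of p u] assms horizon_pos
    by (auto simp: quadrant_iff)
qed

lemma path_cost_horizon_le:
  assumes "p \<in> quadrant" "horizon \<le> t"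
  shows "F horizon p \<le> F t p"
proof -
  have "0 \<le> integral {horizon..t} (\<lambda>u. exp (- ((lam + mu) * u)) * G (fl u p))"
    by (rule integral_nonneg)
       (use assms horizon_pos in \<open>auto intro!: integrand_integrable mult_nonneg_nonneg G_flow_nonneg_after_horizon\<close>)
  then show ?thesis using path_cost_split[of p horizon t] assms horizon_pos by auto
qed

end

text \<open>The compact range of times makes the infimum attained; \<open>J_le\<close> shows that
  longer times cannot do better.\<close>

definition (in poisson_disorder) J :: "(real \<times> real \<Rightarrow> real) \<Rightarrow> real \<times> real \<Rightarrow> real" where
  "J w p = (INF t\<in>{0..horizon}. path_cost w t p)"

context admissible_fun
begin

lemma J_attained:
  assumes "p \<in> quadrant"
  obtains t where "t \<in> {0..horizon}" "J w p = F t p"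
proof -
  obtain t where t: "t \<in> {0..horizon}" "\<forall>s\<in>{0..horizon}. F t p \<le> F s p"
    using continuous_attains_inf[OF _ _ continuous_on_path_cost[OF assms, of horizon]] horizon_pos by auto
  have "J w p = F t p" unfolding J_def
    by (rule cInf_eq_minimum) (use t in auto)
  with t that show ?thesis by blast
qed

lemma J_le:
  assumes "p \<in> quadrant" "0 \<le> t"
  shows "J w p \<le> F t p"
proof -
  have *: "J w p \<le> F s p" if "s \<in> {0..horizon}" for s
    unfolding J_def by (rule cINF_lower) (use that assms in \<open>auto intro!: bdd_belowI2[of _ "-bound"] path_cost_ge\<close>)
  show ?thesis
    using *[of t] *[of horizon] path_cost_horizon_le[OF assms(1), of t] assms horizon_pos
    by (cases "t \<le> horizon") auto
qed

lemma admissible_J: "admissible (J w)"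
  unfolding admissible_def
proof (intro conjI ballI impI)
  fix p :: "real \<times> real" assume p: "p \<in> quadrant"
  show "- bound \<le> J w p" by (rule J_attained[OF p]) (use p path_cost_ge in auto)
  show "J w p \<le> 0" using J_le[OF p, of 0] by simp
  fix q :: "real \<times> real" assume q: "q \<in> quadrant"
  { assume "p \<le> q"
    obtain t where t: "t \<in> {0..horizon}" "J w q = F t q" using J_attained[OF q] .
    then show "J w p \<le> J w q" using J_le[OF p, of t] path_cost_mono[OF p q \<open>p \<le> q\<close>, of t] by simp }
  have "J w p - J w q \<le> L0 * \<bar>fst p - fst q\<bar> + L1 * \<bar>snd p - snd q\<bar>"
    if p: "p \<in> quadrant" and q: "q \<in> quadrant" for p q
  proof -
    obtain t where t: "t \<in> {0..horizon}" "J w q = F t q" using J_attained[OF q] .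
    then show ?thesis using J_le[OF p, of t] path_cost_lipschitz[OF p q, of t] by auto
  qed
  from this[OF p q] this[OF q p]
  show "\<bar>J w p - J w q\<bar> \<le> L0 * \<bar>fst p - fst q\<bar> + L1 * \<bar>snd p - snd q\<bar>"
    by (simp add: abs_minus_commute abs_le_iff)
qed

end

section \<open>Value iteration and its limit\<close>

context poisson_disorder
begin

text \<open>The iteration starts from 0, an upper bound of all admissible functions on the quadrant,
  so that the iterates decrease.\<close>

primrec iter :: "nat \<Rightarrow> real \<times> real \<Rightarrow> real" where
  "iter 0 = (\<lambda>p. 0)"
| "iter (Suc n) = J (iter n)"

definition val :: "real \<times> real \<Rightarrow> real" where
  "val p = lim (\<lambda>n. iter n p)"

lemma admissible_iter: "admissible (iter n)"
proof (induction n)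
  case 0
  show ?case using bound_pos L0_nonneg L1_nonneg by (auto simp: admissible_def)
next
  case (Suc n)
  interpret admissible_fun lam mu c m "iter n" by unfold_locales (rule Suc)
  show ?case using admissible_J by simp
qed

lemma path_cost_mono_fun:
  assumes "admissible w" "admissible w'" "\<And>p. p \<in> quadrant \<Longrightarrow> w p \<le> w' p" "p \<in> quadrant"
  shows "path_cost w t p \<le> path_cost w' t p"
proof -
  interpret a: admissible_fun lam mu c m w by unfold_locales (rule assms)
  interpret b: admissible_fun lam mu c m w' by unfold_locales (rule assms)
  show ?thesis unfolding path_cost_def
    by (rule integral_le)
       (use assms(4) mu_gt_1 in \<open>auto intro!: a.integrand_integrable b.integrand_integrable,
         auto simp: dyn_cost_def intro!: assms(3) flow_in_quadrant jump_in_quadrant\<close>)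
qed

lemma J_mono_fun:
  assumes "admissible w" "admissible w'" "\<And>p. p \<in> quadrant \<Longrightarrow> w p \<le> w' p" "p \<in> quadrant"
  shows "J w p \<le> J w' p"
proof -
  interpret a: admissible_fun lam mu c m w by unfold_locales (rule assms)
  interpret b: admissible_fun lam mu c m w' by unfold_locales (rule assms)
  obtain t where "t \<in> {0..horizon}" "J w' p = path_cost w' t p" using b.J_attained[OF assms(4)] .
  then show ?thesis using a.J_le[OF assms(4), of t] path_cost_mono_fun[OF assms, of t] by simp
qed

lemma iter_Suc_le: "p \<in> quadrant \<Longrightarrow> iter (Suc n) p \<le> iter n p"
proof (induction n arbitrary: p)
  case 0
  then show ?case using admissible_iter[of "Suc 0"] by (auto simp: admissible_def)
next
  case (Suc n)
  then show ?case using J_mono_fun[OF admissible_iter admissible_iter, of "Suc n" n p] by simp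
qed

lemma iter_tendsto:
  assumes "p \<in> quadrant"
  shows "(\<lambda>n. iter n p) \<longlonglongrightarrow> val p" and "val p \<le> iter n p"
proof -
  have dec: "decseq (\<lambda>n. iter n p)" using iter_Suc_le[OF assms] by (rule decseq_SucI)
  obtain L where L: "(\<lambda>n. iter n p) \<longlonglongrightarrow> L"
    using decseq_convergent[OF dec, of "- bound"] admissible_iter[unfolded admissible_def] assms by metis
  have "lim (\<lambda>n. iter n p) = L" using L by (rule limI)
  with L show *: "(\<lambda>n. iter n p) \<longlonglongrightarrow> val p" by (simp add: val_def)
  show "val p \<le> iter n p" using decseq_ge[OF dec *] .
qed

lemma admissible_value: "admissible val"
  unfolding admissible_def
proof (intro conjI ballI impI)
  note a = admissible_iter[unfolded admissible_def]
  fix p :: "real \<times> real" assume p: "p \<in> quadrant"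
  note pt = iter_tendsto(1)[OF p]
  show "- bound \<le> val p" using tendsto_lowerbound[OF pt, of "-bound"] a p by auto
  show "val p \<le> 0" using tendsto_upperbound[OF pt, of 0] a p by auto
  fix q :: "real \<times> real" assume q: "q \<in> quadrant"
  note qt = iter_tendsto(1)[OF q]
  show "val p \<le> val q" if "p \<le> q" using tendsto_le[OF _ qt pt] a p q that by auto
  show "\<bar>val p - val q\<bar> \<le> L0 * \<bar>fst p - fst q\<bar> + L1 * \<bar>snd p - snd q\<bar>"
    using tendsto_upperbound[OF tendsto_rabs[OF tendsto_diff[OF pt qt]]] a p q by auto
qed

text \<open>One inequality follows by dominated convergence at a minimising time for the limit, the
  other from monotonicity of \<open>J\<close> in the function, since \<open>val\<close> lies below
  all iterates.\<close>

lemma value_fixed_point: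
  assumes p: "p \<in> quadrant"
  shows "val p = J val p"
proof (rule antisym)
  interpret v: admissible_fun lam mu c m "val" by unfold_locales (rule admissible_value)
  have it: "admissible_fun lam mu c m (iter n)" for n by unfold_locales (rule admissible_iter)
  have F: "(\<lambda>n. path_cost (iter n) t p) \<longlonglongrightarrow> path_cost val t p" if "0 \<le> t" for t
    unfolding path_cost_def
  proof (rule dominated_convergence)
    show "(\<lambda>u. exp (- ((lam + mu) * u)) * dyn_cost (iter k) (fl u p)) integrable_on {0..t}" for k
      using admissible_fun.integrand_integrable[OF it p] by simp
    show "(\<lambda>u. \<bar>g (fl u p)\<bar> + mu * bound) integrable_on {0..t}"
      by (intro integrable_continuous_interval)
         (auto simp: g_eq intro!: continuous_intros continuous_on_fst_flow continuous_on_snd_flow)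
    show "norm (exp (- ((lam + mu) * u)) * dyn_cost (iter k) (fl u p)) \<le> \<bar>g (fl u p)\<bar> + mu * bound"
      if u: "u \<in> {0..t}" for k u
    proof -
      have q: "S (fl u p) \<in> quadrant" using u p by (auto intro!: jump_in_quadrant flow_in_quadrant)
      have "\<bar>iter k (S (fl u p))\<bar> \<le> bound"
        using admissible_fun.w_ge[OF it q] admissible_fun.w_le_0[OF it q] bound_pos by (smt (verit))
      then have "\<bar>dyn_cost (iter k) (fl u p)\<bar> \<le> \<bar>g (fl u p)\<bar> + mu * bound"
        unfolding dyn_cost_def using mu_gt_1 by (intro order_trans[OF abs_triangle_ineq]) (simp add: abs_mult)
      moreover have "exp (- ((lam + mu) * u)) \<le> 1" using u lam_pos mu_gt_1 by simp
      ultimately show ?thesis by (simp add: abs_mult mult_left_le_one_le order_trans[OF mult_left_le_one_le])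
    qed
    show "(\<lambda>k. exp (- ((lam + mu) * u)) * dyn_cost (iter k) (fl u p)) \<longlonglongrightarrow> exp (- ((lam + mu) * u)) * dyn_cost val (fl u p)"
      if "u \<in> {0..t}" for u
      unfolding dyn_cost_def
      by (intro tendsto_intros iter_tendsto) (use that p in \<open>auto intro!: jump_in_quadrant flow_in_quadrant\<close>)
  qed
  obtain t where t: "t \<in> {0..horizon}" "J val p = path_cost val t p" using v.J_attained[OF p] .
  have "iter (Suc n) p \<le> path_cost (iter n) t p" for n
    using admissible_fun.J_le[OF it p, of t n] t by simp
  then show "val p \<le> J val p"
    using tendsto_le[OF _ F[of t] LIMSEQ_Suc[OF iter_tendsto(1)[OF p]]] t by auto
  have "J val p \<le> iter (Suc n) p" for n
    using J_mono_fun[OF admissible_value admissible_iter iter_tendsto(2) p, of n] by simp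
  then show "J val p \<le> val p"
    using tendsto_lowerbound[OF LIMSEQ_Suc[OF iter_tendsto(1)[OF p]]] by auto
qed

end

text \<open>From here on \<open>G\<close> and \<open>F\<close> refer to \<open>val\<close>.\<close>

sublocale poisson_disorder \<subseteq> admissible_fun lam mu c m "val"
  by unfold_locales (rule admissible_value)

context poisson_disorder
begin

lemma value_le: "p \<in> quadrant \<Longrightarrow> 0 \<le> t \<Longrightarrow> val p \<le> F t p"
  using J_le[of p t] value_fixed_point[of p] by simp

lemma value_attained:
  assumes "p \<in> quadrant"
  obtains t where "t \<in> {0..horizon}" "val p = F t p"
  using J_attained[OF assms] value_fixed_point[OF assms] by metis

lemma value_le_flow:
  assumes p: "p \<in> quadrant" and t: "0 \<le> t"
  shows "val p \<le> F t p + exp (- ((lam + mu) * t)) * val (fl t p)"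
proof -
  obtain s where s: "s \<in> {0..horizon}" "val (fl t p) = F s (fl t p)"
    using value_attained[OF flow_in_quadrant[OF p t]] .
  then show ?thesis using value_le[OF p, of "t + s"] path_cost_add[OF p t, of s] t by auto
qed

text \<open>Nothing is lost by waiting while \<open>val\<close> is negative along the path: an
  optimal time \<open>s < t\<close> would force \<open>val (fl s p)\<close> to be nonnegative by
  \<open>value_le_flow\<close>.\<close>

lemma value_eq_flow:
  assumes p: "p \<in> quadrant" and t: "0 \<le> t" and neg: "\<And>u. 0 \<le> u \<Longrightarrow> u < t \<Longrightarrow> val (fl u p) < 0"
  shows "val p = F t p + exp (- ((lam + mu) * t)) * val (fl t p)"
proof (rule antisym[OF value_le_flow[OF p t]])
  obtain s where s: "s \<in> {0..horizon}" "val p = F s p" using value_attained[OF p] .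
  show "F t p + exp (- ((lam + mu) * t)) * val (fl t p) \<le> val p"
  proof (cases "s < t")
    case True
    then have "0 \<le> exp (- ((lam + mu) * s)) * val (fl s p)"
      using value_le_flow[OF p, of s] s by auto
    then have "0 \<le> val (fl s p)" by (simp add: zero_le_mult_iff)
    with neg[of s] True s show ?thesis by auto
  next
    case False
    then have "F s p = F t p + exp (- ((lam + mu) * t)) * F (s - t) (fl t p)"
      using path_cost_add[OF p t, of "s - t"] by simp
    moreover have "val (fl t p) \<le> F (s - t) (fl t p)"
      using False by (intro value_le flow_in_quadrant p t) auto
    ultimately show ?thesis using s by simp
  qed
qed

section \<open>Lipschitz estimates in the l1 metric\<close>

lemma mu_coeffs: "0 \<le> 1 - 1 / mu" "1 - 1 / mu \<le> 2" "\<bar>1 - 1 / mu\<bar> \<le> 2" "1 + 1 / mu \<le> 2" "\<bar>1 + 1 / mu\<bar> \<le> 2"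
  using mu_gt_1 by (auto simp: field_simps)

lemma abs_val_diff_le: "a \<in> quadrant \<Longrightarrow> b \<in> quadrant \<Longrightarrow> \<bar>val a - val b\<bar> \<le> (L0 + L1) * d1 a b"
  using w_lipschitz[of a b] mult_nonneg_nonneg[OF L0_nonneg, of "\<bar>snd a - snd b\<bar>"]
    mult_nonneg_nonneg[OF L1_nonneg, of "\<bar>fst a - fst b\<bar>"]
  unfolding d1_def distrib_left distrib_right by linarith

lemma abs_g_diff_le: "\<bar>g a - g b\<bar> \<le> d1 a b"
  by (simp add: d1_def g_eq)

lemma d1_jump: "d1 (S a) (S b) \<le> 2 * d1 a b"
proof -
  have "\<bar>(1 - 1 / mu) * (fst a - fst b)\<bar> \<le> 2 * \<bar>fst a - fst b\<bar>" "\<bar>(1 + 1 / mu) * (snd a - snd b)\<bar> \<le> 2 * \<bar>snd a - snd b\<bar>"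
    unfolding abs_mult by (intro mult_right_mono mu_coeffs abs_ge_zero)+
  then show ?thesis by (simp add: d1_def fst_jump snd_jump flip: right_diff_distrib)
qed

lemma d1_triangle: "d1 a e \<le> d1 a b + d1 b e"
  by (simp add: d1_def)

lemma abs_G_diff_le:
  assumes "a \<in> quadrant" "b \<in> quadrant"
  shows "\<bar>G a - G b\<bar> \<le> (1 + mu * ((L0 + L1) * 2)) * d1 a b"
proof -
  have L: "0 \<le> L0 + L1" using L0_nonneg L1_nonneg by simp
  have "\<bar>val (S a) - val (S b)\<bar> \<le> (L0 + L1) * d1 (S a) (S b)"
    by (intro abs_val_diff_le jump_in_quadrant assms)
  also have "\<dots> \<le> (L0 + L1) * (2 * d1 a b)" by (intro mult_left_mono d1_jump L)
  finally have "mu * \<bar>val (S a) - val (S b)\<bar> \<le> mu * ((L0 + L1) * (2 * d1 a b))"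
    using mu_gt_1 by (intro mult_left_mono) auto
  moreover have "G a - G b = (g a - g b) + mu * (val (S a) - val (S b))"
    by (simp add: dyn_cost_def algebra_simps)
  then have "\<bar>G a - G b\<bar> \<le> \<bar>g a - g b\<bar> + mu * \<bar>val (S a) - val (S b)\<bar>"
    using mu_gt_1 abs_triangle_ineq[of "g a - g b" "mu * (val (S a) - val (S b))"] by (simp add: abs_mult)
  ultimately have "\<bar>G a - G b\<bar> \<le> d1 a b + mu * ((L0 + L1) * (2 * d1 a b))"
    using abs_g_diff_le[of a b] by linarith
  also have "\<dots> = (1 + mu * ((L0 + L1) * 2)) * d1 a b" by (simp add: algebra_simps)
  finally show ?thesis .
qed

end

section \<open>Poisson paths and their filtration\<close>

locale poisson_path =
  fixes M :: "'a measure" and mu :: real and N :: "real \<Rightarrow> 'a \<Rightarrow> nat" and \<sigma> :: "nat \<Rightarrow> 'a \<Rightarrow> real"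
  assumes poisson: "poisson_process M mu N \<sigma>"
begin

lemma prob_space_M: "prob_space M"
  using poisson by (simp add: poisson_process_def)

sublocale M: prob_space M by (rule prob_space_M)

text \<open>The filtration contains null sets of the completed measure, so expectations are taken
  under the completion.\<close>

sublocale P: prob_space "completion M"
  by (rule M.prob_space_completion)

lemma N_measurable: "0 \<le> t \<Longrightarrow> N t \<in> measurable M (count_space UNIV)"
  using poisson by (simp add: poisson_process_def)

lemma jump_time_0: "\<omega> \<in> space M \<Longrightarrow> \<sigma> 0 \<omega> = 0"
  and jump_time_strict_mono: "\<omega> \<in> space M \<Longrightarrow> strict_mono (\<lambda>n. \<sigma> n \<omega>)"
  and jump_time_at_top: "\<omega> \<in> space M \<Longrightarrow> filterlim (\<lambda>n. \<sigma> n \<omega>) at_top sequentially"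
  and N_card: "\<omega> \<in> space M \<Longrightarrow> 0 \<le> t \<Longrightarrow> N t \<omega> = card {n. 1 \<le> n \<and> \<sigma> n \<omega> \<le> t}"
  using poisson by (auto simp: poisson_process_def)

lemma jump_time_mono: "\<omega> \<in> space M \<Longrightarrow> i \<le> j \<Longrightarrow> \<sigma> i \<omega> \<le> \<sigma> j \<omega>"
  using strict_mono_less_eq[OF jump_time_strict_mono, of \<omega> i j] by simp

lemma jump_time_nonneg: "\<omega> \<in> space M \<Longrightarrow> 0 \<le> \<sigma> n \<omega>"
  using jump_time_mono[of \<omega> 0 n] jump_time_0[of \<omega>] by simp

text \<open>As the jump times increase to infinity, the indices of the jumps up to \<open>t\<close>
  form the initial segment \<open>{1..N t \<omega>}\<close>. All later dealings with
  \<open>N\<close> and \<open>\<sigma>\<close> rest on this duality.\<close>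

lemma N_ge_iff:
  assumes \<omega>: "\<omega> \<in> space M" and t: "0 \<le> t"
  shows "n \<le> N t \<omega> \<longleftrightarrow> \<sigma> n \<omega> \<le> t"
proof -
  let ?A = "{n. 1 \<le> n \<and> \<sigma> n \<omega> \<le> t}"
  obtain k where k: "\<And>n. k \<le> n \<Longrightarrow> t < \<sigma> n \<omega>"
    using jump_time_at_top[OF \<omega>] by (auto simp: filterlim_at_top_dense eventually_sequentially)
  have "?A \<subseteq> {..k}" using k by (auto simp: not_le[symmetric]) (meson nat_le_linear)
  then have fin: "finite ?A" by (rule finite_subset) simp
  have down: "j \<in> ?A" if "i \<in> ?A" "1 \<le> j" "j \<le> i" for i j
    using that jump_time_mono[OF \<omega>, of j i] by auto
  have A: "?A = {1..N t \<omega>}"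
  proof (cases "?A = {}")
    case True
    have "N t \<omega> = card ?A" using N_card[OF \<omega> t] .
    then have "N t \<omega> = 0" unfolding True by simp
    then show ?thesis unfolding True by simp
  next
    case False
    have "?A = {1..Max ?A}"
    proof (intro set_eqI iffI)
      fix i assume "i \<in> {1..Max ?A}"
      then show "i \<in> ?A" using down[OF Max_in[OF fin False], of i] by auto
    qed (use fin in auto)
    then have "card ?A = Max ?A" by (metis card_atLeastAtMost diff_Suc_1)
    with \<open>?A = {1..Max ?A}\<close> N_card[OF \<omega> t] show ?thesis by simp
  qed
  have "n \<le> N t \<omega> \<longleftrightarrow> n = 0 \<or> n \<in> {1..N t \<omega>}" by auto
  also have "\<dots> \<longleftrightarrow> n = 0 \<or> n \<in> ?A" by (simp only: A)
  also have "\<dots> \<longleftrightarrow> \<sigma> n \<omega> \<le> t" using jump_time_0[OF \<omega>] t by auto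
  finally show ?thesis .
qed

lemma N_eq_iff:
  assumes "\<omega> \<in> space M" "0 \<le> t"
  shows "N t \<omega> = n \<longleftrightarrow> \<sigma> n \<omega> \<le> t \<and> t < \<sigma> (Suc n) \<omega>"
  using N_ge_iff[OF assms, of n] N_ge_iff[OF assms, of "Suc n"] by auto

lemma N_mono:
  assumes "\<omega> \<in> space M" "0 \<le> s" "s \<le> t"
  shows "N s \<omega> \<le> N t \<omega>"
  using N_ge_iff[of \<omega> t "N s \<omega>"] N_ge_iff[of \<omega> s "N s \<omega>"] assms by auto

lemma N_0: "\<omega> \<in> space M \<Longrightarrow> N 0 \<omega> = 0"
  using N_eq_iff[of \<omega> 0 0] jump_time_0[of \<omega>] jump_time_strict_mono[of \<omega>] by (simp add: strict_mono_Suc_iff) metis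

lemma jump_time_N_le: "\<omega> \<in> space M \<Longrightarrow> 0 \<le> t \<Longrightarrow> i \<le> N t \<omega> \<Longrightarrow> \<sigma> i \<omega> \<le> t"
  using N_ge_iff by blast

text \<open>Truncation at \<open>s\<close> makes every sublevel set either trivial or an event about
  \<open>N a\<close> with \<open>a < s\<close>.\<close>

lemma min_jump_measurable:
  assumes sp: "space \<F> = space M"
    and N: "\<And>u. 0 \<le> u \<Longrightarrow> u \<le> s \<Longrightarrow> N u \<in> measurable \<F> (count_space UNIV)"
  shows "(\<lambda>\<omega>. min (\<sigma> n \<omega>) s) \<in> borel_measurable \<F>"
proof (rule borel_measurableI_le)
  fix a
  show "{\<omega> \<in> space \<F>. min (\<sigma> n \<omega>) s \<le> a} \<in> sets \<F>"
  proof (cases "0 \<le> a \<and> a < s")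
    case True
    then have "{\<omega> \<in> space \<F>. min (\<sigma> n \<omega>) s \<le> a} = N a -` {n..} \<inter> space \<F>"
      using N_ge_iff by (auto simp: sp min_le_iff_disj)
    then show ?thesis using N[of a] True by (auto intro: measurable_sets)
  next
    case False
    then have "{\<omega> \<in> space \<F>. min (\<sigma> n \<omega>) s \<le> a} = (if s \<le> a then space \<F> else {})"
      using jump_time_nonneg[of _ n] by (auto simp: sp min_le_iff_disj) (meson not_le order_trans)+
    then show ?thesis by simp
  qed
qed

lemma jump_time_measurable: "\<sigma> n \<in> borel_measurable M"
proof (rule borel_measurableI_le)
  fix a
  show "{\<omega> \<in> space M. \<sigma> n \<omega> \<le> a} \<in> sets M"
  proof (cases "0 \<le> a")
    case True
    then have "{\<omega> \<in> space M. \<sigma> n \<omega> \<le> a} = N a -` {n..} \<inter> space M"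
      using N_ge_iff by auto
    then show ?thesis using N_measurable[of a] True by (auto intro: measurable_sets)
  next
    case False
    then have "{\<omega> \<in> space M. \<sigma> n \<omega> \<le> a} = {}"
      using jump_time_nonneg[of _ n] by (auto simp: not_le) (meson not_le order_trans)
    then show ?thesis by (simp only: sets.empty_sets)
  qed
qed

section \<open>The filtration and the independence of the next increment from the past\<close>

abbreviation natural_sets :: "real \<Rightarrow> 'a set set" where
  "natural_sets s \<equiv> sigma_sets (space M) {N u -` B \<inter> space M | u B. 0 \<le> u \<and> u \<le> s}"

abbreviation \<F> :: "real \<Rightarrow> 'a measure" where
  "\<F> s \<equiv> augmented_filtration M N (ennreal s)"

lemma null_sets_subset_Pow: "null_sets (completion M) \<subseteq> Pow (space M)"
  using sets.sets_into_space[of _ "completion M"] by (auto simp: null_sets_def)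

lemma space_\<F>: "space (augmented_filtration M N s) = space M"
  unfolding augmented_filtration_def using null_sets_subset_Pow by (intro space_measure_of) auto

lemma sets_augmented:
  "sets (augmented_filtration M N s) =
     sigma_sets (space M) ({N u -` B \<inter> space M | u B. 0 \<le> u \<and> ennreal u \<le> s} \<union> null_sets (completion M))"
  unfolding augmented_filtration_def using null_sets_subset_Pow by (intro sets_measure_of) auto

lemma sets_augmented_subset: "sets (augmented_filtration M N s) \<subseteq> sets (completion M)"
proof -
  have "N u -` B \<inter> space M \<in> sets (completion M)" if "0 \<le> u" for u B
    using measurable_sets[OF N_measurable[OF that], of B] by (intro sets_completionI_sets) auto
  then have "{N u -` B \<inter> space M | u B. 0 \<le> u \<and> ennreal u \<le> s} \<union> null_sets (completion M) \<subseteq> sets (completion M)"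
    by (auto simp: null_sets_def)
  then show ?thesis
    unfolding sets_augmented using sets.sigma_sets_subset[of _ "completion M"] by simp
qed

lemma sets_augmented_mono: "s \<le> t \<Longrightarrow> sets (augmented_filtration M N s) \<subseteq> sets (augmented_filtration M N t)"
  unfolding sets_augmented by (rule sigma_sets_mono') (auto intro: order_trans)

lemma N_measurable_\<F>: "0 \<le> u \<Longrightarrow> u \<le> s \<Longrightarrow> N u \<in> measurable (\<F> s) (count_space UNIV)"
  unfolding measurable_def space_\<F> sets_augmented
  by (auto simp: space_\<F> intro!: sigma_sets.Basic)

lemma measurable_\<F>_completion: "f \<in> measurable (\<F> s) K \<Longrightarrow> f \<in> measurable (completion M) K"
  using sets_augmented_subset[of "ennreal s"] by (auto simp: measurable_def space_\<F>)

lemma increment_prob: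
  assumes "0 \<le> s" "s < t"
  shows "measure M {\<omega> \<in> space M. N t \<omega> - N s \<omega> \<in> D} = measure_pmf.prob (poisson_pmf (mu * (t - s))) D"
proof -
  have d: "distr M (count_space UNIV) (\<lambda>\<omega>. N t \<omega> - N s \<omega>) = measure_pmf (poisson_pmf (mu * (t - s)))"
    using poisson assms by (simp add: poisson_process_def)
  have [measurable]: "N t \<in> measurable M (count_space UNIV)" "N s \<in> measurable M (count_space UNIV)"
    using N_measurable assms by auto
  have "measure M {\<omega> \<in> space M. N t \<omega> - N s \<omega> \<in> D} =
      measure (distr M (count_space UNIV) (\<lambda>\<omega>. N t \<omega> - N s \<omega>)) D"
    by (subst measure_distr) (auto intro!: arg_cong[where f = "measure M"])
  then show ?thesis by (simp add: d)
qed

lemma increment_measurable: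
  "0 \<le> s \<Longrightarrow> s < t \<Longrightarrow> (\<lambda>\<omega>. N t \<omega> - N s \<omega>) \<in> measurable M (count_space UNIV)"
  using N_measurable[of s] N_measurable[of t] by measurable

lemma increment_sets:
  assumes "0 \<le> s" "s < t"
  shows "{\<omega> \<in> space M. N t \<omega> - N s \<omega> \<in> D} \<in> sets M"
proof -
  have "{\<omega> \<in> space M. N t \<omega> - N s \<omega> \<in> D} = (\<lambda>\<omega>. N t \<omega> - N s \<omega>) -` D \<inter> space M" by blast
  then show ?thesis using measurable_sets[OF increment_measurable[OF assms], of D] by simp
qed

text \<open>Independence is assumed only for increments along one monotone sequence of times. The
  past values are partial sums of such increments, hence functions of those before
  \<open>s\<close>.\<close>

lemma indep_finite_past:
  assumes s: "0 \<le> s" and st: "s < t" and J: "finite J" "J \<subseteq> {0..s}"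
  shows "measure M ({\<omega> \<in> space M. \<forall>u\<in>J. N u \<omega> \<in> B u} \<inter> {\<omega> \<in> space M. N t \<omega> - N s \<omega> \<in> D})
    = measure M {\<omega> \<in> space M. \<forall>u\<in>J. N u \<omega> \<in> B u} * measure M {\<omega> \<in> space M. N t \<omega> - N s \<omega> \<in> D}"
proof -
  define J' where "J' = insert 0 (insert s J)"
  define xs where "xs = sorted_list_of_set J'"
  have J': "finite J'" "J' \<subseteq> {0..s}" "0 \<in> J'" "s \<in> J'" using J s by (auto simp: J'_def)
  have set_xs: "set xs = J'" and sorted: "sorted xs" using J' by (simp_all add: xs_def)
  have "xs \<noteq> []" using set_xs J'(3) by auto
  then obtain n where n: "length xs = Suc n" by (cases xs) auto
  \<comment> \<open>The past times in increasing order, from \<open>T 0 = 0\<close> to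
    \<open>T n = s\<close>, and then constantly \<open>t\<close>. Increment number \<open>n\<close>
    is the one over the step from \<open>s\<close> to \<open>t\<close>.\<close>
  define T where "T i = (if i \<le> n then xs ! i else t)" for i
  have T_in: "T i \<in> {0..s}" if "i \<le> n" for i
    using that n J'(2) set_xs nth_mem[of i xs] by (auto simp: T_def)
  have mono: "mono T"
  proof (rule monoI)
    fix i j :: nat assume "i \<le> j"
    then show "T i \<le> T j"
      using sorted n T_in[of i] st by (auto simp: T_def sorted_nth_mono split: if_splits)
  qed
  have T_ex: "\<exists>i\<le>n. T i = u" if "u \<in> J'" for u
    using that set_xs n by (metis T_def in_set_conv_nth less_Suc_eq_le)
  obtain i0 i1 where i: "i0 \<le> n" "T i0 = 0" "i1 \<le> n" "T i1 = s"
    using T_ex[OF J'(3)] T_ex[OF J'(4)] by blast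
  have T0: "T 0 = 0" using i T_in[of 0] monoD[OF mono, of 0 i0] by simp
  have Tn: "T n = s" using i T_in[of n] monoD[OF mono, of i1 n] by simp
  have TS: "T (Suc n) = t" by (simp add: T_def)
  define \<Delta> where "\<Delta> i \<omega> = N (T (Suc i)) \<omega> - N (T i) \<omega>" for i \<omega>
  have "M.indep_vars (\<lambda>_. count_space UNIV) \<Delta> {..<Suc n}"
    using poisson mono T0 by (auto simp: poisson_process_def \<Delta>_def[abs_def])
  \<comment> \<open>The increments are grouped into the past ones and the last one; grouping
    preserves independence.\<close>
  define K where "K j = (if j then {..<n} else {n})" for j :: bool
  have ind: "M.indep_vars (\<lambda>j. Pi\<^sub>M (K j) (\<lambda>_. count_space UNIV)) (\<lambda>j \<omega>. \<lambda>i\<in>K j. \<Delta> i \<omega>) UNIV"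
    by (rule M.indep_vars_restrict[OF \<open>M.indep_vars _ _ _\<close>])
       (auto simp: K_def disjoint_family_on_def)
  have N_sum: "N (T i) \<omega> = (\<Sum>l<i. \<Delta> l \<omega>)" if "i \<le> n" "\<omega> \<in> space M" for i \<omega>
    using that
  proof (induction i)
    case 0 then show ?case by (simp add: T0 N_0)
  next
    case (Suc i)
    have "N (T i) \<omega> \<le> N (T (Suc i)) \<omega>"
      using Suc T_in[of i] monoD[OF mono, of i "Suc i"] by (intro N_mono) auto
    then show ?case using Suc by (simp add: \<Delta>_def)
  qed
  obtain idx where idx: "\<And>u. u \<in> J' \<Longrightarrow> idx u \<le> n \<and> T (idx u) = u" using T_ex by metis
  define A where "A = {x \<in> space (Pi\<^sub>M {..<n} (\<lambda>_. count_space (UNIV :: nat set))). \<forall>u\<in>J. (\<Sum>l<idx u. x l) \<in> B u}"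
  have sum_meas: "(\<lambda>x. \<Sum>l<k. x l) \<in> measurable (Pi\<^sub>M {..<n} (\<lambda>_. count_space (UNIV :: nat set))) (count_space UNIV)"
    if "k \<le> n" for k
    using that
  proof (induction k)
    case (Suc k)
    then have xk: "(\<lambda>x. x k) \<in> measurable (Pi\<^sub>M {..<n} (\<lambda>_. count_space (UNIV :: nat set))) (count_space UNIV)"
      by (intro measurable_component_singleton) auto
    have IH: "(\<lambda>x. \<Sum>l<k. x l) \<in> measurable (Pi\<^sub>M {..<n} (\<lambda>_. count_space (UNIV :: nat set))) (count_space UNIV)"
      using Suc by simp
    have "(\<lambda>x. (\<Sum>l<k. x l) + x k) \<in> measurable (Pi\<^sub>M {..<n} (\<lambda>_. count_space (UNIV :: nat set))) (count_space UNIV)"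
      by (rule measurable_compose_countable[where f = "\<lambda>i x. i + x k", OF measurable_compose[OF xk] IH]) simp
    then show ?case by simp
  qed simp
  have A: "A \<in> sets (Pi\<^sub>M {..<n} (\<lambda>_. count_space UNIV))"
  proof -
    have "{x \<in> space (Pi\<^sub>M {..<n} (\<lambda>_. count_space (UNIV :: nat set))). (\<Sum>l<idx u. x l) \<in> B u} \<in> sets (Pi\<^sub>M {..<n} (\<lambda>_. count_space UNIV))"
      if "u \<in> J" for u
    proof -
      have "idx u \<le> n" using idx[of u] that by (auto simp: J'_def)
      from measurable_sets[OF sum_meas[OF this], of "B u"] show ?thesis
        by (simp add: vimage_def Int_def conj_commute)
    qed
    then show ?thesis unfolding A_def using J(1) by (rule sets.sets_Collect_finite_All)
  qed
  define A' where "A' = (\<lambda>x. x n) -` D \<inter> space (Pi\<^sub>M {n} (\<lambda>_. count_space (UNIV :: nat set)))"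
  have A': "A' \<in> sets (Pi\<^sub>M {n} (\<lambda>_. count_space UNIV))"
    unfolding A'_def by (rule measurable_sets[OF measurable_component_singleton]) auto
  let ?E = "\<lambda>j. (\<lambda>\<omega>. \<lambda>i\<in>K j. \<Delta> i \<omega>) -` (if j then A else A') \<inter> space M"
  have "M.prob (\<Inter>j\<in>UNIV. ?E j) = (\<Prod>j\<in>UNIV. M.prob (?E j))"
    by (rule M.indep_varsD[OF ind]) (use A A' in \<open>auto simp: K_def\<close>)
  then have prob: "M.prob (?E True \<inter> ?E False) = M.prob (?E True) * M.prob (?E False)"
    by (simp add: UNIV_bool Int_commute mult.commute)
  have key: "(\<Sum>l<idx u. (\<lambda>i\<in>{..<n}. \<Delta> i \<omega>) l) = N u \<omega>" if "u \<in> J" "\<omega> \<in> space M" for u \<omega>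
  proof -
    have "u \<in> J'" using that by (simp add: J'_def)
    from idx[OF this] have "(\<Sum>l<idx u. (\<lambda>i\<in>{..<n}. \<Delta> i \<omega>) l) = (\<Sum>l<idx u. \<Delta> l \<omega>)"
      by (intro sum.cong) auto
    then show ?thesis using N_sum[of "idx u" \<omega>] idx[OF \<open>u \<in> J'\<close>] that by simp
  qed
  have "(\<lambda>i\<in>{..<n}. \<Delta> i \<omega>) \<in> A \<longleftrightarrow> (\<forall>u\<in>J. N u \<omega> \<in> B u)" if "\<omega> \<in> space M" for \<omega>
  proof -
    have "(\<lambda>i\<in>{..<n}. \<Delta> i \<omega>) \<in> space (Pi\<^sub>M {..<n} (\<lambda>_. count_space (UNIV :: nat set)))"
      by (simp add: space_PiM)
    then show ?thesis unfolding A_def mem_Collect_eq by (simp only: key[OF _ that] cong: ball_cong) simp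
  qed
  then have E1: "?E True = {\<omega> \<in> space M. \<forall>u\<in>J. N u \<omega> \<in> B u}"
    unfolding K_def if_True by blast
  have E2: "?E False = {\<omega> \<in> space M. N t \<omega> - N s \<omega> \<in> D}"
    by (auto simp: A'_def K_def space_PiM \<Delta>_def Tn TS)
  show ?thesis using prob by (simp only: E1 E2)
qed

text \<open>A pi-lambda argument: the events about finitely many past values are stable under
  intersection and generate the natural sets.\<close>

lemma indep_natural:
  assumes s: "0 \<le> s" and st: "s < t" and A: "A \<in> natural_sets s"
  shows "A \<in> sets M \<and> measure M (A \<inter> {\<omega> \<in> space M. N t \<omega> - N s \<omega> \<in> D})
    = measure M A * measure M {\<omega> \<in> space M. N t \<omega> - N s \<omega> \<in> D}"
proof -
  let ?D = "{\<omega> \<in> space M. N t \<omega> - N s \<omega> \<in> D}"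
  have D: "?D \<in> sets M"
    by (rule increment_sets[OF s st])
  define \<P> where "\<P> = {{\<omega> \<in> space M. \<forall>u\<in>J. N u \<omega> \<in> B u} | J B. finite J \<and> J \<subseteq> {0..s}}"
  have stable: "Int_stable \<P>"
  proof (rule Int_stableI)
    fix a b assume "a \<in> \<P>" "b \<in> \<P>"
    then obtain J B J' B' where J: "finite J" "J \<subseteq> {0..s}" "a = {\<omega> \<in> space M. \<forall>u\<in>J. N u \<omega> \<in> B u}"
      and J': "finite J'" "J' \<subseteq> {0..s}" "b = {\<omega> \<in> space M. \<forall>u\<in>J'. N u \<omega> \<in> B' u}"
      by (auto simp: \<P>_def)
    define B'' where "B'' u = (if u \<in> J then B u else UNIV) \<inter> (if u \<in> J' then B' u else UNIV)" for u
    have "a \<inter> b = {\<omega> \<in> space M. \<forall>u\<in>J \<union> J'. N u \<omega> \<in> B'' u}"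
      by (auto simp: J(3) J'(3) B''_def)
    moreover have "finite (J \<union> J')" "J \<union> J' \<subseteq> {0..s}" using J J' by auto
    ultimately show "a \<inter> b \<in> \<P>" unfolding \<P>_def by blast
  qed
  have sub: "\<P> \<subseteq> Pow (space M)" by (auto simp: \<P>_def)
  have in_M: "a \<in> sets M" if aP: "a \<in> \<P>" for a
  proof -
    obtain J B where J: "finite J" "J \<subseteq> {0..s}" and a: "a = {\<omega> \<in> space M. \<forall>u\<in>J. N u \<omega> \<in> B u}"
      using aP by (auto simp: \<P>_def)
    have "Measurable.pred M (\<lambda>\<omega>. N u \<omega> \<in> B u)" if "u \<in> J" for u
      using J that by (intro measurable_compose[OF N_measurable[of u], of "\<lambda>k. k \<in> B u"]) auto
    then have "Measurable.pred M (\<lambda>\<omega>. \<forall>u\<in>J. N u \<omega> \<in> B u)" using J(1) by (intro pred_intros_finite) auto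
    then show ?thesis by (simp add: a)
  qed
  have "A \<in> sigma_sets (space M) \<P>"
  proof -
    have "{N u -` B \<inter> space M | u B. 0 \<le> u \<and> u \<le> s} \<subseteq> \<P>"
    proof safe
      fix u B assume "0 \<le> u" "u \<le> s"
      then show "N u -` B \<inter> space M \<in> \<P>" unfolding \<P>_def
        by (intro CollectI exI[of _ "{u}"] exI[of _ "\<lambda>_. B"]) auto
    qed
    then show ?thesis using A sigma_sets_mono' by blast
  qed
  then show ?thesis
  proof (induction rule: sigma_sets_induct_disjoint[OF stable sub, consumes 1, case_names basic empty compl union])
    case (basic a)
    then obtain J B where "finite J" "J \<subseteq> {0..s}" "a = {\<omega> \<in> space M. \<forall>u\<in>J. N u \<omega> \<in> B u}"
      by (auto simp: \<P>_def)
    with in_M[OF basic] indep_finite_past[OF s st] show ?case by auto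
  next
    case (compl a)
    have "measure M ((space M - a) \<inter> ?D) = measure M (?D - a \<inter> ?D)"
      by (intro arg_cong[where f = "measure M"]) auto
    also have "\<dots> = measure M ?D - measure M (a \<inter> ?D)"
      using compl D by (intro M.finite_measure_Diff) auto
    finally show ?case using compl D M.prob_compl[of a] by (auto simp: left_diff_distrib)
  next
    case (union a)
    have "(\<lambda>i. measure M (a i)) sums measure M (\<Union>i. a i)"
      using union by (intro M.finite_measure_UNION) auto
    then have "(\<lambda>i. measure M (a i) * measure M ?D) sums (measure M (\<Union>i. a i) * measure M ?D)"
      by (rule sums_mult2)
    moreover have "(\<lambda>i. measure M (a i \<inter> ?D)) sums measure M (\<Union>i. a i \<inter> ?D)"
      using union D by (intro M.finite_measure_UNION) (auto simp: disjoint_family_on_def)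
    ultimately show ?case using union by (auto simp: sums_iff)
  qed simp
qed

text \<open>The sets that agree with a natural set up to a null set form a sigma-algebra; it
  contains both kinds of generators of the augmented one.\<close>

lemma augmented_approx:
  assumes "A \<in> sets (\<F> s)" "0 \<le> s"
  shows "\<exists>A'\<in>natural_sets s. (A - A') \<union> (A' - A) \<in> null_sets (completion M)"
proof -
  have cm: "complete_measure (completion M)" ..
  have "A \<in> sigma_sets (space M) ({N u -` B \<inter> space M | u B. 0 \<le> u \<and> u \<le> s} \<union> null_sets (completion M))"
  proof -
    have "{N u -` B \<inter> space M | u B. 0 \<le> u \<and> ennreal u \<le> ennreal s} = {N u -` B \<inter> space M | u B. 0 \<le> u \<and> u \<le> s}"
      using assms(2) by (auto simp: ennreal_le_iff)
    then show ?thesis using assms(1) by (simp add: sets_augmented)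
  qed
  then show ?thesis
  proof induction
    case (Basic a)
    then show ?case
    proof
      assume "a \<in> {N u -` B \<inter> space M | u B. 0 \<le> u \<and> u \<le> s}"
      then show ?thesis by (intro bexI[of _ a] sigma_sets.Basic) auto
    next
      assume "a \<in> null_sets (completion M)"
      then show ?thesis by (intro bexI[of _ "{}"] sigma_sets.Empty) auto
    qed
  next
    case Empty
    show ?case by (intro bexI[of _ "{}"] sigma_sets.Empty) auto
  next
    case (Compl a)
    then obtain A' where A': "A' \<in> natural_sets s" "(a - A') \<union> (A' - a) \<in> null_sets (completion M)" by blast
    have "((space M - a) - (space M - A')) \<union> ((space M - A') - (space M - a)) \<subseteq> (a - A') \<union> (A' - a)" by auto
    then have "((space M - a) - (space M - A')) \<union> ((space M - A') - (space M - a)) \<in> null_sets (completion M)"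
      using A'(2) complete_measure.complete2[OF cm] by blast
    then show ?case using A'(1) by (intro bexI[of _ "space M - A'"] sigma_sets.Compl) auto
  next
    case (Union a)
    then have "\<forall>i. \<exists>X. X \<in> natural_sets s \<and> (a i - X) \<union> (X - a i) \<in> null_sets (completion M)"
      by blast
    from choice[OF this] obtain A' where A': "\<And>i. A' i \<in> natural_sets s" "\<And>i. (a i - A' i) \<union> (A' i - a i) \<in> null_sets (completion M)"
      by blast
    have "((\<Union>i. a i) - (\<Union>i. A' i)) \<union> ((\<Union>i. A' i) - (\<Union>i. a i)) \<subseteq> (\<Union>i. (a i - A' i) \<union> (A' i - a i))" by auto
    moreover have "(\<Union>i. (a i - A' i) \<union> (A' i - a i)) \<in> null_sets (completion M)"
      using A'(2) by (intro null_sets_UN) auto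
    ultimately have "((\<Union>i. a i) - (\<Union>i. A' i)) \<union> ((\<Union>i. A' i) - (\<Union>i. a i)) \<in> null_sets (completion M)"
      using complete_measure.complete2[OF cm] by blast
    then show ?case using A'(1) by (intro bexI[of _ "\<Union>i. A' i"] sigma_sets.Union) auto
  qed
qed

lemma indep_augmented:
  assumes s: "0 \<le> s" and st: "s < t" and A: "A \<in> sets (\<F> s)"
  shows "P.prob (A \<inter> {\<omega> \<in> space M. N t \<omega> - N s \<omega> \<in> D})
    = P.prob A * P.prob {\<omega> \<in> space M. N t \<omega> - N s \<omega> \<in> D}"
proof -
  let ?D = "{\<omega> \<in> space M. N t \<omega> - N s \<omega> \<in> D}"
  have D: "?D \<in> sets M"
    by (rule increment_sets[OF s st])
  obtain A' where A': "A' \<in> natural_sets s" and null: "(A - A') \<union> (A' - A) \<in> null_sets (completion M)"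
    using augmented_approx[OF A s] by blast
  note ind = indep_natural[OF s st A', of D]
  have AE: "AE \<omega> in completion M. \<omega> \<in> A \<longleftrightarrow> \<omega> \<in> A'"
    using AE_not_in[OF null] by eventually_elim auto
  have A_P: "A \<in> sets (completion M)" using A sets_augmented_subset by blast
  have "P.prob (A \<inter> ?D) = P.prob (A' \<inter> ?D)"
    using AE by (intro P.finite_measure_eq_AE) (use A_P ind D in \<open>auto intro!: sets.Int\<close>)
  moreover have "P.prob A = P.prob A'"
    using AE by (intro P.finite_measure_eq_AE) (use A_P ind D in auto)
  ultimately show ?thesis using ind D by (simp add: sets.Int)
qed

text \<open>Independence of events is passed on to integrals through independent real random
  variables, whence the detour over the increment as a real number.\<close>

lemma expectation_increment:
  assumes s: "0 \<le> s" and st: "s < t" and f: "f \<in> borel_measurable (\<F> s)" and int: "integrable (completion M) (f :: 'a \<Rightarrow> real)"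
  shows "(\<integral>\<omega>. f \<omega> * indicator D (N t \<omega> - N s \<omega>) \<partial>completion M)
    = (\<integral>\<omega>. f \<omega> \<partial>completion M) * measure_pmf.prob (poisson_pmf (mu * (t - s))) D"
proof -
  let ?Y = "\<lambda>\<omega>. real (N t \<omega> - N s \<omega>)"
  have Y: "?Y \<in> borel_measurable (completion M)"
    by (rule measurable_completion, rule measurable_compose[OF increment_measurable[OF s st], of real]) simp
  have iv: "P.indep_var borel f borel ?Y"
  proof -
    let ?A = "{f -` A \<inter> space (completion M) |A. A \<in> sets borel}"
    let ?B = "{?Y -` A \<inter> space (completion M) |A. A \<in> sets borel}"
    have "P.indep_set ?A ?B"
    proof (rule P.indep_setI)
      show "?A \<subseteq> P.events"
        using measurable_\<F>_completion[OF f] by (auto simp: measurable_def)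
      show "?B \<subseteq> P.events"
        using Y by (auto simp: measurable_def)
    next
      fix a b
      assume "a \<in> ?A"
      then have a: "a \<in> sets (\<F> s)" using f by (auto simp: measurable_def space_\<F>)
      assume "b \<in> ?B"
      then obtain B where "b = ?Y -` B \<inter> space (completion M)" by blast
      then have b: "b = {\<omega> \<in> space M. N t \<omega> - N s \<omega> \<in> real -` B}" by auto
      show "P.prob (a \<inter> b) = P.prob a * P.prob b"
        unfolding b by (rule indep_augmented[OF s st a])
    qed
    moreover have stable: "Int_stable {h -` A \<inter> space (completion M) |A. A \<in> sets borel}" for h :: "'a \<Rightarrow> real"
    proof (rule Int_stableI, clarify)
      fix A B :: "real set" assume "A \<in> sets borel" "B \<in> sets borel"
      then show "\<exists>C. (h -` A \<inter> space (completion M)) \<inter> (h -` B \<inter> space (completion M)) = h -` C \<inter> space (completion M) \<and> C \<in> sets borel"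
        by (intro exI[of _ "A \<inter> B"]) auto
    qed
    ultimately have "P.indep_set (sigma_sets (space (completion M)) ?A) (sigma_sets (space (completion M)) ?B)"
      by (intro P.indep_set_sigma_sets stable)
    then show ?thesis
      unfolding P.indep_var_eq using measurable_\<F>_completion[OF f] Y by simp
  qed
  \<comment> \<open>A set of naturals is closed in the reals, so no condition on \<open>D\<close>
    arises from measurability.\<close>
  have D: "real ` D \<in> sets borel" by (intro borel_closed closed_of_nat_image)
  have ind: "indicator (real ` D) (?Y \<omega>) = (indicator D (N t \<omega> - N s \<omega>) :: real)" for \<omega>
    by (simp add: indicator_def inj_image_mem_iff[OF inj_of_nat])
  have iv': "P.indep_var borel f borel (\<lambda>\<omega>. indicator D (N t \<omega> - N s \<omega>) :: real)"
    using P.indep_var_compose[OF iv measurable_ident, of "indicator (real ` D) :: real \<Rightarrow> real" borel] D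
    by (simp add: comp_def id_def ind)
  have eq: "(\<integral>\<omega>. indicator D (N t \<omega> - N s \<omega>) \<partial>completion M) = measure_pmf.prob (poisson_pmf (mu * (t - s))) D"
  proof -
    have "(\<integral>\<omega>. indicator D (N t \<omega> - N s \<omega>) \<partial>completion M) = (\<integral>\<omega>. indicator {\<omega> \<in> space M. N t \<omega> - N s \<omega> \<in> D} \<omega> \<partial>completion M)"
      by (intro Bochner_Integration.integral_cong) (auto simp: indicator_def)
    also have "\<dots> = measure (completion M) {\<omega> \<in> space M. N t \<omega> - N s \<omega> \<in> D}"
      using increment_sets[OF s st, of D] by (subst Bochner_Integration.integral_indicator) (auto intro!: arg_cong[where f = "measure _"])
    finally show ?thesis using increment_sets[OF s st, of D] increment_prob[OF s st, of D] by simp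
  qed
  have "integrable (completion M) (\<lambda>\<omega>. indicator D (N t \<omega> - N s \<omega>) :: real)"
    using iv'[unfolded P.indep_var_eq] by (intro P.integrable_const_bound[of _ 1]) (auto simp: indicator_def)
  from P.indep_var_lebesgue_integral[OF iv' int this] show ?thesis by (simp add: eq)
qed

end

section \<open>One time step of the controlled path\<close>

text \<open>The bound covers integrands of any kind, because the Bochner integral of a function that
  is not integrable is 0.\<close>

lemma lborel_integral_cell_bound:
  fixes f :: "real \<Rightarrow> real"
  assumes "\<And>u. u \<in> {s..<s + h} \<Longrightarrow> \<bar>f u\<bar> \<le> B" "0 \<le> h" "0 \<le> B"
  shows "\<bar>LINT u|lborel. indicator {s..<s + h} u * f u\<bar> \<le> B * h"
proof -
  have "\<bar>LINT u|lborel. indicator {s..<s + h} u * f u\<bar> \<le> (LINT u|lborel. indicator {s..<s + h} u * B)"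
  proof (rule integral_abs_bound[THEN order_trans])
    show "(LINT u|lborel. \<bar>indicator {s..<s + h} u * f u\<bar>) \<le> (LINT u|lborel. indicator {s..<s + h} u * B)"
    proof (rule integral_mono')
      show "integrable lborel (\<lambda>u. indicator {s..<s + h} u * B)"
        using assms(2) by (intro integrable_mult_left integrable_real_indicator) auto
    qed (use assms in \<open>auto simp: indicator_def\<close>)
  qed
  also have "\<dots> = B * h" using assms(2) by simp
  finally show ?thesis .
qed

lemma integrable_cell:
  fixes f :: "real \<Rightarrow> real"
  assumes "(\<lambda>u. indicator {s..<t} u * f u) \<in> borel_measurable borel"
    and "\<And>u. u \<in> {s..<t} \<Longrightarrow> \<bar>f u\<bar> \<le> B"
  shows "integrable lborel (\<lambda>u. indicator {s..<t} u * f u)"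
proof (rule Bochner_Integration.integrable_bound[where f = "\<lambda>u. indicator {s..<t} u * B"])
  show "integrable lborel (\<lambda>u. indicator {s..<t} u * B)"
    by (cases "s \<le> t") (auto intro!: integrable_mult_left integrable_real_indicator)
  show "AE u in lborel. norm (indicator {s..<t} u * f u) \<le> norm (indicator {s..<t} u * B)"
    using assms(2) by (intro AE_I2) (force simp: indicator_def)
qed (use assms(1) in simp)

lemma exp_minus_one_le: "exp x - 1 \<le> x * exp (x::real)"
proof -
  have "(1 - x) * exp x \<le> exp (- x) * exp x"
    using exp_ge_add_one_self[of "- x"] by (intro mult_right_mono) auto
  also have "exp (- x) * exp x = 1" by (simp flip: exp_add)
  finally show ?thesis by (simp add: algebra_simps)
qed

locale poisson_disorder_process = poisson_disorder lam mu c m + poisson_path M mu N \<sigma>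
  for lam mu c m :: real and M :: "'a measure" and N :: "real \<Rightarrow> 'a \<Rightarrow> nat" and \<sigma> :: "nat \<Rightarrow> 'a \<Rightarrow> real" +
  fixes p :: "real \<times> real"
  assumes p_in: "p \<in> quadrant"
begin

lemma drift_ratio_pos: "0 < drift0 / (lam + 1)"
  using drift0_pos lam_pos by simp

abbreviation "PJ \<equiv> Phi_at_jump \<sigma> lam mu m p"
abbreviation "X \<equiv> Phi N \<sigma> lam mu m p"

lemma X_eq: "X t \<omega> = fl (t - \<sigma> (N t \<omega>) \<omega>) (PJ \<omega> (N t \<omega>))"
  by (simp add: Phi_def Let_def)

lemma PJ_in_quadrant: "\<omega> \<in> space M \<Longrightarrow> PJ \<omega> n \<in> quadrant"
  by (induction n) (auto intro!: p_in jump_in_quadrant flow_in_quadrant simp: jump_time_mono)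

lemma X_in_quadrant: "\<omega> \<in> space M \<Longrightarrow> 0 \<le> t \<Longrightarrow> X t \<omega> \<in> quadrant"
  unfolding X_eq by (intro flow_in_quadrant PJ_in_quadrant) (auto simp: jump_time_N_le)

lemma X_0: "\<omega> \<in> space M \<Longrightarrow> X 0 \<omega> = p"
  by (simp add: X_eq N_0 jump_time_0)

lemma X_flow:
  assumes "\<omega> \<in> space M" "0 \<le> s" "s \<le> t" "N t \<omega> = N s \<omega>"
  shows "X t \<omega> = fl (t - s) (X s \<omega>)"
  by (simp add: X_eq assms flow_flow)

lemma PJ_next:
  assumes "\<omega> \<in> space M" "0 \<le> s" "n = N s \<omega>"
  shows "PJ \<omega> (Suc n) = S (fl (\<sigma> (Suc n) \<omega> - s) (X s \<omega>))"
  by (simp add: X_eq assms flow_flow)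

lemma next_jump_gt: "\<omega> \<in> space M \<Longrightarrow> 0 \<le> s \<Longrightarrow> n = N s \<omega> \<Longrightarrow> s < \<sigma> (Suc n) \<omega>"
  using N_eq_iff by blast

lemma X_one_jump:
  assumes "\<omega> \<in> space M" "0 \<le> s" "s \<le> t" "N t \<omega> = Suc (N s \<omega>)"
  obtains r where "s \<le> r" "r \<le> t" "X t \<omega> = fl (t - r) (S (fl (r - s) (X s \<omega>)))"
proof (rule that)
  show "s \<le> \<sigma> (Suc (N s \<omega>)) \<omega>" using next_jump_gt[of \<omega> s] assms by auto
  show "\<sigma> (Suc (N s \<omega>)) \<omega> \<le> t" using jump_time_N_le[of \<omega> t "Suc (N s \<omega>)"] assms by auto
  show "X t \<omega> = fl (t - \<sigma> (Suc (N s \<omega>)) \<omega>) (S (fl (\<sigma> (Suc (N s \<omega>)) \<omega> - s) (X s \<omega>)))"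
    using PJ_next[of \<omega> s "N s \<omega>"] assms by (simp add: X_eq[of t])
qed

text \<open>\<open>weight\<close> dominates both coordinates, grows at most by the factor \<open>exp (2 * t)\<close> along the flow and at most
  doubles at a jump.\<close>

definition weight :: "real \<times> real \<Rightarrow> real" where
  "weight q = fst q + drift0 / (lam + 1) + max (snd q) (phi_d lam m)"

lemma weight_pos: "q \<in> quadrant \<Longrightarrow> 0 < weight q"
  using drift0_pos lam_pos phi_d_pos by (simp add: weight_def quadrant_iff add_nonneg_pos add_pos_nonneg less_max_iff_disj)

lemma weight_flow:
  assumes "q \<in> quadrant" "0 \<le> u"
  shows "weight (fl u q) \<le> exp ((lam + 1) * u) * weight q"
proof -
  have "max (snd (fl u q)) (phi_d lam m) \<le> max (snd q) (phi_d lam m)"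
    using snd_flow_le_max[OF assms(2), of q] by simp
  also have "\<dots> \<le> exp ((lam + 1) * u) * max (snd q) (phi_d lam m)"
    using assms lam_pos phi_d_pos by (simp add: le_max_iff_disj mult_le_cancel_right1 less_max_iff_disj)
  finally show ?thesis by (simp add: weight_def fst_flow algebra_simps)
qed

lemma weight_jump:
  assumes "q \<in> quadrant"
  shows "weight (S q) \<le> 2 * weight q"
proof -
  have "(1 - 1 / mu) * fst q \<le> 2 * fst q" "(1 + 1 / mu) * snd q \<le> 2 * snd q"
    using mult_right_mono[OF mu_coeffs(2), of "fst q"] mult_right_mono[OF mu_coeffs(4), of "snd q"] assms
    by (auto simp: quadrant_iff)
  then show ?thesis
    using drift_ratio_pos phi_d_pos
    unfolding weight_def fst_jump snd_jump by (auto simp: max_def)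
qed

lemma PJ_weight:
  assumes \<omega>: "\<omega> \<in> space M" and s: "0 \<le> s"
  shows "weight (PJ \<omega> (Suc (N s \<omega> + k)))
    \<le> 2 ^ Suc k * exp ((lam + 1) * (\<sigma> (Suc (N s \<omega> + k)) \<omega> - s)) * weight (X s \<omega>)"
proof (induction k)
  case 0
  let ?r = "\<sigma> (Suc (N s \<omega>)) \<omega>"
  have r: "s \<le> ?r" using next_jump_gt[OF \<omega> s] by auto
  have X: "X s \<omega> \<in> quadrant" by (rule X_in_quadrant[OF \<omega> s])
  have "weight (PJ \<omega> (Suc (N s \<omega>))) \<le> 2 * weight (fl (?r - s) (X s \<omega>))"
    unfolding PJ_next[OF \<omega> s refl] using r X by (intro weight_jump flow_in_quadrant) auto
  also have "\<dots> \<le> 2 * (exp ((lam + 1) * (?r - s)) * weight (X s \<omega>))"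
    using r X by (intro mult_left_mono weight_flow) auto
  finally show ?case by simp
next
  case (Suc k)
  let ?n = "Suc (N s \<omega> + k)"
  have r: "\<sigma> ?n \<omega> \<le> \<sigma> (Suc ?n) \<omega>" using jump_time_mono[OF \<omega>] by simp
  have "weight (PJ \<omega> (Suc ?n)) \<le> 2 * weight (fl (\<sigma> (Suc ?n) \<omega> - \<sigma> ?n \<omega>) (PJ \<omega> ?n))"
    unfolding Phi_at_jump.simps(2)[where n = ?n] using r by (intro weight_jump flow_in_quadrant PJ_in_quadrant[OF \<omega>]) auto
  also have "\<dots> \<le> 2 * (exp ((lam + 1) * (\<sigma> (Suc ?n) \<omega> - \<sigma> ?n \<omega>)) * weight (PJ \<omega> ?n))"
    using r by (intro mult_left_mono weight_flow PJ_in_quadrant[OF \<omega>]) auto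
  also have "\<dots> \<le> 2 * (exp ((lam + 1) * (\<sigma> (Suc ?n) \<omega> - \<sigma> ?n \<omega>)) *
      (2 ^ Suc k * exp ((lam + 1) * (\<sigma> ?n \<omega> - s)) * weight (X s \<omega>)))"
    using Suc.IH by (intro mult_left_mono) auto
  also have "\<dots> = 2 ^ Suc (Suc k) * exp ((lam + 1) * (\<sigma> (Suc ?n) \<omega> - \<sigma> ?n \<omega>) + (lam + 1) * (\<sigma> ?n \<omega> - s)) * weight (X s \<omega>)"
    unfolding exp_add by simp
  also have "(lam + 1) * (\<sigma> (Suc ?n) \<omega> - \<sigma> ?n \<omega>) + (lam + 1) * (\<sigma> ?n \<omega> - s) = (lam + 1) * (\<sigma> (Suc ?n) \<omega> - s)"
    by (simp add: algebra_simps)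
  finally show ?case by simp
qed

lemma X_weight:
  assumes \<omega>: "\<omega> \<in> space M" and s: "0 \<le> s" "s \<le> t"
  shows "weight (X t \<omega>) \<le> 2 ^ (N t \<omega> - N s \<omega>) * exp ((lam + 1) * (t - s)) * weight (X s \<omega>)"
proof (cases "N t \<omega> = N s \<omega>")
  case True
  then show ?thesis using weight_flow[OF X_in_quadrant[OF \<omega> s(1)], of "t - s"] s X_flow[OF \<omega> s] by simp
next
  case False
  then have "N s \<omega> < N t \<omega>" using N_mono[OF \<omega> s] by simp
  then obtain k where k: "N t \<omega> = Suc (N s \<omega> + k)" by (auto dest: less_imp_Suc_add)
  let ?n = "N t \<omega>"
  have r: "\<sigma> ?n \<omega> \<le> t" using jump_time_N_le[OF \<omega>, of t ?n] s by simp
  have "weight (X t \<omega>) \<le> exp ((lam + 1) * (t - \<sigma> ?n \<omega>)) * weight (PJ \<omega> ?n)"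
    unfolding X_eq[of t] using r by (intro weight_flow PJ_in_quadrant[OF \<omega>]) auto
  also have "\<dots> \<le> exp ((lam + 1) * (t - \<sigma> ?n \<omega>)) *
      (2 ^ Suc k * exp ((lam + 1) * (\<sigma> ?n \<omega> - s)) * weight (X s \<omega>))"
    using PJ_weight[OF \<omega> s(1), of k] by (intro mult_left_mono) (auto simp: k)
  also have "\<dots> = 2 ^ Suc k * exp ((lam + 1) * (t - \<sigma> ?n \<omega>) + (lam + 1) * (\<sigma> ?n \<omega> - s)) * weight (X s \<omega>)"
    unfolding exp_add by simp
  also have "(lam + 1) * (t - \<sigma> ?n \<omega>) + (lam + 1) * (\<sigma> ?n \<omega> - s) = (lam + 1) * (t - s)"
    by (simp add: algebra_simps)
  also have "Suc k = N t \<omega> - N s \<omega>" using k by simp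
  finally show ?thesis .
qed

lemma abs_g_le_weight: "q \<in> quadrant \<Longrightarrow> \<bar>g q\<bar> \<le> weight q + cost_shift"
  using divide_nonneg_pos[of drift0 "lam + 1"] drift0_pos lam_pos cost_shift_pos max.cobounded1[of "snd q" "phi_d lam m"]
  unfolding g_eq weight_def quadrant_iff by linarith

lemma g_ge: "q \<in> quadrant \<Longrightarrow> - cost_shift \<le> g q"
  by (auto simp: g_eq quadrant_iff)

lemma flow_measurable:
  assumes "f \<in> borel_measurable K" "h \<in> borel_measurable K"
  shows "(\<lambda>x. fl (f x) (h x)) \<in> borel_measurable K"
  using measurable_compose[OF borel_measurable_Pair[OF assms] borel_measurable_continuous_onI[OF continuous_on_flow_pair]]
  by simp

lemma Phi_at_jump_measurable:
  assumes "\<And>i. \<tau> i \<in> borel_measurable K"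
  shows "(\<lambda>\<omega>. Phi_at_jump \<tau> lam mu m p \<omega> n) \<in> borel_measurable K"
proof (induction n)
  case (Suc n)
  show ?case
    unfolding Phi_at_jump.simps
    by (rule measurable_compose[OF _ borel_measurable_continuous_onI[OF continuous_on_jump]],
        rule flow_measurable) (use assms Suc in auto)
qed simp

lemma Phi_at_jump_cong: "(\<And>i. i \<le> n \<Longrightarrow> \<tau> i \<omega> = \<tau>' i \<omega>) \<Longrightarrow>
    Phi_at_jump \<tau> lam mu m p \<omega> n = Phi_at_jump \<tau>' lam mu m p \<omega> n"
  by (induction n) auto

text \<open>Only the jump times up to \<open>s\<close> enter \<open>X s\<close>, so they may be replaced by \<open>min (\<sigma> i) s\<close>,
  which is known at time \<open>s\<close>.\<close>

lemma X_measurable_past: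
  assumes sp: "space K = space M" and s: "0 \<le> s"
    and N: "\<And>u. 0 \<le> u \<Longrightarrow> u \<le> s \<Longrightarrow> N u \<in> measurable K (count_space UNIV)"
  shows "X s \<in> borel_measurable K"
proof -
  define \<tau> where "\<tau> i \<omega> = min (\<sigma> i \<omega>) s" for i \<omega>
  have \<tau>: "\<tau> i \<in> borel_measurable K" for i
    unfolding \<tau>_def by (rule min_jump_measurable[OF sp N])
  have "(\<lambda>\<omega>. fl (s - \<tau> (N s \<omega>) \<omega>) (Phi_at_jump \<tau> lam mu m p \<omega> (N s \<omega>))) \<in> borel_measurable K"
    by (rule measurable_compose_countable[where f = "\<lambda>n \<omega>. fl (s - \<tau> n \<omega>) (Phi_at_jump \<tau> lam mu m p \<omega> n)", OF _ N[OF s order_refl]],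
        rule flow_measurable) (use \<tau> in \<open>auto intro: Phi_at_jump_measurable\<close>)
  also have "(\<lambda>\<omega>. fl (s - \<tau> (N s \<omega>) \<omega>) (Phi_at_jump \<tau> lam mu m p \<omega> (N s \<omega>))) \<in> borel_measurable K
     \<longleftrightarrow> X s \<in> borel_measurable K"
  proof (rule measurable_cong)
    fix \<omega> assume "\<omega> \<in> space K"
    then have "\<tau> i \<omega> = \<sigma> i \<omega>" if "i \<le> N s \<omega>" for i
      using jump_time_N_le[OF _ s that] by (simp add: \<tau>_def sp)
    then show "fl (s - \<tau> (N s \<omega>) \<omega>) (Phi_at_jump \<tau> lam mu m p \<omega> (N s \<omega>)) = X s \<omega>"
      unfolding X_eq using Phi_at_jump_cong[of "N s \<omega>" \<tau> \<omega> \<sigma>] by simp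
  qed
  finally show ?thesis .
qed

lemma X_measurable_\<F>: "0 \<le> s \<Longrightarrow> X s \<in> borel_measurable (\<F> s)"
  by (rule X_measurable_past) (auto simp: space_\<F> intro: N_measurable_\<F>)

text \<open>Nothing is known about \<open>N\<close> at negative times, so time is cut off at 0; the
  costs below only involve \<open>u >= 0\<close>. Joint measurability makes the time integrals
  measurable in the path.\<close>

lemma X_measurable_joint: "(\<lambda>(\<omega>, u). X (max u 0) \<omega>) \<in> borel_measurable (M \<Otimes>\<^sub>M lborel)"
proof -
  have [measurable]: "\<sigma> i \<in> borel_measurable M" for i by (rule jump_time_measurable)
  have idx: "(\<lambda>z. N (max (snd z) 0) (fst z)) \<in> measurable (M \<Otimes>\<^sub>M lborel) (count_space UNIV)"
  proof (rule measurable_count_space_eq2_countable[THEN iffD2], safe)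
    fix n
    have "(\<lambda>z. N (max (snd z) 0) (fst z)) -` {n} \<inter> space (M \<Otimes>\<^sub>M lborel) =
        {z \<in> space (M \<Otimes>\<^sub>M lborel). \<sigma> n (fst z) \<le> max (snd z) 0 \<and> max (snd z) 0 < \<sigma> (Suc n) (fst z)}"
      unfolding vimage_def Int_def space_pair_measure
      by (rule set_eqI, clarsimp simp: N_eq_iff simp del: max_less_iff_conj le_max_iff_disj) (metis N_eq_iff max.cobounded2)
    also have "\<dots> \<in> sets (M \<Otimes>\<^sub>M lborel)" by measurable
    finally show "(\<lambda>z. N (max (snd z) 0) (fst z)) -` {n} \<inter> space (M \<Otimes>\<^sub>M lborel) \<in> sets (M \<Otimes>\<^sub>M lborel)" .
  qed auto
  have "(\<lambda>z. fl (max (snd z) 0 - \<sigma> (N (max (snd z) 0) (fst z)) (fst z)) (PJ (fst z) (N (max (snd z) 0) (fst z))))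
      \<in> borel_measurable (M \<Otimes>\<^sub>M lborel)"
  proof (rule measurable_compose_countable[OF _ idx, where f = "\<lambda>n z. fl (max (snd z) 0 - \<sigma> n (fst z)) (PJ (fst z) n)"])
    fix n
    have [measurable]: "(\<lambda>\<omega>. PJ \<omega> n) \<in> borel_measurable M"
      by (rule Phi_at_jump_measurable) measurable
    show "(\<lambda>z. fl (max (snd z) 0 - \<sigma> n (fst z)) (PJ (fst z) n)) \<in> borel_measurable (M \<Otimes>\<^sub>M lborel)"
      by (rule flow_measurable) measurable
  qed
  then show ?thesis by (simp add: split_beta X_eq)
qed

section \<open>The cost accumulated during one time step\<close>

lemma g_measurable: "g \<in> borel_measurable borel"
  unfolding running_cost_def[abs_def] by (intro borel_measurable_continuous_onI continuous_intros)

text \<open>Discounted to the start \<open>s\<close> of the step, not to time 0, so that it can be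
  compared with \<open>val\<close> at \<open>X s\<close>.\<close>

definition step_cost :: "real \<Rightarrow> real \<Rightarrow> 'a \<Rightarrow> real" where
  "step_cost s h \<omega> = (LINT u|lborel. indicator {s..<s + h} u * (exp (- (lam * (u - s))) * g (X u \<omega>)))"

lemma cell_measurable:
  assumes "0 \<le> s"
  shows "(\<lambda>(\<omega>, u). indicator {s..<t} u * (exp (- (lam * (u - r))) * g (X u \<omega>))) \<in> borel_measurable (M \<Otimes>\<^sub>M lborel)"
proof -
  have [measurable]: "(\<lambda>z. g (X (max (snd z) 0) (fst z))) \<in> borel_measurable (M \<Otimes>\<^sub>M lborel)"
    using measurable_compose[OF X_measurable_joint g_measurable] by (simp add: split_beta)
  have "(\<lambda>z. indicator {s..<t} (snd z) * (exp (- (lam * (snd z - r))) * g (X (max (snd z) 0) (fst z)))) \<in> borel_measurable (M \<Otimes>\<^sub>M lborel)"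
    by measurable
  also have "(\<lambda>z. indicator {s..<t} (snd z) * (exp (- (lam * (snd z - r))) * g (X (max (snd z) 0) (fst z))))
     = (\<lambda>(\<omega>, u). indicator {s..<t} u * (exp (- (lam * (u - r))) * g (X u \<omega>)))"
    using assms by (auto simp: fun_eq_iff indicator_def)
  finally show ?thesis .
qed

lemma cell_measurable_path:
  assumes "0 \<le> s" "\<omega> \<in> space M"
  shows "(\<lambda>u. indicator {s..<t} u * (exp (- (lam * (u - r))) * g (X u \<omega>))) \<in> borel_measurable borel"
  using measurable_Pair2[OF cell_measurable[OF assms(1)] assms(2)] by simp

lemma step_cost_measurable: "0 \<le> s \<Longrightarrow> step_cost s h \<in> borel_measurable M"
  unfolding step_cost_def[abs_def]
  by (rule lborel.borel_measurable_lebesgue_integral[OF cell_measurable])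

lemma abs_g_X_le:
  assumes \<omega>: "\<omega> \<in> space M" and s: "0 \<le> s" and u: "s \<le> u" "u \<le> t"
  shows "\<bar>g (X u \<omega>)\<bar> \<le> 2 ^ (N t \<omega> - N s \<omega>) * (exp (2 * (t - s)) * weight (X s \<omega>) + cost_shift)"
proof -
  have "0 < weight (X s \<omega>)" by (intro weight_pos X_in_quadrant \<omega> s)
  have "(lam + 1) * (u - s) \<le> 2 * (t - s)" using lam_lt_1 lam_pos u by (intro mult_mono) auto
  moreover have "N u \<omega> - N s \<omega> \<le> N t \<omega> - N s \<omega>" using N_mono[OF \<omega>, of u t] s u by auto
  ultimately have "2 ^ (N u \<omega> - N s \<omega>) * exp ((lam + 1) * (u - s)) * weight (X s \<omega>)
      \<le> 2 ^ (N t \<omega> - N s \<omega>) * exp (2 * (t - s)) * weight (X s \<omega>)"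
    using \<open>0 < weight _\<close> by (intro mult_right_mono mult_mono) auto
  moreover have "cost_shift \<le> 2 ^ (N t \<omega> - N s \<omega>) * cost_shift"
    using cost_shift_pos by (simp add: mult_le_cancel_right1)
  ultimately show ?thesis
    using abs_g_le_weight[OF X_in_quadrant[OF \<omega>, of u]] X_weight[OF \<omega> s u(1)] s u
    by (simp add: distrib_left mult.assoc)
qed

lemma integrable_cell_path:
  assumes "0 \<le> s" "\<omega> \<in> space M"
  shows "integrable lborel (\<lambda>u. indicator {s..<t} u * (exp (- (lam * (u - r))) * g (X u \<omega>)))"
proof (rule integrable_cell[OF cell_measurable_path[OF assms]])
  fix u assume u: "u \<in> {s..<t}"
  have "exp (- (lam * (u - r))) \<le> exp (- (lam * (s - r)))" using u lam_pos by simp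
  then show "\<bar>exp (- (lam * (u - r))) * g (X u \<omega>)\<bar> \<le>
     exp (- (lam * (s - r))) * (2 ^ (N t \<omega> - N s \<omega>) * (exp (2 * (t - s)) * weight (X s \<omega>) + cost_shift))"
    using abs_g_X_le[OF assms(2,1), of u t] u by (auto simp: abs_mult intro!: mult_mono)
qed

lemma abs_step_cost_le:
  assumes \<omega>: "\<omega> \<in> space M" and s: "0 \<le> s" and h: "0 \<le> h"
  shows "\<bar>step_cost s h \<omega>\<bar> \<le> 2 ^ (N (s + h) \<omega> - N s \<omega>) * (exp (2 * h) * weight (X s \<omega>) + cost_shift) * h"
  unfolding step_cost_def
proof (rule lborel_integral_cell_bound)
  show "0 \<le> 2 ^ (N (s + h) \<omega> - N s \<omega>) * (exp (2 * h) * weight (X s \<omega>) + cost_shift)"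
    using weight_pos[OF X_in_quadrant[OF \<omega> s]] cost_shift_pos by simp
  fix u assume u: "u \<in> {s..<s + h}"
  then have "exp (- (lam * (u - s))) * \<bar>g (X u \<omega>)\<bar> \<le> 1 * \<bar>g (X u \<omega>)\<bar>"
    using lam_pos by (intro mult_right_mono) auto
  then show "\<bar>exp (- (lam * (u - s))) * g (X u \<omega>)\<bar> \<le> 2 ^ (N (s + h) \<omega> - N s \<omega>) * (exp (2 * h) * weight (X s \<omega>) + cost_shift)"
    using abs_g_X_le[OF \<omega> s, of u "s + h"] u by (simp add: abs_mult)
qed (use h in auto)

text \<open>The speed of the flow in units of \<open>weight\<close>: \<open>2 * exp 2\<close>
  accounts for the first coordinate and 1 for the second.\<close>

definition "flow_const = 2 * exp 2 + (1::real)"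

lemma d1_flow:
  assumes q: "q \<in> quadrant" and u: "0 \<le> u" "u \<le> 1"
  shows "d1 (fl u q) q \<le> flow_const * u * weight q"
proof -
  have w: "fst q + drift0 / (lam + 1) \<le> weight q" "0 \<le> fst q + drift0 / (lam + 1)" "0 < weight q"
    using phi_d_pos drift0_pos lam_pos q weight_pos[OF q] by (auto simp: weight_def quadrant_iff)
  have "exp ((lam + 1) * u) - 1 \<le> ((lam + 1) * u) * exp ((lam + 1) * u)" by (rule exp_minus_one_le)
  also have "\<dots> \<le> (2 * u) * exp 2"
    using lam_pos lam_lt_1 u mult_mono[of "lam + 1" 2 u 1] by (intro mult_mono) auto
  finally have e: "exp ((lam + 1) * u) - 1 \<le> 2 * u * exp 2" .
  have "fst (fl u q) - fst q = (fst q + drift0 / (lam + 1)) * (exp ((lam + 1) * u) - 1)"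
    by (simp add: fst_flow algebra_simps)
  moreover have "0 \<le> exp ((lam + 1) * u) - 1" using u lam_pos by simp
  ultimately have "\<bar>fst (fl u q) - fst q\<bar> = (fst q + drift0 / (lam + 1)) * (exp ((lam + 1) * u) - 1)"
    using w by simp
  also have "\<dots> \<le> weight q * (2 * u * exp 2)"
    using w e \<open>0 \<le> exp ((lam + 1) * u) - 1\<close> by (intro mult_mono) auto
  finally have 1: "\<bar>fst (fl u q) - fst q\<bar> \<le> 2 * exp 2 * u * weight q" by (simp add: algebra_simps)
  have "snd (fl u q) - snd q = (phi_d lam m - snd q) * (1 - exp (- ((1 - lam) * u)))"
    by (simp add: snd_flow algebra_simps)
  moreover have "0 \<le> 1 - exp (- ((1 - lam) * u))" "1 - exp (- ((1 - lam) * u)) \<le> u"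
    using u lam_lt_1 exp_ge_add_one_self[of "- ((1 - lam) * u)"] mult_right_mono[of "1 - lam" 1 u] lam_pos by auto
  moreover have "\<bar>phi_d lam m - snd q\<bar> \<le> weight q"
    using q phi_d_pos divide_nonneg_pos[of drift0 "lam + 1"] drift0_pos lam_pos
    unfolding weight_def quadrant_iff by linarith
  ultimately have 2: "\<bar>snd (fl u q) - snd q\<bar> \<le> weight q * u"
    by (simp add: abs_mult mult_mono)
  show ?thesis using 1 2 by (simp add: d1_def flow_const_def algebra_simps)
qed

text \<open>Once one coordinate exceeds this level, \<open>G_ge\<close> gives
  \<open>0 <= G\<close>.\<close>

definition "far_bound = (lam + mu) * bound"

text \<open>From \<open>far\<close> points the process is still in \<open>calm\<close>, where the value vanishes, after a unit of time with
  at most one jump; all other points have bounded \<open>weight\<close>.\<close>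

definition calm :: "(real \<times> real) set" where
  "calm = {q \<in> quadrant. far_bound \<le> fst q \<or> far_bound * exp horizon \<le> snd q}"

definition far :: "(real \<times> real) set" where
  "far = {q \<in> quadrant. far_bound * (mu / (mu - 1)) \<le> fst q \<or> far_bound * exp horizon * exp 1 \<le> snd q}"

definition "near_weight = far_bound * (mu / (mu - 1)) + drift0 / (lam + 1) + (far_bound * exp horizon * exp 1 + phi_d lam m)"

lemma far_bound_pos: "0 < far_bound"
  using lam_pos mu_gt_1 bound_pos by (simp add: far_bound_def)

lemma snd_flow_ge:
  assumes "q \<in> quadrant" "0 \<le> u"
  shows "snd q * exp (- u) \<le> snd (fl u q)"
proof -
  have "snd q * exp (- u) \<le> snd q * exp (- ((1 - lam) * u))"
    using assms lam_pos by (intro mult_left_mono) (auto simp: quadrant_iff algebra_simps)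
  also have "\<dots> \<le> snd q * exp (- ((1 - lam) * u)) + phi_d lam m * (1 - exp (- ((1 - lam) * u)))"
    using phi_d_pos lam_lt_1 assms by simp
  also have "\<dots> = snd (fl u q)" by (simp add: snd_flow algebra_simps)
  finally show ?thesis .
qed

lemma calm_g: "q \<in> calm \<Longrightarrow> 0 \<le> g q"
proof -
  assume q: "q \<in> calm"
  have "cost_shift \<le> far_bound"
    using mu_gt_1 bound_pos by (simp add: cost_shift_eq far_bound_def mult_right_mono)
  moreover have "far_bound * 1 \<le> far_bound * exp horizon"
    using far_bound_pos horizon_pos by (intro mult_left_mono) auto
  ultimately show ?thesis using q by (auto simp: calm_def g_eq quadrant_iff)
qed

text \<open>\<open>G\<close> stays nonnegative along the whole path. A large first coordinate only
  grows, the factor \<open>exp horizon\<close> keeps a large second coordinate above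
  \<open>far_bound\<close> up to \<open>horizon\<close>, and later times are harmless from any
  start.\<close>

lemma calm_val:
  assumes q: "q \<in> calm"
  shows "val q = 0"
proof -
  have qQ: "q \<in> quadrant" using q by (simp add: calm_def)
  have "0 \<le> G (fl u q)" if u: "0 \<le> u" for u
  proof (cases "u \<le> horizon")
    case False
    then show ?thesis by (intro G_flow_nonneg_after_horizon qQ) simp
  next
    case True
    have fQ: "fl u q \<in> quadrant" by (intro flow_in_quadrant qQ u)
    have "far_bound \<le> fst (fl u q) \<or> far_bound \<le> snd (fl u q)"
    proof (cases "far_bound \<le> fst q")
      case True
      have "0 \<le> drift0 * u" using drift0_pos u by simp
      then show ?thesis using True fst_flow_ge[OF qQ u] by linarith
    next
      case False
      then have *: "far_bound * exp horizon \<le> snd q" using q by (simp add: calm_def)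
      have "far_bound = far_bound * exp horizon * exp (- horizon)" by (simp add: exp_minus)
      also have "\<dots> \<le> snd q * exp (- u)"
        using * True far_bound_pos qQ by (intro mult_mono) (auto simp: quadrant_iff)
      also have "\<dots> \<le> snd (fl u q)" by (rule snd_flow_ge[OF qQ u])
      finally show ?thesis ..
    qed
    then show ?thesis using G_ge[OF fQ] fQ by (auto simp: far_bound_def quadrant_iff)
  qed
  then have F: "0 \<le> F t q" if "0 \<le> t" for t
    unfolding path_cost_def by (intro integral_nonneg integrand_integrable qQ) auto
  obtain t where "t \<in> {0..horizon}" "val q = F t q" using value_attained[OF qQ] .
  with F[of t] w_le_0[OF qQ] show ?thesis by auto
qed

lemma near_weight: "q \<in> quadrant \<Longrightarrow> q \<notin> far \<Longrightarrow> weight q \<le> near_weight"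
  using phi_d_pos mult_pos_pos[OF mult_pos_pos[OF far_bound_pos exp_gt_zero[of horizon]] exp_gt_zero[of 1]]
  unfolding far_def weight_def near_weight_def mem_Collect_eq by linarith

lemma far_flow_calm:
  assumes q: "q \<in> far" and u: "0 \<le> u" "u \<le> 1"
  shows "fl u q \<in> calm"
proof -
  have qQ: "q \<in> quadrant" using q by (simp add: far_def)
  have fQ: "fl u q \<in> quadrant" by (intro flow_in_quadrant qQ u)
  show ?thesis
  proof (cases "far_bound * (mu / (mu - 1)) \<le> fst q")
    case True
    have "far_bound * 1 \<le> far_bound * (mu / (mu - 1))"
      using far_bound_pos mu_gt_1 by (intro mult_left_mono) (auto simp: divide_simps)
    moreover have "0 \<le> drift0 * u" using drift0_pos u by simp
    ultimately show ?thesis using True fst_flow_ge[OF qQ u(1)] fQ by (auto simp: calm_def)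
  next
    case False
    then have *: "far_bound * exp horizon * exp 1 \<le> snd q" using q by (simp add: far_def)
    have "far_bound * exp horizon = far_bound * exp horizon * exp 1 * exp (- 1)" by (simp add: exp_minus)
    also have "\<dots> \<le> snd q * exp (- u)"
      using * u far_bound_pos qQ by (intro mult_mono) (auto simp: quadrant_iff)
    also have "\<dots> \<le> snd (fl u q)" by (rule snd_flow_ge[OF qQ u(1)])
    finally show ?thesis using fQ by (simp add: calm_def)
  qed
qed

text \<open>The factors in \<open>far\<close> are made for this: \<open>mu / (mu - 1)\<close> undoes
  the contraction of the first coordinate by one jump, \<open>exp 1\<close> the decay of the second
  coordinate during a unit of time.\<close>

lemma far_jump_calm:
  assumes q: "q \<in> far" and u: "0 \<le> u" "0 \<le> v" "u + v \<le> 1"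
  shows "fl v (S (fl u q)) \<in> calm"
proof -
  have qQ: "q \<in> quadrant" using q by (simp add: far_def)
  have fQ: "fl u q \<in> quadrant" by (intro flow_in_quadrant qQ u)
  have sQ: "S (fl u q) \<in> quadrant" by (intro jump_in_quadrant fQ)
  have vQ: "fl v (S (fl u q)) \<in> quadrant" by (intro flow_in_quadrant sQ u)
  show ?thesis
  proof (cases "far_bound * (mu / (mu - 1)) \<le> fst q")
    case True
    have "0 \<le> drift0 * u" "0 \<le> drift0 * v" using drift0_pos u by auto
    then have "far_bound * (mu / (mu - 1)) \<le> fst (fl u q)" using True fst_flow_ge[OF qQ u(1)] by linarith
    then have "(1 - 1 / mu) * (far_bound * (mu / (mu - 1))) \<le> fst (S (fl u q))"
      unfolding fst_jump using mu_coeffs(1) by (rule mult_left_mono)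
    also have "(1 - 1 / mu) * (far_bound * (mu / (mu - 1))) = far_bound" using mu_gt_1 by (simp add: field_simps)
    finally have "far_bound \<le> fst (fl v (S (fl u q)))"
      using fst_flow_ge[OF sQ u(2)] \<open>0 \<le> drift0 * v\<close> by linarith
    then show ?thesis using vQ by (simp add: calm_def)
  next
    case False
    then have *: "far_bound * exp horizon * exp 1 \<le> snd q" using q by (simp add: far_def)
    have "far_bound * exp horizon = far_bound * exp horizon * exp 1 * exp (- 1)" by (simp add: exp_minus)
    also have "\<dots> \<le> snd q * exp (- (u + v))"
      using * u far_bound_pos qQ by (intro mult_mono) (auto simp: quadrant_iff)
    also have "\<dots> = snd q * exp (- u) * exp (- v)" by (simp add: exp_add[symmetric] mult.assoc)
    also have "\<dots> \<le> snd (fl u q) * exp (- v)"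
      by (intro mult_right_mono snd_flow_ge[OF qQ u(1)]) auto
    also have "\<dots> \<le> snd (S (fl u q)) * exp (- v)"
      using fQ mu_gt_1 by (intro mult_right_mono) (auto simp: snd_jump quadrant_iff algebra_simps)
    also have "\<dots> \<le> snd (fl v (S (fl u q)))" by (rule snd_flow_ge[OF sQ u(2)])
    finally show ?thesis using vQ by (simp add: calm_def)
  qed
qed

lemma far_measurable: "far \<in> sets borel"
proof -
  have "far = quadrant \<inter> ({q. far_bound * (mu / (mu - 1)) \<le> fst q} \<union> {q. far_bound * exp horizon * exp 1 \<le> snd q})"
    by (auto simp: far_def)
  moreover have "closed (quadrant \<inter> ({q. far_bound * (mu / (mu - 1)) \<le> fst q} \<union> {q. far_bound * exp horizon * exp 1 \<le> snd q}))"
    unfolding quadrant_def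
    by (intro closed_Int closed_Un closed_Times closed_Collect_le continuous_intros; simp)
  ultimately show ?thesis by (simp only: borel_closed)
qed

text \<open>\<open>jump_part h q j\<close> approximates \<open>step_value\<close> when the step starts at \<open>q\<close> and has \<open>j\<close> jumps; the mean of
  \<open>jump_error\<close> is of order \<open>h\<^sup>2\<close>.\<close>

definition "jump_part h q j = (if j = (0::nat) then exp (- (lam * h)) * val (fl h q) + h * g q
  else if j = 1 then val (S q) else 0)"

definition "jump_error h j = h\<^sup>2 * indicator {0::nat} j + h * indicator {1} j + 2 ^ j * indicator {2..} j"

definition "step_value s h \<omega> = exp (- (lam * h)) * val (X (s + h) \<omega>) + step_cost s h \<omega>"

text \<open>\<open>W\<close> bounds the running cost at the points of bounded weight. The first two
  terms serve steps without a jump, \<open>2 * W\<close> and \<open>bound\<close> those with several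
  jumps, the rest, together with \<open>2 * W\<close>, those with exactly one.\<close>

definition "err_const = (let W = exp 2 * near_weight + cost_shift in
   flow_const * near_weight + lam * W + 2 * W + bound + (L0 + L1) * (flow_const * (2 * exp 2 * near_weight)) + (L0 + L1) * 2 * (flow_const * near_weight) + lam * bound)"

lemma near_weight_pos: "0 < near_weight"
proof -
  have "0 < far_bound * (mu / (mu - 1))" using far_bound_pos mu_gt_1 by (intro mult_pos_pos divide_pos_pos) auto
  moreover have "0 < drift0 / (lam + 1)" using drift0_pos lam_pos by auto
  moreover have "0 < far_bound * exp horizon * exp 1" using far_bound_pos by auto
  ultimately show ?thesis using phi_d_pos unfolding near_weight_def by linarith
qed

lemma flow_const_pos: "0 < flow_const"
  by (simp add: flow_const_def add_pos_pos)

text \<open>Without a jump, freezing cost and discount costs order \<open>h^2\<close>. With one jump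
  its time and place are unknown and the error is of order \<open>h\<close>, but such a step has
  probability of order \<open>h\<close>. For more jumps a crude bound growing like
  \<open>2 ^ j\<close> is enough, their probability being of order \<open>h^2\<close>.\<close>

lemma near_step:
  assumes \<omega>: "\<omega> \<in> space M" and s: "0 \<le> s" and h: "0 < h" "h \<le> 1" and near: "weight (X s \<omega>) \<le> near_weight"
  shows "\<bar>step_value s h \<omega> - jump_part h (X s \<omega>) (N (s + h) \<omega> - N s \<omega>)\<bar>
    \<le> err_const * jump_error h (N (s + h) \<omega> - N s \<omega>)"
proof -
  define q where "q = X s \<omega>"
  define j where "j = N (s + h) \<omega> - N s \<omega>"
  define W where "W = exp 2 * near_weight + cost_shift"
  have qQ: "q \<in> quadrant" unfolding q_def by (rule X_in_quadrant[OF \<omega> s])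
  have wq: "0 < weight q" "weight q \<le> near_weight" using weight_pos[OF qQ] near by (auto simp: q_def)
  have W: "0 < W" using near_weight_pos cost_shift_pos by (simp add: W_def add_pos_pos)
  have L: "0 \<le> L0 + L1" using L0_nonneg L1_nonneg by simp
  define K1 where "K1 = flow_const * near_weight + lam * W"
  define K2 where "K2 = 2 * W + bound"
  define K3 where "K3 = (L0 + L1) * (flow_const * (2 * exp 2 * near_weight)) + (L0 + L1) * 2 * (flow_const * near_weight) + lam * bound"
  have K: "0 \<le> K1" "0 \<le> K2" "0 \<le> K3"
    unfolding K1_def K2_def K3_def
    using flow_const_pos near_weight_pos lam_pos W bound_pos L by (auto intro!: add_nonneg_nonneg mult_nonneg_nonneg)
  have err: "err_const = K1 + K2 + K3"
    by (simp add: err_const_def Let_def W_def K1_def K2_def K3_def)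
  have abs_val: "\<bar>val a\<bar> \<le> bound" if "a \<in> quadrant" for a
    using w_ge[OF that] w_le_0[OF that] bound_pos by (simp add: abs_le_iff)
  have sh: "X (s + h) \<omega> \<in> quadrant" using s h by (intro X_in_quadrant \<omega>) auto
  have step: "\<bar>step_cost s h \<omega>\<bar> \<le> 2 ^ j * W * h"
  proof -
    have "exp (2 * h) * weight q \<le> exp 2 * near_weight" using h wq by (intro mult_mono) auto
    then have "2 ^ j * (exp (2 * h) * weight q + cost_shift) * h \<le> 2 ^ j * W * h"
      unfolding W_def using h by (intro mult_right_mono mult_left_mono) auto
    with abs_step_cost_le[OF \<omega> s, of h, folded q_def j_def] h show ?thesis by linarith
  qed
  have disc: "\<bar>exp (- (lam * h)) * val (X (s + h) \<omega>)\<bar> \<le> bound"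
  proof -
    have "exp (- (lam * h)) * \<bar>val (X (s + h) \<omega>)\<bar> \<le> 1 * bound"
      using h lam_pos abs_val[OF sh] by (intro mult_mono) auto
    then show ?thesis by (simp add: abs_mult)
  qed
  consider "j = 0" | "j = 1" | "2 \<le> j" by linarith
  then have "\<bar>step_value s h \<omega> - jump_part h q j\<bar> \<le> err_const * jump_error h j"
  proof cases
    case 1
    have X: "X u \<omega> = fl (u - s) q" if "u \<in> {s..s + h}" for u
    proof -
      have "N s \<omega> \<le> N u \<omega>" "N u \<omega> \<le> N (s + h) \<omega>" using N_mono[OF \<omega>] s that by auto
      then have "N u \<omega> = N s \<omega>" using 1 by (simp add: j_def)
      then show ?thesis using X_flow[OF \<omega> s, of u] that by (simp add: q_def)
    qed
    have gi: "integrable lborel (\<lambda>u. indicator {s..<s + h} u * g q)"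
      using h by (intro integrable_mult_left integrable_real_indicator) auto
    have "step_cost s h \<omega> - h * g q =
       (LINT u|lborel. indicator {s..<s + h} u * (exp (- (lam * (u - s))) * g (X u \<omega>))) - (LINT u|lborel. indicator {s..<s + h} u * g q)"
      using h by (simp add: step_cost_def)
    also have "\<dots> = (LINT u|lborel. indicator {s..<s + h} u * (exp (- (lam * (u - s))) * g (X u \<omega>) - g q))"
      by (subst Bochner_Integration.integral_diff[symmetric, OF integrable_cell_path[OF s \<omega>] gi]) (simp add: right_diff_distrib)
    finally have eq: "step_cost s h \<omega> - h * g q = \<dots>" .
    have "\<bar>step_cost s h \<omega> - h * g q\<bar> \<le> (K1 * h) * h"
      unfolding eq
    proof (rule lborel_integral_cell_bound)
      fix u assume u: "u \<in> {s..<s + h}"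
      define v where "v = u - s"
      have v: "0 \<le> v" "v \<le> h" "v \<le> 1" using u h by (auto simp: v_def)
      have e: "0 \<le> 1 - exp (- (lam * v))" "1 - exp (- (lam * v)) \<le> lam * v"
        using v lam_pos exp_ge_add_one_self[of "- (lam * v)"] by auto
      have "exp (- (lam * v)) * g (fl v q) - g q = exp (- (lam * v)) * (g (fl v q) - g q) - (1 - exp (- (lam * v))) * g q"
        by (simp add: algebra_simps)
      then have "\<bar>exp (- (lam * v)) * g (fl v q) - g q\<bar> \<le> exp (- (lam * v)) * \<bar>g (fl v q) - g q\<bar> + (1 - exp (- (lam * v))) * \<bar>g q\<bar>"
        using e(1) abs_triangle_ineq4[of "exp (- (lam * v)) * (g (fl v q) - g q)" "(1 - exp (- (lam * v))) * g q"]
        by (simp only: abs_mult abs_of_nonneg abs_exp_cancel)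
      also have "exp (- (lam * v)) * \<bar>g (fl v q) - g q\<bar> \<le> 1 * (flow_const * v * weight q)"
        using v lam_pos abs_g_diff_le[of "fl v q" q] d1_flow[OF qQ v(1,3)] by (intro mult_mono) auto
      also have "1 * (flow_const * v * weight q) \<le> flow_const * h * near_weight"
        using v wq flow_const_pos near_weight_pos h by (simp add: mult_mono)
      also have "(1 - exp (- (lam * v))) * \<bar>g q\<bar> \<le> (lam * h) * W"
      proof (rule mult_mono)
        show "1 - exp (- (lam * v)) \<le> lam * h" using e(2) mult_left_mono[OF v(2), of lam] lam_pos by linarith
        have "1 * near_weight \<le> exp 2 * near_weight" using near_weight_pos by (intro mult_right_mono) auto
        then show "\<bar>g q\<bar> \<le> W" using abs_g_le_weight[OF qQ] wq unfolding W_def by linarith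
      qed (use lam_pos h in auto)
      finally show "\<bar>exp (- (lam * (u - s))) * g (X u \<omega>) - g q\<bar> \<le> K1 * h"
        using X[of u] u by (simp add: v_def K1_def algebra_simps)
    qed (use h K in auto)
    then have "\<bar>step_value s h \<omega> - jump_part h q j\<bar> \<le> K1 * h\<^sup>2"
      using X[of "s + h"] h 1 by (simp add: step_value_def jump_part_def power2_eq_square algebra_simps)
    also have "\<dots> \<le> err_const * jump_error h j"
      using 1 K by (simp add: jump_error_def err mult_right_mono)
    finally show ?thesis .
  next
    case 2
    then have "N (s + h) \<omega> = Suc (N s \<omega>)" by (simp add: j_def)
    then obtain r where r: "s \<le> r" "r \<le> s + h" and X: "X (s + h) \<omega> = fl (s + h - r) (S (fl (r - s) q))"
      using X_one_jump[OF \<omega> s, of "s + h"] h unfolding q_def by auto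
    \<comment> \<open>The path jumps at \<open>a\<close> and lands in \<open>b\<close>; the pieces
      of flow before and after the jump both displace by order \<open>h\<close> only.\<close>
    define a b where "a = fl (r - s) q" and "b = S a"
    have a: "a \<in> quadrant" and b: "b \<in> quadrant"
      using r qQ by (auto simp: a_def b_def intro!: flow_in_quadrant jump_in_quadrant)
    have "weight b \<le> 2 * (exp ((lam + 1) * (r - s)) * weight q)"
      unfolding b_def using weight_jump[OF a] weight_flow[OF qQ, of "r - s"] r by (simp add: a_def)
    also have "\<dots> \<le> 2 * (exp 2 * near_weight)"
      using wq r h lam_pos lam_lt_1 mult_mono[of "lam + 1" 2 "r - s" 1] by (intro mult_left_mono mult_mono) auto
    finally have wb: "weight b \<le> 2 * exp 2 * near_weight" by simp
    have "d1 (X (s + h) \<omega>) (S q) \<le> d1 (fl (s + h - r) b) b + d1 b (S q)"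
      unfolding X a_def[symmetric] b_def[symmetric] by (rule d1_triangle)
    also have "d1 (fl (s + h - r) b) b \<le> flow_const * (s + h - r) * weight b"
      using r h by (intro d1_flow b) auto
    also have "\<dots> \<le> flow_const * h * (2 * exp 2 * near_weight)"
      using r wb flow_const_pos near_weight_pos weight_pos[OF b] h by (intro mult_mono) auto
    also have "d1 b (S q) \<le> 2 * d1 a q" unfolding b_def by (rule d1_jump)
    also have "d1 a q \<le> flow_const * (r - s) * weight q"
      unfolding a_def using r h by (intro d1_flow qQ) auto
    also have "\<dots> \<le> flow_const * h * near_weight"
      using r wq flow_const_pos near_weight_pos h by (intro mult_mono) auto
    finally have d: "d1 (X (s + h) \<omega>) (S q) \<le> flow_const * h * (2 * exp 2 * near_weight) + 2 * (flow_const * h * near_weight)"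
      by simp
    have "\<bar>val (X (s + h) \<omega>) - val (S q)\<bar> \<le> (L0 + L1) * (flow_const * h * (2 * exp 2 * near_weight) + 2 * (flow_const * h * near_weight))"
      using abs_val_diff_le[OF sh jump_in_quadrant[OF qQ]] mult_left_mono[OF d L] by simp
    moreover have "\<bar>exp (- (lam * h)) * val (X (s + h) \<omega>) - val (X (s + h) \<omega>)\<bar> \<le> lam * h * bound"
    proof -
      have "\<bar>exp (- (lam * h)) - 1\<bar> \<le> lam * h"
        using lam_pos h exp_ge_add_one_self[of "- (lam * h)"] by auto
      then have "\<bar>exp (- (lam * h)) - 1\<bar> * \<bar>val (X (s + h) \<omega>)\<bar> \<le> lam * h * bound"
        using abs_val[OF sh] lam_pos h by (intro mult_mono) auto
      then show ?thesis by (simp add: abs_mult[symmetric] left_diff_distrib)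
    qed
    ultimately have "\<bar>step_value s h \<omega> - val (S q)\<bar> \<le> K3 * h + 2 * W * h"
      using step 2 unfolding step_value_def K3_def by (simp add: algebra_simps)
    also have "\<dots> \<le> err_const * h"
      using K bound_pos h by (simp add: err K2_def distrib_right)
    finally show ?thesis using 2 by (simp add: jump_part_def jump_error_def)
  next
    case 3
    have "1 * bound \<le> 2 ^ j * bound" using bound_pos by (intro mult_right_mono) auto
    moreover have "2 ^ j * W * h \<le> 2 ^ j * W" using h W by simp
    moreover have "0 \<le> 2 ^ j * W" using W by simp
    moreover have "K2 * 2 ^ j = 2 * (2 ^ j * W) + 2 ^ j * bound" by (simp add: K2_def algebra_simps)
    ultimately have "\<bar>step_value s h \<omega>\<bar> \<le> K2 * 2 ^ j"
      using disc step abs_triangle_ineq[of "exp (- (lam * h)) * val (X (s + h) \<omega>)" "step_cost s h \<omega>"]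
      unfolding step_value_def by linarith
    also have "\<dots> \<le> err_const * 2 ^ j" using K by (simp add: err)
    finally show ?thesis using 3 by (simp add: jump_part_def jump_error_def)
  qed
  then show ?thesis by (simp add: q_def j_def)
qed

lemma step_value_ge:
  assumes \<omega>: "\<omega> \<in> space M" and s: "0 \<le> s" and h: "0 < h" "h \<le> 1"
  shows "- (bound + cost_shift) \<le> step_value s h \<omega>"
proof -
  have "X (s + h) \<omega> \<in> quadrant" using s h by (intro X_in_quadrant \<omega>) auto
  then have "exp (- (lam * h)) * (- val (X (s + h) \<omega>)) \<le> 1 * bound"
    using h lam_pos w_ge w_le_0 by (intro mult_mono) (auto simp: minus_le_iff)
  moreover have "- cost_shift \<le> step_cost s h \<omega>"
  proof -
    have "- cost_shift \<le> (LINT u|lborel. indicator {s..<s + h} u * (- cost_shift))"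
      using h cost_shift_pos by simp
    also have "\<dots> \<le> step_cost s h \<omega>"
      unfolding step_cost_def
    proof (rule integral_mono[OF _ integrable_cell_path[OF s \<omega>]])
      show "integrable lborel (\<lambda>u. indicator {s..<s + h} u * (- cost_shift))"
        using h by (intro integrable_mult_left integrable_real_indicator) auto
      fix u
      have "- cost_shift \<le> exp (- (lam * (u - s))) * g (X u \<omega>)" if u: "u \<in> {s..<s + h}"
      proof -
        have "exp (- (lam * (u - s))) * (- g (X u \<omega>)) \<le> exp (- (lam * (u - s))) * cost_shift"
          using g_ge[OF X_in_quadrant[OF \<omega>, of u]] u s by (intro mult_left_mono) auto
        also have "\<dots> \<le> 1 * cost_shift" using u lam_pos cost_shift_pos by (intro mult_right_mono) auto
        finally show ?thesis by simp
      qed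
      then show "indicator {s..<s + h} u * (- cost_shift) \<le> indicator {s..<s + h} u * (exp (- (lam * (u - s))) * g (X u \<omega>))"
        by (simp add: indicator_def)
    qed
    finally show ?thesis .
  qed
  ultimately show ?thesis by (simp add: step_value_def)
qed

text \<open>The estimate of \<open>near_step\<close> grows with the weight and is useless far out.
  There \<open>val\<close> vanishes at the start of the step, so a lower bound is all that is
  needed, and it can fail to be 0 only after two jumps.\<close>

lemma far_step:
  assumes \<omega>: "\<omega> \<in> space M" and s: "0 \<le> s" and h: "0 < h" "h \<le> 1" and far: "X s \<omega> \<in> far"
  shows "- (bound + cost_shift) * indicator {2..} (N (s + h) \<omega> - N s \<omega>) \<le> step_value s h \<omega>"
proof (cases "2 \<le> N (s + h) \<omega> - N s \<omega>")
  case True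
  then show ?thesis using step_value_ge[OF \<omega> s h] by simp
next
  case False
  have calm: "X u \<omega> \<in> calm" if u: "u \<in> {s..s + h}" for u
  proof -
    have le: "N s \<omega> \<le> N u \<omega>" "N u \<omega> \<le> N (s + h) \<omega>" using N_mono[OF \<omega>] s u by auto
    with False consider "N u \<omega> = N s \<omega>" | "N u \<omega> = Suc (N s \<omega>)" by linarith
    then show ?thesis
    proof cases
      case 1
      then have "X u \<omega> = fl (u - s) (X s \<omega>)" using X_flow[OF \<omega> s, of u] u by simp
      then show ?thesis using far_flow_calm[OF far, of "u - s"] u h by simp
    next
      case 2
      then obtain r where "s \<le> r" "r \<le> u" "X u \<omega> = fl (u - r) (S (fl (r - s) (X s \<omega>)))"
        using X_one_jump[OF \<omega> s, of u] u by auto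
      then show ?thesis using far_jump_calm[OF far, of "r - s" "u - r"] u h by simp
    qed
  qed
  have "0 \<le> step_cost s h \<omega>"
    unfolding step_cost_def
    by (rule Bochner_Integration.integral_nonneg) (use calm calm_g in \<open>auto simp: indicator_def\<close>)
  moreover have "val (X (s + h) \<omega>) = 0" using calm[of "s + h"] h by (intro calm_val) auto
  ultimately show ?thesis using False by (simp add: step_value_def)
qed

end

section \<open>Expected cost of one time step\<close>

lemma measure_pmf_nat_integral:
  fixes f :: "nat \<Rightarrow> real"
  assumes "\<And>j. 0 \<le> f j" "summable (\<lambda>j. pmf P j * f j)"
  shows "integrable (measure_pmf P) f" "(LINT j|measure_pmf P. f j) = (\<Sum>j. pmf P j * f j)"
proof -
  have 1: "integrable (count_space UNIV) (\<lambda>j. pmf P j * f j)"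
    using assms by (simp add: integrable_count_space_nat_iff)
  then show "integrable (measure_pmf P) f"
    unfolding measure_pmf_eq_density by (subst integrable_density) auto
  show "(LINT j|measure_pmf P. f j) = (\<Sum>j. pmf P j * f j)"
    unfolding measure_pmf_eq_density using integral_count_space_nat[OF 1] by (subst integral_density) auto
qed

lemma fact_Suc_Suc_ge: "fact k \<le> (fact (k + 2) :: real)"
  by (rule fact_mono) simp

context poisson_disorder_process
begin

lemma increment_expectation:
  fixes f :: "nat \<Rightarrow> real"
  assumes st: "0 \<le> s" "s < t" and f: "\<And>j. 0 \<le> f j" "summable (\<lambda>j. pmf (poisson_pmf (mu * (t - s))) j * f j)"
  shows "integrable (completion M) (\<lambda>\<omega>. f (N t \<omega> - N s \<omega>))"
    and "(\<integral>\<omega>. f (N t \<omega> - N s \<omega>) \<partial>completion M) = (\<Sum>j. pmf (poisson_pmf (mu * (t - s))) j * f j)"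
proof -
  have d: "distr M (count_space UNIV) (\<lambda>\<omega>. N t \<omega> - N s \<omega>) = measure_pmf (poisson_pmf (mu * (t - s)))"
    using poisson st by (simp add: poisson_process_def)
  note m = increment_measurable[OF st]
  have fm: "(\<lambda>\<omega>. f (N t \<omega> - N s \<omega>)) \<in> borel_measurable M"
    by (rule measurable_compose[OF m]) simp
  show "integrable (completion M) (\<lambda>\<omega>. f (N t \<omega> - N s \<omega>))"
    using measure_pmf_nat_integral(1)[OF f] integrable_distr_eq[OF m, of f] fm
    by (simp add: d integrable_completion)
  show "(\<integral>\<omega>. f (N t \<omega> - N s \<omega>) \<partial>completion M) = (\<Sum>j. pmf (poisson_pmf (mu * (t - s))) j * f j)"
    using measure_pmf_nat_integral(2)[OF f] integral_distr[OF m, of f] fm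
    by (simp add: d integral_completion)
qed

text \<open>Each jump at most doubles \<open>weight\<close>, so this exponential moment dominates
  all costs up to a fixed time.\<close>

lemma integrable_two_power_N:
  assumes t: "0 < t"
  shows "integrable (completion M) (\<lambda>\<omega>. 2 ^ N t \<omega> :: real)"
proof -
  have "summable (\<lambda>j. exp (- (mu * t)) * ((2 * (mu * t)) ^ j /\<^sub>R fact j))"
    by (intro summable_mult summable_exp_generic)
  also have "(\<lambda>j. exp (- (mu * t)) * ((2 * (mu * t)) ^ j /\<^sub>R fact j)) = (\<lambda>j. pmf (poisson_pmf (mu * (t - 0))) j * 2 ^ j)"
    using t mu_gt_1 by (auto simp: fun_eq_iff power_mult_distrib field_simps)
  finally have "integrable (completion M) (\<lambda>\<omega>. 2 ^ (N t \<omega> - N 0 \<omega>) :: real)"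
    by (intro increment_expectation(1)) (use t in auto)
  then show ?thesis
    by (rule Bochner_Integration.integrable_cong[THEN iffD1, rotated -1]) (auto simp: N_0)
qed

text \<open>The three terms are the contributions of no jump, one jump and at least two jumps to the
  mean of \<open>jump_error\<close>, for \<open>h <= 1\<close>.\<close>

definition "error_rate = 1 + mu + 4 * mu\<^sup>2 * exp (2 * mu)"

lemma error_rate_pos: "0 < error_rate"
  using mu_gt_1 by (simp add: error_rate_def add_pos_pos)

lemma jump_error_expectation:
  assumes s: "0 \<le> s" and h: "0 < h" "h \<le> 1"
  shows "integrable (completion M) (\<lambda>\<omega>. jump_error h (N (s + h) \<omega> - N s \<omega>))"
    and "(\<integral>\<omega>. jump_error h (N (s + h) \<omega> - N s \<omega>) \<partial>completion M) \<le> error_rate * h\<^sup>2"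
proof -
  define r where "r = mu * h"
  have r: "0 < r" "r \<le> mu" using h mu_gt_1 by (auto simp: r_def)
  define f where "f j = pmf (poisson_pmf r) j * jump_error h j" for j
  have nn: "0 \<le> jump_error h j" for j using h by (auto simp: jump_error_def)
  \<comment> \<open>The factor \<open>r^2\<close> is pulled out of the Poisson weights, and
    \<open>fact k <= fact (k + 2)\<close> leaves an exponential series.\<close>
  have tail: "f (k + 2) \<le> 4 * r\<^sup>2 * ((2 * r) ^ k /\<^sub>R fact k)" for k
  proof -
    have "f (k + 2) = r ^ (k + 2) / fact (k + 2) * exp (- r) * 2 ^ (k + 2)"
      using r by (simp add: f_def jump_error_def)
    also have "\<dots> = 4 * r\<^sup>2 * ((2 * r) ^ k / fact (k + 2)) * exp (- r)"
      by (simp add: power_add power_mult_distrib power2_eq_square)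
    also have "\<dots> \<le> 4 * r\<^sup>2 * ((2 * r) ^ k / fact k) * 1"
      using r fact_Suc_Suc_ge[of k] by (intro mult_mono mult_left_mono divide_left_mono) (auto simp del: fact_Suc)
    finally show ?thesis by (simp add: divide_inverse mult.commute)
  qed
  have sum_exp: "(\<lambda>k. 4 * r\<^sup>2 * ((2 * r) ^ k /\<^sub>R fact k)) sums (4 * r\<^sup>2 * exp (2 * r))"
    by (intro sums_mult exp_converges)
  have f_nn: "0 \<le> f j" for j by (simp add: f_def nn)
  have "summable (\<lambda>k. f (k + 2))"
    by (rule summable_comparison_test'[OF sums_summable[OF sum_exp], of 0]) (use tail f_nn in auto)
  then have sf: "summable f" by (simp only: summable_iff_shift)
  have "suminf f = (\<Sum>k. f (k + 2)) + (f 0 + f 1)"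
    using suminf_split_initial_segment[OF sf, of 2] by (simp add: eval_nat_numeral)
  also have "(\<Sum>k. f (k + 2)) \<le> 4 * r\<^sup>2 * exp (2 * r)"
    using suminf_le[OF tail \<open>summable (\<lambda>k. f (k + 2))\<close> sums_summable[OF sum_exp]] sums_unique[OF sum_exp] by simp
  also have "4 * r\<^sup>2 * exp (2 * r) \<le> 4 * r\<^sup>2 * exp (2 * mu)" using r by (intro mult_left_mono) auto
  also have "f 0 \<le> h\<^sup>2" using r by (simp add: f_def jump_error_def mult_left_le_one_le)
  also have "f 1 \<le> r * h"
  proof -
    have "f 1 = (r * h) * exp (- r)" using r by (simp add: f_def jump_error_def)
    also have "\<dots> \<le> (r * h) * 1" using r h by (intro mult_left_mono) auto
    finally show ?thesis by simp
  qed
  finally have "suminf f \<le> error_rate * h\<^sup>2"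
    by (simp add: error_rate_def r_def power2_eq_square algebra_simps)
  moreover have "s + h - s = h" by simp
  moreover have "f = (\<lambda>j. pmf (poisson_pmf (mu * (s + h - s))) j * jump_error h j)"
    by (simp add: f_def r_def fun_eq_iff)
  ultimately show "integrable (completion M) (\<lambda>\<omega>. jump_error h (N (s + h) \<omega> - N s \<omega>))"
    and "(\<integral>\<omega>. jump_error h (N (s + h) \<omega> - N s \<omega>) \<partial>completion M) \<le> error_rate * h\<^sup>2"
    using increment_expectation[of s "s + h" "jump_error h"] s h nn sf by auto
qed

lemma function_of_X_measurable:
  assumes s: "0 \<le> s" and f: "continuous_on quadrant (f :: real \<times> real \<Rightarrow> real)"
  shows "(\<lambda>\<omega>. f (X s \<omega>)) \<in> borel_measurable (\<F> s)"
proof -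
  have "closed quadrant" by (simp add: quadrant_def closed_Times)
  then have "(\<lambda>q. indicator quadrant q *\<^sub>R f q) \<in> borel_measurable borel"
    by (intro borel_measurable_continuous_on_indicator f) auto
  from measurable_compose[OF X_measurable_\<F>[OF s] this]
  show ?thesis
    by (rule measurable_cong[THEN iffD1, rotated]) (auto simp: space_\<F> X_in_quadrant s)
qed

lemma continuous_on_g: "continuous_on U g"
  unfolding running_cost_def[abs_def] by (intro continuous_intros)

lemma continuous_on_flow_point: "continuous_on U (\<lambda>q. fl h q)"
  unfolding flow_def x_flow_def y_flow_def affine_ode_sol_eq using lam_pos lam_lt_1
  by (auto intro!: continuous_intros)

lemma abs_val_le: "q \<in> quadrant \<Longrightarrow> \<bar>val q\<bar> \<le> bound"
  using w_ge[of q] w_le_0[of q] bound_pos by (simp add: abs_le_iff)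

text \<open>The mean of \<open>jump_part h q\<close> under the Poisson law with mean
  \<open>mu * h\<close>.\<close>

definition "comb h q = exp (- (mu * h)) * (exp (- (lam * h)) * val (fl h q) + h * g q) + mu * h * exp (- (mu * h)) * val (S q)"

lemma comb_eq: "comb h q = exp (- ((lam + mu) * h)) * val (fl h q) + exp (- (mu * h)) * (h * G q)"
proof -
  have "exp (- ((lam + mu) * h)) = exp (- (mu * h)) * exp (- (lam * h))"
    by (simp add: exp_add[symmetric] algebra_simps)
  then show ?thesis by (simp add: comb_def dyn_cost_def algebra_simps)
qed

definition "comb_const = (let A = exp 2 * near_weight + cost_shift + mu * bound in
   mu * A + (lam + mu) * A + (1 + mu * ((L0 + L1) * 2)) * (flow_const * near_weight))"

text \<open>Both expressions contain the same term with \<open>val (fl h q)\<close>. What remains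
  are \<open>exp (- (mu * h)) * (h * G q)\<close> and \<open>F h q\<close>, each within order
  \<open>h^2\<close> of \<open>h * G q\<close>.\<close>

lemma comb_near:
  assumes q: "q \<in> quadrant" "weight q \<le> near_weight" and h: "0 < h" "h \<le> 1"
  shows "\<bar>comb h q - (F h q + exp (- ((lam + mu) * h)) * val (fl h q))\<bar> \<le> comb_const * h\<^sup>2"
proof -
  define A where "A = exp 2 * near_weight + cost_shift + mu * bound"
  define B where "B = (1 + mu * ((L0 + L1) * 2)) * (flow_const * near_weight)"
  have L: "0 \<le> L0 + L1" using L0_nonneg L1_nonneg by simp
  have nw: "0 < near_weight" by (rule near_weight_pos)
  have A: "\<bar>G q\<bar> \<le> A"
  proof -
    have "\<bar>g q\<bar> \<le> weight q + cost_shift" by (rule abs_g_le_weight[OF q(1)])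
    moreover have "1 * near_weight \<le> exp 2 * near_weight" using nw by (intro mult_right_mono) auto
    moreover have "\<bar>mu * val (S q)\<bar> \<le> mu * bound"
      using abs_val_le[OF jump_in_quadrant[OF q(1)]] mu_gt_1 by (simp add: abs_mult)
    moreover have "\<bar>G q\<bar> \<le> \<bar>g q\<bar> + \<bar>mu * val (S q)\<bar>" unfolding dyn_cost_def by (rule abs_triangle_ineq)
    ultimately show ?thesis using q(2) unfolding A_def by linarith
  qed
  then have A0: "0 \<le> A" by linarith
  have B0: "0 \<le> B" unfolding B_def using L0_nonneg L1_nonneg mu_gt_1 flow_const_pos nw by (intro mult_nonneg_nonneg add_nonneg_nonneg) auto
  have diff: "\<bar>G (fl u q) - G q\<bar> \<le> B * h" if u: "0 \<le> u" "u \<le> h" for u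
  proof -
    have fQ: "fl u q \<in> quadrant" by (intro flow_in_quadrant q u)
    have d: "d1 (fl u q) q \<le> flow_const * h * near_weight"
    proof -
      have "d1 (fl u q) q \<le> flow_const * u * weight q" using u h by (intro d1_flow q) auto
      also have "\<dots> \<le> flow_const * h * near_weight"
        using u q(2) flow_const_pos weight_pos[OF q(1)] h by (intro mult_mono) auto
      finally show ?thesis .
    qed
    have "\<bar>G (fl u q) - G q\<bar> \<le> (1 + mu * ((L0 + L1) * 2)) * d1 (fl u q) q"
      by (intro abs_G_diff_le fQ q)
    also have "\<dots> \<le> (1 + mu * ((L0 + L1) * 2)) * (flow_const * h * near_weight)"
      using d mu_gt_1 L by (intro mult_left_mono) auto
    finally show ?thesis by (simp add: B_def algebra_simps)
  qed
  have "\<bar>F h q - h * G q\<bar> \<le> ((lam + mu) * A * h + B * h) * h"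
  proof -
    have ci: "(\<lambda>u. exp (- ((lam + mu) * u)) * G (fl u q)) integrable_on {0..h}"
      by (rule integrand_integrable[OF q(1)]) simp
    have "F h q - h * G q = integral {0..h} (\<lambda>u. exp (- ((lam + mu) * u)) * G (fl u q) - G q)"
      unfolding path_cost_def
      using Henstock_Kurzweil_Integration.integral_diff[OF ci integrable_const_ivl[of "G q" 0 h]] h by simp
    also have "\<bar>\<dots>\<bar> \<le> ((lam + mu) * A * h + B * h) * (h - 0)"
      unfolding real_norm_def[symmetric]
    proof (rule integral_bound)
      show "continuous_on {0..h} (\<lambda>u. exp (- ((lam + mu) * u)) * G (fl u q) - G q)"
        by (intro continuous_intros continuous_on_integrand[OF q(1)]) auto
      fix u assume u: "u \<in> {0..h}"
      have e: "0 \<le> 1 - exp (- ((lam + mu) * u))" "1 - exp (- ((lam + mu) * u)) \<le> (lam + mu) * u"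
        using u lam_pos mu_gt_1 exp_ge_add_one_self[of "- ((lam + mu) * u)"] by auto
      have "exp (- ((lam + mu) * u)) * G (fl u q) - G q = exp (- ((lam + mu) * u)) * (G (fl u q) - G q) - (1 - exp (- ((lam + mu) * u))) * G q"
        by (simp add: algebra_simps)
      then have "\<bar>exp (- ((lam + mu) * u)) * G (fl u q) - G q\<bar> \<le> exp (- ((lam + mu) * u)) * \<bar>G (fl u q) - G q\<bar> + (1 - exp (- ((lam + mu) * u))) * \<bar>G q\<bar>"
        using e(1) abs_triangle_ineq4[of "exp (- ((lam + mu) * u)) * (G (fl u q) - G q)" "(1 - exp (- ((lam + mu) * u))) * G q"]
        by (simp only: abs_mult abs_of_nonneg abs_exp_cancel)
      also have "exp (- ((lam + mu) * u)) * \<bar>G (fl u q) - G q\<bar> \<le> 1 * (B * h)"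
        using e diff[of u] u by (intro mult_mono) auto
      also have "(1 - exp (- ((lam + mu) * u))) * \<bar>G q\<bar> \<le> ((lam + mu) * h) * A"
      proof (rule mult_mono)
        have "(lam + mu) * u \<le> (lam + mu) * h" using u lam_pos mu_gt_1 by (intro mult_left_mono) auto
        then show "1 - exp (- ((lam + mu) * u)) \<le> (lam + mu) * h" using e(2) by linarith
      qed (use A lam_pos mu_gt_1 h in auto)
      finally show "norm (exp (- ((lam + mu) * u)) * G (fl u q) - G q) \<le> (lam + mu) * A * h + B * h"
        by (simp add: algebra_simps)
    qed (use h in auto)
    finally show ?thesis by simp
  qed
  moreover have "\<bar>exp (- (mu * h)) * (h * G q) - h * G q\<bar> \<le> mu * h * (h * A)"
  proof -
    have "\<bar>exp (- (mu * h)) - 1\<bar> \<le> mu * h"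
      using mu_gt_1 h exp_ge_add_one_self[of "- (mu * h)"] by auto
    then have "\<bar>exp (- (mu * h)) - 1\<bar> * (h * \<bar>G q\<bar>) \<le> mu * h * (h * A)"
      using A h mu_gt_1 by (intro mult_mono) auto
    moreover have "\<bar>exp (- (mu * h)) * (h * G q) - h * G q\<bar> = \<bar>exp (- (mu * h)) - 1\<bar> * (h * \<bar>G q\<bar>)"
    proof -
      have "exp (- (mu * h)) * (h * G q) - h * G q = (exp (- (mu * h)) - 1) * (h * G q)" by (simp add: algebra_simps)
      then show ?thesis using h by (simp add: abs_mult)
    qed
    ultimately show ?thesis by simp
  qed
  moreover have "comb h q - (F h q + exp (- ((lam + mu) * h)) * val (fl h q)) =
     (exp (- (mu * h)) * (h * G q) - h * G q) - (F h q - h * G q)" by (simp add: comb_eq)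
  ultimately have "\<bar>comb h q - (F h q + exp (- ((lam + mu) * h)) * val (fl h q))\<bar> \<le>
     mu * h * (h * A) + ((lam + mu) * A * h + B * h) * h"
    using abs_triangle_ineq4[of "exp (- (mu * h)) * (h * G q) - h * G q" "F h q - h * G q"] by linarith
  also have "\<dots> = comb_const * h\<^sup>2"
    by (simp add: comb_const_def Let_def A_def B_def power2_eq_square algebra_simps)
  finally show ?thesis .
qed

lemma abs_step_cost_le_initial:
  assumes \<omega>: "\<omega> \<in> space M" and s: "0 \<le> s" and h: "0 < h" "s + h \<le> t"
  shows "\<bar>step_cost s h \<omega>\<bar> \<le> 2 ^ N t \<omega> * (exp (2 * t) * weight p + cost_shift) * h"
  unfolding step_cost_def
proof (rule lborel_integral_cell_bound)
  show "0 \<le> 2 ^ N t \<omega> * (exp (2 * t) * weight p + cost_shift)"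
    using weight_pos[OF p_in] cost_shift_pos by simp
  fix u assume u: "u \<in> {s..<s + h}"
  then have "exp (- (lam * (u - s))) * \<bar>g (X u \<omega>)\<bar> \<le> 1 * \<bar>g (X u \<omega>)\<bar>"
    using lam_pos by (intro mult_right_mono) auto
  then show "\<bar>exp (- (lam * (u - s))) * g (X u \<omega>)\<bar> \<le> 2 ^ N t \<omega> * (exp (2 * t) * weight p + cost_shift)"
    using abs_g_X_le[OF \<omega>, of 0 u t] u s h X_0[OF \<omega>] N_0[OF \<omega>] by (simp add: abs_mult)
qed (use h in auto)

lemma integrable_step_cost:
  assumes "0 \<le> s" "0 < h"
  shows "integrable (completion M) (step_cost s h)"
proof (rule Bochner_Integration.integrable_bound)
  show "integrable (completion M) (\<lambda>\<omega>. 2 ^ N (s + h) \<omega> * (exp (2 * (s + h)) * weight p + cost_shift) * h)"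
    using assms by (intro integrable_mult_left integrable_two_power_N) auto
  show "step_cost s h \<in> borel_measurable (completion M)"
    by (intro measurable_completion step_cost_measurable assms)
  show "AE \<omega> in completion M. norm (step_cost s h \<omega>) \<le> norm (2 ^ N (s + h) \<omega> * (exp (2 * (s + h)) * weight p + cost_shift) * h)"
  proof (rule AE_I2)
    fix \<omega> assume "\<omega> \<in> space (completion M)"
    then have "\<bar>step_cost s h \<omega>\<bar> \<le> 2 ^ N (s + h) \<omega> * (exp (2 * (s + h)) * weight p + cost_shift) * h"
      using assms by (intro abs_step_cost_le_initial) auto
    then show "norm (step_cost s h \<omega>) \<le> norm (2 ^ N (s + h) \<omega> * (exp (2 * (s + h)) * weight p + cost_shift) * h)"
      by simp
  qed
qed

lemma integrable_val_X:
  assumes "0 \<le> s"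
  shows "integrable (completion M) (\<lambda>\<omega>. val (X s \<omega>))"
  by (rule P.integrable_const_bound[of _ bound])
     (use assms in \<open>auto intro!: AE_I2 abs_val_le X_in_quadrant measurable_\<F>_completion[OF function_of_X_measurable[OF _ continuous_on_w]]\<close>)

lemma integrable_step_value:
  assumes "0 \<le> s" "0 < h"
  shows "integrable (completion M) (step_value s h)"
  unfolding step_value_def[abs_def]
  using assms by (intro Bochner_Integration.integrable_add integrable_mult_right integrable_val_X integrable_step_cost) auto

lemma continuous_on_val_jump: "continuous_on quadrant (\<lambda>q. val (S q))"
  by (rule continuous_on_compose2[OF continuous_on_w continuous_on_jump]) (auto intro: jump_in_quadrant)

lemma continuous_on_val_flow: "0 \<le> h \<Longrightarrow> continuous_on quadrant (\<lambda>q. val (fl h q))"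
  by (rule continuous_on_compose2[OF continuous_on_w continuous_on_flow_point]) (auto intro: flow_in_quadrant)

text \<open>The factors depending on \<open>X s\<close> are known at time \<open>s\<close> and the
  number of jumps in the step is independent of the past, so the indicators of zero and one jumps
  turn into their probabilities.\<close>

lemma near_jump_part_expectation:
  assumes s: "0 \<le> s" and h: "0 < h" "h \<le> 1" and A: "A \<in> sets (\<F> s)"
    and near: "\<And>\<omega>. \<omega> \<in> A \<Longrightarrow> weight (X s \<omega>) \<le> near_weight"
  shows "integrable (completion M) (\<lambda>\<omega>. indicator A \<omega> * jump_part h (X s \<omega>) (N (s + h) \<omega> - N s \<omega>))"
    and "integrable (completion M) (\<lambda>\<omega>. indicator A \<omega> * comb h (X s \<omega>))"
    and "(\<integral>\<omega>. indicator A \<omega> * jump_part h (X s \<omega>) (N (s + h) \<omega> - N s \<omega>) \<partial>completion M)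
      = (\<integral>\<omega>. indicator A \<omega> * comb h (X s \<omega>) \<partial>completion M)"
proof -
  have st: "s < s + h" using h by simp
  define f0 where "f0 q = exp (- (lam * h)) * val (fl h q) + h * g q" for q
  define f1 where "f1 q = val (S q)" for q
  have A_sub: "A \<subseteq> space M" using sets.sets_into_space[OF A] by (simp add: space_\<F>)
  have AX: "X s \<omega> \<in> quadrant" if "\<omega> \<in> A" for \<omega> using that A_sub by (intro X_in_quadrant s) auto
  have m0: "(\<lambda>\<omega>. indicator A \<omega> * f0 (X s \<omega>)) \<in> borel_measurable (\<F> s)"
    unfolding f0_def using A h
    by (intro borel_measurable_times borel_measurable_indicator function_of_X_measurable s continuous_intros continuous_on_g continuous_on_val_flow) auto
  have m1: "(\<lambda>\<omega>. indicator A \<omega> * f1 (X s \<omega>)) \<in> borel_measurable (\<F> s)"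
    unfolding f1_def using A
    by (intro borel_measurable_times borel_measurable_indicator function_of_X_measurable s continuous_on_val_jump) auto
  have b0: "\<bar>f0 (X s \<omega>)\<bar> \<le> bound + (near_weight + cost_shift)" if "\<omega> \<in> A" for \<omega>
  proof -
    have "\<bar>exp (- (lam * h)) * val (fl h (X s \<omega>))\<bar> \<le> 1 * bound"
      unfolding abs_mult using h lam_pos abs_val_le[OF flow_in_quadrant[OF AX[OF that]]] by (intro mult_mono) auto
    moreover have "\<bar>h * g (X s \<omega>)\<bar> \<le> 1 * (near_weight + cost_shift)"
      unfolding abs_mult using h abs_g_le_weight[OF AX[OF that]] near[OF that] by (intro mult_mono) auto
    ultimately show ?thesis unfolding f0_def by (intro order_trans[OF abs_triangle_ineq] add_mono) simp_all
  qed
  have i0: "integrable (completion M) (\<lambda>\<omega>. indicator A \<omega> * f0 (X s \<omega>))"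
  proof (rule P.integrable_const_bound[of _ "bound + (near_weight + cost_shift)"])
    show "AE \<omega> in completion M. norm (indicator A \<omega> * f0 (X s \<omega>)) \<le> bound + (near_weight + cost_shift)"
      using b0 bound_pos near_weight_pos cost_shift_pos by (intro AE_I2) (auto simp: indicator_def)
  qed (rule measurable_\<F>_completion[OF m0])
  have i1: "integrable (completion M) (\<lambda>\<omega>. indicator A \<omega> * f1 (X s \<omega>))"
  proof (rule P.integrable_const_bound[of _ bound])
    show "AE \<omega> in completion M. norm (indicator A \<omega> * f1 (X s \<omega>)) \<le> bound"
      using abs_val_le[OF jump_in_quadrant[OF AX]] bound_pos by (intro AE_I2) (auto simp: indicator_def f1_def)
  qed (rule measurable_\<F>_completion[OF m1])
  have ind: "(\<lambda>\<omega>. indicator {j} (N (s + h) \<omega> - N s \<omega>) :: real) \<in> borel_measurable (completion M)" for j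
    by (rule measurable_completion, rule measurable_compose[OF increment_measurable[OF s st], of "indicator {j}"]) simp
  have prod: "integrable (completion M) (\<lambda>\<omega>. f \<omega> * indicator {j} (N (s + h) \<omega> - N s \<omega>))"
    if "integrable (completion M) f" for f :: "'a \<Rightarrow> real" and j
    by (rule Bochner_Integration.integrable_bound[OF that])
       (use that ind[of j] in \<open>auto simp: indicator_def intro!: AE_I2\<close>)
  have split: "indicator A \<omega> * jump_part h (X s \<omega>) (N (s + h) \<omega> - N s \<omega>) =
     indicator A \<omega> * f0 (X s \<omega>) * indicator {0} (N (s + h) \<omega> - N s \<omega>)
     + indicator A \<omega> * f1 (X s \<omega>) * indicator {1} (N (s + h) \<omega> - N s \<omega>)" for \<omega>
    by (simp add: jump_part_def f0_def f1_def)
  show "integrable (completion M) (\<lambda>\<omega>. indicator A \<omega> * jump_part h (X s \<omega>) (N (s + h) \<omega> - N s \<omega>))"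
    unfolding split by (intro Bochner_Integration.integrable_add prod i0 i1)
  have pr: "measure_pmf.prob (poisson_pmf (mu * h)) {0} = exp (- (mu * h))"
      "measure_pmf.prob (poisson_pmf (mu * h)) {Suc 0} = mu * h * exp (- (mu * h))"
    using mu_gt_1 h by (simp_all add: measure_pmf_single)
  have comb: "indicator A \<omega> * comb h (X s \<omega>) = indicator A \<omega> * f0 (X s \<omega>) * exp (- (mu * h))
     + indicator A \<omega> * f1 (X s \<omega>) * (mu * h * exp (- (mu * h)))" for \<omega>
    by (simp add: comb_def f0_def f1_def algebra_simps)
  show "integrable (completion M) (\<lambda>\<omega>. indicator A \<omega> * comb h (X s \<omega>))"
    unfolding comb by (intro Bochner_Integration.integrable_add integrable_mult_left i0 i1)
  show "(\<integral>\<omega>. indicator A \<omega> * jump_part h (X s \<omega>) (N (s + h) \<omega> - N s \<omega>) \<partial>completion M)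
      = (\<integral>\<omega>. indicator A \<omega> * comb h (X s \<omega>) \<partial>completion M)"
    unfolding split comb
    using expectation_increment[OF s st m0 i0, of "{0}"] expectation_increment[OF s st m1 i1, of "{1}"]
    by (simp add: Bochner_Integration.integral_add prod i0 i1 pr del: Bochner_Integration.integral_mult_left_zero)
qed

definition "step_const = err_const * error_rate + comb_const + (bound + cost_shift) * error_rate"

lemma err_const_nonneg: "0 \<le> err_const"
  unfolding err_const_def Let_def
  using flow_const_pos near_weight_pos lam_pos cost_shift_pos bound_pos L0_nonneg L1_nonneg
  by (intro add_nonneg_nonneg mult_nonneg_nonneg) auto

lemma near_step_expectation:
  assumes s: "0 \<le> s" and h: "0 < h" "h \<le> 1" and A: "A \<in> sets (\<F> s)"
    and near: "\<And>\<omega>. \<omega> \<in> A \<Longrightarrow> weight (X s \<omega>) \<le> near_weight"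
  shows "\<bar>(\<integral>\<omega>. indicator A \<omega> * step_value s h \<omega> \<partial>completion M) - (\<integral>\<omega>. indicator A \<omega> * comb h (X s \<omega>) \<partial>completion M)\<bar>
     \<le> err_const * error_rate * h\<^sup>2"
proof -
  let ?j = "\<lambda>\<omega>. N (s + h) \<omega> - N s \<omega>"
  have A_P: "A \<in> sets (completion M)" using A sets_augmented_subset by blast
  have A_sub: "A \<subseteq> space M" using sets.sets_into_space[OF A] by (simp add: space_\<F>)
  have i1: "integrable (completion M) (\<lambda>\<omega>. indicator A \<omega> * step_value s h \<omega>)"
    using integrable_mult_indicator[OF A_P integrable_step_value[OF s h(1)]] by simp
  note i2 = near_jump_part_expectation(1)[OF s h A near]
  have "\<bar>(\<integral>\<omega>. indicator A \<omega> * step_value s h \<omega> \<partial>completion M) - (\<integral>\<omega>. indicator A \<omega> * jump_part h (X s \<omega>) (?j \<omega>) \<partial>completion M)\<bar>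
     = \<bar>\<integral>\<omega>. indicator A \<omega> * step_value s h \<omega> - indicator A \<omega> * jump_part h (X s \<omega>) (?j \<omega>) \<partial>completion M\<bar>"
    by (subst Bochner_Integration.integral_diff[OF i1 i2]) auto
  also have "\<dots> \<le> (\<integral>\<omega>. \<bar>indicator A \<omega> * step_value s h \<omega> - indicator A \<omega> * jump_part h (X s \<omega>) (?j \<omega>)\<bar> \<partial>completion M)"
    by (rule integral_abs_bound)
  also have "\<dots> \<le> (\<integral>\<omega>. err_const * jump_error h (?j \<omega>) \<partial>completion M)"
  proof (rule integral_mono)
    show "integrable (completion M) (\<lambda>\<omega>. \<bar>indicator A \<omega> * step_value s h \<omega> - indicator A \<omega> * jump_part h (X s \<omega>) (?j \<omega>)\<bar>)"
      by (intro integrable_abs Bochner_Integration.integrable_diff i1 i2)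
    show "integrable (completion M) (\<lambda>\<omega>. err_const * jump_error h (?j \<omega>))"
      by (intro integrable_mult_right jump_error_expectation s h)
    fix \<omega> assume \<omega>: "\<omega> \<in> space (completion M)"
    have "0 \<le> err_const * jump_error h (?j \<omega>)"
      using err_const_nonneg h by (intro mult_nonneg_nonneg) (auto simp: jump_error_def)
    then show "\<bar>indicator A \<omega> * step_value s h \<omega> - indicator A \<omega> * jump_part h (X s \<omega>) (?j \<omega>)\<bar> \<le> err_const * jump_error h (?j \<omega>)"
      using near_step[OF _ s h near, of \<omega>] \<omega> by (cases "\<omega> \<in> A") auto
  qed
  also have "\<dots> \<le> err_const * (error_rate * h\<^sup>2)"
    using jump_error_expectation(2)[OF s h] err_const_nonneg by (simp add: mult_left_mono)
  finally show ?thesis using near_jump_part_expectation(3)[OF s h A near] by simp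
qed

lemma far_sets: "0 \<le> s \<Longrightarrow> {\<omega> \<in> space M. X s \<omega> \<in> far} \<in> sets (\<F> s)"
  using measurable_sets[OF X_measurable_\<F> far_measurable, of s]
  by (simp add: space_\<F> vimage_def Int_def conj_commute)

lemma not_far_near: "\<omega> \<in> space M \<Longrightarrow> 0 \<le> s \<Longrightarrow> X s \<omega> \<notin> far \<Longrightarrow> weight (X s \<omega>) \<le> near_weight"
  by (intro near_weight X_in_quadrant)

lemma far_val: "q \<in> far \<Longrightarrow> val q = 0"
  using calm_val[OF far_flow_calm[of q 0]] by simp

lemma integrable_times_indicator:
  assumes "A \<in> sets (\<F> s)" "integrable (completion M) (f :: 'a \<Rightarrow> real)"
  shows "integrable (completion M) (\<lambda>\<omega>. indicator A \<omega> * f \<omega>)"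
  using integrable_mult_indicator[OF _ assms(2), of A] assms(1) sets_augmented_subset by auto

lemma integral_indicator_le_1:
  assumes "A \<in> sets (\<F> s)"
  shows "(\<integral>\<omega>. indicator A \<omega> * (a::real) \<partial>completion M) \<le> \<bar>a\<bar>"
proof -
  have "A \<in> sets (completion M)" using assms sets_augmented_subset by blast
  then have "(\<integral>\<omega>. indicator A \<omega> * a \<partial>completion M) = P.prob A * a"
    using sets.sets_into_space[of A "completion M"] by (simp add: Int_absorb2)
  also have "\<dots> \<le> P.prob A * \<bar>a\<bar>" by (intro mult_left_mono) auto
  also have "\<dots> \<le> 1 * \<bar>a\<bar>" by (intro mult_right_mono) auto
  finally show ?thesis by simp
qed

text \<open>Up to order \<open>h^2\<close>, the discounted value plus the accumulated cost is a
  submartingale. Near points use \<open>value_le_flow\<close> through \<open>comb\<close>; at far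
  points \<open>val\<close> vanishes and only steps with several jumps can contribute
  negatively.\<close>

lemma step_expectation_ge:
  assumes s: "0 \<le> s" and h: "0 < h" "h \<le> 1" and A: "A \<in> sets (\<F> s)"
  shows "- (step_const * h\<^sup>2) \<le> (\<integral>\<omega>. indicator A \<omega> * (step_value s h \<omega> - val (X s \<omega>)) \<partial>completion M)"
proof -
  define B where "B = A \<inter> {\<omega> \<in> space M. X s \<omega> \<in> far}"
  define D where "D = A - {\<omega> \<in> space M. X s \<omega> \<in> far}"
  have sets: "B \<in> sets (\<F> s)" "D \<in> sets (\<F> s)" using A far_sets[OF s] by (auto simp: B_def D_def)
  have A_sub: "A \<subseteq> space M" using sets.sets_into_space[OF A] by (simp add: space_\<F>)
  have near: "weight (X s \<omega>) \<le> near_weight" if "\<omega> \<in> D" for \<omega>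
    using that A_sub by (intro not_far_near s) (auto simp: D_def)
  let ?E = "\<lambda>f. \<integral>\<omega>. f \<omega> \<partial>completion M"
  note iv = integrable_times_indicator[OF _ integrable_val_X[OF s]]
  note isv = integrable_times_indicator[OF _ integrable_step_value[OF s h(1)]]
  have cc: "0 \<le> comb_const * h\<^sup>2"
    using comb_near[of "(0, 0)" h] h abs_ge_zero order_trans comb_near[OF p_in]
    unfolding comb_const_def Let_def
    using mu_gt_1 lam_pos near_weight_pos cost_shift_pos bound_pos L0_nonneg L1_nonneg flow_const_pos
    by (intro mult_nonneg_nonneg add_nonneg_nonneg) auto
  have "?E (\<lambda>\<omega>. indicator D \<omega> * val (X s \<omega>)) - comb_const * h\<^sup>2 \<le> ?E (\<lambda>\<omega>. indicator D \<omega> * val (X s \<omega>)) - ?E (\<lambda>\<omega>. indicator D \<omega> * (comb_const * h\<^sup>2))"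
    using integral_indicator_le_1[OF sets(2), of "comb_const * h\<^sup>2"] cc by simp
  also have "\<dots> = ?E (\<lambda>\<omega>. indicator D \<omega> * val (X s \<omega>) - indicator D \<omega> * (comb_const * h\<^sup>2))"
    by (intro Bochner_Integration.integral_diff[symmetric] iv[OF sets(2)] integrable_times_indicator[OF sets(2)] P.integrable_const)
  also have "\<dots> \<le> ?E (\<lambda>\<omega>. indicator D \<omega> * comb h (X s \<omega>))"
  proof (rule integral_mono[OF _ near_jump_part_expectation(2)[OF s h sets(2) near]])
    show "integrable (completion M) (\<lambda>\<omega>. indicator D \<omega> * val (X s \<omega>) - indicator D \<omega> * (comb_const * h\<^sup>2))"
      by (intro Bochner_Integration.integrable_diff iv[OF sets(2)] integrable_times_indicator[OF sets(2)] P.integrable_const)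
    fix \<omega> assume \<omega>: "\<omega> \<in> space (completion M)"
    have "val (X s \<omega>) - comb_const * h\<^sup>2 \<le> comb h (X s \<omega>)" if "\<omega> \<in> D"
    proof -
      have q: "X s \<omega> \<in> quadrant" using \<omega> s by (intro X_in_quadrant) auto
      show ?thesis using comb_near[OF q near[OF that] h] value_le_flow[OF q, of h] h by linarith
    qed
    then show "indicator D \<omega> * val (X s \<omega>) - indicator D \<omega> * (comb_const * h\<^sup>2) \<le> indicator D \<omega> * comb h (X s \<omega>)"
      by (simp add: indicator_def)
  qed
  finally have D: "?E (\<lambda>\<omega>. indicator D \<omega> * val (X s \<omega>)) - comb_const * h\<^sup>2 - err_const * error_rate * h\<^sup>2 \<le> ?E (\<lambda>\<omega>. indicator D \<omega> * step_value s h \<omega>)"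
    using near_step_expectation[OF s h sets(2) near] by linarith
  have B: "- ((bound + cost_shift) * (error_rate * h\<^sup>2)) \<le> ?E (\<lambda>\<omega>. indicator B \<omega> * step_value s h \<omega>)"
  proof -
    have "(bound + cost_shift) * ?E (\<lambda>\<omega>. jump_error h (N (s + h) \<omega> - N s \<omega>)) \<le> (bound + cost_shift) * (error_rate * h\<^sup>2)"
      using jump_error_expectation(2)[OF s h] bound_pos cost_shift_pos by (intro mult_left_mono) auto
    then have "- ((bound + cost_shift) * (error_rate * h\<^sup>2)) \<le> ?E (\<lambda>\<omega>. - (bound + cost_shift) * jump_error h (N (s + h) \<omega> - N s \<omega>))"
      by (subst Bochner_Integration.integral_mult_right_zero) (simp add: algebra_simps)
    also have "\<dots> \<le> ?E (\<lambda>\<omega>. indicator B \<omega> * step_value s h \<omega>)"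
    proof (rule integral_mono[OF _ isv[OF sets(1)]])
      show "integrable (completion M) (\<lambda>\<omega>. - (bound + cost_shift) * jump_error h (N (s + h) \<omega> - N s \<omega>))"
        by (intro integrable_mult_right jump_error_expectation s h)
      fix \<omega> assume \<omega>: "\<omega> \<in> space (completion M)"
      let ?j = "N (s + h) \<omega> - N s \<omega>"
      have le: "indicator {2..} ?j \<le> jump_error h ?j" "0 \<le> jump_error h ?j"
        using h by (auto simp: jump_error_def indicator_def)
      show "- (bound + cost_shift) * jump_error h ?j \<le> indicator B \<omega> * step_value s h \<omega>"
      proof (cases "\<omega> \<in> B")
        case True
        have "- (bound + cost_shift) * jump_error h ?j \<le> - (bound + cost_shift) * indicator {2..} ?j"
          using le(1) bound_pos cost_shift_pos by (intro mult_left_mono_neg) auto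
        then show ?thesis using True far_step[OF _ s h, of \<omega>] \<omega> by (simp add: B_def)
      next
        case False
        then show ?thesis using le(2) bound_pos cost_shift_pos by (simp add: mult_nonpos_nonneg)
      qed
    qed
    finally show ?thesis .
  qed
  have split: "indicator A \<omega> * (step_value s h \<omega> - val (X s \<omega>)) =
     indicator D \<omega> * step_value s h \<omega> - indicator D \<omega> * val (X s \<omega>) + indicator B \<omega> * step_value s h \<omega>"
    if "\<omega> \<in> space M" for \<omega>
    using that far_val by (auto simp: indicator_def B_def D_def)
  have "?E (\<lambda>\<omega>. indicator A \<omega> * (step_value s h \<omega> - val (X s \<omega>))) =
     ?E (\<lambda>\<omega>. indicator D \<omega> * step_value s h \<omega> - indicator D \<omega> * val (X s \<omega>) + indicator B \<omega> * step_value s h \<omega>)"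
    by (intro Bochner_Integration.integral_cong refl split) simp
  also have "\<dots> = ?E (\<lambda>\<omega>. indicator D \<omega> * step_value s h \<omega>) - ?E (\<lambda>\<omega>. indicator D \<omega> * val (X s \<omega>)) + ?E (\<lambda>\<omega>. indicator B \<omega> * step_value s h \<omega>)"
    by (simp only: Bochner_Integration.integral_add[OF Bochner_Integration.integrable_diff[OF isv[OF sets(2)] iv[OF sets(2)]] isv[OF sets(1)]]
        Bochner_Integration.integral_diff[OF isv[OF sets(2)] iv[OF sets(2)]])
  finally show ?thesis using B D by (simp add: step_const_def algebra_simps)
qed

text \<open>The smallness of \<open>h\<close> and the Lipschitz bound keep \<open>val\<close>
  negative along the flow during the step, so \<open>value_eq_flow\<close> turns the submartingale
  inequality into an equality up to order \<open>h^2\<close>. Far points do not occur, as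
  \<open>val\<close> vanishes there.\<close>

lemma step_expectation_le:
  assumes s: "0 \<le> s" and h: "0 < h" "h \<le> 1" and A: "A \<in> sets (\<F> s)"
    and cont: "\<And>\<omega>. \<omega> \<in> A \<Longrightarrow> val (X s \<omega>) < - \<epsilon>" and h\<epsilon>: "0 < \<epsilon>" "(L0 + L1) * (flow_const * h * near_weight) \<le> \<epsilon>"
  shows "(\<integral>\<omega>. indicator A \<omega> * (step_value s h \<omega> - val (X s \<omega>)) \<partial>completion M) \<le> step_const * h\<^sup>2"
proof -
  have A_sub: "A \<subseteq> space M" using sets.sets_into_space[OF A] by (simp add: space_\<F>)
  have near: "weight (X s \<omega>) \<le> near_weight" if "\<omega> \<in> A" for \<omega>
    using that A_sub far_val[of "X s \<omega>"] cont[OF that] h\<epsilon>(1) by (intro not_far_near s) auto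
  let ?E = "\<lambda>f. \<integral>\<omega>. f \<omega> \<partial>completion M"
  note iv = integrable_times_indicator[OF A integrable_val_X[OF s]]
  note isv = integrable_times_indicator[OF A integrable_step_value[OF s h(1)]]
  have L: "0 \<le> L0 + L1" using L0_nonneg L1_nonneg by simp
  have cc: "0 \<le> comb_const * h\<^sup>2"
    unfolding comb_const_def Let_def
    using mu_gt_1 lam_pos near_weight_pos cost_shift_pos bound_pos L0_nonneg L1_nonneg flow_const_pos
    by (intro mult_nonneg_nonneg add_nonneg_nonneg) auto
  have "?E (\<lambda>\<omega>. indicator A \<omega> * comb h (X s \<omega>)) \<le> ?E (\<lambda>\<omega>. indicator A \<omega> * val (X s \<omega>) + indicator A \<omega> * (comb_const * h\<^sup>2))"
  proof (rule integral_mono[OF near_jump_part_expectation(2)[OF s h A near]])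
    show "integrable (completion M) (\<lambda>\<omega>. indicator A \<omega> * val (X s \<omega>) + indicator A \<omega> * (comb_const * h\<^sup>2))"
      by (intro Bochner_Integration.integrable_add iv integrable_times_indicator[OF A] P.integrable_const)
    fix \<omega> assume \<omega>: "\<omega> \<in> space (completion M)"
    have "comb h (X s \<omega>) \<le> val (X s \<omega>) + comb_const * h\<^sup>2" if \<omega>A: "\<omega> \<in> A"
    proof -
      define q where "q = X s \<omega>"
      have q: "q \<in> quadrant" unfolding q_def using \<omega> s by (intro X_in_quadrant) auto
      have wq: "weight q \<le> near_weight" using near[OF \<omega>A] by (simp add: q_def)
      have "val q = F h q + exp (- ((lam + mu) * h)) * val (fl h q)"
      proof (rule value_eq_flow[OF q])
        fix u assume u: "0 \<le> u" "u < h"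
        have "d1 (fl u q) q \<le> flow_const * u * weight q" using u h by (intro d1_flow q) auto
        also have "\<dots> \<le> flow_const * h * near_weight"
          using u wq flow_const_pos weight_pos[OF q] h by (intro mult_mono) auto
        finally have "(L0 + L1) * d1 (fl u q) q \<le> (L0 + L1) * (flow_const * h * near_weight)"
          using L by (rule mult_left_mono)
        then have "(L0 + L1) * d1 (fl u q) q \<le> \<epsilon>" using h\<epsilon>(2) by linarith
        then have "\<bar>val (fl u q) - val q\<bar> \<le> \<epsilon>"
          using abs_val_diff_le[OF flow_in_quadrant[OF q u(1)] q] by linarith
        then show "val (fl u q) < 0" using cont[OF \<omega>A] by (simp add: q_def)
      qed (use h in simp)
      then show ?thesis using comb_near[OF q wq h] unfolding q_def by linarith
    qed
    then show "indicator A \<omega> * comb h (X s \<omega>) \<le> indicator A \<omega> * val (X s \<omega>) + indicator A \<omega> * (comb_const * h\<^sup>2)"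
      by (simp add: indicator_def)
  qed
  also have "\<dots> = ?E (\<lambda>\<omega>. indicator A \<omega> * val (X s \<omega>)) + ?E (\<lambda>\<omega>. indicator A \<omega> * (comb_const * h\<^sup>2))"
    by (intro Bochner_Integration.integral_add iv integrable_times_indicator[OF A] P.integrable_const)
  finally have "?E (\<lambda>\<omega>. indicator A \<omega> * step_value s h \<omega>) \<le> ?E (\<lambda>\<omega>. indicator A \<omega> * val (X s \<omega>)) + comb_const * h\<^sup>2 + err_const * error_rate * h\<^sup>2"
    using near_step_expectation[OF s h A near] integral_indicator_le_1[OF A, of "comb_const * h\<^sup>2"] cc by linarith
  moreover have "?E (\<lambda>\<omega>. indicator A \<omega> * (step_value s h \<omega> - val (X s \<omega>))) = ?E (\<lambda>\<omega>. indicator A \<omega> * step_value s h \<omega>) - ?E (\<lambda>\<omega>. indicator A \<omega> * val (X s \<omega>))"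
    by (simp add: right_diff_distrib Bochner_Integration.integral_diff isv iv)
  moreover have "0 \<le> (bound + cost_shift) * (error_rate * h\<^sup>2)"
    using bound_pos cost_shift_pos error_rate_pos by simp
  ultimately show ?thesis by (simp add: step_const_def algebra_simps)
qed

end

section \<open>Verification\<close>

lemma ext_integral_mono:
  assumes "\<And>x. x \<in> space M \<Longrightarrow> f x \<le> g x"
  shows "ext_integral M f \<le> ext_integral M g"
  unfolding ext_integral_def
  by (intro ereal_minus_mono) (use assms in \<open>auto simp: less_eq_ennreal.rep_eq[symmetric] intro!: nn_integral_mono e2ennreal_mono\<close>)

lemma ext_integral_cong: "(\<And>x. x \<in> space M \<Longrightarrow> f x = g x) \<Longrightarrow> ext_integral M f = ext_integral M g"
  by (intro antisym ext_integral_mono) auto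

lemma ext_integral_real:
  assumes "integrable M f"
  shows "ext_integral M (\<lambda>x. ereal (f x)) = ereal (integral\<^sup>L M f)"
proof -
  have fin: "(\<integral>\<^sup>+ x. ennreal (f x) \<partial>M) < \<infinity>" "(\<integral>\<^sup>+ x. ennreal (- f x) \<partial>M) < \<infinity>"
    using assms by (auto simp: real_integrable_def less_top)
  have e: "enn2ereal a = ereal (enn2real a)" if "a < \<infinity>" for a
    using that by (cases a) (auto simp: enn2ereal_ennreal)
  have "e2ennreal (ereal r) = ennreal r" for r by (simp add: e2ennreal_def ennreal_def max_def e2ennreal_neg sup_max)
  then show ?thesis
    unfolding ext_integral_def uminus_ereal.simps
    by (simp add: e[OF fin(1)] e[OF fin(2)] real_lebesgue_integral_def[OF assms])
qed

text \<open>Optional stopping on a grid: the sum runs until the first failure of \<open>P\<close>,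
  capped at \<open>n\<close>.\<close>

lemma telescope_until:
  fixes V :: "nat \<Rightarrow> real"
  assumes "\<And>k. P (Suc k) \<Longrightarrow> P k"
  shows "\<exists>\<kappa>\<le>n. (\<Sum>k<n. of_bool (P k) * (V (Suc k) - V k)) = V \<kappa> - V 0 \<and> (\<kappa> = n \<or> \<not> P \<kappa>) \<and> (\<forall>k<\<kappa>. P k)"
proof (induction n)
  case (Suc n)
  then obtain \<kappa> where \<kappa>: "\<kappa> \<le> n" "(\<Sum>k<n. of_bool (P k) * (V (Suc k) - V k)) = V \<kappa> - V 0" "\<kappa> = n \<or> \<not> P \<kappa>" "\<forall>k<\<kappa>. P k" by blast
  have down: "P i" if "P j" "i \<le> j" for i j
    using that(2,1) by (induction rule: dec_induct) (use assms in auto)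
  show ?case
  proof (cases "P n")
    case True
    then have "\<kappa> = n" using \<kappa> down by blast
    then show ?thesis using \<kappa> True by (intro exI[of _ "Suc n"]) (auto simp: less_Suc_eq)
  next
    case False
    then show ?thesis using \<kappa> by (intro exI[of _ \<kappa>]) auto
  qed
qed simp

lemma mem_cell_iff:
  assumes "0 < (h::real)"
  shows "t \<in> {real i * h..<real i * h + h} \<longleftrightarrow> 0 \<le> t \<and> nat \<lfloor>t / h\<rfloor> = i"
proof -
  have "t \<in> {real i * h..<real i * h + h} \<longleftrightarrow> real i \<le> t / h \<and> t / h < real i + 1"
    using assms by (auto simp: field_simps)
  also have "\<dots> \<longleftrightarrow> \<lfloor>t / h\<rfloor> = int i" by (simp add: floor_eq_iff)
  also have "\<dots> \<longleftrightarrow> 0 \<le> t \<and> nat \<lfloor>t / h\<rfloor> = i"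
    using assms by (auto simp: nat_eq_iff zero_le_divide_iff) (metis of_nat_0_le_iff zero_le_divide_iff zero_le_floor not_less)
  finally show ?thesis .
qed

lemma sum_cells:
  fixes a :: "nat \<Rightarrow> real"
  assumes h: "0 < h"
  shows "(\<Sum>i<n. indicator {real i * h..<real i * h + h} t * a i) =
    (if 0 \<le> t \<and> t < real n * h then a (nat \<lfloor>t / h\<rfloor>) else 0)"
proof -
  have "(\<Sum>i<n. indicator {real i * h..<real i * h + h} t * a i) = (\<Sum>i<n. if nat \<lfloor>t / h\<rfloor> = i then (if 0 \<le> t then a i else 0) else 0)"
    by (intro sum.cong refl) (simp only: indicator_def mem_cell_iff[OF h], auto)
  also have "\<dots> = (if nat \<lfloor>t / h\<rfloor> < n \<and> 0 \<le> t then a (nat \<lfloor>t / h\<rfloor>) else 0)"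
    by (simp add: sum.delta')
  also have "nat \<lfloor>t / h\<rfloor> < n \<and> 0 \<le> t \<longleftrightarrow> 0 \<le> t \<and> t < real n * h"
    using h by (auto simp: nat_less_iff floor_less_iff divide_less_eq mult.commute)
  finally show ?thesis .
qed

context poisson_disorder_process
begin

section \<open>Sums over a time grid\<close>

definition "cell_cost h k \<omega> = exp (- (lam * (real k * h))) * step_cost (real k * h) h \<omega>"

lemma cell_cost_eq:
  "cell_cost h k \<omega> = (LINT u|lborel. indicator {real k * h..<real k * h + h} u * (exp (- (lam * u)) * g (X u \<omega>)))"
proof -
  have eq: "exp (- (lam * (real k * h))) * (indicator {real k * h..<real k * h + h} u * (exp (- (lam * (u - real k * h))) * y))
     = indicator {real k * h..<real k * h + h} u * (exp (- (lam * u)) * y)" for u y :: real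
  proof -
    have "exp (- (lam * (real k * h))) * exp (- (lam * (u - real k * h))) = exp (- (lam * u))"
      by (simp add: mult_exp_exp algebra_simps)
    moreover have "a * (i * (b * y)) = i * ((a * b) * y)" for a b i :: real by simp
    ultimately show ?thesis by (simp only:)
  qed
  have "cell_cost h k \<omega> = (LINT u|lborel. exp (- (lam * (real k * h))) * (indicator {real k * h..<real k * h + h} u * (exp (- (lam * (u - real k * h))) * g (X u \<omega>))))"
    unfolding cell_cost_def step_cost_def by (rule Bochner_Integration.integral_mult_right_zero[symmetric])
  then show ?thesis by (simp only: eq)
qed

lemma integrable_cell_cost:
  "0 < h \<Longrightarrow> A \<in> sets (\<F> (real k * h)) \<Longrightarrow> integrable (completion M) (\<lambda>\<omega>. indicator A \<omega> * cell_cost h k \<omega>)"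
  unfolding cell_cost_def by (intro integrable_times_indicator integrable_mult_right integrable_step_cost) auto

lemma integrable_grid_cost:
  assumes "0 < h" "\<And>k. A k \<in> sets (\<F> (real k * h))"
  shows "integrable (completion M) (\<lambda>\<omega>. \<Sum>k<n. indicator (A k) \<omega> * cell_cost h k \<omega>)"
  by (intro Bochner_Integration.integrable_sum integrable_cell_cost assms)

definition "disc_val h k \<omega> = exp (- (lam * (real k * h))) * val (X (real k * h) \<omega>)"

lemma disc_val_step:
  "exp (- (lam * (real k * h))) * (step_value (real k * h) h \<omega> - val (X (real k * h) \<omega>))
   = disc_val h (Suc k) \<omega> - disc_val h k \<omega> + cell_cost h k \<omega>"
proof -
  have "real k * h + h = real (Suc k) * h" by (simp add: algebra_simps)
  moreover have "exp (- (lam * (real k * h))) * exp (- (lam * h)) = exp (- (lam * (real (Suc k) * h)))"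
    by (simp add: mult_exp_exp algebra_simps)
  ultimately show ?thesis
    by (simp add: step_value_def disc_val_def cell_cost_def algebra_simps del: of_nat_Suc)
qed

lemma grid_sum:
  assumes h: "0 < h" and A: "\<And>k. A k \<in> sets (\<F> (real k * h))" "\<And>k. A (Suc k) \<subseteq> A k" and \<omega>: "\<omega> \<in> space M"
  obtains \<kappa> where "\<kappa> \<le> n" "\<kappa> = n \<or> \<omega> \<notin> A \<kappa>" "\<And>k. k < \<kappa> \<Longrightarrow> \<omega> \<in> A k"
    "(\<Sum>k<n. exp (- (lam * (real k * h))) * (indicator (A k) \<omega> * (step_value (real k * h) h \<omega> - val (X (real k * h) \<omega>))))
     = disc_val h \<kappa> \<omega> - val p + (\<Sum>k<n. indicator (A k) \<omega> * cell_cost h k \<omega>)"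
proof -
  have "\<exists>\<kappa>\<le>n. (\<Sum>k<n. of_bool (\<omega> \<in> A k) * (disc_val h (Suc k) \<omega> - disc_val h k \<omega>)) = disc_val h \<kappa> \<omega> - disc_val h 0 \<omega> \<and> (\<kappa> = n \<or> \<omega> \<notin> A \<kappa>) \<and> (\<forall>k<\<kappa>. \<omega> \<in> A k)"
    by (rule telescope_until) (use A(2) in auto)
  then obtain \<kappa> where \<kappa>: "\<kappa> \<le> n" "(\<Sum>k<n. of_bool (\<omega> \<in> A k) * (disc_val h (Suc k) \<omega> - disc_val h k \<omega>)) = disc_val h \<kappa> \<omega> - disc_val h 0 \<omega>" "\<kappa> = n \<or> \<omega> \<notin> A \<kappa>" "\<forall>k<\<kappa>. \<omega> \<in> A k"
    by blast
  have "(\<Sum>k<n. exp (- (lam * (real k * h))) * (indicator (A k) \<omega> * (step_value (real k * h) h \<omega> - val (X (real k * h) \<omega>))))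
     = (\<Sum>k<n. of_bool (\<omega> \<in> A k) * (disc_val h (Suc k) \<omega> - disc_val h k \<omega>) + indicator (A k) \<omega> * cell_cost h k \<omega>)"
    by (intro sum.cong refl) (simp only: mult.left_commute[of "exp _"] disc_val_step, simp add: indicator_def)
  also have "\<dots> = disc_val h \<kappa> \<omega> - disc_val h 0 \<omega> + (\<Sum>k<n. indicator (A k) \<omega> * cell_cost h k \<omega>)"
    by (simp only: sum.distrib \<kappa>)
  also have "disc_val h 0 \<omega> = val p" by (simp add: disc_val_def X_0[OF \<omega>])
  finally show ?thesis using that \<kappa> by blast
qed

lemma disc_val_le_0: "\<omega> \<in> space M \<Longrightarrow> 0 < h \<Longrightarrow> disc_val h k \<omega> \<le> 0"
  unfolding disc_val_def by (intro mult_nonneg_nonpos w_le_0 X_in_quadrant) auto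

lemma step_const_nonneg: "0 \<le> step_const"
proof -
  have "0 \<le> comb_const" unfolding comb_const_def Let_def
    using mu_gt_1 lam_pos near_weight_pos cost_shift_pos bound_pos L0_nonneg L1_nonneg flow_const_pos
    by (intro mult_nonneg_nonneg add_nonneg_nonneg) auto
  then show ?thesis unfolding step_const_def
    using err_const_nonneg error_rate_pos bound_pos cost_shift_pos by (intro add_nonneg_nonneg mult_nonneg_nonneg) auto
qed

lemma integrable_grid_term:
  assumes "0 < h" "A \<in> sets (\<F> (real k * h))"
  shows "integrable (completion M) (\<lambda>\<omega>. exp (- (lam * (real k * h))) * (indicator A \<omega> * (step_value (real k * h) h \<omega> - val (X (real k * h) \<omega>))))"
  using assms
  by (intro integrable_mult_right integrable_times_indicator Bochner_Integration.integrable_diff integrable_step_value integrable_val_X) auto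

text \<open>\<open>A k\<close> is the event that step \<open>k\<close> is still run. The one-step
  errors are summed with discounts at most 1, and the discounted value left at the end of the run
  may be dropped because it is nonpositive.\<close>

lemma grid_cost_ge:
  assumes h: "0 < h" "h \<le> 1" and A: "\<And>k. A k \<in> sets (\<F> (real k * h))" "\<And>k. A (Suc k) \<subseteq> A k"
  shows "val p - real n * (step_const * h\<^sup>2) \<le> (\<integral>\<omega>. (\<Sum>k<n. indicator (A k) \<omega> * cell_cost h k \<omega>) \<partial>completion M)"
proof -
  let ?T = "\<lambda>k \<omega>. exp (- (lam * (real k * h))) * (indicator (A k) \<omega> * (step_value (real k * h) h \<omega> - val (X (real k * h) \<omega>)))"
  have "- (step_const * h\<^sup>2) \<le> (\<integral>\<omega>. ?T k \<omega> \<partial>completion M)" for k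
  proof -
    define E where "E = (\<integral>\<omega>. indicator (A k) \<omega> * (step_value (real k * h) h \<omega> - val (X (real k * h) \<omega>)) \<partial>completion M)"
    have E: "- (step_const * h\<^sup>2) \<le> E" unfolding E_def using h by (intro step_expectation_ge A) auto
    have e: "0 < exp (- (lam * (real k * h)))" "exp (- (lam * (real k * h))) \<le> 1" using lam_pos h by auto
    have "- (step_const * h\<^sup>2) \<le> exp (- (lam * (real k * h))) * (- (step_const * h\<^sup>2))"
      using e step_const_nonneg by (simp add: mult_left_le_one_le)
    also have "\<dots> \<le> exp (- (lam * (real k * h))) * E" using E e by (intro mult_left_mono) auto
    finally show ?thesis by (simp add: E_def)
  qed
  then have "(\<Sum>k<n. - (step_const * h\<^sup>2)) \<le> (\<Sum>k<n. \<integral>\<omega>. ?T k \<omega> \<partial>completion M)" by (intro sum_mono)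
  also have "\<dots> = (\<integral>\<omega>. (\<Sum>k<n. ?T k \<omega>) \<partial>completion M)"
    by (rule Bochner_Integration.integral_sum[symmetric]) (intro integrable_grid_term h A)
  also have "\<dots> \<le> (\<integral>\<omega>. (\<Sum>k<n. indicator (A k) \<omega> * cell_cost h k \<omega>) + - val p \<partial>completion M)"
  proof (rule integral_mono)
    show "integrable (completion M) (\<lambda>\<omega>. \<Sum>k<n. ?T k \<omega>)"
      by (intro Bochner_Integration.integrable_sum integrable_grid_term h A)
    show "integrable (completion M) (\<lambda>\<omega>. (\<Sum>k<n. indicator (A k) \<omega> * cell_cost h k \<omega>) + - val p)"
      by (intro Bochner_Integration.integrable_add Bochner_Integration.integrable_sum integrable_cell_cost h A P.integrable_const)
    fix \<omega> assume "\<omega> \<in> space (completion M)"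
    then have \<omega>: "\<omega> \<in> space M" by simp
    show "(\<Sum>k<n. ?T k \<omega>) \<le> (\<Sum>k<n. indicator (A k) \<omega> * cell_cost h k \<omega>) + - val p"
      by (rule grid_sum[where A = A and n = n, OF h(1) A \<omega>]) (use disc_val_le_0[OF \<omega> h(1)] in \<open>auto simp: algebra_simps\<close>)
  qed
  also have "\<dots> = (\<integral>\<omega>. (\<Sum>k<n. indicator (A k) \<omega> * cell_cost h k \<omega>) \<partial>completion M) + - val p"
    by (subst Bochner_Integration.integral_add[OF integrable_grid_cost[OF h(1) A(1)] P.integrable_const])
       (simp add: P.prob_space[simplified])
  finally show ?thesis by simp
qed

text \<open>Here the value left at the end must be controlled: it is at least
  \<open>- \<epsilon>\<close> if the rule stops, and at least \<open>- bound\<close>, heavily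
  discounted, if the grid ends first.\<close>

lemma grid_cost_le:
  assumes h: "0 < h" "h \<le> 1" and A: "\<And>k. A k \<in> sets (\<F> (real k * h))" "\<And>k. A (Suc k) \<subseteq> A k"
    and cont: "\<And>k \<omega>. \<omega> \<in> A k \<Longrightarrow> val (X (real k * h) \<omega>) < - \<epsilon>"
    and stop: "\<And>k \<omega>. \<omega> \<in> space M \<Longrightarrow> \<omega> \<notin> A k \<Longrightarrow> (\<And>i. i < k \<Longrightarrow> \<omega> \<in> A i) \<Longrightarrow> - \<epsilon> \<le> val (X (real k * h) \<omega>)"
    and h\<epsilon>: "0 < \<epsilon>" "(L0 + L1) * (flow_const * h * near_weight) \<le> \<epsilon>"
  shows "(\<integral>\<omega>. (\<Sum>k<n. indicator (A k) \<omega> * cell_cost h k \<omega>) \<partial>completion M)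
    \<le> val p + real n * (step_const * h\<^sup>2) + \<epsilon> + exp (- (lam * (real n * h))) * bound"
proof -
  let ?T = "\<lambda>k \<omega>. exp (- (lam * (real k * h))) * (indicator (A k) \<omega> * (step_value (real k * h) h \<omega> - val (X (real k * h) \<omega>)))"
  have "(\<integral>\<omega>. ?T k \<omega> \<partial>completion M) \<le> step_const * h\<^sup>2" for k
  proof -
    define E where "E = (\<integral>\<omega>. indicator (A k) \<omega> * (step_value (real k * h) h \<omega> - val (X (real k * h) \<omega>)) \<partial>completion M)"
    have E: "E \<le> step_const * h\<^sup>2" unfolding E_def using h by (intro step_expectation_le[where \<epsilon> = \<epsilon>] A cont h\<epsilon>) auto
    have e: "0 < exp (- (lam * (real k * h)))" "exp (- (lam * (real k * h))) \<le> 1" using lam_pos h by auto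
    have "exp (- (lam * (real k * h))) * E \<le> exp (- (lam * (real k * h))) * (step_const * h\<^sup>2)"
      using E e by (intro mult_left_mono) auto
    also have "\<dots> \<le> step_const * h\<^sup>2"
      using e step_const_nonneg by (simp add: mult_left_le_one_le)
    finally show ?thesis by (simp add: E_def)
  qed
  then have "(\<Sum>k<n. \<integral>\<omega>. ?T k \<omega> \<partial>completion M) \<le> (\<Sum>k<n. step_const * h\<^sup>2)" by (intro sum_mono)
  moreover have "(\<Sum>k<n. \<integral>\<omega>. ?T k \<omega> \<partial>completion M) = (\<integral>\<omega>. (\<Sum>k<n. ?T k \<omega>) \<partial>completion M)"
    by (rule Bochner_Integration.integral_sum[symmetric]) (intro integrable_grid_term h A)
  moreover have "(\<integral>\<omega>. (\<Sum>k<n. indicator (A k) \<omega> * cell_cost h k \<omega>) + - (val p + \<epsilon> + exp (- (lam * (real n * h))) * bound) \<partial>completion M)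
    \<le> (\<integral>\<omega>. (\<Sum>k<n. ?T k \<omega>) \<partial>completion M)"
  proof (rule integral_mono)
    show "integrable (completion M) (\<lambda>\<omega>. \<Sum>k<n. ?T k \<omega>)"
      by (intro Bochner_Integration.integrable_sum integrable_grid_term h A)
    show "integrable (completion M) (\<lambda>\<omega>. (\<Sum>k<n. indicator (A k) \<omega> * cell_cost h k \<omega>) + - (val p + \<epsilon> + exp (- (lam * (real n * h))) * bound))"
      by (intro Bochner_Integration.integrable_add Bochner_Integration.integrable_sum integrable_cell_cost h A P.integrable_const)
    fix \<omega> assume "\<omega> \<in> space (completion M)"
    then have \<omega>: "\<omega> \<in> space M" by simp
    obtain \<kappa> where \<kappa>: "\<kappa> \<le> n" "\<kappa> = n \<or> \<omega> \<notin> A \<kappa>" "\<And>k. k < \<kappa> \<Longrightarrow> \<omega> \<in> A k"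
      and sum: "(\<Sum>k<n. ?T k \<omega>) = disc_val h \<kappa> \<omega> - val p + (\<Sum>k<n. indicator (A k) \<omega> * cell_cost h k \<omega>)"
      by (rule grid_sum[where A = A and n = n, OF h(1) A \<omega>]) (rule that)
    have q: "X (real \<kappa> * h) \<omega> \<in> quadrant" using h by (intro X_in_quadrant \<omega>) auto
    have "- (\<epsilon> + exp (- (lam * (real n * h))) * bound) \<le> disc_val h \<kappa> \<omega>"
    proof (cases "\<omega> \<notin> A \<kappa>")
      case True
      then have "- \<epsilon> \<le> val (X (real \<kappa> * h) \<omega>)" using \<kappa>(3) by (intro stop[OF \<omega>])
      then have "exp (- (lam * (real \<kappa> * h))) * - val (X (real \<kappa> * h) \<omega>) \<le> 1 * \<epsilon>"
        using lam_pos h w_le_0[OF q] by (intro mult_mono) auto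
      moreover have "0 \<le> exp (- (lam * (real n * h))) * bound" using bound_pos by simp
      ultimately show ?thesis unfolding disc_val_def by simp
    next
      case False
      then have "\<kappa> = n" using \<kappa>(2) by simp
      have "exp (- (lam * (real \<kappa> * h))) * - val (X (real \<kappa> * h) \<omega>) \<le> exp (- (lam * (real \<kappa> * h))) * bound"
        using w_ge[OF q] by (intro mult_left_mono) auto
      then show ?thesis using h\<epsilon>(1) \<open>\<kappa> = n\<close> unfolding disc_val_def by simp
    qed
    then show "(\<Sum>k<n. indicator (A k) \<omega> * cell_cost h k \<omega>) + - (val p + \<epsilon> + exp (- (lam * (real n * h))) * bound) \<le> (\<Sum>k<n. ?T k \<omega>)"
      unfolding sum by linarith
  qed
  moreover have "(\<integral>\<omega>. (\<Sum>k<n. indicator (A k) \<omega> * cell_cost h k \<omega>) + - (val p + \<epsilon> + exp (- (lam * (real n * h))) * bound) \<partial>completion M)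
     = (\<integral>\<omega>. (\<Sum>k<n. indicator (A k) \<omega> * cell_cost h k \<omega>) \<partial>completion M) + - (val p + \<epsilon> + exp (- (lam * (real n * h))) * bound)"
    by (subst Bochner_Integration.integral_add[OF integrable_grid_cost[OF h(1) A(1)] P.integrable_const])
       (simp add: P.prob_space[simplified])
  ultimately show ?thesis by simp
qed

section \<open>From grid sums to the cost of a stopping time\<close>

lemma exp_tail_integral:
  "integrable lborel (\<lambda>t. indicator {a..} t * (exp (- (lam * t)) * cost_shift))"
  "(LINT t|lborel. indicator {a..} t * (exp (- (lam * t)) * cost_shift)) = exp (- (lam * a)) * bound"
proof -
  have lim: "((\<lambda>t. - (exp (- (lam * t)) * bound)) \<longlongrightarrow> 0) at_top"
  proof -
    have "((\<lambda>t. - (exp (- (lam * t)) * bound)) \<longlongrightarrow> - (0 * bound)) at_top"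
      by (intro tendsto_intros filterlim_compose[OF exp_at_bot] filterlim_uminus_at_bot_at_top[THEN filterlim_compose]
        filterlim_tendsto_pos_mult_at_top[OF tendsto_const lam_pos filterlim_ident])
    then show ?thesis by simp
  qed
  have "(\<integral>\<^sup>+ t. ennreal (exp (- (lam * t)) * cost_shift) * indicator {a..} t \<partial>lborel) = ennreal (0 - (- (exp (- (lam * a)) * bound)))"
    by (rule nn_integral_FTC_atLeast[OF _ _ _ lim])
       (use cost_shift_pos in \<open>auto intro!: derivative_eq_intros simp: cost_shift_eq\<close>)
  also have "(\<integral>\<^sup>+ t. ennreal (exp (- (lam * t)) * cost_shift) * indicator {a..} t \<partial>lborel) =
      (\<integral>\<^sup>+ t. ennreal (indicator {a..} t * (exp (- (lam * t)) * cost_shift)) \<partial>lborel)"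
    by (intro nn_integral_cong) (auto simp: indicator_def)
  finally have eq: "(\<integral>\<^sup>+ t. ennreal (indicator {a..} t * (exp (- (lam * t)) * cost_shift)) \<partial>lborel) = ennreal (exp (- (lam * a)) * bound)"
    by simp
  have nn: "0 \<le> indicator {a..} t * (exp (- (lam * t)) * cost_shift)" for t :: real using cost_shift_pos by simp
  have hb: "has_bochner_integral lborel (\<lambda>t. indicator {a..} t * (exp (- (lam * t)) * cost_shift)) (exp (- (lam * a)) * bound)"
    by (rule has_bochner_integral_nn_integral[OF _ _ _ eq]) (use nn bound_pos in auto)
  show "integrable lborel (\<lambda>t. indicator {a..} t * (exp (- (lam * t)) * cost_shift))"
    using hb by (rule integrable.intros)
  show "(LINT t|lborel. indicator {a..} t * (exp (- (lam * t)) * cost_shift)) = exp (- (lam * a)) * bound"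
    using hb by (rule has_bochner_integral_integral_eq)
qed

definition running :: "ennreal \<Rightarrow> 'a \<Rightarrow> real \<Rightarrow> real" where
  "running T \<omega> t = indicator {t. 0 \<le> t \<and> ennreal t < T} t * (exp (- lam * t) * g (X t \<omega>))"

lemma expected_cost_eq:
  "expected_cost M N \<sigma> lam mu c m p \<tau> =
     ext_integral (completion M) (\<lambda>\<omega>. ext_integral lborel (\<lambda>t. ereal (running (\<tau> \<omega>) \<omega> t)))"
  by (simp add: expected_cost_def running_def)

lemma integrable_cell_running:
  assumes \<omega>: "\<omega> \<in> space M" and h: "0 < h"
  shows "integrable lborel (\<lambda>t. indicator {real k * h..<real k * h + h} t * (a * (exp (- (lam * t)) * g (X t \<omega>)) - b))"
    "(LINT t|lborel. indicator {real k * h..<real k * h + h} t * (a * (exp (- (lam * t)) * g (X t \<omega>)) - b))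
      = a * cell_cost h k \<omega> - b * h"
proof -
  have i1: "integrable lborel (\<lambda>t. indicator {real k * h..<real k * h + h} t * (exp (- (lam * t)) * g (X t \<omega>)))"
    using integrable_cell_path[OF _ \<omega>, of "real k * h" "real k * h + h" 0] h by simp
  have i2: "integrable lborel (\<lambda>t. b * indicator {real k * h..<real k * h + h} t)"
    using h by (intro integrable_mult_right integrable_real_indicator) auto
  have eq: "indicator {real k * h..<real k * h + h} t * (a * (exp (- (lam * t)) * g (X t \<omega>)) - b)
    = a * (indicator {real k * h..<real k * h + h} t * (exp (- (lam * t)) * g (X t \<omega>))) - b * indicator {real k * h..<real k * h + h} t" for t
    by (simp add: algebra_simps)
  show "integrable lborel (\<lambda>t. indicator {real k * h..<real k * h + h} t * (a * (exp (- (lam * t)) * g (X t \<omega>)) - b))"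
    unfolding eq by (intro Bochner_Integration.integrable_diff integrable_mult_right i1 i2)
  show "(LINT t|lborel. indicator {real k * h..<real k * h + h} t * (a * (exp (- (lam * t)) * g (X t \<omega>)) - b))
      = a * cell_cost h k \<omega> - b * h"
    unfolding eq cell_cost_eq
    by (subst Bochner_Integration.integral_diff[OF integrable_mult_right[OF i1] i2]) (use h in simp)
qed

text \<open>The grid sum runs the cell in which \<open>T\<close> falls to its end. This
  overestimates the cost by at most \<open>h\<close> times a bound of the integrand, and after time
  \<open>n * h\<close> the integrand is at least \<open>- cost_shift\<close>, discounted.\<close>

lemma running_ge:
  assumes \<omega>: "\<omega> \<in> space M" and h: "0 < h"
    and A: "\<And>k. \<omega> \<in> A k \<longleftrightarrow> ennreal (real k * h) \<le> T"
  shows "ereal ((\<Sum>k<n. indicator (A k) \<omega> * cell_cost h k \<omega>)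
       - h * (2 ^ N (real n * h) \<omega> * (exp (2 * (real n * h)) * weight p + cost_shift)) - exp (- (lam * (real n * h))) * bound)
     \<le> ext_integral lborel (\<lambda>t. ereal (running T \<omega> t))"
proof -
  define D where "D = 2 ^ N (real n * h) \<omega> * (exp (2 * (real n * h)) * weight p + cost_shift)"
  define a where "a k = (indicator (A k) \<omega> :: real)" for k
  \<comment> \<open>Nonzero only in the cell that contains \<open>T\<close>, so the sum over the
    cells telescopes to at most \<open>D\<close>.\<close>
  define b where "b k = (a k - a (Suc k)) * D" for k
  have dec: "\<omega> \<in> A k" if "\<omega> \<in> A (Suc k)" for k
  proof -
    have "ennreal (real k * h) \<le> ennreal (real (Suc k) * h)" using h by (intro ennreal_leI mult_right_mono) auto
    from order_trans[OF this] that show ?thesis unfolding A by blast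
  qed
  have D: "0 \<le> D" using weight_pos[OF p_in] cost_shift_pos by (simp add: D_def)
  let ?c = "\<lambda>k. indicator {real k * h..<real k * h + h} :: real \<Rightarrow> real"
  \<comment> \<open>An integrable function below \<open>running T \<omega>\<close> pointwise: the
    grid cost, corrected by \<open>b\<close> in the last cell and by the worst case beyond the
    grid.\<close>
  define f where "f t = (\<Sum>k<n. ?c k t * (a k * (exp (- (lam * t)) * g (X t \<omega>)) - b k)) - indicator {real n * h..} t * (exp (- (lam * t)) * cost_shift)" for t
  have int: "integrable lborel f"
    unfolding f_def by (intro Bochner_Integration.integrable_diff Bochner_Integration.integrable_sum integrable_cell_running(1) exp_tail_integral(1) \<omega> h)
  have LINT: "integral\<^sup>L lborel f = (\<Sum>k<n. a k * cell_cost h k \<omega> - b k * h) - exp (- (lam * (real n * h))) * bound"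
    unfolding f_def
    by (simp only: Bochner_Integration.integral_diff[OF Bochner_Integration.integrable_sum[OF integrable_cell_running(1)[OF \<omega> h]] exp_tail_integral(1)]
        Bochner_Integration.integral_sum[OF integrable_cell_running(1)[OF \<omega> h]] integrable_cell_running(2)[OF \<omega> h] exp_tail_integral(2))
  have "(\<Sum>k<n. b k * h) = h * D * (a 0 - a n)"
    using sum_lessThan_telescope'[of a n] by (simp add: b_def sum_distrib_left[symmetric] sum_distrib_right[symmetric] mult_ac)
  also have "\<dots> \<le> h * D * 1" using D h by (intro mult_left_mono) (auto simp: a_def indicator_def)
  finally have "(\<Sum>k<n. a k * cell_cost h k \<omega>) - h * D - exp (- (lam * (real n * h))) * bound \<le> integral\<^sup>L lborel f"
    unfolding LINT sum_subtractf by simp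
  then have "ereal ((\<Sum>k<n. a k * cell_cost h k \<omega>) - h * D - exp (- (lam * (real n * h))) * bound) \<le> ext_integral lborel (\<lambda>t. ereal (f t))"
    by (simp add: ext_integral_real[OF int])
  also have "\<dots> \<le> ext_integral lborel (\<lambda>t. ereal (running T \<omega> t))"
  proof (rule ext_integral_mono)
    fix t :: real
    have "f t \<le> running T \<omega> t"
    proof (cases "0 \<le> t \<and> t < real n * h")
      case True
      define k where "k = nat \<lfloor>t / h\<rfloor>"
      have cell: "t \<in> {real k * h..<real k * h + h}" using True by (subst mem_cell_iff[OF h]) (simp add: k_def)
      have ft: "f t = a k * (exp (- (lam * t)) * g (X t \<omega>)) - b k"
        using True by (simp add: f_def sum_cells[OF h] k_def)
      have g: "exp (- (lam * t)) * g (X t \<omega>) \<le> D"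
      proof -
        have "exp (- (lam * t)) * g (X t \<omega>) \<le> exp (- (lam * t)) * \<bar>g (X t \<omega>)\<bar>" by (intro mult_left_mono) auto
        also have "\<dots> \<le> 1 * \<bar>g (X t \<omega>)\<bar>" using lam_pos True by (intro mult_right_mono) auto
        also have "\<dots> \<le> D"
          using abs_g_X_le[OF \<omega>, of 0 t "real n * h"] True X_0[OF \<omega>] N_0[OF \<omega>] by (simp add: D_def)
        finally show ?thesis .
      qed
      show ?thesis
      proof (cases "ennreal t < T")
        case lt: True
        have "ennreal (real k * h) \<le> ennreal t" using cell by (intro ennreal_leI) auto
        then have "\<omega> \<in> A k" using lt unfolding A by (meson order_le_less_trans less_imp_le)
        moreover have "0 \<le> b k" using dec[of k] D by (auto simp: b_def a_def indicator_def)
        ultimately show ?thesis using True lt by (simp add: ft running_def a_def)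
      next
        case ge: False
        have "real (Suc k) * h > t" using cell by (simp add: algebra_simps)
        then have "ennreal t < ennreal (real (Suc k) * h)" using True h by (simp add: ennreal_less_iff del: of_nat_Suc)
        then have "T < ennreal (real (Suc k) * h)" using ge by (meson not_less order_le_less_trans)
        then have "\<omega> \<notin> A (Suc k)" unfolding A by (simp add: not_le del: of_nat_Suc)
        then show ?thesis using ge g by (cases "\<omega> \<in> A k") (auto simp: ft running_def a_def b_def)
      qed
    next
      case False
      have "- (exp (- (lam * t)) * cost_shift) \<le> exp (- (lam * t)) * g (X t \<omega>)" if "0 \<le> t"
      proof -
        have "exp (- (lam * t)) * - cost_shift \<le> exp (- (lam * t)) * g (X t \<omega>)"
          using g_ge[OF X_in_quadrant[OF \<omega> that]] by (intro mult_left_mono) auto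
        then show ?thesis by simp
      qed
      moreover have "0 \<le> real n * h" using h by simp
      moreover have "f t = - (indicator {real n * h..} t * (exp (- (lam * t)) * cost_shift))"
        unfolding f_def sum_cells[OF h] if_not_P[OF False] by simp
      ultimately show ?thesis using False cost_shift_pos
        by (auto simp: running_def indicator_def)
    qed
    then show "ereal (f t) \<le> ereal (running T \<omega> t)" by simp
  qed
  finally show ?thesis by (simp add: D_def a_def)
qed

lemma running_grid:
  assumes \<omega>: "\<omega> \<in> space M" and h: "0 < h" and \<kappa>: "\<kappa> \<le> n" "\<And>k. k < n \<Longrightarrow> \<omega> \<in> A k \<longleftrightarrow> k < \<kappa>"
  shows "ext_integral lborel (\<lambda>t. ereal (running (ennreal (real \<kappa> * h)) \<omega> t)) = ereal (\<Sum>k<n. indicator (A k) \<omega> * cell_cost h k \<omega>)"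
proof -
  let ?c = "\<lambda>k. indicator {real k * h..<real k * h + h} :: real \<Rightarrow> real"
  define f where "f t = (\<Sum>k<n. ?c k t * (indicator (A k) \<omega> * (exp (- (lam * t)) * g (X t \<omega>)) - 0))" for t
  have eq: "running (ennreal (real \<kappa> * h)) \<omega> t = f t" for t
  proof (cases "0 \<le> t \<and> t < real n * h")
    case True
    define k where "k = nat \<lfloor>t / h\<rfloor>"
    have cell: "t \<in> {real k * h..<real k * h + h}" using True by (subst mem_cell_iff[OF h]) (simp add: k_def)
    have "real k * h < real n * h" by (rule order_le_less_trans[of _ t]) (use True cell in auto)
    then have kn: "k < n" using h by simp
    have "ennreal t < ennreal (real \<kappa> * h) \<longleftrightarrow> t < real \<kappa> * h" using True h by (simp add: ennreal_less_iff)
    also have "\<dots> \<longleftrightarrow> k < \<kappa>"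
    proof
      assume "t < real \<kappa> * h"
      then have "real k * h < real \<kappa> * h" by (rule order_le_less_trans[rotated]) (use cell in auto)
      then show "k < \<kappa>" using h by simp
    next
      assume "k < \<kappa>"
      then have "real (Suc k) * h \<le> real \<kappa> * h" using h by (intro mult_right_mono) auto
      then show "t < real \<kappa> * h" using cell by (simp add: algebra_simps)
    qed
    finally have "ennreal t < ennreal (real \<kappa> * h) \<longleftrightarrow> \<omega> \<in> A k" using \<kappa>(2)[OF kn] by simp
    moreover have "f t = indicator (A k) \<omega> * (exp (- (lam * t)) * g (X t \<omega>))"
      unfolding f_def sum_cells[OF h] if_P[OF True] k_def by simp
    ultimately show ?thesis using True by (simp add: running_def indicator_def)
  next
    case False
    have "\<not> (0 \<le> t \<and> ennreal t < ennreal (real \<kappa> * h))"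
    proof
      assume *: "0 \<le> t \<and> ennreal t < ennreal (real \<kappa> * h)"
      then have "t < real \<kappa> * h" using ennreal_less_iff[of t "real \<kappa> * h"] by blast
      also have "\<dots> \<le> real n * h" using \<kappa>(1) h by simp
      finally show False using * False by simp
    qed
    moreover have "f t = 0" unfolding f_def sum_cells[OF h] if_not_P[OF False] ..
    ultimately show ?thesis by (simp add: running_def)
  qed
  have int: "integrable lborel f"
    unfolding f_def by (intro Bochner_Integration.integrable_sum integrable_cell_running(1) \<omega> h)
  have "integral\<^sup>L lborel f = (\<Sum>k<n. indicator (A k) \<omega> * cell_cost h k \<omega> - 0 * h)"
    unfolding f_def
    by (subst Bochner_Integration.integral_sum[OF integrable_cell_running(1)[OF \<omega> h]])
       (simp only: integrable_cell_running(2)[OF \<omega> h])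
  then show ?thesis by (simp add: eq ext_integral_real[OF int])
qed

abbreviation \<G> :: "ennreal \<Rightarrow> 'a measure" where
  "\<G> \<equiv> usual_filtration M N"

lemma Inter_augmented_Pow: "(\<Inter>s\<in>insert \<infinity> {t<..}. sets (augmented_filtration M N s)) \<subseteq> Pow (space M)"
  using sets.sets_into_space[of _ "augmented_filtration M N \<infinity>"] by (auto simp: space_\<F>)

lemma space_\<G>: "space (\<G> t) = space M"
  unfolding usual_filtration_def using Inter_augmented_Pow by (intro space_measure_of)

lemma sets_\<G>: "sets (\<G> t) = sigma_sets (space M) (\<Inter>s\<in>insert \<infinity> {t<..}. sets (augmented_filtration M N s))"
  unfolding usual_filtration_def using Inter_augmented_Pow by (intro sets_measure_of)

lemma sets_\<G>_subset: "t < s \<Longrightarrow> sets (\<G> t) \<subseteq> sets (augmented_filtration M N s)"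
proof -
  assume "t < s"
  then have "(\<Inter>s\<in>insert \<infinity> {t<..}. sets (augmented_filtration M N s)) \<subseteq> sets (augmented_filtration M N s)" by auto
  from sets.sigma_sets_subset[OF this] show ?thesis by (simp only: sets_\<G> space_\<F>)
qed

lemma sets_augmented_subset_\<G>: "sets (augmented_filtration M N t) \<subseteq> sets (\<G> t)"
proof
  fix A assume A: "A \<in> sets (augmented_filtration M N t)"
  have "A \<in> sets (augmented_filtration M N s)" if "t \<le> s" for s
    using A sets_augmented_mono[OF that] by blast
  then have "A \<in> (\<Inter>s\<in>insert \<infinity> {t<..}. sets (augmented_filtration M N s))" by auto
  then show "A \<in> sets (\<G> t)" unfolding sets_\<G> by (rule sigma_sets.Basic)
qed

lemma stopping_time_sets: "\<tau> \<in> stopping_times M N \<Longrightarrow> {\<omega> \<in> space M. \<tau> \<omega> \<le> t} \<in> sets (\<G> t)"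
  by (auto simp: stopping_times_def stopping_time_def pred_def space_\<G>)

text \<open>The complement is a countable union of events \<open>\<tau> \<le> q\<close> with
  \<open>q < s\<close>. Each of these lies in the right-continuous filtration at \<open>q\<close>,
  hence in the augmented one at \<open>s\<close>, for which the independence of increments is
  known.\<close>

lemma stopping_time_ge_sets:
  assumes \<tau>: "\<tau> \<in> stopping_times M N" and s: "0 \<le> s"
  shows "{\<omega> \<in> space M. ennreal s \<le> \<tau> \<omega>} \<in> sets (\<F> s)"
proof (cases "s = 0")
  case True
  then show ?thesis using sets.top[of "\<F> s"] by (simp add: space_\<F>)
next
  case False
  then have s0: "0 < s" using s by simp
  \<comment> \<open>A sequence below \<open>s\<close> that converges to \<open>s\<close>.\<close>
  define q where "q i = s - s / real (Suc i)" for i :: nat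
  have q: "0 \<le> q i" "q i < s" for i
    using s0 by (auto simp: q_def divide_le_eq)
  have "{\<omega> \<in> space M. \<tau> \<omega> < ennreal s} = (\<Union>i. {\<omega> \<in> space M. \<tau> \<omega> \<le> ennreal (q i)})"
  proof (intro set_eqI iffI)
    fix \<omega> assume "\<omega> \<in> {\<omega> \<in> space M. \<tau> \<omega> < ennreal s}"
    then have \<omega>: "\<omega> \<in> space M" "\<tau> \<omega> < ennreal s" by auto
    then obtain r where r: "0 \<le> r" "\<tau> \<omega> = ennreal r" by (cases "\<tau> \<omega>") auto
    with \<omega> have "r < s" by (simp add: ennreal_less_iff)
    then obtain i where i: "s < real i * (s - r)" using reals_Archimedean3[of "s - r"] by auto
    then have "s < real (Suc i) * (s - r)" using \<open>r < s\<close> by (simp add: algebra_simps)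
    then have "s / real (Suc i) < s - r" by (simp add: divide_less_eq mult.commute del: of_nat_Suc)
    then have "r \<le> q i" by (simp add: q_def del: of_nat_Suc)
    then have "\<tau> \<omega> \<le> ennreal (q i)" using r by (simp add: ennreal_leI)
    with \<omega> show "\<omega> \<in> (\<Union>i. {\<omega> \<in> space M. \<tau> \<omega> \<le> ennreal (q i)})" by blast
  next
    fix \<omega> assume "\<omega> \<in> (\<Union>i. {\<omega> \<in> space M. \<tau> \<omega> \<le> ennreal (q i)})"
    then obtain i where i: "\<omega> \<in> space M" "\<tau> \<omega> \<le> ennreal (q i)" by blast
    moreover have "ennreal (q i) < ennreal s" using q[of i] by (simp add: ennreal_less_iff)
    ultimately show "\<omega> \<in> {\<omega> \<in> space M. \<tau> \<omega> < ennreal s}" by (auto intro: order_le_less_trans)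
  qed
  moreover have "{\<omega> \<in> space M. \<tau> \<omega> \<le> ennreal (q i)} \<in> sets (\<F> s)" for i
    using stopping_time_sets[OF \<tau>, of "ennreal (q i)"] sets_\<G>_subset[of "ennreal (q i)" "ennreal s"] q[of i]
    by (auto simp: ennreal_less_iff)
  ultimately have "{\<omega> \<in> space M. \<tau> \<omega> < ennreal s} \<in> sets (\<F> s)" by auto
  from sets.compl_sets[OF this] show ?thesis
    by (rule back_subst[of "\<lambda>A. A \<in> sets (\<F> s)"]) (auto simp: space_\<F> not_less)
qed

lemma expected_cost_ge:
  assumes \<tau>: "\<tau> \<in> stopping_times M N" and h: "0 < h" "h \<le> 1" and n: "0 < n"
  shows "ereal (val p - real n * (step_const * h\<^sup>2)
      - h * ((\<integral>\<omega>. 2 ^ N (real n * h) \<omega> \<partial>completion M) * (exp (2 * (real n * h)) * weight p + cost_shift))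
      - exp (- (lam * (real n * h))) * bound) \<le> expected_cost M N \<sigma> lam mu c m p \<tau>"
proof -
  define A where "A k = {\<omega> \<in> space M. ennreal (real k * h) \<le> \<tau> \<omega>}" for k
  have A: "A k \<in> sets (\<F> (real k * h))" for k
    unfolding A_def using h by (intro stopping_time_ge_sets \<tau>) auto
  have dec: "A (Suc k) \<subseteq> A k" for k
  proof -
    have "ennreal (real k * h) \<le> ennreal (real (Suc k) * h)" using h by (intro ennreal_leI mult_right_mono) auto
    then show ?thesis unfolding A_def by (auto intro: order_trans)
  qed
  define W where "W = exp (2 * (real n * h)) * weight p + cost_shift"
  define e where "e = exp (- (lam * (real n * h))) * bound"
  let ?S = "\<lambda>\<omega>. \<Sum>k<n. indicator (A k) \<omega> * cell_cost h k \<omega>"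
  let ?z = "\<lambda>\<omega>. ?S \<omega> - h * (2 ^ N (real n * h) \<omega> * W) - e"
  have i1: "integrable (completion M) ?S" by (rule integrable_grid_cost[OF h(1) A])
  have i2: "integrable (completion M) (\<lambda>\<omega>. h * (2 ^ N (real n * h) \<omega> * W))"
    using h n by (intro integrable_mult_right integrable_mult_left integrable_two_power_N) auto
  have iz: "integrable (completion M) ?z"
    by (intro Bochner_Integration.integrable_diff i1 i2 P.integrable_const)
  have "(\<integral>\<omega>. ?z \<omega> \<partial>completion M) = (\<integral>\<omega>. ?S \<omega> \<partial>completion M) - h * ((\<integral>\<omega>. 2 ^ N (real n * h) \<omega> \<partial>completion M) * W) - e"
    by (simp only: Bochner_Integration.integral_diff[OF Bochner_Integration.integrable_diff[OF i1 i2] P.integrable_const]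
        Bochner_Integration.integral_diff[OF i1 i2]) (simp add: P.prob_space[simplified])
  then have "val p - real n * (step_const * h\<^sup>2) - h * ((\<integral>\<omega>. 2 ^ N (real n * h) \<omega> \<partial>completion M) * W) - e \<le> (\<integral>\<omega>. ?z \<omega> \<partial>completion M)"
    using grid_cost_ge[where A = A and n = n, OF h A dec] by linarith
  then have "ereal (val p - real n * (step_const * h\<^sup>2) - h * ((\<integral>\<omega>. 2 ^ N (real n * h) \<omega> \<partial>completion M) * W) - e) \<le> ext_integral (completion M) (\<lambda>\<omega>. ereal (?z \<omega>))"
    by (simp only: ext_integral_real[OF iz] ereal_less_eq)
  also have "\<dots> \<le> expected_cost M N \<sigma> lam mu c m p \<tau>"
    unfolding expected_cost_eq
  proof (rule ext_integral_mono)
    fix \<omega> assume "\<omega> \<in> space (completion M)"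
    then have \<omega>: "\<omega> \<in> space M" by simp
    show "ereal (?z \<omega>) \<le> ext_integral lborel (\<lambda>t. ereal (running (\<tau> \<omega>) \<omega> t))"
      unfolding W_def e_def by (rule running_ge[OF \<omega> h(1)]) (simp add: A_def \<omega>)
  qed
  finally show ?thesis by (simp only: W_def e_def)
qed

text \<open>The nearly optimal rule stops at the first grid time where \<open>val\<close> is at
  least \<open>- \<epsilon>\<close>, and at \<open>n * h\<close> at the latest.\<close>

lemma expected_cost_le:
  assumes h: "0 < h" "h \<le> 1" and h\<epsilon>: "0 < \<epsilon>" "(L0 + L1) * (flow_const * h * near_weight) \<le> \<epsilon>"
  shows "\<exists>\<tau>\<in>stopping_times M N. expected_cost M N \<sigma> lam mu c m p \<tau>
    \<le> ereal (val p + real n * (step_const * h\<^sup>2) + \<epsilon> + exp (- (lam * (real n * h))) * bound)"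
proof -
  define B where "B k = {\<omega> \<in> space M. val (X (real k * h) \<omega>) < - \<epsilon>}" for k
  define A where "A k = {\<omega> \<in> space M. \<forall>i\<le>k. \<omega> \<in> B i}" for k
  have B: "B k \<in> sets (\<F> (real k * h))" for k
  proof -
    have "(\<lambda>\<omega>. val (X (real k * h) \<omega>)) \<in> borel_measurable (\<F> (real k * h))"
      using h by (intro function_of_X_measurable continuous_on_w) auto
    from measurable_sets[OF this, of "{..<- \<epsilon>}"] show ?thesis
      by (simp add: B_def vimage_def Int_def space_\<F> conj_commute)
  qed
  have A: "A k \<in> sets (\<F> (real k * h))" for k
  proof -
    have "A k = (\<Inter>i\<in>{..k}. B i)" by (auto simp: A_def B_def)
    moreover have "B i \<in> sets (\<F> (real k * h))" if "i \<le> k" for i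
    proof -
      have "ennreal (real i * h) \<le> ennreal (real k * h)" using that h by (intro ennreal_leI mult_right_mono) auto
      from sets_augmented_mono[OF this] B[of i] show ?thesis by blast
    qed
    ultimately show ?thesis by (auto intro!: sets.finite_INT)
  qed
  have dec: "A (Suc k) \<subseteq> A k" for k by (auto simp: A_def)
  \<comment> \<open>As the events \<open>A k\<close> decrease, counting those that hold gives the
    index of the first failure, capped at \<open>n\<close>.\<close>
  define \<kappa> where "\<kappa> \<omega> = card {k. k < n \<and> \<omega> \<in> A k}" for \<omega>
  have \<kappa>_iff: "\<omega> \<in> A k \<longleftrightarrow> k < \<kappa> \<omega>" if "k < n" for \<omega> k
  proof -
    have down: "\<omega> \<in> A i" if "\<omega> \<in> A j" "i \<le> j" for i j using that by (auto simp: A_def)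
    show ?thesis
    proof
      assume "\<omega> \<in> A k"
      then have "{..k} \<subseteq> {k. k < n \<and> \<omega> \<in> A k}" using down \<open>k < n\<close> by auto
      from card_mono[OF _ this] show "k < \<kappa> \<omega>" by (simp add: \<kappa>_def)
    next
      assume k: "k < \<kappa> \<omega>"
      show "\<omega> \<in> A k"
      proof (rule ccontr)
        assume "\<omega> \<notin> A k"
        then have "{k. k < n \<and> \<omega> \<in> A k} \<subseteq> {..<k}" using down by (auto simp: not_less[symmetric])
        from card_mono[OF _ this] k show False by (simp add: \<kappa>_def)
      qed
    qed
  qed
  have \<kappa>_le: "\<kappa> \<omega> \<le> n" for \<omega>
    using card_mono[of "{..<n}" "{k. k < n \<and> \<omega> \<in> A k}"] by (auto simp: \<kappa>_def)
  define \<tau> where "\<tau> \<omega> = ennreal (real (\<kappa> \<omega>) * h)" for \<omega>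
  have st: "\<tau> \<in> stopping_times M N"
    unfolding stopping_times_def stopping_time_def mem_Collect_eq
  proof
    fix t :: ennreal
    show "Measurable.pred (\<G> t) (\<lambda>\<omega>. \<tau> \<omega> \<le> t)"
    proof (cases "t < ennreal (real n * h)")
      case False
      have "\<tau> \<omega> \<le> t" for \<omega>
      proof -
        have "\<tau> \<omega> \<le> ennreal (real n * h)" unfolding \<tau>_def using \<kappa>_le h by (intro ennreal_leI mult_right_mono) auto
        then show ?thesis using False by (meson not_less order_trans)
      qed
      then show ?thesis by simp
    next
      case True
      then obtain r where r: "0 \<le> r" "t = ennreal r" "r < real n * h"
        by (cases t) (auto simp: ennreal_less_iff)
      \<comment> \<open>The cell containing \<open>r\<close>. Since \<tau> takes grid values only,
        having stopped by \<open>r\<close> means failure of \<open>A j\<close>, which is decided at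
        time \<open>j * h <= r\<close>.\<close>
      define j where "j = nat \<lfloor>r / h\<rfloor>"
      have "r \<in> {real j * h..<real j * h + h}" by (subst mem_cell_iff[OF h(1)]) (simp add: j_def r(1))
      then have cell: "real j * h \<le> r" "r < real (Suc j) * h" by (auto simp: algebra_simps)
      have "real j * h < real n * h" using cell r by linarith
      then have "j < n" using h by simp
      have "\<tau> \<omega> \<le> t \<longleftrightarrow> \<omega> \<notin> A j" for \<omega>
      proof -
        have "\<tau> \<omega> \<le> t \<longleftrightarrow> real (\<kappa> \<omega>) * h \<le> r" using r by (simp add: \<tau>_def ennreal_le_iff)
        also have "\<dots> \<longleftrightarrow> \<kappa> \<omega> \<le> j"
        proof
          assume "real (\<kappa> \<omega>) * h \<le> r"
          then have "real (\<kappa> \<omega>) * h < real (Suc j) * h" using cell by linarith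
          then show "\<kappa> \<omega> \<le> j" using h by (simp del: of_nat_Suc)
        next
          assume "\<kappa> \<omega> \<le> j"
          then have "real (\<kappa> \<omega>) * h \<le> real j * h" using h by (intro mult_right_mono) auto
          then show "real (\<kappa> \<omega>) * h \<le> r" using cell by linarith
        qed
        finally show ?thesis using \<kappa>_iff[OF \<open>j < n\<close>] by auto
      qed
      moreover have "A j \<in> sets (\<G> t)"
      proof -
        have "ennreal (real j * h) \<le> t" unfolding r(2) by (rule ennreal_leI[OF cell(1)])
        from sets_augmented_mono[OF this] sets_augmented_subset_\<G>[of t] A[of j] show ?thesis by blast
      qed
      ultimately show ?thesis by simp
    qed
  qed
  have "expected_cost M N \<sigma> lam mu c m p \<tau> = ext_integral (completion M) (\<lambda>\<omega>. ereal (\<Sum>k<n. indicator (A k) \<omega> * cell_cost h k \<omega>))"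
    unfolding expected_cost_eq
  proof (rule ext_integral_cong)
    fix \<omega> assume "\<omega> \<in> space (completion M)"
    then have \<omega>: "\<omega> \<in> space M" by simp
    show "ext_integral lborel (\<lambda>t. ereal (running (\<tau> \<omega>) \<omega> t)) = ereal (\<Sum>k<n. indicator (A k) \<omega> * cell_cost h k \<omega>)"
      unfolding \<tau>_def by (rule running_grid[OF \<omega> h(1) \<kappa>_le \<kappa>_iff])
  qed
  also have "\<dots> = ereal (\<integral>\<omega>. (\<Sum>k<n. indicator (A k) \<omega> * cell_cost h k \<omega>) \<partial>completion M)"
    by (rule ext_integral_real[OF integrable_grid_cost[OF h(1) A]])
  also have "\<dots> \<le> ereal (val p + real n * (step_const * h\<^sup>2) + \<epsilon> + exp (- (lam * (real n * h))) * bound)"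
    unfolding ereal_less_eq(3)
  proof (rule grid_cost_le[OF h A dec _ _ h\<epsilon>])
    show "val (X (real k * h) \<omega>) < - \<epsilon>" if "\<omega> \<in> A k" for k \<omega>
      using that by (auto simp: A_def B_def)
    show "- \<epsilon> \<le> val (X (real k * h) \<omega>)" if exit: "\<omega> \<in> space M" "\<omega> \<notin> A k" "\<And>i. i < k \<Longrightarrow> \<omega> \<in> A i" for k \<omega>
    proof -
      obtain i where i: "i \<le> k" "\<omega> \<notin> B i" using exit by (auto simp: A_def)
      have "i = k"
      proof (rule ccontr)
        assume "i \<noteq> k"
        then have "\<omega> \<in> A i" using i exit(3) by simp
        then show False using i by (auto simp: A_def)
      qed
      then show ?thesis using i exit by (auto simp: B_def)
    qed
  qed
  finally show ?thesis using st by blast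
qed

lemma grid_choice:
  assumes "0 < \<delta>"
  obtains K where "0 < K" "exp (- (lam * K)) * bound < \<delta>"
proof -
  have "((\<lambda>t. exp (- (lam * t)) * bound) \<longlongrightarrow> 0 * bound) at_top"
    by (intro tendsto_intros filterlim_compose[OF exp_at_bot] filterlim_uminus_at_bot_at_top[THEN filterlim_compose]
        filterlim_tendsto_pos_mult_at_top[OF tendsto_const lam_pos filterlim_ident])
  then have "eventually (\<lambda>t. exp (- (lam * t)) * bound < \<delta>) at_top"
    using assms by (intro order_tendstoD(2)) auto
  then have "eventually (\<lambda>t. exp (- (lam * t)) * bound < \<delta> \<and> 0 < t) at_top"
    using eventually_gt_at_top[of 0] by eventually_elim auto
  then show ?thesis using that by (auto simp: eventually_at_top_linorder)
qed

lemma small_step: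
  assumes "0 < K" "0 < \<delta>"
  obtains n h where "0 < (n::nat)" "0 < h" "h \<le> 1" "real n * h = K" "h * C < \<delta>"
proof -
  obtain n where n: "K + K * \<bar>C\<bar> / \<delta> < real n" using reals_Archimedean2 by blast
  have "0 \<le> K * \<bar>C\<bar> / \<delta>" using assms by simp
  then have n': "K < real n" "K * \<bar>C\<bar> / \<delta> < real n" using n assms by linarith+
  then have "0 < real n" using assms by linarith
  then have "K / real n * C \<le> K / real n * \<bar>C\<bar>" using assms by (intro mult_left_mono) auto
  also have "\<dots> < \<delta>" using n' \<open>0 < real n\<close> assms by (simp add: field_simps)
  finally show ?thesis using that[of n "K / real n"] n' \<open>0 < real n\<close> assms by simp
qed

text \<open>\<open>K\<close> is chosen first, so that discounting makes the time beyond it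
  negligible, and then \<open>h\<close> with \<open>n * h = K\<close>: the \<open>n\<close> errors
  of order \<open>h^2\<close> sum to order \<open>K * h\<close>.\<close>

theorem value_function_eq_val: "value_function M N \<sigma> lam mu c m p = val p"
proof -
  let ?I = "INF \<tau>\<in>stopping_times M N. expected_cost M N \<sigma> lam mu c m p \<tau>"
  have "ereal (val p) \<le> ?I"
  proof (rule INF_greatest)
    fix \<tau> assume \<tau>: "\<tau> \<in> stopping_times M N"
    show "ereal (val p) \<le> expected_cost M N \<sigma> lam mu c m p \<tau>"
    proof (rule ereal_le_epsilon2)
      fix \<delta> :: real assume \<delta>: "0 < \<delta>"
      obtain K where K: "0 < K" "exp (- (lam * K)) * bound < \<delta> / 2" using grid_choice[of "\<delta> / 2"] \<delta> by auto
      define C where "C = K * step_const + (\<integral>\<omega>. 2 ^ N K \<omega> \<partial>completion M) * (exp (2 * K) * weight p + cost_shift)"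
      obtain n h where nh: "0 < (n::nat)" "0 < h" "h \<le> 1" "real n * h = K" "h * C < \<delta> / 2"
        using small_step[of K "\<delta> / 2" C] K \<delta> by auto
      have "real n * (step_const * h\<^sup>2) = h * (K * step_const)"
        unfolding nh(4)[symmetric] by (simp add: power2_eq_square)
      then have "val p - \<delta> \<le> val p - real n * (step_const * h\<^sup>2)
        - h * ((\<integral>\<omega>. 2 ^ N (real n * h) \<omega> \<partial>completion M) * (exp (2 * (real n * h)) * weight p + cost_shift))
        - exp (- (lam * (real n * h))) * bound"
        using nh(5) K(2) unfolding nh(4) C_def distrib_left by linarith
      then have "ereal (val p - \<delta>) \<le> expected_cost M N \<sigma> lam mu c m p \<tau>"
        using expected_cost_ge[OF \<tau> nh(2,3,1)] by (meson ereal_less_eq(3) order_trans)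
      then have "ereal (val p - \<delta>) + ereal \<delta> \<le> expected_cost M N \<sigma> lam mu c m p \<tau> + ereal \<delta>"
        by (rule add_right_mono)
      then show "ereal (val p) \<le> expected_cost M N \<sigma> lam mu c m p \<tau> + ereal \<delta>" by simp
    qed
  qed
  moreover have "?I \<le> ereal (val p)"
  proof (rule ereal_le_epsilon2)
    fix \<delta> :: real assume \<delta>: "0 < \<delta>"
    obtain K where K: "0 < K" "exp (- (lam * K)) * bound < \<delta> / 4" using grid_choice[of "\<delta> / 4"] \<delta> by auto
    define C1 where "C1 = (L0 + L1) * (flow_const * near_weight)"
    have C1: "0 \<le> C1" unfolding C1_def using L0_nonneg L1_nonneg flow_const_pos near_weight_pos
      by (intro mult_nonneg_nonneg add_nonneg_nonneg) auto
    obtain n h where nh: "0 < (n::nat)" "0 < h" "h \<le> 1" "real n * h = K" "h * (K * step_const + C1) < \<delta> / 4"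
      using small_step[of K "\<delta> / 4" "K * step_const + C1"] K \<delta> by auto
    have C2: "0 \<le> h * (K * step_const)" "0 \<le> h * C1" using nh K step_const_nonneg C1 by auto
    have "(L0 + L1) * (flow_const * h * near_weight) = h * C1" by (simp add: C1_def)
    then have "(L0 + L1) * (flow_const * h * near_weight) \<le> \<delta> / 4"
      using nh(5) C2 unfolding distrib_left by linarith
    then obtain \<tau> where \<tau>: "\<tau> \<in> stopping_times M N"
      "expected_cost M N \<sigma> lam mu c m p \<tau> \<le> ereal (val p + real n * (step_const * h\<^sup>2) + \<delta> / 4 + exp (- (lam * (real n * h))) * bound)"
      using expected_cost_le[OF nh(2,3), of "\<delta> / 4" n] \<delta> by auto
    have "real n * (step_const * h\<^sup>2) = h * (K * step_const)"
      unfolding nh(4)[symmetric] by (simp add: power2_eq_square)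
    then have "val p + real n * (step_const * h\<^sup>2) + \<delta> / 4 + exp (- (lam * (real n * h))) * bound \<le> val p + \<delta>"
      using nh(5) K(2) C2 \<delta> unfolding nh(4) distrib_left by linarith
    then have "expected_cost M N \<sigma> lam mu c m p \<tau> \<le> ereal (val p + \<delta>)"
      using \<tau>(2) by (meson ereal_less_eq(3) order_trans)
    then show "?I \<le> ereal (val p) + ereal \<delta>" using INF_lower2[OF \<tau>(1)] by simp
  qed
  ultimately have "?I = ereal (val p)" by (rule antisym[rotated])
  then show ?thesis by (simp add: value_function_def)
qed

end

section \<open>Minimisers along the deterministic flow and the exit boundary\<close>

text \<open>The condition \<open>lam_small\<close> makes \<open>(0, phi_d)\<close> a point of negative running cost.\<close>

locale poisson_disorder_exit = poisson_disorder +
  assumes lam_small: "lam < 1 - (1 + m) * (c / 2)"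
    and jump_above: "phi1_bar lam c m < (mu + 1) / mu * phi_d lam m"
    and star_below: "phi1_star lam c < (mu + 1) / mu * a_0 lam c (mu / (mu - 1) * phi0_star lam c)"
    and bar_below: "phi1_bar lam c m < (mu + 1) / mu * a_0 lam c (mu / (mu - 1) * 0)"
begin

abbreviation "xs \<equiv> phi0_star lam c"
abbreviation "ys \<equiv> phi1_star lam c"
abbreviation "yb \<equiv> phi1_bar lam c m"
abbreviation "\<phi>d \<equiv> phi_d lam m"

lemma two_div_sqrt2: "2 / sqrt 2 = sqrt (2::real)"
  by (rule real_div_sqrt) simp

lemma lam_sqrt2: "lam / sqrt 2 * 2 = lam * sqrt 2"
proof -
  have "lam / sqrt 2 * 2 = lam * (2 / sqrt 2)" by simp
  then show ?thesis by (simp only: two_div_sqrt2)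
qed

lemma star_sum: "xs + ys = cost_shift"
proof -
  have "xs + ys = lam / sqrt 2 * ((1 - lam) / c + (1 + lam) / c)"
    by (simp add: phi0_star_def phi1_star_def algebra_simps)
  also have "(1 - lam) / c + (1 + lam) / c = 2 / c" by (simp add: add_divide_distrib[symmetric])
  also have "lam / sqrt 2 * (2 / c) = lam / sqrt 2 * 2 / c" by simp
  also have "\<dots> = cost_shift" by (simp only: lam_sqrt2) (simp add: cost_shift_def)
  finally show ?thesis .
qed

text \<open>The second line through the point. On it the derivative of the running cost along the
  flow is 0 (\<open>slope_0\<close>), so the flow touches the line \<open>g = 0\<close> at
  \<open>(xs, ys)\<close>.\<close>

lemma star_slope: "(lam + 1) * xs + lam * sqrt 2 = (1 - lam) * ys"
proof -
  have "(1 - lam) * ys - (lam + 1) * xs = lam / sqrt 2 * ((1 - lam) * ((1 + lam) / c + 1) - (lam + 1) * ((1 - lam) / c - 1))"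
  proof -
    have "(1 - lam) * (q * a) - (lam + 1) * (q * b) = q * ((1 - lam) * a - (lam + 1) * b)" for q a b
      by (simp add: algebra_simps)
    then show ?thesis unfolding phi0_star_def phi1_star_def .
  qed
  also have "(1 - lam) * ((1 + lam) / c + 1) - (lam + 1) * ((1 - lam) / c - 1) = 2"
    by (simp add: algebra_simps)
  finally show ?thesis by (simp only: lam_sqrt2)
qed

lemma ys_pos: "0 < ys"
  using lam_pos c_pos by (simp add: phi1_star_def add_pos_pos)

lemma mu_ratio: "0 < (mu + 1) / mu" "0 < mu / (mu - 1)" "(mu + 1) / mu = 1 + 1 / mu"
  using mu_gt_1 by (auto simp: field_simps)

text \<open>Since \<open>ys\<close> is positive, \<open>star_below\<close> excludes the default
  value 0 of \<open>a_0\<close>, so its argument lies in \<open>[0, cost_shift)\<close>. This gives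
  the sign of \<open>xs\<close>, and the inequality then becomes linear.\<close>

lemma xs_nonneg: "0 \<le> xs" and star_ell: "mu / (mu - 1) * xs + mu / (mu + 1) * ys < cost_shift"
proof -
  let ?z = "mu / (mu - 1) * xs"
  have "a_0 lam c ?z \<noteq> 0"
    using star_below ys_pos by auto
  then have z: "0 \<le> ?z" "?z < cost_shift" "a_0 lam c ?z = cost_shift - ?z"
    by (auto simp: a_0_def cost_shift_def split: if_splits)
  show "0 \<le> xs" using z(1) mu_ratio(2) by (simp only: zero_le_mult_iff) auto
  have "mu / (mu + 1) * ys < mu / (mu + 1) * ((mu + 1) / mu * (cost_shift - ?z))"
    using star_below mu_gt_1 unfolding z(3) by (intro mult_strict_left_mono) auto
  also have "\<dots> = cost_shift - ?z" using mu_gt_1 by simp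
  finally show "?z + mu / (mu + 1) * ys < cost_shift" by linarith
qed

lemma bar_ell: "mu / (mu + 1) * yb < cost_shift"
proof -
  have a: "a_0 lam c (mu / (mu - 1) * 0) = cost_shift"
    using cost_shift_pos by (simp add: a_0_def cost_shift_def)
  have "mu / (mu + 1) * yb < mu / (mu + 1) * ((mu + 1) / mu * cost_shift)"
    using bar_below mu_gt_1 unfolding a by (intro mult_strict_left_mono) auto
  also have "\<dots> = cost_shift" using mu_gt_1 by simp
  finally show ?thesis .
qed

lemma phi_d_less_cost_shift: "\<phi>d < cost_shift"
proof -
  have "(1 + m) / sqrt 2 * c < sqrt 2 * (1 - lam)"
  proof -
    have "(1 + m) * c < 2 * (1 - lam)" using lam_small by (simp add: field_simps)
    then have "(1 + m) * c / sqrt 2 < 2 * (1 - lam) / sqrt 2" by (intro divide_strict_right_mono) auto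
    also have "2 * (1 - lam) / sqrt 2 = 2 / sqrt 2 * (1 - lam)" by simp
    also have "\<dots> = sqrt 2 * (1 - lam)" by (simp only: two_div_sqrt2)
    finally show ?thesis by simp
  qed
  then have "lam * ((1 + m) / sqrt 2 * c) < lam * (sqrt 2 * (1 - lam))" using lam_pos by (rule mult_strict_left_mono)
  then show ?thesis using lam_lt_1 c_pos by (simp add: phi_d_def cost_shift_def field_simps)
qed

lemma phi_d_less_ys: "\<phi>d < ys"
proof -
  have "(1 - lam) * \<phi>d = lam * (1 + m) / sqrt 2" using lam_lt_1 by (simp add: phi_d_def)
  also have "\<dots> < lam * 2 / sqrt 2"
    using lam_pos m_lt by (intro divide_strict_right_mono mult_strict_left_mono) auto
  also have "\<dots> = lam * sqrt 2" using lam_sqrt2 by simp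
  also have "\<dots> \<le> (1 - lam) * ys" using star_slope xs_nonneg lam_pos mult_nonneg_nonneg[of "lam + 1" xs] by linarith
  finally show ?thesis using lam_lt_1 by simp
qed

text \<open>\<open>- k0\<close> is the rest point of the first equation.\<close>

definition "k0 = drift0 / (lam + 1)"

lemma k0_pos: "0 < k0"
  using drift0_pos lam_pos by (simp add: k0_def)

text \<open>The power in \<open>phi1_bar\<close> is \<open>exp ((1 - lam) * r)\<close> for the time
  \<open>r\<close> that the first coordinate takes from 0 to \<open>xs\<close>; it undoes the
  contraction of the second coordinate towards \<open>phi_d\<close>.\<close>

lemma bar_flow:
  obtains r where "0 \<le> r" "fl r (0, yb) = (xs, ys)"
proof -
  define E where "E = 1 + xs / k0"
  define r where "r = ln E / (lam + 1)"
  have E: "1 \<le> E" using xs_nonneg k0_pos by (simp add: E_def)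
  have r: "0 \<le> r" using E lam_pos by (simp add: r_def)
  have exp_r: "exp ((lam + 1) * r) = E" using E lam_pos by (simp add: r_def)
  have k: "sqrt 2 * (lam + 1) / (lam * (1 - m)) = 1 / k0"
    using lam_pos by (simp add: k0_def drift0_def field_simps)
  have ph: "lam * (1 + m) / (sqrt 2 * (lam - 1)) = - \<phi>d"
    using lam_lt_1 by (simp add: phi_d_def field_simps)
  have "yb = \<phi>d + (ys - \<phi>d) * (1 + xs * (1 / k0)) powr (- (lam - 1) / (lam + 1))"
    unfolding phi1_bar_def ph k by simp
  also have "1 + xs * (1 / k0) = E" by (simp add: E_def)
  also have "E powr (- (lam - 1) / (lam + 1)) = exp ((1 - lam) * r)"
    using E by (simp add: powr_def r_def algebra_simps)
  finally have yb: "yb = \<phi>d + (ys - \<phi>d) * exp ((1 - lam) * r)" .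
  have "snd (fl r (0, yb)) = ys"
    by (simp add: snd_flow yb mult.assoc mult_exp_exp)
  moreover have "fst (fl r (0, yb)) = xs"
    unfolding fst_flow k0_def[symmetric] exp_r E_def using k0_pos by (simp add: field_simps)
  ultimately show ?thesis using that[OF r] by (simp add: prod_eq_iff)
qed

lemma phi_d_less_yb: "\<phi>d < yb"
proof -
  obtain r where r: "0 \<le> r" "fl r (0, yb) = (xs, ys)" by (rule bar_flow)
  then have "snd (fl r (0, yb)) = ys" by simp
  then have "\<phi>d < snd (fl r (0, yb))" using phi_d_less_ys by simp
  then have "0 < (yb - \<phi>d) * exp (- ((1 - lam) * r))" by (simp add: snd_flow)
  then show ?thesis by (simp add: zero_less_mult_iff)
qed

text \<open>\<open>slope p\<close> is the derivative of the running cost along the flow from \<open>p\<close>; above the level \<open>phi_d\<close> it is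
  increasing, so the running cost is convex along the flow there.\<close>

definition "slope p u = (lam + 1) * (fst p + k0) * exp ((lam + 1) * u) - (1 - lam) * (snd p - \<phi>d) * exp (- ((1 - lam) * u))"

lemma fst_flow_k0: "fst (fl u p) = (fst p + k0) * exp ((lam + 1) * u) - k0"
  by (simp add: fst_flow k0_def)

lemma g_flow: "g (fl u p) = (fst p + k0) * exp ((lam + 1) * u) + (snd p - \<phi>d) * exp (- ((1 - lam) * u)) + (\<phi>d - k0 - cost_shift)"
  by (simp add: g_eq fst_flow snd_flow k0_def)

lemma g_flow_deriv: "((\<lambda>u. g (fl u p)) has_real_derivative slope p u) (at u)"
  unfolding g_flow slope_def by (auto intro!: derivative_eq_intros simp: algebra_simps)

lemma slope_strict_mono:
  assumes "p \<in> quadrant" "\<phi>d \<le> snd p" "u < v"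
  shows "slope p u < slope p v"
proof -
  have "(lam + 1) * (fst p + k0) * exp ((lam + 1) * u) < (lam + 1) * (fst p + k0) * exp ((lam + 1) * v)"
    using assms lam_pos k0_pos by (intro mult_strict_left_mono mult_pos_pos) (auto simp: quadrant_iff)
  moreover have "(1 - lam) * (snd p - \<phi>d) * exp (- ((1 - lam) * v)) \<le> (1 - lam) * (snd p - \<phi>d) * exp (- ((1 - lam) * u))"
    using assms lam_lt_1 by (intro mult_left_mono mult_nonneg_nonneg) auto
  ultimately show ?thesis unfolding slope_def by linarith
qed

lemma g_flow_MVT:
  assumes "u < v"
  obtains z where "u < z" "z < v" "g (fl v p) - g (fl u p) = (v - u) * slope p z"
  using MVT2[OF assms, of "\<lambda>u. g (fl u p)" "slope p"] g_flow_deriv that by blast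

text \<open>Strict convexity along the flow: the rise from \<open>t0\<close> to \<open>t1\<close>
  needs a nonnegative slope in between, and slopes increase afterwards.\<close>

lemma g_flow_pos_after:
  assumes p: "p \<in> quadrant" "\<phi>d \<le> snd p"
    and t: "t0 < t1" "t1 < t" "g (fl t0 p) \<le> 0" "0 \<le> g (fl t1 p)"
  shows "0 < g (fl t p)"
proof (rule ccontr)
  assume "\<not> 0 < g (fl t p)"
  obtain a where a: "a < t1" "g (fl t1 p) - g (fl t0 p) = (t1 - t0) * slope p a"
    using g_flow_MVT[OF t(1), of p] by blast
  obtain b where b: "t1 < b" "g (fl t p) - g (fl t1 p) = (t - t1) * slope p b"
    using g_flow_MVT[OF t(2), of p] by blast
  have "0 \<le> (t1 - t0) * slope p a" using a t by linarith
  then have "0 \<le> slope p a" using t by (simp add: zero_le_mult_iff)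
  moreover have "(t - t1) * slope p b \<le> 0" using b t \<open>\<not> 0 < g (fl t p)\<close> by linarith
  then have "slope p b \<le> 0" using t by (simp add: mult_le_0_iff)
  moreover have "slope p a < slope p b" using a b by (intro slope_strict_mono p) auto
  ultimately show False by linarith
qed

lemma g_flow_nonneg_from:
  assumes p: "p \<in> quadrant" "\<phi>d \<le> snd p" and r: "0 \<le> g (fl r p)" "0 \<le> slope p r" and t: "r \<le> t"
  shows "0 \<le> g (fl t p)"
proof (cases "t = r")
  case False
  then have "r < t" using t by simp
  then obtain z where z: "r < z" "g (fl t p) - g (fl r p) = (t - r) * slope p z"
    using g_flow_MVT[OF \<open>r < t\<close>, of p] by blast
  then have "0 < slope p z" using slope_strict_mono[OF p z(1)] r by linarith
  then have "0 \<le> (t - r) * slope p z" using \<open>r < t\<close> by simp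
  then show ?thesis using z r by linarith
qed (use r in simp)

text \<open>On \<open>safe\<close> the running cost stays nonnegative along the flow, and \<open>jump_above\<close> makes jumps lead back
  to \<open>safe\<close>, so stopping at once is optimal there.\<close>

definition safe :: "(real \<times> real) set" where
  "safe = {p \<in> quadrant. \<phi>d \<le> snd p \<and> (\<forall>u\<ge>0. 0 \<le> g (fl u p))}"

lemma snd_flow_ge_phi_d: "\<phi>d \<le> snd p \<Longrightarrow> 0 \<le> u \<Longrightarrow> \<phi>d \<le> snd (fl u p)"
  using snd_flow_ge_min[of u p] by simp

lemma safe_flow: "p \<in> safe \<Longrightarrow> 0 \<le> t \<Longrightarrow> fl t p \<in> safe"
  by (auto simp: safe_def flow_in_quadrant flow_flow intro: snd_flow_ge_phi_d)

lemma g_mono: "p \<le> q \<Longrightarrow> g p \<le> g q"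
  by (auto simp: g_eq less_eq_prod_def)

lemma quadrant_up: "p \<in> quadrant \<Longrightarrow> p \<le> q \<Longrightarrow> q \<in> quadrant"
  by (auto simp: quadrant_iff less_eq_prod_def)

lemma safe_up: "p \<in> safe \<Longrightarrow> p \<le> q \<Longrightarrow> q \<in> safe"
  using quadrant_up[of p q] g_mono[OF flow_mono, of p q] 
  by (auto simp: safe_def less_eq_prod_def intro: order_trans)

lemma slope_0: "slope p 0 = (lam + 1) * fst p + lam * sqrt 2 - (1 - lam) * snd p"
proof -
  have "(1 - lam) * \<phi>d = lam * (1 + m) / sqrt 2" using lam_lt_1 by (simp add: phi_d_def)
  moreover have "(lam + 1) * k0 = lam * (1 - m) / sqrt 2" using lam_pos by (simp add: k0_def drift0_def)
  moreover have "lam * (1 - m) / sqrt 2 + lam * (1 + m) / sqrt 2 = lam / sqrt 2 * 2"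
    by (simp add: field_simps)
  ultimately have "(lam + 1) * k0 + (1 - lam) * \<phi>d = lam * sqrt 2" by (simp only: lam_sqrt2)
  then show ?thesis by (simp add: slope_def algebra_simps)
qed

lemma slope_flow: "slope (fl r p) u = slope p (r + u)"
  by (simp add: slope_def fst_flow snd_flow k0_def[symmetric] mult.assoc mult_exp_exp)
     (simp add: algebra_simps)

lemma yb_pos: "0 < yb"
  using phi_d_less_yb phi_d_pos by simp

text \<open>When this path reaches \<open>(xs, ys)\<close>, both the running cost and its slope are
  0. By convexity the cost has its minimum 0 there.\<close>

lemma bar_safe: "(0, yb) \<in> safe"
proof -
  obtain r where r: "0 \<le> r" "fl r (0, yb) = (xs, ys)" by (rule bar_flow)
  have p: "(0, yb) \<in> quadrant" using yb_pos by (simp add: quadrant_iff)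
  have gr: "g (fl r (0, yb)) = 0" unfolding r using star_sum by (simp add: g_eq)
  have sr: "slope (0, yb) r = 0"
    using slope_flow[of r "(0, yb)" 0] star_slope unfolding r by (simp add: slope_0)
  have "0 \<le> g (fl u (0, yb))" for u
  proof (cases "r \<le> u")
    case True
    then show ?thesis using gr sr phi_d_less_yb by (auto intro: g_flow_nonneg_from[OF p _ _ _ True])
  next
    case False
    then have "u < r" by simp
    then obtain z where z: "z < r" "g (fl r (0, yb)) - g (fl u (0, yb)) = (r - u) * slope (0, yb) z"
      using g_flow_MVT[OF \<open>u < r\<close>, of "(0, yb)"] by blast
    then have "slope (0, yb) z < 0" using slope_strict_mono[OF p _ z(1)] sr phi_d_less_yb by simp
    then have "(r - u) * slope (0, yb) z \<le> 0" using \<open>u < r\<close> by (simp add: mult_le_0_iff)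
    then show ?thesis using z gr by linarith
  qed
  then show ?thesis using p phi_d_less_yb by (simp add: safe_def)
qed

lemma star_safe: "(xs, ys) \<in> safe"
proof -
  obtain r where r: "0 \<le> r" "fl r (0, yb) = (xs, ys)" by (rule bar_flow)
  show ?thesis using safe_flow[OF bar_safe r(1)] r(2) by simp
qed

lemma jump_above_bar: "\<phi>d \<le> snd q \<Longrightarrow> yb < snd (S q)"
proof -
  assume "\<phi>d \<le> snd q"
  then have "(mu + 1) / mu * \<phi>d \<le> (mu + 1) / mu * snd q" using mu_ratio(1) by (intro mult_left_mono) auto
  then show ?thesis using jump_above by (simp add: snd_jump mu_ratio(3))
qed

lemma above_bar_safe: "p \<in> quadrant \<Longrightarrow> yb \<le> snd p \<Longrightarrow> p \<in> safe"
  by (rule safe_up[OF bar_safe]) (auto simp: less_eq_prod_def quadrant_iff)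

lemma jump_safe: "q \<in> quadrant \<Longrightarrow> \<phi>d \<le> snd q \<Longrightarrow> S q \<in> safe"
  using jump_above_bar[of q] by (intro above_bar_safe jump_in_quadrant) auto

text \<open>If the slope at \<open>p\<close> is nonnegative, the running cost cannot fall. A
  negative slope places \<open>p\<close> above the line of \<open>star_slope\<close>, which to the
  right of \<open>xs\<close> means above \<open>(xs, ys)\<close>.\<close>

lemma right_safe:
  assumes p: "p \<in> quadrant" "xs \<le> fst p" "\<phi>d \<le> snd p" "0 \<le> g p"
  shows "p \<in> safe"
proof (cases "0 \<le> slope p 0")
  case True
  then have "0 \<le> g (fl u p)" if "0 \<le> u" for u using p True g_flow_nonneg_from[of p 0 u] that by simp
  then show ?thesis using p by (simp add: safe_def)
next
  case False
  then have "(lam + 1) * fst p + lam * sqrt 2 < (1 - lam) * snd p" by (simp add: slope_0)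
  moreover have "(lam + 1) * xs \<le> (lam + 1) * fst p" using p lam_pos by (intro mult_left_mono) auto
  ultimately have "(1 - lam) * ys < (1 - lam) * snd p" using star_slope by linarith
  then have "ys \<le> snd p" using lam_lt_1 by simp
  then show ?thesis using p by (intro safe_up[OF star_safe]) (auto simp: less_eq_prod_def)
qed

lemma iter_safe: "p \<in> safe \<Longrightarrow> iter n p = 0"
proof (induction n arbitrary: p)
  case (Suc n)
  interpret it: admissible_fun lam mu c m "iter n" by unfold_locales (rule admissible_iter)
  have p: "p \<in> quadrant" using Suc by (simp add: safe_def)
  have "0 \<le> path_cost (iter n) t p" for t
    unfolding path_cost_def
  proof (rule Henstock_Kurzweil_Integration.integral_nonneg)
    show "(\<lambda>u. exp (- ((lam + mu) * u)) * dyn_cost (iter n) (fl u p)) integrable_on {0..t}"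
      by (rule it.integrand_integrable[OF p]) simp
    fix u assume u: "u \<in> {0..t}"
    then have f: "fl u p \<in> safe" using Suc by (intro safe_flow) auto
    then have "S (fl u p) \<in> safe" by (intro jump_safe) (auto simp: safe_def)
    then have "dyn_cost (iter n) (fl u p) = g (fl u p)" by (simp add: dyn_cost_def Suc.IH)
    moreover have "0 \<le> g (fl u p)" using Suc u by (auto simp: safe_def)
    ultimately show "0 \<le> exp (- ((lam + mu) * u)) * dyn_cost (iter n) (fl u p)" by simp
  qed
  moreover obtain t where "J (iter n) p = path_cost (iter n) t p" using it.J_attained[OF p] by blast
  ultimately have "0 \<le> J (iter n) p" by simp
  moreover have "iter (Suc n) p \<le> 0" using admissible_iter[of "Suc n"] p by (auto simp: admissible_def)
  ultimately show ?case by simp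
qed simp

lemma val_safe: "p \<in> safe \<Longrightarrow> val p = 0"
  by (simp add: val_def iter_safe)

lemma G_eq_g: "q \<in> quadrant \<Longrightarrow> \<phi>d \<le> snd q \<Longrightarrow> G q = g q"
  by (simp add: dyn_cost_def val_safe jump_safe)

lemma G_flow_eq_g: "p \<in> quadrant \<Longrightarrow> \<phi>d \<le> snd p \<Longrightarrow> 0 \<le> u \<Longrightarrow> G (fl u p) = g (fl u p)"
  by (intro G_eq_g flow_in_quadrant snd_flow_ge_phi_d)

text \<open>The term with \<open>val\<close> in \<open>G\<close> is monotone, so \<open>G\<close>
  grows at least as fast as \<open>g\<close>, with slope at least 1 in either coordinate.\<close>

lemma G_diff_ge: "p \<in> quadrant \<Longrightarrow> p \<le> q \<Longrightarrow> (fst q - fst p) + (snd q - snd p) \<le> G q - G p"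
  using w_mono[OF jump_in_quadrant jump_in_quadrant jump_mono, of p q] quadrant_up[of p q] mu_gt_1
  by (simp add: dyn_cost_def g_eq)

lemma G_le_g: "q \<in> quadrant \<Longrightarrow> G q \<le> g q"
  using w_le_0[OF jump_in_quadrant, of q] mu_gt_1 by (simp add: dyn_cost_def mult_le_0_iff)

lemma flow_increasing:
  assumes p: "p \<in> quadrant" "snd p \<le> \<phi>d" and uv: "0 \<le> u" "u < v"
  shows "fl u p \<le> fl v p" "fst (fl u p) < fst (fl v p)"
proof -
  show f: "fst (fl u p) < fst (fl v p)"
    using p uv lam_pos k0_pos by (auto simp: fst_flow k0_def[symmetric] quadrant_iff intro!: mult_strict_left_mono)
  have "(\<phi>d - snd p) * exp (- ((1 - lam) * v)) \<le> (\<phi>d - snd p) * exp (- ((1 - lam) * u))"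
    using p uv lam_lt_1 by (intro mult_left_mono) auto
  then have "snd (fl u p) \<le> snd (fl v p)" by (simp add: snd_flow algebra_simps)
  with f show "fl u p \<le> fl v p" by (simp add: less_eq_prod_def)
qed

lemma G_flow_increasing:
  assumes p: "p \<in> quadrant" "snd p \<le> \<phi>d" and uv: "0 \<le> u" "u < v"
  shows "G (fl u p) < G (fl v p)"
proof -
  have le: "fl u p \<le> fl v p" "fst (fl u p) < fst (fl v p)" by (rule flow_increasing[OF assms])+
  show ?thesis
    using G_diff_ge[OF flow_in_quadrant[OF p(1) uv(1)] le(1)] le by (simp add: less_eq_prod_def)
qed

text \<open>Starting above \<open>phi_d\<close> this is convexity of \<open>g\<close> along the
  flow, starting below it is monotonicity of \<open>G\<close>. The two regimes cover every path
  because the flow never crosses the level \<open>phi_d\<close>.\<close>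

lemma G_flow_pos_after:
  assumes p: "p \<in> quadrant" and t: "0 \<le> t0" "t0 < t1" "t1 < t" "G (fl t0 p) \<le> 0" "0 \<le> G (fl t1 p)"
  shows "0 < G (fl t p)"
proof (cases "\<phi>d \<le> snd p")
  case True
  then show ?thesis using g_flow_pos_after[OF p True t(2,3)] t by (simp add: G_flow_eq_g p)
next
  case False
  then show ?thesis using G_flow_increasing[OF p _ _ t(3)] t by simp
qed

lemma path_cost_deriv_at:
  assumes p: "p \<in> quadrant" and t: "0 < t"
  shows "((\<lambda>t. F t p) has_real_derivative exp (- ((lam + mu) * t)) * G (fl t p)) (at t)"
proof -
  have "((\<lambda>t. F t p) has_real_derivative exp (- ((lam + mu) * t)) * G (fl t p)) (at t within {0..t + 1})"
    using t by (intro path_cost_has_derivative p) auto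
  moreover have "at t within {0..t + 1} = at t" using t by (intro at_within_interior) auto
  ultimately show ?thesis by simp
qed

lemma path_cost_MVT:
  assumes p: "p \<in> quadrant" and t: "0 \<le> s" "s < t"
  obtains z where "s < z" "z < t" "F t p - F s p = (t - s) * (exp (- ((lam + mu) * z)) * G (fl z p))"
proof -
  have "continuous_on {s..t} (\<lambda>t. F t p)"
    using t by (intro continuous_on_subset[OF continuous_on_path_cost[OF p, of t]]) auto
  moreover have "((\<lambda>t. F t p) has_derivative (\<lambda>x. exp (- ((lam + mu) * z)) * G (fl z p) * x)) (at z)" if "s < z" "z < t" for z
    using path_cost_deriv_at[OF p, of z] that t by (simp add: has_field_derivative_def)
  ultimately obtain z where "z \<in> {s<..<t}" "F t p - F s p = exp (- ((lam + mu) * z)) * G (fl z p) * (t - s)"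
    using mvt[OF t(2), of "\<lambda>t. F t p" "\<lambda>z x. exp (- ((lam + mu) * z)) * G (fl z p) * x"] by auto
  then show ?thesis using that[of z] by (simp add: mult.commute)
qed

lemma G_sign_of_path_cost:
  assumes "x = a * (exp b * y)" "0 < (a::real)"
  shows "x \<le> 0 \<longleftrightarrow> y \<le> 0" "x < 0 \<longleftrightarrow> y < 0" "0 < x \<longleftrightarrow> 0 < y" "0 \<le> x \<longleftrightarrow> 0 \<le> y"
  using assms by (auto simp: mult_le_0_iff mult_less_0_iff zero_less_mult_iff zero_le_mult_iff not_less)

text \<open>At an interior minimiser \<open>G\<close> vanishes. The path cost is not above its
  initial value 0 there, so \<open>G\<close> was nonpositive somewhere before, and by
  \<open>G_flow_pos_after\<close> it is positive from then on.\<close>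

lemma positive_minimizer_unique:
  assumes p: "p \<in> quadrant" and t: "0 < t1" "t1 < t2" "F t1 p = val p"
  shows "val p < F t2 p"
proof -
  have "exp (- ((lam + mu) * t1)) * G (fl t1 p) = 0"
  proof (rule DERIV_local_min[OF path_cost_deriv_at[OF p t(1)] t(1)])
    show "\<forall>y. \<bar>t1 - y\<bar> < t1 \<longrightarrow> F t1 p \<le> F y p" unfolding t(3) by (auto intro: value_le[OF p])
  qed
  then have G1: "G (fl t1 p) = 0" by simp
  obtain z where z: "0 < z" "z < t1" "F t1 p - F 0 p = (t1 - 0) * (exp (- ((lam + mu) * z)) * G (fl z p))"
    using path_cost_MVT[OF p order_refl t(1)] by blast
  have "F t1 p - F 0 p \<le> 0" using t(3) w_le_0[OF p] by simp
  then have Gz: "G (fl z p) \<le> 0" using G_sign_of_path_cost(1)[OF z(3)] t by simp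
  obtain y where y: "t1 < y" "y < t2" "F t2 p - F t1 p = (t2 - t1) * (exp (- ((lam + mu) * y)) * G (fl y p))"
    using path_cost_MVT[OF p _ t(2)] t(1) by auto
  have "0 < G (fl y p)" using G_flow_pos_after[OF p _ z(2) y(1) Gz] z G1 by simp
  then show ?thesis using G_sign_of_path_cost(3)[OF y(3)] t by simp
qed

lemma val_neg_of_G_neg:
  assumes p: "p \<in> quadrant" and G: "G p < 0"
  shows "val p < 0"
proof -
  have "continuous_on {0..1} (\<lambda>u. G (fl u p))" by (intro continuous_on_G_flow p) auto
  then have "((\<lambda>u. G (fl u p)) \<longlongrightarrow> G (fl 0 p)) (at 0 within {0..1})"
    unfolding continuous_on_def by (rule bspec) simp
  then have "eventually (\<lambda>u. G (fl u p) < 0) (at 0 within {0..1})"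
    using G by (intro order_tendstoD(2)) auto
  then obtain d where d: "0 < d" "\<And>u. u \<in> {0..1} \<Longrightarrow> u \<noteq> 0 \<Longrightarrow> dist u 0 < d \<Longrightarrow> G (fl u p) < 0"
    unfolding eventually_at by auto
  define t where "t = min 1 d"
  have t: "0 < t" using d by (simp add: t_def)
  obtain z where z: "0 < z" "z < t" "F t p - F 0 p = (t - 0) * (exp (- ((lam + mu) * z)) * G (fl z p))"
    using path_cost_MVT[OF p order_refl t] by blast
  have "G (fl z p) < 0" using z by (intro d) (auto simp: t_def)
  then have "F t p < 0" using G_sign_of_path_cost(2)[OF z(3)] t by simp
  then show ?thesis using value_le[OF p, of t] t by simp
qed

lemma val_0_of_G_nonneg:
  assumes p: "p \<in> quadrant" and G: "\<And>u. 0 \<le> u \<Longrightarrow> 0 \<le> G (fl u p)"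
  shows "val p = 0"
proof -
  have F: "0 \<le> F t p" for t
    unfolding path_cost_def
    by (rule Henstock_Kurzweil_Integration.integral_nonneg) (use G integrand_integrable[OF p] in auto)
  obtain t where "val p = F t p" using value_attained[OF p] by blast
  with F[of t] w_le_0[OF p] show ?thesis by simp
qed

text \<open>Below \<open>phi_d\<close> the sign of \<open>G\<close> at the start decides, as
  \<open>G\<close> increases along the flow.\<close>

lemma low_val_0_iff:
  assumes p: "p \<in> quadrant" "snd p \<le> \<phi>d"
  shows "val p = 0 \<longleftrightarrow> 0 \<le> G p"
proof
  assume "val p = 0" then show "0 \<le> G p" using val_neg_of_G_neg[OF p(1)] by force
next
  assume G: "0 \<le> G p"
  have "0 \<le> G (fl u p)" if "0 \<le> u" for u
    using G_flow_increasing[OF p order_refl, of u] that G by (cases "u = 0") auto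
  then show "val p = 0" by (rule val_0_of_G_nonneg[OF p(1)])
qed

lemma path_cost_nonneg: "p \<in> quadrant \<Longrightarrow> val p = 0 \<Longrightarrow> 0 \<le> t \<Longrightarrow> 0 \<le> F t p"
  using value_le[of p t] by simp

section \<open>Location and characterisation of the exit boundary\<close>

definition "exits = exit_boundary lam m (stopping_region val)"

lemma stopping_region_val: "stopping_region val = {p \<in> quadrant. val p = 0}"
  by (simp add: stopping_region_def)

lemma val_less_0_iff: "p \<in> quadrant \<Longrightarrow> val p < 0 \<longleftrightarrow> val p \<noteq> 0"
  using w_le_0[of p] by auto

lemma exitsD:
  assumes "p \<in> exits"
  shows "p \<in> quadrant" "val p = 0" "\<exists>\<delta>>0. \<forall>t\<in>{0<..\<delta>}. val (fl t p) < 0"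
  using assms unfolding exits_def exit_boundary_def stopping_region_val
  by (auto simp: val_less_0_iff)

text \<open>Below \<open>phi_d\<close> the flow increases both coordinates and \<open>val\<close> is
  monotone, so a path cannot leave the stopping region.\<close>

lemma exits_high:
  assumes "p \<in> exits"
  shows "\<phi>d < snd p"
proof (rule ccontr)
  assume "\<not> \<phi>d < snd p"
  then have low: "snd p \<le> \<phi>d" by simp
  obtain \<delta> where \<delta>: "0 < \<delta>" "\<And>t. t \<in> {0<..\<delta>} \<Longrightarrow> val (fl t p) < 0" using exitsD(3)[OF assms] by auto
  have p: "p \<in> quadrant" by (rule exitsD[OF assms])
  have "val p \<le> val (fl \<delta> p)"
    using flow_increasing(1)[OF p low order_refl \<delta>(1)] \<delta>(1) by (intro w_mono p flow_in_quadrant) auto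
  then show False using \<delta>(2)[of \<delta>] \<delta>(1) exitsD(2)[OF assms] by simp
qed

lemma exits_not_safe: "p \<in> exits \<Longrightarrow> p \<notin> safe"
proof
  assume E: "p \<in> exits" and s: "p \<in> safe"
  obtain \<delta> where \<delta>: "0 < \<delta>" "\<And>t. t \<in> {0<..\<delta>} \<Longrightarrow> val (fl t p) < 0" using exitsD(3)[OF E] by auto
  then show False using val_safe[OF safe_flow[OF s, of \<delta>]] by force
qed

lemma g_nonneg_of_val_0: "p \<in> quadrant \<Longrightarrow> val p = 0 \<Longrightarrow> 0 \<le> G p"
  using val_neg_of_G_neg[of p] by force

lemma exits_left: "p \<in> exits \<Longrightarrow> fst p < xs"
  using right_safe[of p] exits_not_safe[of p] exits_high[of p] exitsD(1,2)[of p] g_nonneg_of_val_0[of p] G_eq_g[of p]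
  by force

text \<open>An exit point is not safe and lies to the left of \<open>xs\<close>, hence strictly
  below the arc of the flow from \<open>(0, yb)\<close> to \<open>(xs, ys)\<close>. The linear form
  is convex along this arc and below \<open>cost_shift\<close> at both ends, by
  \<open>bar_ell\<close> and \<open>star_ell\<close>.\<close>

lemma exits_ell:
  assumes E: "p \<in> exits"
  shows "mu / (mu - 1) * fst p + mu / (mu + 1) * snd p < cost_shift"
proof -
  obtain r where r: "0 \<le> r" "fl r (0, yb) = (xs, ys)" by (rule bar_flow)
  have p: "p \<in> quadrant" by (rule exitsD[OF E])
  have "0 \<le> fst p" using p by (simp add: quadrant_iff)
  have "\<exists>u\<ge>0. u \<le> r \<and> fst (fl u (0, yb)) = fst p"
  proof (rule IVT')
    show "fst (fl 0 (0, yb)) \<le> fst p" using p by (simp add: quadrant_iff)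
    show "fst p \<le> fst (fl r (0, yb))" using exits_left[OF E] r by simp
  qed (use r continuous_on_fst_flow in auto)
  then obtain u where u: "0 \<le> u" "u \<le> r" "fst (fl u (0, yb)) = fst p" by blast
  define a where "a = fl u (0, yb)"
  have a: "a \<in> safe" unfolding a_def by (intro safe_flow bar_safe u)
  have "snd p < snd a"
  proof (rule ccontr)
    assume "\<not> snd p < snd a"
    then have "a \<le> p" using u by (simp add: a_def less_eq_prod_def)
    then show False using safe_up[OF a] exits_not_safe[OF E] by blast
  qed
  then have "mu / (mu + 1) * snd p \<le> mu / (mu + 1) * snd a" using mu_gt_1 by (intro mult_left_mono) auto
  moreover have "mu / (mu - 1) * fst a + mu / (mu + 1) * snd a < cost_shift"
  proof -
    \<comment> \<open>Along the arc the form is a combination of two exponentials with nonnegative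
      coefficients and a constant, which is convex.\<close>
    define A where "A = mu / (mu - 1) * k0"
    define B where "B = mu / (mu + 1) * (yb - \<phi>d)"
    define D where "D = mu / (mu + 1) * \<phi>d - mu / (mu - 1) * k0"
    define L where "L u = A * exp ((lam + 1) * u) + B * exp (- ((1 - lam) * u)) + D" for u
    have AB: "0 \<le> A" "0 \<le> B" using mu_gt_1 k0_pos phi_d_less_yb by (auto simp: A_def B_def)
    have L: "mu / (mu - 1) * fst (fl v (0, yb)) + mu / (mu + 1) * snd (fl v (0, yb)) = L v" for v
    proof -
      have "a * ((0 + k0) * e - k0) + b * (\<phi>d + (y - \<phi>d) * e') = a * k0 * e + b * (y - \<phi>d) * e' + (b * \<phi>d - a * k0)"
        for a b e e' y by (simp add: algebra_simps)
      then show ?thesis unfolding L_def A_def B_def D_def fst_flow_k0 snd_flow fst_conv snd_conv .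
    qed
    have conv: "convex_on UNIV L"
    proof (rule f''_ge0_imp_convex[where f' = "\<lambda>u. A * (lam + 1) * exp ((lam + 1) * u) - B * (1 - lam) * exp (- ((1 - lam) * u))"
        and f'' = "\<lambda>u. A * (lam + 1)\<^sup>2 * exp ((lam + 1) * u) + B * (1 - lam)\<^sup>2 * exp (- ((1 - lam) * u))"])
      show "0 \<le> A * (lam + 1)\<^sup>2 * exp ((lam + 1) * u) + B * (1 - lam)\<^sup>2 * exp (- ((1 - lam) * u))" for u
        using AB by simp
    qed (auto simp: L_def[abs_def] intro!: derivative_eq_intros, auto simp: power2_eq_square algebra_simps)
    have L0: "L 0 < cost_shift" using L[of 0] bar_ell by simp
    have Lr: "L r < cost_shift" using L[of r] star_ell unfolding r by simp
    have "L u < cost_shift"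
    proof (cases "r = 0")
      case True
      then show ?thesis using u L0 by simp
    next
      case False
      then have "0 < r" using r by simp
      define t where "t = u / r"
      have t: "0 \<le> t" "t \<le> 1" "u = (1 - t) * 0 + t * r" using u \<open>0 < r\<close> by (auto simp: t_def)
      have "L u \<le> (1 - t) * L 0 + t * L r"
        using convex_onD[OF conv t(1,2), of 0 r] t(3) by simp
      also have "\<dots> < cost_shift" by (rule convex_bound_lt[OF L0 Lr]) (use t in auto)
      finally show ?thesis .
    qed
    then show ?thesis using L[of u] by (simp add: a_def)
  qed
  moreover have "fst a = fst p" using u by (simp add: a_def)
  ultimately show ?thesis by simp
qed

text \<open>The linear form of \<open>exits_ell\<close> at \<open>S q\<close> is the sum of the
  coordinates of \<open>q\<close>.\<close>

lemma jump_exits_g_neg: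
  assumes "S q \<in> exits"
  shows "g q < 0"
proof -
  have "mu / (mu - 1) * fst (S q) = fst q" "mu / (mu + 1) * snd (S q) = snd q"
  proof -
    have c: "mu / (mu - 1) * (1 - 1 / mu) = 1" "mu / (mu + 1) * (1 + 1 / mu) = 1"
      using mu_gt_1 by (simp_all add: divide_simps)
    show "mu / (mu - 1) * fst (S q) = fst q" "mu / (mu + 1) * snd (S q) = snd q"
      unfolding fst_jump snd_jump mult.assoc[symmetric] c mult_1 by (rule refl)+
  qed
  then show ?thesis using exits_ell[OF assms] by (simp add: g_eq)
qed

text \<open>At an exit point stopping at once and stopping at some positive time are both optimal.
  From points slightly further along the path it is optimal to continue, the optimal times stay away
  from 0 because the cost first rises, and compactness gives a limit.\<close>

lemma exits_contact:
  assumes E: "p \<in> exits"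
  shows "\<exists>t>0. F t p = 0" "0 < g p"
proof -
  have p: "p \<in> quadrant" "val p = 0" by (rule exitsD[OF E])+
  have hi: "\<phi>d \<le> snd p" using exits_high[OF E] by simp
  obtain \<delta> where \<delta>: "0 < \<delta>" "\<And>t. t \<in> {0<..\<delta>} \<Longrightarrow> val (fl t p) < 0" using exitsD(3)[OF E] by auto
  note Gg = G_flow_eq_g[OF p(1) hi]
  have g0: "0 \<le> g p" using g_nonneg_of_val_0[OF p] G_eq_g[OF p(1) hi] by simp
  obtain u0 where u0: "0 \<le> u0" "g (fl u0 p) < 0"
  proof -
    have "\<exists>u\<ge>0. g (fl u p) < 0"
    proof (rule ccontr)
      assume "\<not> (\<exists>u\<ge>0. g (fl u p) < 0)"
      then have "p \<in> safe" using p hi by (auto simp: safe_def not_less)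
      then show False using exits_not_safe[OF E] by simp
    qed
    then show ?thesis using that by blast
  qed
  have "0 < u0" using u0 g0 by (cases "u0 = 0") auto
  \<comment> \<open>If \<open>g p\<close> were 0, convexity and a later negative value would make
    \<open>g\<close> negative all the way to \<open>u0\<close>, so that waiting until
    \<open>u0\<close> would be profitable, against \<open>val p = 0\<close>.\<close>
  show gpos: "0 < g p"
  proof (rule ccontr)
    assume "\<not> 0 < g p"
    then have g00: "g (fl 0 p) \<le> 0" by simp
    obtain z where z: "0 < z" "z < u0" "F u0 p - F 0 p = (u0 - 0) * (exp (- ((lam + mu) * z)) * G (fl z p))"
      using path_cost_MVT[OF p(1) order_refl \<open>0 < u0\<close>] by blast
    have "g (fl z p) < 0"
    proof (rule ccontr)
      assume "\<not> g (fl z p) < 0"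
      then have "0 < g (fl u0 p)" using g_flow_pos_after[OF p(1) hi z(1,2) g00] by simp
      then show False using u0 by simp
    qed
    then have "G (fl z p) < 0" using Gg[of z] z by simp
    then have "F u0 p < 0" using G_sign_of_path_cost(2)[OF z(3)] \<open>0 < u0\<close> by simp
    then show False using path_cost_nonneg[OF p, of u0] u0 by simp
  qed
  have "((\<lambda>u. g (fl u p)) \<longlongrightarrow> g (fl 0 p)) (at 0)"
    using g_flow_deriv[of p 0, THEN DERIV_isCont] by (simp add: isCont_def)
  then have "eventually (\<lambda>u. 0 < g (fl u p)) (at 0)" using gpos by (intro order_tendstoD(1)) auto
  then obtain d where d: "0 < d" "\<And>u. u \<noteq> 0 \<Longrightarrow> dist u 0 < d \<Longrightarrow> 0 < g (fl u p)"
    unfolding eventually_at by auto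
  define e where "e = min \<delta> (d / 2)"
  have e: "0 < e" "e \<le> \<delta>" "e < d" using d \<delta> by (auto simp: e_def)
  have Finc: "0 < F s p" if s: "0 < s" "s \<le> e" for s
  proof -
    obtain z where z: "0 < z" "z < s" "F s p - F 0 p = (s - 0) * (exp (- ((lam + mu) * z)) * G (fl z p))"
      using path_cost_MVT[OF p(1) order_refl s(1)] by blast
    have "0 < g (fl z p)" using z s e by (intro d) auto
    then have "0 < G (fl z p)" using Gg[of z] z by simp
    then show ?thesis using G_sign_of_path_cost(3)[OF z(3)] s by simp
  qed
  have Fmono: "F s p \<le> F s' p" if s: "0 < s" "s \<le> s'" "s' \<le> e" for s s'
  proof (cases "s = s'")
    case False
    then have "s < s'" using s by simp
    obtain z where z: "s < z" "z < s'" "F s' p - F s p = (s' - s) * (exp (- ((lam + mu) * z)) * G (fl z p))"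
      using path_cost_MVT[OF p(1) _ \<open>s < s'\<close>] s by auto
    have "0 < g (fl z p)" using z s e by (intro d) auto
    then have "0 < G (fl z p)" using Gg[of z] z s by simp
    then show ?thesis using G_sign_of_path_cost(3)[OF z(3)] \<open>s < s'\<close> by simp
  qed simp
  \<comment> \<open>An optimal total time \<open>s + r\<close> with \<open>s <= e\<close> and
    \<open>r <= horizon\<close> must exceed \<open>e\<close>, as \<open>F\<close> increases up to
    \<open>e\<close>; so it falls into this window.\<close>
  have cont: "continuous_on {e..e + horizon} (\<lambda>t. F t p)"
    by (rule continuous_on_subset[OF continuous_on_path_cost[OF p(1), of "e + horizon"]]) (use e in auto)
  obtain t where t: "t \<in> {e..e + horizon}" "\<And>s. s \<in> {e..e + horizon} \<Longrightarrow> F t p \<le> F s p"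
    using continuous_attains_inf[OF _ _ cont] horizon_pos by auto
  have "F t p \<le> F s p" if s: "0 < s" "s \<le> e" for s
  proof -
    have fq: "fl s p \<in> quadrant" using s by (intro flow_in_quadrant p) auto
    have neg: "val (fl s p) < 0" using s e by (intro \<delta>) auto
    obtain r where r: "r \<in> {0..horizon}" "val (fl s p) = F r (fl s p)" using value_attained[OF fq] .
    have "F (s + r) p = F s p + exp (- ((lam + mu) * s)) * F r (fl s p)"
      using s r by (intro path_cost_add p) auto
    then have lt: "F (s + r) p < F s p" using neg r by (simp add: mult_less_0_iff)
    have "e < s + r"
    proof (rule ccontr)
      assume "\<not> e < s + r"
      then show False using Fmono[of s "s + r"] s r lt by simp
    qed
    then have "F t p \<le> F (s + r) p" using s r by (intro t) auto
    then show ?thesis using lt by simp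
  qed
  moreover have "((\<lambda>s. F s p) \<longlongrightarrow> F 0 p) (at 0 within {0..e})"
    using continuous_on_path_cost[OF p(1), of e] unfolding continuous_on_def by (rule bspec) (use e in simp)
  ultimately have "F t p \<le> F 0 p"
    by (intro tendsto_lowerbound[where F = "at 0 within {0..e}"])
       (use e in \<open>auto simp: eventually_at_filter trivial_limit_within islimpt_Icc intro!: always_eventually\<close>)
  then have "F t p = 0" using path_cost_nonneg[OF p, of t] t e by simp
  then show "\<exists>t>0. F t p = 0" using t e by (intro exI[of _ t]) auto
qed

text \<open>Strictly between 0 and the contact time \<open>t\<close> the cost is positive by
  uniqueness of a positive minimiser. The remaining part up to \<open>t\<close> is then negative, so
  continuing is profitable.\<close>

lemma exitsI:
  assumes p: "p \<in> quadrant" "val p = 0" and t: "0 < t" "F t p = 0"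
  shows "p \<in> exits"
proof -
  have "val (fl s p) < 0" if s: "0 < s" "s < t" for s
  proof -
    have "F s p \<noteq> 0" using positive_minimizer_unique[OF p(1) s] t p(2) by auto
    then have Fs: "0 < F s p" using path_cost_nonneg[OF p, of s] s by simp
    have "F (s + (t - s)) p = F s p + exp (- ((lam + mu) * s)) * F (t - s) (fl s p)"
      using s by (intro path_cost_add p) auto
    then have "exp (- ((lam + mu) * s)) * F (t - s) (fl s p) < 0" using Fs t by simp
    then have "F (t - s) (fl s p) < 0" by (simp add: mult_less_0_iff)
    moreover have "val (fl s p) \<le> F (t - s) (fl s p)" using s by (intro value_le flow_in_quadrant p) auto
    ultimately show ?thesis by simp
  qed
  then have *: "fl s p \<in> quadrant - stopping_region val" if "s \<in> {0<..t / 2}" for s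
    using that t flow_in_quadrant[OF p(1), of s] by (force simp: stopping_region_val)
  then show ?thesis unfolding exits_def exit_boundary_def
    using p t by (auto simp: stopping_region_val intro!: exI[of _ "t / 2"])
qed

lemma path_cost_strict_mono:
  assumes p: "p \<in> quadrant" and le: "p \<le> q" "fst p < fst q" and t: "0 < t"
  shows "F t p < F t q"
proof -
  have q: "q \<in> quadrant" by (rule quadrant_up[OF p le(1)])
  let ?c = "exp (- ((lam + mu) * t)) * (fst q - fst p)"
  have "?c * (t - 0) = integral {0..t} (\<lambda>u. ?c)" using t by simp
  also have "\<dots> \<le> integral {0..t} (\<lambda>u. exp (- ((lam + mu) * u)) * G (fl u q) - exp (- ((lam + mu) * u)) * G (fl u p))"
  proof (rule integral_le)
    show "(\<lambda>u. exp (- ((lam + mu) * u)) * G (fl u q) - exp (- ((lam + mu) * u)) * G (fl u p)) integrable_on {0..t}"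
      using p q by (intro Henstock_Kurzweil_Integration.integrable_diff integrand_integrable) auto
    fix u assume u: "u \<in> {0..t}"
    have "fst q - fst p \<le> exp ((lam + 1) * u) * (fst q - fst p)"
      using le u lam_pos by (simp add: mult_le_cancel_right1)
    also have "\<dots> = fst (fl u q) - fst (fl u p)" by (rule fst_flow_diff[symmetric])
    also have "\<dots> \<le> G (fl u q) - G (fl u p)"
      using G_diff_ge[OF flow_in_quadrant[OF p, of u] flow_mono[OF le(1), of u]] flow_mono[OF le(1), of u] u
      by (simp add: less_eq_prod_def)
    finally have "exp (- ((lam + mu) * t)) * (fst q - fst p) \<le> exp (- ((lam + mu) * u)) * (G (fl u q) - G (fl u p))"
      using u le lam_pos mu_gt_1 by (intro mult_mono) auto
    then show "?c \<le> exp (- ((lam + mu) * u)) * G (fl u q) - exp (- ((lam + mu) * u)) * G (fl u p)"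
      by (simp add: algebra_simps)
  qed auto
  also have "\<dots> = F t q - F t p"
    unfolding path_cost_def using p q
    by (intro Henstock_Kurzweil_Integration.integral_diff integrand_integrable) auto
  finally have "?c * (t - 0) \<le> F t q - F t p" .
  moreover have "0 < ?c * (t - 0)" using le t by simp
  ultimately show ?thesis by linarith
qed

text \<open>Such a path lies below \<open>phi_d\<close>, where the jump image moves upwards with
  time. The later exit point has zero cost at some positive time; strict monotonicity would make
  this cost negative at the earlier one, where \<open>val\<close> is 0.\<close>

lemma jump_exits_time_unique:
  assumes p: "p \<in> quadrant" and u: "0 \<le> u" "u < v" and E: "S (fl u p) \<in> exits" "S (fl v p) \<in> exits"
  shows False
proof -
  have low: "snd p < \<phi>d"
  proof (rule ccontr)
    assume "\<not> snd p < \<phi>d"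
    then have "S (fl u p) \<in> safe" using u by (intro jump_safe flow_in_quadrant p snd_flow_ge_phi_d) auto
    then show False using exits_not_safe E by blast
  qed
  have le: "fl u p \<le> fl v p" "fst (fl u p) < fst (fl v p)" using flow_increasing[OF p _ u] low by auto
  have "S (fl u p) \<le> S (fl v p)" by (rule jump_mono[OF le(1)])
  moreover have "fst (S (fl u p)) < fst (S (fl v p))"
    unfolding fst_jump using le(2) mu_gt_1 by (intro mult_strict_left_mono) auto
  moreover obtain t where t: "0 < t" "F t (S (fl v p)) = 0" using exits_contact(1)[OF E(2)] by blast
  ultimately have "F t (S (fl u p)) < 0" using path_cost_strict_mono[OF exitsD(1)[OF E(1)], of "S (fl v p)" t] by simp
  then show False using path_cost_nonneg[OF exitsD(1,2)[OF E(1)], of t] t by simp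
qed

lemma minimizer_unique:
  assumes p: "p \<in> quadrant" "p \<notin> exits" and s: "0 \<le> s" "F s p = val p" and t: "0 \<le> t" "F t p = val p"
  shows "s = t"
proof -
  have *: False if st: "0 \<le> s" "s < t" "F s p = val p" "F t p = val p" for s t
  proof (cases "s = 0")
    case True
    then have v: "val p = 0" using st by simp
    then have "p \<in> exits" using st True by (intro exitsI[OF p(1) v, of t]) auto
    then show False using p by simp
  next
    case False
    then show False using positive_minimizer_unique[OF p(1), of s t] st by simp
  qed
  show ?thesis using *[of s t] *[of t s] s t by (cases s t rule: linorder_cases) auto
qed

end

section \<open>Strict differentiability\<close>

lemma d1_nonneg: "0 \<le> d1 x y" and d1_self [simp]: "d1 x x = 0"
  and abs_fst_le_d1: "\<bar>fst x - fst y\<bar> \<le> d1 x y" and abs_snd_le_d1: "\<bar>snd x - snd y\<bar> \<le> d1 x y"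
  by (simp_all add: d1_def)

lemma d1_pos: "x \<noteq> y \<Longrightarrow> 0 < d1 x y"
  by (cases x, cases y) (simp add: d1_def, linarith)

lemma dist_le_d1: "dist x y \<le> d1 x y"
  unfolding d1_def dist_prod_def dist_real_def by (rule order_trans[OF sqrt_sum_squares_le_sum_abs]) simp

lemma d1_le_dist: "d1 x y \<le> 2 * dist x y"
  using dist_fst_le[of x y] dist_snd_le[of x y] by (simp add: d1_def dist_real_def)

lemma tendsto_d1:
  assumes "(X \<longlongrightarrow> p) F"
  shows "((\<lambda>n. d1 (X n) p) \<longlongrightarrow> 0) F"
proof -
  have "((\<lambda>n. \<bar>fst (X n) - fst p\<bar> + \<bar>snd (X n) - snd p\<bar>) \<longlongrightarrow> \<bar>fst p - fst p\<bar> + \<bar>snd p - snd p\<bar>) F"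
    by (rule tendsto_add[OF tendsto_rabs[OF tendsto_diff[OF tendsto_fst[OF assms] tendsto_const]]
          tendsto_rabs[OF tendsto_diff[OF tendsto_snd[OF assms] tendsto_const]]])
  then show ?thesis by (simp add: d1_def)
qed

lemma tendsto_of_d1_le:
  assumes "\<And>n. d1 (X n) p \<le> e n" "e \<longlonglongrightarrow> 0"
  shows "X \<longlonglongrightarrow> p"
proof (rule iffD2[OF tendsto_dist_iff], rule tendsto_sandwich[OF _ _ tendsto_const assms(2)])
  have "dist (X n) p \<le> e n" for n by (rule order_trans[OF dist_le_d1 assms(1)])
  then show "eventually (\<lambda>n. dist (X n) p \<le> e n) sequentially" by simp
qed simp

text \<open>Strict differentiability at every point of a set already implies continuity of the derivative.\<close>

definition strict_diff :: "(real \<times> real \<Rightarrow> real) \<Rightarrow> real \<times> real \<Rightarrow> real \<Rightarrow> real \<Rightarrow> bool" where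
  "strict_diff w p a b \<longleftrightarrow>
     (\<forall>X Y. range X \<subseteq> quadrant \<longrightarrow> range Y \<subseteq> quadrant \<longrightarrow> X \<longlonglongrightarrow> p \<longrightarrow> Y \<longlonglongrightarrow> p \<longrightarrow>
       (\<lambda>n. (w (X n) - w (Y n) - (a * (fst (X n) - fst (Y n)) + b * (snd (X n) - snd (Y n)))) / d1 (X n) (Y n)) \<longlonglongrightarrow> 0)"

lemma strict_diffD:
  assumes "strict_diff w p a b" "range X \<subseteq> quadrant" "range Y \<subseteq> quadrant" "X \<longlonglongrightarrow> p" "Y \<longlonglongrightarrow> p"
  shows "(\<lambda>n. (w (X n) - w (Y n) - (a * (fst (X n) - fst (Y n)) + b * (snd (X n) - snd (Y n)))) / d1 (X n) (Y n)) \<longlonglongrightarrow> 0"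
  using assms unfolding strict_diff_def by blast

lemma strict_diff_eps:
  assumes sd: "strict_diff w p a b" and e: "0 < e"
  shows "\<exists>\<delta>>0. \<forall>x\<in>quadrant. \<forall>y\<in>quadrant. d1 x p < \<delta> \<longrightarrow> d1 y p < \<delta> \<longrightarrow>
       \<bar>w x - w y - (a * (fst x - fst y) + b * (snd x - snd y))\<bar> \<le> e * d1 x y"
proof (rule ccontr)
  let ?r = "\<lambda>x y. w x - w y - (a * (fst x - fst y) + b * (snd x - snd y))"
  assume neg: "\<not> ?thesis"
  have "\<exists>x\<in>quadrant. \<exists>y\<in>quadrant. d1 x p < inverse (real (Suc n)) \<and> d1 y p < inverse (real (Suc n))
      \<and> e * d1 x y < \<bar>?r x y\<bar>" for n
  proof (rule ccontr)
    assume "\<not> ?thesis"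
    then have "\<forall>x\<in>quadrant. \<forall>y\<in>quadrant. d1 x p < inverse (real (Suc n)) \<longrightarrow> d1 y p < inverse (real (Suc n)) \<longrightarrow> \<bar>?r x y\<bar> \<le> e * d1 x y"
      unfolding not_le[symmetric] by blast
    moreover have "0 < inverse (real (Suc n))" by simp
    ultimately show False using neg by blast
  qed
  then have "\<exists>X. \<forall>n. X n \<in> quadrant \<and> (\<exists>y\<in>quadrant. d1 (X n) p < inverse (real (Suc n)) \<and> d1 y p < inverse (real (Suc n))
      \<and> e * d1 (X n) y < \<bar>?r (X n) y\<bar>)"
    by (intro choice) blast
  then obtain X where X: "\<And>n. X n \<in> quadrant" "\<And>n. \<exists>y\<in>quadrant. d1 (X n) p < inverse (real (Suc n)) \<and> d1 y p < inverse (real (Suc n))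
      \<and> e * d1 (X n) y < \<bar>?r (X n) y\<bar>"
    by blast
  from X(2) have "\<exists>Y. \<forall>n. Y n \<in> quadrant \<and> d1 (X n) p < inverse (real (Suc n)) \<and> d1 (Y n) p < inverse (real (Suc n))
      \<and> e * d1 (X n) (Y n) < \<bar>?r (X n) (Y n)\<bar>"
    by (intro choice) blast
  then obtain Y where Y: "\<And>n. Y n \<in> quadrant" "\<And>n. d1 (X n) p < inverse (real (Suc n))" "\<And>n. d1 (Y n) p < inverse (real (Suc n))"
      "\<And>n. e * d1 (X n) (Y n) < \<bar>?r (X n) (Y n)\<bar>"
    by blast
  have "(\<lambda>n. ?r (X n) (Y n) / d1 (X n) (Y n)) \<longlonglongrightarrow> 0"
  proof (rule strict_diffD[OF sd, of X Y])
    show "X \<longlonglongrightarrow> p" by (rule tendsto_of_d1_le[OF less_imp_le[OF Y(2)] LIMSEQ_inverse_real_of_nat])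
    show "Y \<longlonglongrightarrow> p" by (rule tendsto_of_d1_le[OF less_imp_le[OF Y(3)] LIMSEQ_inverse_real_of_nat])
  qed (use X(1) Y(1) in auto)
  from tendsto_rabs[OF this] have "eventually (\<lambda>n. \<bar>?r (X n) (Y n) / d1 (X n) (Y n)\<bar> < e) sequentially"
    using e by (intro order_tendstoD(2)[where y = "\<bar>0\<bar>"]) auto
  then obtain n where n: "\<bar>?r (X n) (Y n) / d1 (X n) (Y n)\<bar> < e"
    by (auto simp: eventually_sequentially)
  show False
  proof (cases "X n = Y n")
    case True then show False using Y(4)[of n] by simp
  next
    case False
    then have "\<bar>?r (X n) (Y n)\<bar> < e * d1 (X n) (Y n)"
      using n d1_pos[OF False] by (simp add: abs_divide pos_divide_less_eq)
    then show False using Y(4)[of n] by simp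
  qed
qed

lemma strict_diff_has_derivative:
  assumes sd: "strict_diff w p a b" and p: "p \<in> quadrant"
  shows "(w has_derivative (\<lambda>h. a * fst h + b * snd h)) (at p within quadrant)"
  unfolding has_derivative_within_alt
proof (intro conjI allI impI)
  show "bounded_linear (\<lambda>h. a * fst h + b * snd h)"
    by (intro bounded_linear_intros)
  fix e :: real assume e: "0 < e"
  then have e2: "0 < e / 2" by simp
  obtain \<delta> where \<delta>: "0 < \<delta>" "\<forall>x\<in>quadrant. \<forall>y\<in>quadrant. d1 x p < \<delta> \<longrightarrow> d1 y p < \<delta> \<longrightarrow>
       \<bar>w x - w y - (a * (fst x - fst y) + b * (snd x - snd y))\<bar> \<le> e / 2 * d1 x y"
    using strict_diff_eps[OF sd e2] by (elim exE conjE)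
  have "norm (w y - w p - (a * fst (y - p) + b * snd (y - p))) \<le> e * norm (y - p)"
    if y: "y \<in> quadrant" "norm (y - p) < \<delta> / 2" for y
  proof -
    have d: "d1 y p \<le> 2 * norm (y - p)" using d1_le_dist[of y p] by (simp add: dist_norm)
    then have "\<bar>w y - w p - (a * (fst y - fst p) + b * (snd y - snd p))\<bar> \<le> e / 2 * d1 y p"
      using y p \<delta>(1) by (intro \<delta>(2)[rule_format]) auto
    also have "\<dots> \<le> e / 2 * (2 * norm (y - p))" using d e by (intro mult_left_mono) auto
    finally show ?thesis by simp
  qed
  then show "\<exists>d>0. \<forall>y\<in>quadrant. norm (y - p) < d \<longrightarrow>
      norm (w y - w p - (a * fst (y - p) + b * snd (y - p))) \<le> e * norm (y - p)"
    using \<delta>(1) by (intro exI[of _ "\<delta> / 2"] conjI ballI impI) simp_all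
qed

lemma strict_diff_partial:
  assumes sd: "strict_diff w p a b" and p: "p \<in> quadrant" and h: "\<And>n. 0 < h n" "h \<longlonglongrightarrow> 0"
  shows "(\<lambda>n. (w (p + (h n, 0)) - w p) / h n) \<longlonglongrightarrow> a"
    and "(\<lambda>n. (w (p + (0, h n)) - w p) / h n) \<longlonglongrightarrow> b"
proof -
  have lim: "(\<lambda>n. p + (h n, 0)) \<longlonglongrightarrow> p" "(\<lambda>n. p + (0, h n)) \<longlonglongrightarrow> p"
  proof -
    have "d1 (p + (h n, 0)) p \<le> h n" "d1 (p + (0, h n)) p \<le> h n" for n using h(1)[of n] by (simp_all add: d1_def)
    then show "(\<lambda>n. p + (h n, 0)) \<longlonglongrightarrow> p" "(\<lambda>n. p + (0, h n)) \<longlonglongrightarrow> p"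
      by (simp_all only: tendsto_of_d1_le[OF _ h(2)])
  qed
  have Q: "range (\<lambda>n. p + (h n, 0)) \<subseteq> quadrant" "range (\<lambda>n. p + (0, h n)) \<subseteq> quadrant" "range (\<lambda>n::nat. p) \<subseteq> quadrant"
    using p less_imp_le[OF h(1)] by (auto simp: quadrant_iff)
  have *: "x / h n + a = (x + a * h n) / h n" for x a n using h(1)[of n] by (simp add: add_divide_distrib)
  show "(\<lambda>n. (w (p + (h n, 0)) - w p) / h n) \<longlonglongrightarrow> a"
    using tendsto_add[OF strict_diffD[OF sd Q(1,3) lim(1) tendsto_const] tendsto_const[of a]] h(1)
    by (simp add: d1_def less_imp_le *)
  show "(\<lambda>n. (w (p + (0, h n)) - w p) / h n) \<longlonglongrightarrow> b"
    using tendsto_add[OF strict_diffD[OF sd Q(2,3) lim(2) tendsto_const] tendsto_const[of b]] h(1)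
    by (simp add: d1_def less_imp_le *)
qed

text \<open>The two-point estimate around \<open>p\<close> also governs small increments at a nearby
  \<open>q\<close>, so the partial derivatives at \<open>q\<close> cannot differ much from those at
  \<open>p\<close>.\<close>

lemma strict_diff_continuous_on:
  assumes sd: "\<And>p. p \<in> A \<Longrightarrow> strict_diff w p (a p) (b p)" and A: "A \<subseteq> quadrant"
  shows "continuous_on A a" "continuous_on A b"
proof -
  have *: "\<exists>d>0. \<forall>q\<in>A. dist q p < d \<longrightarrow> \<bar>a q - a p\<bar> \<le> e \<and> \<bar>b q - b p\<bar> \<le> e"
    if p: "p \<in> A" and e: "0 < e" for p e
  proof -
    obtain \<delta> where \<delta>: "0 < \<delta>" "\<forall>x\<in>quadrant. \<forall>y\<in>quadrant. d1 x p < \<delta> \<longrightarrow> d1 y p < \<delta> \<longrightarrow>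
         \<bar>w x - w y - (a p * (fst x - fst y) + b p * (snd x - snd y))\<bar> \<le> e * d1 x y"
      using strict_diff_eps[OF sd[OF p] e] by (elim exE conjE)
    have "\<bar>a q - a p\<bar> \<le> e \<and> \<bar>b q - b p\<bar> \<le> e" if q: "q \<in> A" "dist q p < \<delta> / 4" for q
    proof -
      have qp: "d1 q p < \<delta> / 2" using d1_le_dist[of q p] q by simp
      let ?h = "\<lambda>n. inverse (real (Suc n))"
      have h: "0 < ?h n" "?h \<longlonglongrightarrow> 0" for n by (simp, rule LIMSEQ_inverse_real_of_nat)
      have ev: "eventually (\<lambda>n. inverse (real (Suc n)) < \<delta> / 2) sequentially"
        by (rule order_tendstoD(2)[OF LIMSEQ_inverse_real_of_nat]) (use \<delta>(1) in simp)
      have qQ: "q \<in> quadrant" using q A by blast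
      have 1: "\<bar>(w (q + (h, 0)) - w q) / h - a p\<bar> \<le> e" if h: "0 < h" "h < \<delta> / 2" for h
      proof -
        have "\<bar>w (q + (h, 0)) - w q - (a p * (fst (q + (h, 0)) - fst q) + b p * (snd (q + (h, 0)) - snd q))\<bar> \<le> e * d1 (q + (h, 0)) q"
        proof (intro \<delta>(2)[rule_format])
          have "d1 (q + (h, 0)) p \<le> h + d1 q p" using h by (simp add: d1_def)
          then show "d1 (q + (h, 0)) p < \<delta>" using h qp by linarith
          show "d1 q p < \<delta>" using qp \<delta>(1) d1_nonneg[of q p] by linarith
        qed (use h qQ in \<open>auto simp: quadrant_iff\<close>)
        then have "\<bar>w (q + (h, 0)) - w q - a p * h\<bar> \<le> e * h" using h by (simp add: d1_def)
        then have "\<bar>(w (q + (h, 0)) - w q - a p * h) / h\<bar> \<le> e" using h by (simp add: pos_divide_le_eq)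
        then show ?thesis using h by (simp add: diff_divide_distrib)
      qed
      have 2: "\<bar>(w (q + (0, h)) - w q) / h - b p\<bar> \<le> e" if h: "0 < h" "h < \<delta> / 2" for h
      proof -
        have "\<bar>w (q + (0, h)) - w q - (a p * (fst (q + (0, h)) - fst q) + b p * (snd (q + (0, h)) - snd q))\<bar> \<le> e * d1 (q + (0, h)) q"
        proof (intro \<delta>(2)[rule_format])
          have "d1 (q + (0, h)) p \<le> h + d1 q p" using h by (simp add: d1_def)
          then show "d1 (q + (0, h)) p < \<delta>" using h qp by linarith
          show "d1 q p < \<delta>" using qp \<delta>(1) d1_nonneg[of q p] by linarith
        qed (use h qQ in \<open>auto simp: quadrant_iff\<close>)
        then have "\<bar>w (q + (0, h)) - w q - b p * h\<bar> \<le> e * h" using h by (simp add: d1_def)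
        then have "\<bar>(w (q + (0, h)) - w q - b p * h) / h\<bar> \<le> e" using h by (simp add: pos_divide_le_eq)
        then show ?thesis using h by (simp add: diff_divide_distrib)
      qed
      have "\<bar>a q - a p\<bar> \<le> e"
        by (rule tendsto_upperbound[OF tendsto_rabs[OF tendsto_diff[OF strict_diff_partial(1)[OF sd[OF q(1)] qQ h] tendsto_const]]])
           (use ev 1 in \<open>auto elim!: eventually_mono\<close>)
      moreover have "\<bar>b q - b p\<bar> \<le> e"
        by (rule tendsto_upperbound[OF tendsto_rabs[OF tendsto_diff[OF strict_diff_partial(2)[OF sd[OF q(1)] qQ h] tendsto_const]]])
           (use ev 2 in \<open>auto elim!: eventually_mono\<close>)
      ultimately show ?thesis by simp
    qed
    then show ?thesis using \<delta>(1) by (intro exI[of _ "\<delta> / 4"]) auto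
  qed
  have *: "\<exists>d>0. \<forall>q\<in>A. dist q p < d \<longrightarrow> dist (a q) (a p) < e \<and> dist (b q) (b p) < e" if "p \<in> A" "0 < e" for p e
  proof -
    have "0 < e / 2" using that by simp
    from *[OF that(1) this] obtain d where d: "0 < d" "\<forall>q\<in>A. dist q p < d \<longrightarrow> \<bar>a q - a p\<bar> \<le> e / 2 \<and> \<bar>b q - b p\<bar> \<le> e / 2"
      by blast
    have "dist (a q) (a p) < e \<and> dist (b q) (b p) < e" if q: "q \<in> A" "dist q p < d" for q
      using d(2) q \<open>0 < e\<close> unfolding dist_real_def by force
    then show ?thesis using d(1) by blast
  qed
  show "continuous_on A a" "continuous_on A b"
    unfolding continuous_on_iff using * by blast+
qed

lemma strict_diff_local_0:
  assumes \<delta>: "0 < \<delta>" and w: "\<And>q. q \<in> quadrant \<Longrightarrow> d1 q p < \<delta> \<Longrightarrow> w q = 0"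
  shows "strict_diff w p 0 0"
  unfolding strict_diff_def
proof (intro allI impI)
  fix X Y :: "nat \<Rightarrow> real \<times> real"
  assume Q: "range X \<subseteq> quadrant" "range Y \<subseteq> quadrant" and lim: "X \<longlonglongrightarrow> p" "Y \<longlonglongrightarrow> p"
  have "eventually (\<lambda>n. d1 (X n) p < \<delta>) sequentially" "eventually (\<lambda>n. d1 (Y n) p < \<delta>) sequentially"
    using order_tendstoD(2)[OF tendsto_d1[OF lim(1)] \<delta>] order_tendstoD(2)[OF tendsto_d1[OF lim(2)] \<delta>] by auto
  then have "eventually (\<lambda>n. (w (X n) - w (Y n) - (0 * (fst (X n) - fst (Y n)) + 0 * (snd (X n) - snd (Y n)))) / d1 (X n) (Y n) = 0) sequentially"
    by eventually_elim (use Q w in \<open>auto simp: image_subset_iff\<close>)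
  then show "(\<lambda>n. (w (X n) - w (Y n) - (0 * (fst (X n) - fst (Y n)) + 0 * (snd (X n) - snd (Y n)))) / d1 (X n) (Y n)) \<longlonglongrightarrow> 0"
    by (rule tendsto_eventually)
qed

text \<open>On the compact set outside a ball around the minimiser the minimum is strictly larger,
  so the sequence must leave that set.\<close>

lemma unique_minimizer_tendsto:
  fixes f :: "real \<Rightarrow> real"
  assumes K: "compact K" "continuous_on K f" and uniq: "\<And>t. t \<in> K \<Longrightarrow> f t \<le> f t0 \<Longrightarrow> t = t0"
    and t: "\<And>n. t n \<in> K" "(\<lambda>n. f (t n)) \<longlonglongrightarrow> f t0"
  shows "t \<longlonglongrightarrow> t0"
proof (rule tendstoI)
  fix e :: real assume e: "0 < e"
  define K' where "K' = K - ball t0 e"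
  have K': "compact K'" "continuous_on K' f"
    unfolding K'_def by (rule compact_diff[OF K(1) open_ball], rule continuous_on_subset[OF K(2)]) auto
  show "eventually (\<lambda>n. dist (t n) t0 < e) sequentially"
  proof (cases "K' = {}")
    case True
    then have "dist (t n) t0 < e" for n using t(1)[of n] by (auto simp: K'_def dist_commute)
    then show ?thesis by simp
  next
    case False
    obtain s where s: "s \<in> K'" "\<And>r. r \<in> K' \<Longrightarrow> f s \<le> f r" using continuous_attains_inf[OF K'(1) False K'(2)] by blast
    have "f t0 < f s"
    proof (rule ccontr)
      assume "\<not> f t0 < f s"
      then have "s = t0" using uniq[of s] s(1) by (simp add: K'_def)
      then show False using s(1) e by (simp add: K'_def)
    qed
    then have "eventually (\<lambda>n. f (t n) < f s) sequentially" by (rule order_tendstoD(2)[OF t(2)])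
    then show ?thesis
    proof eventually_elim
      case (elim n)
      then have "t n \<notin> K'" using s(2)[of "t n"] by auto
      then show ?case using t(1)[of n] by (auto simp: K'_def dist_commute)
    qed
  qed
qed

section \<open>Smoothness of the value function\<close>

lemma strict_diff_compose:
  assumes sd: "strict_diff w (f p) a b" and p: "p \<in> quadrant" and Q: "\<And>x. x \<in> quadrant \<Longrightarrow> f x \<in> quadrant"
    and f: "\<And>x y. fst (f x) - fst (f y) = \<alpha> * (fst x - fst y)" "\<And>x y. snd (f x) - snd (f y) = \<beta> * (snd x - snd y)"
  shows "strict_diff (\<lambda>x. w (f x)) p (a * \<alpha>) (b * \<beta>)"
  unfolding strict_diff_def
proof (intro allI impI)
  fix X Y :: "nat \<Rightarrow> real \<times> real"
  assume XY: "range X \<subseteq> quadrant" "range Y \<subseteq> quadrant" and lim: "X \<longlonglongrightarrow> p" "Y \<longlonglongrightarrow> p"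
  define C where "C = \<bar>\<alpha>\<bar> + \<bar>\<beta>\<bar>"
  have C: "d1 (f x) (f y) \<le> C * d1 x y" for x y
  proof -
    have "d1 (f x) (f y) = \<bar>\<alpha>\<bar> * \<bar>fst x - fst y\<bar> + \<bar>\<beta>\<bar> * \<bar>snd x - snd y\<bar>" by (simp add: d1_def f abs_mult)
    also have "\<dots> \<le> C * \<bar>fst x - fst y\<bar> + C * \<bar>snd x - snd y\<bar>" by (intro add_mono mult_right_mono) (auto simp: C_def)
    finally show ?thesis by (simp add: d1_def distrib_left)
  qed
  let ?r = "\<lambda>n. w (f (X n)) - w (f (Y n)) - (a * (fst (f (X n)) - fst (f (Y n))) + b * (snd (f (X n)) - snd (f (Y n))))"
  have "(\<lambda>n. ?r n / d1 (f (X n)) (f (Y n))) \<longlonglongrightarrow> 0"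
  proof (rule strict_diffD[OF sd, of "\<lambda>n. f (X n)" "\<lambda>n. f (Y n)"])
    have lim': "(\<lambda>n. f (Z n)) \<longlonglongrightarrow> f p" if "Z \<longlonglongrightarrow> p" for Z
    proof (rule tendsto_of_d1_le[OF C])
      show "(\<lambda>n. C * d1 (Z n) p) \<longlonglongrightarrow> 0" by (rule tendsto_mult_right_zero[OF tendsto_d1[OF that]])
    qed
    show "(\<lambda>n. f (X n)) \<longlonglongrightarrow> f p" "(\<lambda>n. f (Y n)) \<longlonglongrightarrow> f p" by (rule lim'[OF lim(1)], rule lim'[OF lim(2)])
  qed (use XY Q in \<open>simp_all add: image_subset_iff\<close>)
  then have "(\<lambda>n. C * \<bar>?r n / d1 (f (X n)) (f (Y n))\<bar>) \<longlonglongrightarrow> 0"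
    by (intro tendsto_mult_right_zero tendsto_rabs_zero)
  moreover have "norm (?r n / d1 (X n) (Y n)) \<le> C * \<bar>?r n / d1 (f (X n)) (f (Y n))\<bar>" for n
  proof (cases "f (X n) = f (Y n)")
    case False
    then have pos: "0 < d1 (f (X n)) (f (Y n))" by (rule d1_pos)
    then have "0 < C * d1 (X n) (Y n)" using C[of "X n" "Y n"] by linarith
    then have pos': "0 < d1 (X n) (Y n)" using d1_nonneg[of "X n" "Y n"] by (auto simp: zero_less_mult_iff)
    have "\<bar>?r n\<bar> * d1 (f (X n)) (f (Y n)) \<le> \<bar>?r n\<bar> * (C * d1 (X n) (Y n))" by (intro mult_left_mono C) simp
    then have "\<bar>?r n\<bar> / d1 (X n) (Y n) \<le> C * (\<bar>?r n\<bar> / d1 (f (X n)) (f (Y n)))"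
      using pos pos' by (simp add: field_simps)
    then show ?thesis using pos pos' by (simp add: abs_divide)
  qed simp
  then have "\<forall>n. norm (?r n / d1 (X n) (Y n)) \<le> C * \<bar>?r n / d1 (f (X n)) (f (Y n))\<bar>" by blast
  ultimately have "(\<lambda>n. ?r n / d1 (X n) (Y n)) \<longlonglongrightarrow> 0" by (rule Lim_null_comparison[OF always_eventually, rotated])
  then show "(\<lambda>n. (w (f (X n)) - w (f (Y n)) - (a * \<alpha> * (fst (X n) - fst (Y n)) + b * \<beta> * (snd (X n) - snd (Y n)))) / d1 (X n) (Y n)) \<longlonglongrightarrow> 0"
    by (simp add: f mult.assoc)
qed

lemma strict_diff_affine:
  assumes sd: "strict_diff w p a b"
  shows "strict_diff (\<lambda>x. \<alpha> * fst x + \<beta> * snd x + e + k * w x) p (\<alpha> + k * a) (\<beta> + k * b)"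
  unfolding strict_diff_def
proof (intro allI impI)
  fix X Y :: "nat \<Rightarrow> real \<times> real"
  assume XY: "range X \<subseteq> quadrant" "range Y \<subseteq> quadrant" and lim: "X \<longlonglongrightarrow> p" "Y \<longlonglongrightarrow> p"
  have "(\<alpha> * x + \<beta> * y + e + k * v) - (\<alpha> * x' + \<beta> * y' + e + k * v') - ((\<alpha> + k * a) * (x - x') + (\<beta> + k * b) * (y - y'))
     = k * (v - v' - (a * (x - x') + b * (y - y')))" for x y v x' y' v' by (simp add: algebra_simps)
  then show "(\<lambda>n. ((\<alpha> * fst (X n) + \<beta> * snd (X n) + e + k * w (X n)) - (\<alpha> * fst (Y n) + \<beta> * snd (Y n) + e + k * w (Y n))
      - ((\<alpha> + k * a) * (fst (X n) - fst (Y n)) + (\<beta> + k * b) * (snd (X n) - snd (Y n)))) / d1 (X n) (Y n)) \<longlonglongrightarrow> 0"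
    using tendsto_mult_right_zero[OF strict_diffD[OF sd XY lim], of k] by simp
qed

lemma has_integral_truncate:
  fixes f :: "real \<Rightarrow> real"
  assumes f: "f integrable_on {0..t}" and t: "t \<in> {0..T}" and Z: "finite Z"
  shows "((\<lambda>u. if u \<in> {0..t} then f u else 0) has_integral integral {0..t} f) ({0..T} - Z)"
proof -
  have "((\<lambda>u. if u \<in> {0..t} then f u else 0) has_integral integral {0..t} f) {0..T}"
    using f t by (subst has_integral_restrict) (auto simp: integrable_integral)
  then show ?thesis
    by (rule iffD1[OF has_integral_spike_set_eq, rotated 2])
       (rule negligible_subset[OF negligible_finite[OF Z]]; blast)+
qed

text \<open>Differentiation under the integral sign at a common limit of the upper limits: dominated convergence
  needs the strict derivatives only outside a finite set.\<close>

lemma integral_strict_diff: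
  fixes \<phi> :: "real \<Rightarrow> real \<times> real \<Rightarrow> real"
  assumes p: "p \<in> quadrant" and ts: "ts \<in> {0..T}" and N: "finite N"
    and int: "\<And>q t. q \<in> quadrant \<Longrightarrow> t \<in> {0..T} \<Longrightarrow> (\<lambda>u. \<phi> u q) integrable_on {0..t}"
    and lip: "\<And>u x y. u \<in> {0..T} \<Longrightarrow> x \<in> quadrant \<Longrightarrow> y \<in> quadrant \<Longrightarrow> \<bar>\<phi> u x - \<phi> u y\<bar> \<le> C * d1 x y"
    and sd: "\<And>u. u \<in> {0..T} - N \<Longrightarrow> strict_diff (\<phi> u) p (kx u) (ky u)"
  shows "\<exists>a b. \<forall>X Y t. range X \<subseteq> quadrant \<longrightarrow> range Y \<subseteq> quadrant \<longrightarrow> range t \<subseteq> {0..T} \<longrightarrow>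
     X \<longlonglongrightarrow> p \<longrightarrow> Y \<longlonglongrightarrow> p \<longrightarrow> t \<longlonglongrightarrow> ts \<longrightarrow>
     (\<lambda>n. (integral {0..t n} (\<lambda>u. \<phi> u (X n)) - integral {0..t n} (\<lambda>u. \<phi> u (Y n))
       - (a * (fst (X n) - fst (Y n)) + b * (snd (X n) - snd (Y n)))) / d1 (X n) (Y n)) \<longlonglongrightarrow> 0"
proof -
  \<comment> \<open>At \<open>u = ts\<close> the truncations at \<open>t n\<close> need not
    converge, so this time is left out together with \<open>N\<close>.\<close>
  define U where "U = {0..T} - (insert ts N)"
  have fin: "finite (insert ts N)" using N by simp
  \<comment> \<open>Truncation by 0 brings integrals with different upper limits to the common
    domain \<open>U\<close>.\<close>
  define cut :: "real \<Rightarrow> (real \<Rightarrow> real) \<Rightarrow> real \<Rightarrow> real" where "cut t f u = (if u \<in> {0..t} then f u else 0)" for t f u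
  have cut: "(cut t f has_integral integral {0..t} f) U" if "f integrable_on {0..t}" "t \<in> {0..T}" for t f
    using has_integral_truncate[OF that fin] by (simp add: cut_def[abs_def] U_def)
  have cint: "(\<lambda>u. c) integrable_on U" for c :: real
    using has_integral_truncate[OF integrable_const_ivl, of T T "insert ts N" c] ts fin
      integrable_eq[of "\<lambda>u. if u \<in> {0..T} then c else 0" U "\<lambda>u. c"] by (auto simp: U_def integrable_on_def)
  \<comment> \<open>Quotients along the two coordinate directions exhibit \<open>kx\<close> and
    \<open>ky\<close> as limits of integrable functions dominated by \<open>C\<close>, which makes
    their truncations integrable.\<close>
  define h where "h n = inverse (real (Suc n))" for n
  have h: "0 < h n" "h \<longlonglongrightarrow> 0" for n by (simp add: h_def, unfold h_def, rule LIMSEQ_inverse_real_of_nat)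
  define ex ey :: "nat \<Rightarrow> real \<times> real" where "ex n = p + (h n, 0)" and "ey n = p + (0, h n)" for n
  have eQ: "ex n \<in> quadrant" "ey n \<in> quadrant" for n
    using p less_imp_le[OF h(1)[of n]] by (auto simp: ex_def ey_def quadrant_iff)
  have ed: "d1 (ex n) p = h n" "d1 (ey n) p = h n" for n using h(1)[of n] by (auto simp: ex_def ey_def d1_def)
  have quot: "\<bar>(\<phi> u x - \<phi> u y) / d1 x y\<bar> \<le> C" if "u \<in> {0..T}" "x \<in> quadrant" "y \<in> quadrant" "0 < d1 x y" for u x y
    using lip[OF that(1-3)] that(4) by (simp add: abs_divide pos_divide_le_eq)
  have C0: "0 \<le> C" using quot[OF ts eQ(1)[of 0] p] h(1)[of 0] order_trans[OF abs_ge_zero] by (metis ed(1))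
  have limx: "(\<lambda>n. (\<phi> u (ex n) - \<phi> u p) / h n) \<longlonglongrightarrow> kx u" and limy: "(\<lambda>n. (\<phi> u (ey n) - \<phi> u p) / h n) \<longlonglongrightarrow> ky u" if "u \<in> U" for u
    unfolding ex_def ey_def
    by (rule strict_diff_partial[OF sd p h], use that in \<open>simp add: U_def\<close>)+
  have kb: "\<bar>kx u\<bar> \<le> C" "\<bar>ky u\<bar> \<le> C" if "u \<in> U" for u
  proof -
    have u: "u \<in> {0..T}" using that by (simp add: U_def)
    show "\<bar>kx u\<bar> \<le> C"
    proof (rule tendsto_upperbound[OF tendsto_rabs[OF limx[OF that]]])
      show "eventually (\<lambda>n. \<bar>(\<phi> u (ex n) - \<phi> u p) / h n\<bar> \<le> C) sequentially"
        using quot[OF u eQ(1) p] h(1) by (simp add: ed)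
    qed simp
    show "\<bar>ky u\<bar> \<le> C"
    proof (rule tendsto_upperbound[OF tendsto_rabs[OF limy[OF that]]])
      show "eventually (\<lambda>n. \<bar>(\<phi> u (ey n) - \<phi> u p) / h n\<bar> \<le> C) sequentially"
        using quot[OF u eQ(2) p] h(1) by (simp add: ed)
    qed simp
  qed
  have qint: "(\<lambda>u. (\<phi> u x - \<phi> u y) / d) integrable_on {0..t}" if "x \<in> quadrant" "y \<in> quadrant" "t \<in> {0..T}" for x y d t
    by (intro integrable_on_divide Henstock_Kurzweil_Integration.integrable_diff int that)
  have kint: "cut ts kx integrable_on U" "cut ts ky integrable_on U"
  proof -
    show "cut ts kx integrable_on U"
    proof (rule dominated_convergence(1)[where f = "\<lambda>n. cut ts (\<lambda>u. (\<phi> u (ex n) - \<phi> u p) / h n)" and h = "\<lambda>u. C"])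
      show "cut ts (\<lambda>u. (\<phi> u (ex k) - \<phi> u p) / h k) integrable_on U" for k
        using cut[OF qint[OF eQ(1) p ts] ts] by blast
      show "norm (cut ts (\<lambda>u. (\<phi> u (ex k) - \<phi> u p) / h k) u) \<le> C" if "u \<in> U" for k u
        using quot[OF _ eQ(1) p, of u k] that h(1)[of k] C0 by (auto simp: ed cut_def U_def)
      show "(\<lambda>k. cut ts (\<lambda>u. (\<phi> u (ex k) - \<phi> u p) / h k) u) \<longlonglongrightarrow> cut ts kx u" if "u \<in> U" for u
        using limx[OF that] by (cases "u \<in> {0..ts}") (simp_all add: cut_def del: atLeastAtMost_iff)
    qed (rule cint)
    show "cut ts ky integrable_on U"
    proof (rule dominated_convergence(1)[where f = "\<lambda>n. cut ts (\<lambda>u. (\<phi> u (ey n) - \<phi> u p) / h n)" and h = "\<lambda>u. C"])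
      show "cut ts (\<lambda>u. (\<phi> u (ey k) - \<phi> u p) / h k) integrable_on U" for k
        using cut[OF qint[OF eQ(2) p ts] ts] by blast
      show "norm (cut ts (\<lambda>u. (\<phi> u (ey k) - \<phi> u p) / h k) u) \<le> C" if "u \<in> U" for k u
        using quot[OF _ eQ(2) p, of u k] that h(1)[of k] C0 by (auto simp: ed cut_def U_def)
      show "(\<lambda>k. cut ts (\<lambda>u. (\<phi> u (ey k) - \<phi> u p) / h k) u) \<longlonglongrightarrow> cut ts ky u" if "u \<in> U" for u
        using limy[OF that] by (cases "u \<in> {0..ts}") (simp_all add: cut_def del: atLeastAtMost_iff)
    qed (rule cint)
  qed
  show ?thesis
  proof (rule exI[of _ "integral U (cut ts kx)"], rule exI[of _ "integral U (cut ts ky)"], intro allI impI)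
    fix X Y :: "nat \<Rightarrow> real \<times> real" and t
    assume XY: "range X \<subseteq> quadrant" "range Y \<subseteq> quadrant" and t: "range t \<subseteq> {0..T}"
      and lim: "X \<longlonglongrightarrow> p" "Y \<longlonglongrightarrow> p" "t \<longlonglongrightarrow> ts"
    have Q: "X n \<in> quadrant" "Y n \<in> quadrant" "t n \<in> {0..T}" for n using XY t by (auto simp only: image_subset_iff)
    define D where "D n = d1 (X n) (Y n)" for n
    define dx dy where "dx n = fst (X n) - fst (Y n)" and "dy n = snd (X n) - snd (Y n)" for n
    define q where "q n u = (\<phi> u (X n) - \<phi> u (Y n)) / D n" for n u
    define e where "e n u = cut (t n) (q n) u - (cut ts kx u * (dx n / D n) + cut ts ky u * (dy n / D n))" for n u
    have D: "0 \<le> D n" for n by (simp add: D_def d1_nonneg)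
    have D1: "\<bar>dx n / D n\<bar> \<le> 1" "\<bar>dy n / D n\<bar> \<le> 1" for n
      using abs_fst_le_d1[of "X n" "Y n"] abs_snd_le_d1[of "X n" "Y n"] D[of n]
      by (auto simp: D_def dx_def dy_def abs_divide divide_le_eq_1)
    have eint: "(e n has_integral (integral {0..t n} (q n) - (integral U (cut ts kx) * (dx n / D n) + integral U (cut ts ky) * (dy n / D n)))) U" for n
      unfolding e_def q_def
      by (intro has_integral_diff has_integral_add has_integral_mult_left integrable_integral kint cut qint Q)
    have "(\<lambda>n. integral U (e n)) \<longlonglongrightarrow> integral U (\<lambda>u. 0)"
    proof (rule dominated_convergence(2)[where h = "\<lambda>u. C + (C + C)"])
      show "e k integrable_on U" for k using eint[of k] by blast
      show "norm (e k u) \<le> C + (C + C)" if u: "u \<in> U" for k u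
      proof -
        have uT: "u \<in> {0..T}" using u by (simp add: U_def)
        have "\<bar>q k u\<bar> \<le> C"
        proof (cases "0 < D k")
          case True then show ?thesis using quot[OF uT Q(1) Q(2), of k k] by (simp add: q_def D_def)
        next
          case False then show ?thesis using D[of k] C0 by (simp add: q_def not_less)
        qed
        then have 1: "\<bar>cut (t k) (q k) u\<bar> \<le> C" using C0 by (simp add: cut_def)
        have "\<bar>cut ts kx u\<bar> \<le> C" "\<bar>cut ts ky u\<bar> \<le> C" using kb[OF u] C0 by (simp_all add: cut_def)
        then have "\<bar>cut ts kx u * (dx k / D k)\<bar> \<le> C * 1" "\<bar>cut ts ky u * (dy k / D k)\<bar> \<le> C * 1"
          unfolding abs_mult by (intro mult_mono D1 C0; simp)+
        then show ?thesis using 1 unfolding e_def real_norm_def by linarith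
      qed
      \<comment> \<open>Below \<open>ts\<close> the truncation is eventually inactive and strict
        differentiability applies; above \<open>ts\<close> everything is eventually cut to
        0.\<close>
      show "(\<lambda>k. e k u) \<longlonglongrightarrow> 0" if u: "u \<in> U" for u
      proof (cases "u < ts")
        case True
        then have "u \<in> {0..ts}" using u by (auto simp: U_def)
        have "eventually (\<lambda>k. u < t k) sequentially" by (rule order_tendstoD(1)[OF lim(3) True])
        then have ev: "eventually (\<lambda>k. (\<phi> u (X k) - \<phi> u (Y k) - (kx u * dx k + ky u * dy k)) / D k = e k u) sequentially"
        proof eventually_elim
          case (elim k)
          then show ?case using \<open>u \<in> {0..ts}\<close> by (simp add: e_def cut_def q_def diff_divide_distrib add_divide_distrib)
        qed
        have "u \<in> {0..T} - N" using u by (simp add: U_def)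
        from strict_diffD[OF sd[OF this] XY lim(1,2)] show ?thesis
          by (rule Lim_transform_eventually) (use ev in \<open>simp add: D_def dx_def dy_def\<close>)
      next
        case False
        then have ts_u: "ts < u" using u by (auto simp: U_def)
        have "eventually (\<lambda>k. t k < u) sequentially" by (rule order_tendstoD(2)[OF lim(3) ts_u])
        then have "eventually (\<lambda>k. e k u = 0) sequentially"
          by eventually_elim (use ts_u in \<open>simp add: e_def cut_def\<close>)
        then show ?thesis by (rule tendsto_eventually)
      qed
    qed (rule cint)
    moreover have "integral U (e n) = (integral {0..t n} (\<lambda>u. \<phi> u (X n)) - integral {0..t n} (\<lambda>u. \<phi> u (Y n))
       - (integral U (cut ts kx) * dx n + integral U (cut ts ky) * dy n)) / D n" for n
    proof -
      have "integral {0..t n} (q n) = (integral {0..t n} (\<lambda>u. \<phi> u (X n)) - integral {0..t n} (\<lambda>u. \<phi> u (Y n))) / D n"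
        unfolding q_def integral_divide using Q[of n] by (simp add: Henstock_Kurzweil_Integration.integral_diff int)
      then show ?thesis using integral_unique[OF eint[of n]] by (simp add: diff_divide_distrib add_divide_distrib)
    qed
    ultimately show "(\<lambda>n. (integral {0..t n} (\<lambda>u. \<phi> u (X n)) - integral {0..t n} (\<lambda>u. \<phi> u (Y n))
       - (integral U (cut ts kx) * (fst (X n) - fst (Y n)) + integral U (cut ts ky) * (snd (X n) - snd (Y n)))) / d1 (X n) (Y n)) \<longlonglongrightarrow> 0"
      by (simp add: D_def dx_def dy_def)
  qed
qed

context poisson_disorder_exit
begin

lemma G_strict_diff:
  assumes "strict_diff val (S q) a b" "q \<in> quadrant"
  shows "strict_diff G q (1 + (mu - 1) * a) (1 + (mu + 1) * b)"
proof -
  have "strict_diff (\<lambda>x. val (S x)) q (a * (1 - 1 / mu)) (b * (1 + 1 / mu))"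
    by (rule strict_diff_compose) (use assms jump_in_quadrant in \<open>simp_all add: fst_jump snd_jump flip: right_diff_distrib\<close>)
  then have "strict_diff (\<lambda>x. 1 * fst x + 1 * snd x + (- cost_shift) + mu * val (S x)) q
      (1 + mu * (a * (1 - 1 / mu))) (1 + mu * (b * (1 + 1 / mu)))" by (rule strict_diff_affine)
  moreover have "(\<lambda>x. 1 * fst x + 1 * snd x + (- cost_shift) + mu * val (S x)) = G"
    by (auto simp: dyn_cost_def g_eq)
  moreover have "mu * (a * (1 - 1 / mu)) = (mu - 1) * a" "mu * (b * (1 + 1 / mu)) = (mu + 1) * b"
    using mu_gt_1 by (simp_all add: field_simps)
  ultimately show ?thesis by simp
qed

lemma integrand_strict_diff:
  assumes "strict_diff G (fl u p) a b" "p \<in> quadrant" "0 \<le> u"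
  shows "strict_diff (\<lambda>x. exp (- ((lam + mu) * u)) * G (fl u x)) p
    (exp (- ((lam + mu) * u)) * (a * exp ((lam + 1) * u))) (exp (- ((lam + mu) * u)) * (b * exp (- ((1 - lam) * u))))"
proof -
  have "strict_diff (\<lambda>x. G (fl u x)) p (a * exp ((lam + 1) * u)) (b * exp (- ((1 - lam) * u)))"
    by (rule strict_diff_compose[where f = "fl u" and w = G, OF assms(1,2)]) (use assms flow_in_quadrant in \<open>simp_all add: fst_flow_diff snd_flow_diff\<close>)
  from strict_diff_affine[OF this, of 0 0 0 "exp (- ((lam + mu) * u))"] show ?thesis by simp
qed

lemma integrand_lipschitz:
  assumes "u \<in> {0..horizon}" "x \<in> quadrant" "y \<in> quadrant"
  shows "\<bar>exp (- ((lam + mu) * u)) * G (fl u x) - exp (- ((lam + mu) * u)) * G (fl u y)\<bar>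
    \<le> (1 + mu * ((L0 + L1) * 2)) * exp ((lam + 1) * horizon) * d1 x y"
proof -
  let ?K = "1 + mu * ((L0 + L1) * 2)" and ?E = "exp ((lam + 1) * horizon)"
  have K: "0 \<le> ?K" using mu_gt_1 L0_nonneg L1_nonneg by simp
  have u: "0 \<le> u" "u \<le> horizon" using assms by auto
  have "exp ((lam + 1) * u) \<le> ?E" using u lam_pos by simp
  moreover have "0 \<le> (1 - lam) * u" "0 \<le> (lam + 1) * horizon" using u lam_lt_1 lam_pos horizon_pos by auto
  then have "exp (- ((1 - lam) * u)) \<le> ?E" by (subst exp_le_cancel_iff) linarith
  ultimately have "d1 (fl u x) (fl u y) \<le> ?E * \<bar>fst x - fst y\<bar> + ?E * \<bar>snd x - snd y\<bar>"
    unfolding d1_def fst_flow_diff snd_flow_diff abs_mult abs_exp_cancel by (intro add_mono mult_right_mono) auto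
  then have d: "d1 (fl u x) (fl u y) \<le> ?E * d1 x y" by (simp add: d1_def distrib_left)
  have "\<bar>exp (- ((lam + mu) * u)) * G (fl u x) - exp (- ((lam + mu) * u)) * G (fl u y)\<bar>
     = exp (- ((lam + mu) * u)) * \<bar>G (fl u x) - G (fl u y)\<bar>" by (simp add: abs_mult flip: right_diff_distrib)
  also have "\<dots> \<le> 1 * (?K * d1 (fl u x) (fl u y))"
    using u lam_pos mu_gt_1 by (intro mult_mono abs_G_diff_le flow_in_quadrant assms) auto
  also have "\<dots> \<le> ?K * (?E * d1 x y)" unfolding mult_1 by (intro mult_left_mono d K)
  finally show ?thesis by (simp add: mult.assoc)
qed

text \<open>Path cost and \<open>val\<close> are Lipschitz uniformly in time, so a minimiser at a
  nearby point almost minimises at \<open>p\<close>; uniqueness at \<open>p\<close> does the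
  rest.\<close>

lemma minimizers_tendsto:
  assumes p: "p \<in> quadrant" "p \<notin> exits" and Y: "range Y \<subseteq> quadrant" "Y \<longlonglongrightarrow> p"
    and t: "\<And>n. t n \<in> {0..horizon}" "\<And>n. val (Y n) = F (t n) (Y n)"
    and ts: "ts \<in> {0..horizon}" "val p = F ts p"
  shows "t \<longlonglongrightarrow> ts"
proof (rule unique_minimizer_tendsto[where K = "{0..horizon}" and f = "\<lambda>t. F t p"])
  show "s = ts" if "s \<in> {0..horizon}" "F s p \<le> F ts p" for s
  proof -
    have "0 \<le> s" "0 \<le> ts" using that ts by simp_all
    moreover from this have "F s p = val p" using value_le[OF p(1), of s] that(2) ts(2) by linarith
    ultimately show ?thesis using minimizer_unique[OF p] ts(2) by metis
  qed
  have YQ: "Y n \<in> quadrant" for n using Y by auto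
  show "(\<lambda>n. F (t n) p) \<longlonglongrightarrow> F ts p"
  proof (rule real_tendsto_sandwich)
    show "eventually (\<lambda>n. F ts p \<le> F (t n) p) sequentially"
      using value_le[OF p(1)] t(1) ts(2) by (intro always_eventually) auto
    have "F (t n) p \<le> F ts p + 2 * ((L0 + L1) * d1 (Y n) p)" for n
    proof -
      have "(L0 + L1) * d1 (Y n) p \<ge> L0 * \<bar>fst (Y n) - fst p\<bar> + L1 * \<bar>snd (Y n) - snd p\<bar>"
        using mult_nonneg_nonneg[OF L0_nonneg, of "\<bar>snd (Y n) - snd p\<bar>"]
          mult_nonneg_nonneg[OF L1_nonneg, of "\<bar>fst (Y n) - fst p\<bar>"]
        unfolding d1_def distrib_left distrib_right by linarith
      then have "\<bar>F (t n) (Y n) - F (t n) p\<bar> \<le> (L0 + L1) * d1 (Y n) p"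
        using path_cost_lipschitz[OF YQ p(1), of "t n" n] t(1)[of n] by auto
      moreover have "\<bar>val (Y n) - val p\<bar> \<le> (L0 + L1) * d1 (Y n) p" by (intro abs_val_diff_le YQ p)
      ultimately show ?thesis using t(2)[of n] ts(2) by linarith
    qed
    then show "eventually (\<lambda>n. F (t n) p \<le> F ts p + 2 * ((L0 + L1) * d1 (Y n) p)) sequentially" by simp
    have "(\<lambda>n. F ts p + 2 * ((L0 + L1) * d1 (Y n) p)) \<longlonglongrightarrow> F ts p + 2 * ((L0 + L1) * 0)"
      by (intro tendsto_add tendsto_mult tendsto_const tendsto_d1 Y)
    then show "(\<lambda>n. F ts p + 2 * ((L0 + L1) * d1 (Y n) p)) \<longlonglongrightarrow> F ts p" by simp
  qed simp
qed (use t(1) continuous_on_path_cost[OF p(1)] in auto)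

text \<open>Danskin's argument: \<open>val\<close> is the minimum of \<open>F t\<close> over \<open>t\<close>, and minimisers at nearby points converge to
  the unique minimiser at \<open>p\<close>.\<close>

lemma val_strict_diff_step:
  assumes p: "p \<in> quadrant" "p \<notin> exits" and N: "finite N"
    and sd: "\<And>u. u \<in> {0..horizon} - N \<Longrightarrow> \<exists>a b. strict_diff val (S (fl u p)) a b"
  shows "\<exists>a b. strict_diff val p a b"
proof -
  let ?\<phi> = "\<lambda>u x. exp (- ((lam + mu) * u)) * G (fl u x)"
  have "\<exists>a b. strict_diff (?\<phi> u) p a b" if u: "u \<in> {0..horizon} - N" for u
  proof -
    obtain a b where "strict_diff val (S (fl u p)) a b" using sd[OF u] by blast
    moreover have "fl u p \<in> quadrant" using u by (intro flow_in_quadrant p) auto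
    ultimately have "strict_diff G (fl u p) (1 + (mu - 1) * a) (1 + (mu + 1) * b)" by (rule G_strict_diff)
    from integrand_strict_diff[OF this p(1)] u show ?thesis by auto
  qed
  then obtain kx ky where k: "\<And>u. u \<in> {0..horizon} - N \<Longrightarrow> strict_diff (?\<phi> u) p (kx u) (ky u)" by metis
  obtain ts where ts: "ts \<in> {0..horizon}" "val p = F ts p" using value_attained[OF p(1)] .
  have "\<exists>a b. \<forall>X Y t. range X \<subseteq> quadrant \<longrightarrow> range Y \<subseteq> quadrant \<longrightarrow> range t \<subseteq> {0..horizon} \<longrightarrow>
     X \<longlonglongrightarrow> p \<longrightarrow> Y \<longlonglongrightarrow> p \<longrightarrow> t \<longlonglongrightarrow> ts \<longrightarrow>
     (\<lambda>n. (F (t n) (X n) - F (t n) (Y n)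
       - (a * (fst (X n) - fst (Y n)) + b * (snd (X n) - snd (Y n)))) / d1 (X n) (Y n)) \<longlonglongrightarrow> 0"
    unfolding path_cost_def
  proof (rule integral_strict_diff[where \<phi> = ?\<phi>, OF p(1) ts(1) N _ integrand_lipschitz k])
    show "(\<lambda>u. ?\<phi> u q) integrable_on {0..t}" if "q \<in> quadrant" for q t by (intro integrand_integrable that) simp
  qed
  then obtain a b where ab: "\<And>X Y t. range X \<subseteq> quadrant \<Longrightarrow> range Y \<subseteq> quadrant \<Longrightarrow> range t \<subseteq> {0..horizon} \<Longrightarrow>
     X \<longlonglongrightarrow> p \<Longrightarrow> Y \<longlonglongrightarrow> p \<Longrightarrow> t \<longlonglongrightarrow> ts \<Longrightarrow>
     (\<lambda>n. (F (t n) (X n) - F (t n) (Y n)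
       - (a * (fst (X n) - fst (Y n)) + b * (snd (X n) - snd (Y n)))) / d1 (X n) (Y n)) \<longlonglongrightarrow> 0"
    by blast
  have "strict_diff val p a b"
    unfolding strict_diff_def
  proof (intro allI impI)
    fix X Y :: "nat \<Rightarrow> real \<times> real"
    assume XY: "range X \<subseteq> quadrant" "range Y \<subseteq> quadrant" and lim: "X \<longlonglongrightarrow> p" "Y \<longlonglongrightarrow> p"
    have Q: "X n \<in> quadrant" "Y n \<in> quadrant" for n using XY by auto
    have "\<exists>s. s \<in> {0..horizon} \<and> val (X n) = F s (X n)" "\<exists>s. s \<in> {0..horizon} \<and> val (Y n) = F s (Y n)" for n
      using value_attained[OF Q(1)] value_attained[OF Q(2)] by metis+
    then obtain s t where s: "\<And>n. s n \<in> {0..horizon}" "\<And>n. val (X n) = F (s n) (X n)"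
      and t: "\<And>n. t n \<in> {0..horizon}" "\<And>n. val (Y n) = F (t n) (Y n)" by metis
    let ?d = "\<lambda>n. a * (fst (X n) - fst (Y n)) + b * (snd (X n) - snd (Y n))"
    show "(\<lambda>n. (val (X n) - val (Y n) - ?d n) / d1 (X n) (Y n)) \<longlonglongrightarrow> 0"
    proof (rule real_tendsto_sandwich)
      show "(\<lambda>n. (F (s n) (X n) - F (s n) (Y n) - ?d n) / d1 (X n) (Y n)) \<longlonglongrightarrow> 0"
        by (rule ab[OF XY _ lim minimizers_tendsto[OF p XY(1) lim(1) s ts]]) (use s in auto)
      show "(\<lambda>n. (F (t n) (X n) - F (t n) (Y n) - ?d n) / d1 (X n) (Y n)) \<longlonglongrightarrow> 0"
        by (rule ab[OF XY _ lim minimizers_tendsto[OF p XY(2) lim(2) t ts]]) (use t in auto)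
      \<comment> \<open>The minimiser of one point is a competitor at the other, which squeezes the
        increment of \<open>val\<close> between increments at fixed times.\<close>
      have "F (s n) (X n) - F (s n) (Y n) \<le> val (X n) - val (Y n)" "val (X n) - val (Y n) \<le> F (t n) (X n) - F (t n) (Y n)" for n
        using s[of n] t[of n] value_le[OF Q(2), of "s n" n] value_le[OF Q(1), of "t n" n] by auto
      then show "eventually (\<lambda>n. (F (s n) (X n) - F (s n) (Y n) - ?d n) / d1 (X n) (Y n) \<le> (val (X n) - val (Y n) - ?d n) / d1 (X n) (Y n)) sequentially"
        "eventually (\<lambda>n. (val (X n) - val (Y n) - ?d n) / d1 (X n) (Y n) \<le> (F (t n) (X n) - F (t n) (Y n) - ?d n) / d1 (X n) (Y n)) sequentially"
        by (auto intro!: always_eventually divide_right_mono d1_nonneg diff_right_mono)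
    qed
  qed
  then show ?thesis by blast
qed

lemma finite_jump_exits_times:
  assumes "p \<in> quadrant"
  shows "finite {u. 0 \<le> u \<and> S (fl u p) \<in> exits}"
proof (cases "\<exists>u\<ge>0. S (fl u p) \<in> exits")
  case True
  then obtain u where u: "0 \<le> u" "S (fl u p) \<in> exits" by blast
  have "v = u" if "0 \<le> v" "S (fl v p) \<in> exits" for v
    using jump_exits_time_unique[OF assms] u that by (cases u v rule: linorder_cases) blast+
  then have "{u. 0 \<le> u \<and> S (fl u p) \<in> exits} \<subseteq> {u}" by blast
  then show ?thesis by (rule finite_subset) simp
next
  case False
  then have "{u. 0 \<le> u \<and> S (fl u p) \<in> exits} = {}" by blast
  then show ?thesis by (simp only: finite.emptyI)
qed

lemma val_strict_diff_above_bar: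
  assumes p: "p \<in> quadrant" "yb < snd p"
  shows "strict_diff val p 0 0"
proof (rule strict_diff_local_0[of "snd p - yb"])
  fix q :: "real \<times> real" assume q: "q \<in> quadrant" "d1 q p < snd p - yb"
  have "yb \<le> snd q" using q(2) abs_snd_le_d1[of q p] by linarith
  then show "val q = 0" by (intro val_safe above_bar_safe q)
qed (use p in simp)

text \<open>Induction on the layers \<open>yb / (1 + 1 / mu) ^ n < snd p\<close>: a jump multiplies the second coordinate by
  \<open>1 + 1 / mu\<close>, and the flow pushes it up towards \<open>phi_d\<close>, whose image under the jump lies above \<open>yb\<close>.\<close>

lemma val_strict_diff_layer:
  assumes "p \<in> quadrant" "p \<notin> exits" "yb / (1 + 1 / mu) ^ n < snd p"
  shows "\<exists>a b. strict_diff val p a b"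
  using assms
proof (induction n arbitrary: p)
  case 0
  then show ?case using val_strict_diff_above_bar[of p] by auto
next
  case (Suc n)
  let ?r = "1 + 1 / mu"
  have r: "1 < ?r" using mu_gt_1 by simp
  note p = Suc.prems
  show ?case
  proof (rule val_strict_diff_step[OF p(1,2) finite_jump_exits_times[OF p(1)]])
    fix u assume u: "u \<in> {0..horizon} - {u. 0 \<le> u \<and> S (fl u p) \<in> exits}"
    have f: "fl u p \<in> quadrant" using u by (intro flow_in_quadrant p) auto
    show "\<exists>a b. strict_diff val (S (fl u p)) a b"
    proof (cases "\<phi>d \<le> snd (fl u p)")
      case True
      then show ?thesis using val_strict_diff_above_bar[OF jump_in_quadrant[OF f] jump_above_bar] by blast
    next
      case False
      then have "snd p \<le> snd (fl u p)" using snd_flow_ge_min[of u p] u by (auto simp: min_def split: if_splits)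
      then have "yb / ?r ^ Suc n < snd (fl u p)" using p(3) by simp
      then have "?r * (yb / ?r ^ Suc n) < ?r * snd (fl u p)" using r by (intro mult_strict_left_mono) linarith+
      also have "?r * (yb / ?r ^ Suc n) = yb / ?r ^ n"
      proof -
        have "?r \<noteq> 0" using r by linarith
        then show ?thesis by simp
      qed
      finally show ?thesis using u f by (intro Suc.IH jump_in_quadrant) (auto simp: snd_jump)
    qed
  qed
qed

lemma val_strict_diff:
  assumes p: "p \<in> quadrant" "p \<notin> exits"
  shows "\<exists>a b. strict_diff val p a b"
proof -
  have pos: "\<exists>a b. strict_diff val p a b" if p: "p \<in> quadrant" "p \<notin> exits" "0 < snd p" for p
  proof -
    let ?r = "1 + 1 / mu"
    have r: "1 < ?r" using mu_gt_1 by simp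
    obtain n where "yb / snd p < ?r ^ n" using real_arch_pow[OF r] by blast
    moreover have "0 < ?r ^ n" using r by (intro zero_less_power) linarith
    ultimately have "yb / ?r ^ n < snd p" using p(3) by (simp only: pos_divide_less_eq mult.commute)
    then show ?thesis by (rule val_strict_diff_layer[OF p(1,2)])
  qed
  show ?thesis
  proof (cases "snd p = 0")
    case False
    then show ?thesis using pos[OF p] p(1) by (auto simp: quadrant_iff)
  next
    \<comment> \<open>No layer reaches the axis, but every path from it has a positive second
      coordinate at once. Excluding the time 0 therefore reduces this case to the other one.\<close>
    case True
    show ?thesis
    proof (rule val_strict_diff_step[OF p finite.insertI[OF finite_jump_exits_times[OF p(1)]]])
      fix u assume u: "u \<in> {0..horizon} - insert 0 {u. 0 \<le> u \<and> S (fl u p) \<in> exits}"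
      then have u0: "0 < u" by auto
      have f: "fl u p \<in> quadrant" using u by (intro flow_in_quadrant p) auto
      have "exp (- ((1 - lam) * u)) < 1" using u0 lam_lt_1 by simp
      then have "0 < \<phi>d * (1 - exp (- ((1 - lam) * u)))" using phi_d_pos by simp
      then have "0 < snd (fl u p)" using True by (simp add: snd_flow algebra_simps)
      then have "0 < snd (S (fl u p))" using mu_gt_1 by (simp add: snd_jump add_pos_pos)
      then show "\<exists>a b. strict_diff val (S (fl u p)) a b" using u by (intro pos jump_in_quadrant f) auto
    qed
  qed
qed

end

section \<open>The boundary function\<close>

text \<open>The one-dimensional analogue of \<open>strict_diff\<close>, relative to a set. Indices
  with \<open>X n = Y n\<close> contribute 0 by division by zero.\<close>

definition strict_deriv :: "(real \<Rightarrow> real) \<Rightarrow> real set \<Rightarrow> real \<Rightarrow> real \<Rightarrow> bool" where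
  "strict_deriv f A x a \<longleftrightarrow> (\<forall>X Y. range X \<subseteq> A \<longrightarrow> range Y \<subseteq> A \<longrightarrow> X \<longlonglongrightarrow> x \<longrightarrow> Y \<longlonglongrightarrow> x \<longrightarrow>
     (\<lambda>n. (f (X n) - f (Y n) - a * (X n - Y n)) / (X n - Y n)) \<longlonglongrightarrow> 0)"

lemma strict_derivD:
  assumes "strict_deriv f A x a" "range X \<subseteq> A" "range Y \<subseteq> A" "X \<longlonglongrightarrow> x" "Y \<longlonglongrightarrow> x" "\<And>n. X n \<noteq> Y n"
  shows "(\<lambda>n. (f (X n) - f (Y n)) / (X n - Y n)) \<longlonglongrightarrow> a"
proof -
  have "(\<lambda>n. (f (X n) - f (Y n) - a * (X n - Y n)) / (X n - Y n) + a) \<longlonglongrightarrow> 0 + a"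
    using assms(1-5) unfolding strict_deriv_def by (intro tendsto_add tendsto_const) blast
  moreover have "(f (X n) - f (Y n) - a * (X n - Y n)) / (X n - Y n) + a = (f (X n) - f (Y n)) / (X n - Y n)" for n
    using assms(6)[of n] by (simp add: diff_divide_distrib)
  ultimately show ?thesis by simp
qed

lemma strict_deriv_has_derivative:
  assumes sd: "strict_deriv f A x a" and x: "x \<in> A"
  shows "(f has_real_derivative a) (at x within A)"
  unfolding has_field_derivative_iff
proof (subst tendsto_at_iff_sequentially, intro allI impI)
  fix X assume X: "\<forall>i. X i \<in> A - {x}" "X \<longlonglongrightarrow> x"
  then have "(\<lambda>n. (f (X n) - f x) / (X n - x)) \<longlonglongrightarrow> a"
    using x by (intro strict_derivD[OF sd, of X "\<lambda>n. x"]) auto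
  then show "((\<lambda>y. (f y - f x) / (y - x)) \<circ> X) \<longlonglongrightarrow> a" by (simp add: comp_def)
qed

text \<open>Each derivative at a point of a sequence is replaced by a difference quotient with a
  second point nearby; the two sequences then fall under strict differentiability at the
  limit.\<close>

lemma strict_deriv_continuously_differentiable_on:
  assumes ab: "a < b" and sd: "\<And>x. x \<in> {a..b} \<Longrightarrow> strict_deriv f {a..b} x (f' x)"
  shows "continuously_differentiable_on f {a..b} {a..b}"
proof -
  have der: "(f has_real_derivative f' x) (at x within {a..b})" if "x \<in> {a..b}" for x
    by (rule strict_deriv_has_derivative[OF sd[OF that] that])
  have cont: "continuous_on {a..b} f'"
    unfolding continuous_on_sequentially
  proof (intro allI ballI impI, elim conjE)
    fix x c assume x: "\<forall>n. x n \<in> {a..b}" and c: "c \<in> {a..b}" "x \<longlonglongrightarrow> c"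
    define e where "e n = inverse (real (Suc n))" for n
    have e: "0 < e n" "e \<longlonglongrightarrow> 0" for n by (simp add: e_def, unfold e_def, rule LIMSEQ_inverse_real_of_nat)
    have "\<exists>z. z \<in> {a..b} \<and> z \<noteq> x n \<and> dist z (x n) \<le> e n \<and> \<bar>f' (x n) - (f z - f (x n)) / (z - x n)\<bar> \<le> e n" for n
    proof -
      have xn: "x n \<in> {a..b}" using x by blast
      have "eventually (\<lambda>z. dist ((f z - f (x n)) / (z - x n)) (f' (x n)) < e n) (at (x n) within {a..b})"
        using der[OF xn] e(1)[of n] unfolding has_field_derivative_iff by (rule tendstoD)
      moreover have "eventually (\<lambda>z. z \<in> {a..b} \<and> z \<noteq> x n \<and> dist z (x n) < e n) (at (x n) within {a..b})"
        unfolding eventually_at using e(1)[of n] by blast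
      ultimately have "eventually (\<lambda>z. z \<in> {a..b} \<and> z \<noteq> x n \<and> dist z (x n) \<le> e n \<and> \<bar>f' (x n) - (f z - f (x n)) / (z - x n)\<bar> \<le> e n) (at (x n) within {a..b})"
        by eventually_elim (auto simp: dist_real_def)
      moreover have "at (x n) within {a..b} \<noteq> bot"
        using xn ab by (simp add: trivial_limit_within islimpt_Icc)
      ultimately show ?thesis using eventually_happens' by blast
    qed
    then have "\<exists>z. \<forall>n. z n \<in> {a..b} \<and> z n \<noteq> x n \<and> dist (z n) (x n) \<le> e n \<and> \<bar>f' (x n) - (f (z n) - f (x n)) / (z n - x n)\<bar> \<le> e n"
      by (intro choice) blast
    then obtain z where z: "\<And>n. z n \<in> {a..b}" "\<And>n. z n \<noteq> x n" "\<And>n. dist (z n) (x n) \<le> e n"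
        "\<And>n. \<bar>f' (x n) - (f (z n) - f (x n)) / (z n - x n)\<bar> \<le> e n" by blast
    have "(\<lambda>n. z n - x n) \<longlonglongrightarrow> 0"
      by (rule Lim_null_comparison[OF always_eventually e(2)]) (use z(3) in \<open>simp add: dist_real_def\<close>)
    from tendsto_add[OF this c(2)] have zc: "z \<longlonglongrightarrow> c" by simp
    have 1: "(\<lambda>n. (f (z n) - f (x n)) / (z n - x n)) \<longlonglongrightarrow> f' c"
      by (rule strict_derivD[OF sd[OF c(1)] _ _ zc c(2) z(2)]) (use x z(1) in blast)+
    have 2: "(\<lambda>n. f' (x n) - (f (z n) - f (x n)) / (z n - x n)) \<longlonglongrightarrow> 0"
      by (rule Lim_null_comparison[OF always_eventually e(2)]) (use z(4) in simp)
    from tendsto_add[OF 2 1] show "(f' \<circ> x) \<longlonglongrightarrow> f' c" by (simp add: comp_def)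
  qed
  show ?thesis
    unfolding continuously_differentiable_on_def
  proof (intro exI[of _ "\<lambda>x. f' x *\<^sub>R id_blinfun"] conjI ballI)
    show "continuous_on {a..b} (\<lambda>x. f' x *\<^sub>R (id_blinfun :: real \<Rightarrow>\<^sub>L real))"
      by (intro continuous_on_scaleR cont continuous_on_const)
    fix x assume "x \<in> {a..b}"
    from der[OF this] show "(f has_derivative blinfun_apply (f' x *\<^sub>R id_blinfun)) (at x within {a..b})"
      unfolding has_field_derivative_def by (rule has_derivative_eq_rhs) (auto simp: blinfun.scaleR_left)
  qed
qed

text \<open>\<open>proj\<close> is a truncation to a smaller interval that does nothing near
  \<open>x\<close>; it carries a local result over to the whole interval.\<close>

lemma strict_deriv_local:
  assumes sd: "strict_deriv f B x a" and mem: "\<And>z. z \<in> A \<Longrightarrow> proj z \<in> B"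
    and cont: "\<And>X. X \<longlonglongrightarrow> x \<Longrightarrow> (\<lambda>n. proj (X n)) \<longlonglongrightarrow> x"
    and ev: "\<And>X. X \<longlonglongrightarrow> x \<Longrightarrow> eventually (\<lambda>n. proj (X n) = X n) sequentially"
  shows "strict_deriv f A x a"
  unfolding strict_deriv_def
proof (intro allI impI)
  fix X Y assume XY: "range X \<subseteq> A" "range Y \<subseteq> A" and lim: "X \<longlonglongrightarrow> x" "Y \<longlonglongrightarrow> x"
  have R: "range (\<lambda>n. proj (X n)) \<subseteq> B" "range (\<lambda>n. proj (Y n)) \<subseteq> B" using XY mem by auto
  have "(\<lambda>n. (f (proj (X n)) - f (proj (Y n)) - a * (proj (X n) - proj (Y n))) / (proj (X n) - proj (Y n))) \<longlonglongrightarrow> 0"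
    using sd R cont[OF lim(1)] cont[OF lim(2)] unfolding strict_deriv_def by blast
  then show "(\<lambda>n. (f (X n) - f (Y n) - a * (X n - Y n)) / (X n - Y n)) \<longlonglongrightarrow> 0"
    by (rule Lim_transform_eventually) (use ev[OF lim(1)] ev[OF lim(2)] in eventually_elim, simp)
qed

lemma continuous_on_average:
  fixes f :: "real \<Rightarrow> real"
  assumes f: "continuous_on {0..T} f" and T: "0 < T"
  shows "continuous_on {0..T} (\<lambda>t. if t = 0 then f 0 else integral {0..t} f / t)"
  unfolding continuous_on_eq_continuous_within
proof
  fix t assume t: "t \<in> {0..T}"
  let ?A = "\<lambda>t. if t = 0 then f 0 else integral {0..t} f / t"
  have der: "((\<lambda>t. integral {0..t} f) has_real_derivative f t) (at t within {0..T})"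
    by (rule integral_has_real_derivative[OF f t])
  show "continuous (at t within {0..T}) ?A"
  proof (cases "t = 0")
    case True
    have "((\<lambda>s. (integral {0..s} f - integral {0..t} f) / (s - t)) \<longlongrightarrow> f t) (at t within {0..T})"
      using der by (simp add: has_field_derivative_iff)
    then have "(?A \<longlongrightarrow> f t) (at t within {0..T})"
      by (rule Lim_transform_eventually) (use True in \<open>auto simp: eventually_at_filter\<close>)
    then have "(?A \<longlongrightarrow> ?A t) (at t within {0..T})" using True by (simp only: if_True simp_thms)
    then show ?thesis by (simp add: continuous_within)
  next
    case False
    have c: "continuous (at t within {0..T}) (\<lambda>s. integral {0..s} f / s)"
      using False by (intro continuous_at_within_divide DERIV_continuous[OF der] continuous_ident) 
    have tp: "0 < t" using False t by simp
    show ?thesis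
    proof (rule continuous_transform_within[OF c tp t])
      fix s assume "s \<in> {0..T}" "dist s t < t"
      then show "integral {0..s} f / s = ?A s" by (auto simp: dist_real_def)
    qed
  qed
qed

context poisson_disorder_exit
begin

lemma lipschitz_limit_nonpos:
  assumes f: "\<And>a b. a \<in> quadrant \<Longrightarrow> b \<in> quadrant \<Longrightarrow> \<bar>f a - f b\<bar> \<le> C * d1 a b" and q: "q \<in> quadrant"
    and r: "\<And>e. 0 < e \<Longrightarrow> \<exists>r\<in>quadrant. d1 q r \<le> e \<and> f r \<le> 0"
  shows "f q \<le> (0::real)"
proof (rule field_le_epsilon)
  fix e :: real assume e: "0 < e"
  have "0 < e / (\<bar>C\<bar> + 1)" using e by simp
  from r[OF this] obtain r where r: "r \<in> quadrant" "d1 q r \<le> e / (\<bar>C\<bar> + 1)" "f r \<le> 0" by blast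
  have "f q \<le> C * d1 q r" using f[OF q r(1)] r(3) by linarith
  also have "\<dots> \<le> (\<bar>C\<bar> + 1) * d1 q r" by (intro mult_right_mono d1_nonneg) simp
  also have "\<dots> \<le> (\<bar>C\<bar> + 1) * (e / (\<bar>C\<bar> + 1))" by (intro mult_left_mono r) simp
  also have "\<dots> = e"
  proof -
    have "\<bar>C\<bar> + 1 \<noteq> 0" using abs_ge_zero[of C] by linarith
    then show ?thesis by simp
  qed
  finally show "f q \<le> 0 + e" by simp
qed

lemma val_0_limit:
  assumes "q \<in> quadrant" "\<And>e. 0 < e \<Longrightarrow> \<exists>r\<in>quadrant. d1 q r \<le> e \<and> val r = 0"
  shows "val q = 0"
proof -
  have "- val q \<le> 0"
  proof (rule lipschitz_limit_nonpos[where f = "\<lambda>p. - val p", OF _ assms(1)])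
    show "\<bar>- val a - - val b\<bar> \<le> (L0 + L1) * d1 a b" if "a \<in> quadrant" "b \<in> quadrant" for a b
      using abs_val_diff_le[OF that] by simp
    show "\<exists>r\<in>quadrant. d1 q r \<le> e \<and> - val r \<le> 0" if e: "0 < e" for e
      using assms(2)[OF e] by auto
  qed
  then show ?thesis using w_le_0[OF assms(1)] by simp
qed

lemma val_0_up:
  assumes "p \<in> quadrant" "val p = 0" "p \<le> q"
  shows "val q = 0"
proof -
  have q: "q \<in> quadrant" by (rule quadrant_up[OF assms(1,3)])
  show ?thesis using w_mono[OF assms(1) q assms(3)] w_le_0[OF q] assms(2) by simp
qed

section \<open>The boundary function and the end of its support\<close>

definition bdry :: "real \<Rightarrow> real" where
  "bdry = boundary_function (stopping_region val)"

lemma bdry_eq: "0 \<le> x \<Longrightarrow> bdry x = Inf {y. 0 \<le> y \<and> val (x, y) = 0}"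
  unfolding bdry_def boundary_function_def stopping_region_val
  by (rule arg_cong[where f = Inf]) (auto simp: quadrant_iff)

text \<open>The zero set in each vertical line is upward closed by monotonicity of
  \<open>val\<close>, and its infimum belongs to it by continuity.\<close>

lemma bdry_iff:
  assumes x: "0 \<le> x" and y: "0 \<le> y"
  shows "val (x, y) = 0 \<longleftrightarrow> bdry x \<le> y"
proof
  assume "val (x, y) = 0"
  then show "bdry x \<le> y" unfolding bdry_eq[OF x] using y by (intro cInf_lower bdd_belowI[of _ 0]) auto
next
  assume le: "bdry x \<le> y"
  have "yb \<in> {y. 0 \<le> y \<and> val (x, y) = 0}"
    using x yb_pos above_bar_safe[of "(x, yb)"] by (auto simp: quadrant_iff val_safe)
  then have ne: "{y. 0 \<le> y \<and> val (x, y) = 0} \<noteq> {}" by blast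
  show "val (x, y) = 0"
  proof (rule val_0_limit)
    fix e :: real assume e: "0 < e"
    then have "Inf {y. 0 \<le> y \<and> val (x, y) = 0} < y + e" using le bdry_eq[OF x] by simp
    from cInf_lessD[OF ne this] obtain y' where y': "0 \<le> y'" "val (x, y') = 0" "y' < y + e" by blast
    have "val (x, y + e) = 0" by (rule val_0_up[of "(x, y')"]) (use x y' in \<open>auto simp: quadrant_iff\<close>)
    then show "\<exists>r\<in>quadrant. d1 (x, y) r \<le> e \<and> val r = 0"
      using x y e by (intro bexI[of _ "(x, y + e)"]) (auto simp: quadrant_iff d1_def)
  qed (use x y in \<open>simp add: quadrant_iff\<close>)
qed

lemma bdry_nonneg:
  assumes "0 \<le> x"
  shows "0 \<le> bdry x"
proof (rule ccontr)
  assume "\<not> 0 \<le> bdry x"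
  moreover have "{y. 0 \<le> y \<and> val (x, y) = 0} \<noteq> {}"
    using assms yb_pos above_bar_safe[of "(x, yb)"] val_safe[of "(x, yb)"] by (auto simp: quadrant_iff intro!: exI[of _ yb])
  then have "0 \<le> bdry x" unfolding bdry_eq[OF assms] by (rule cInf_greatest) auto
  ultimately show False by simp
qed

lemma bdryI:
  assumes "0 \<le> x" "0 \<le> y0" "\<And>y. 0 \<le> y \<Longrightarrow> val (x, y) = 0 \<longleftrightarrow> y0 \<le> y"
  shows "bdry x = y0"
  using assms(3)[OF assms(2)] assms(3)[OF bdry_nonneg[OF assms(1)]] bdry_iff[OF assms(1,2)] bdry_iff[OF assms(1) bdry_nonneg[OF assms(1)]]
  by auto

lemma val_bdry: "0 \<le> x \<Longrightarrow> val (x, bdry x) = 0"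
  using bdry_iff[of x "bdry x"] bdry_nonneg[of x] by simp

lemma bdry_antimono: "0 \<le> x \<Longrightarrow> x \<le> x' \<Longrightarrow> bdry x' \<le> bdry x"
  using val_0_up[of "(x, bdry x)" "(x', bdry x)"] val_bdry[of x] bdry_nonneg[of x] bdry_iff[of x' "bdry x"]
  by (auto simp: quadrant_iff)

text \<open>To the right of \<open>xs\<close> the sign of \<open>G\<close> decides at every height:
  below \<open>phi_d\<close> by monotonicity along the flow, above it by
  \<open>right_safe\<close>.\<close>

lemma right_val_0_iff:
  assumes "xs \<le> x" "0 \<le> y"
  shows "val (x, y) = 0 \<longleftrightarrow> 0 \<le> G (x, y)"
proof -
  have p: "(x, y) \<in> quadrant" using assms xs_nonneg by (simp add: quadrant_iff)
  show ?thesis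
  proof (cases "y \<le> \<phi>d")
    case True then show ?thesis using low_val_0_iff[OF p] by simp
  next
    case False
    then show ?thesis using g_nonneg_of_val_0[OF p] right_safe[OF p] val_safe G_eq_g[OF p] assms by auto
  qed
qed

definition "\<xi> = support_end bdry"

lemma bdry_0_iff: "0 \<le> x \<Longrightarrow> bdry x = 0 \<longleftrightarrow> val (x, 0) = 0"
  using bdry_iff[of x 0] bdry_nonneg[of x] by auto

lemma \<xi>_nonneg: "0 \<le> \<xi>" and bdry_\<xi>: "bdry \<xi> = 0" and bdry_pos: "0 \<le> x \<Longrightarrow> x < \<xi> \<Longrightarrow> 0 < bdry x"
proof -
  let ?Z = "{x. 0 \<le> x \<and> bdry x = 0}"
  \<comment> \<open>Far enough to the right for \<open>G\<close> to be nonnegative on the axis by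
    \<open>G_ge\<close>.\<close>
  define x1 where "x1 = max xs ((lam + mu) * bound)"
  have x1: "0 \<le> x1" "xs \<le> x1" using xs_nonneg by (auto simp: x1_def)
  then have "0 \<le> G (x1, 0)" using G_ge[of "(x1, 0)"] by (simp add: quadrant_iff x1_def)
  then have "x1 \<in> ?Z" using right_val_0_iff[OF x1(2), of 0] bdry_0_iff[OF x1(1)] x1 by simp
  then have ne: "?Z \<noteq> {}" by blast
  have bdd: "bdd_below ?Z" by (rule bdd_belowI[of _ 0]) simp
  show xi: "0 \<le> \<xi>" unfolding \<xi>_def support_end_def by (rule cInf_greatest[OF ne]) simp
  have "val (\<xi>, 0) = 0"
  proof (rule val_0_limit)
    fix e :: real assume e: "0 < e"
    then have "Inf ?Z < \<xi> + e" by (simp add: \<xi>_def support_end_def)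
    from cInf_lessD[OF ne this] obtain x where x: "0 \<le> x" "bdry x = 0" "x < \<xi> + e" by blast
    have "val (\<xi> + e, 0) = 0" by (rule val_0_up[of "(x, 0)"]) (use x bdry_0_iff[OF x(1)] in \<open>auto simp: quadrant_iff\<close>)
    then show "\<exists>r\<in>quadrant. d1 (\<xi>, 0) r \<le> e \<and> val r = 0"
      using xi e by (intro bexI[of _ "(\<xi> + e, 0)"]) (auto simp: quadrant_iff d1_def)
  qed (use xi in \<open>simp add: quadrant_iff\<close>)
  then show "bdry \<xi> = 0" using bdry_0_iff[OF xi] by simp
  show "0 < bdry x" if x: "0 \<le> x" "x < \<xi>"
  proof (rule ccontr)
    assume "\<not> 0 < bdry x"
    then have "x \<in> ?Z" using bdry_nonneg[OF x(1)] x by auto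
    then have "\<xi> \<le> x" unfolding \<xi>_def support_end_def by (rule cInf_lower[OF _ bdd])
    then show False using x by simp
  qed
qed

lemma xs_less_\<xi>: "xs < \<xi>"
proof (rule ccontr)
  assume "\<not> xs < \<xi>"
  then have "val (xs, 0) = 0"
    by (intro val_0_up[of "(\<xi>, 0)" "(xs, 0)"]) (use \<xi>_nonneg bdry_\<xi> bdry_0_iff[OF \<xi>_nonneg] in \<open>auto simp: quadrant_iff\<close>)
  then have "0 \<le> g (xs, 0)"
    using g_nonneg_of_val_0[of "(xs, 0)"] G_le_g[of "(xs, 0)"] xs_nonneg by (simp add: quadrant_iff)
  then show False using star_sum ys_pos by (simp add: g_eq)
qed

text \<open>\<open>G\<close> is nonnegative on the stopping region and negative at nearby points of
  the continuation region, so it vanishes in the limit.\<close>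

lemma G_bdry_0:
  assumes x: "xs < x" "x \<le> \<xi>"
  shows "G (x, bdry x) = 0"
proof (rule antisym)
  have x0: "0 \<le> x" using x xs_nonneg by simp
  have p: "(x, bdry x) \<in> quadrant" using x0 bdry_nonneg by (simp add: quadrant_iff)
  show "0 \<le> G (x, bdry x)" using val_bdry[OF x0] g_nonneg_of_val_0[OF p] by simp
  show "G (x, bdry x) \<le> 0"
  proof (rule lipschitz_limit_nonpos[where f = G, OF abs_G_diff_le p])
    fix e :: real assume e: "0 < e"
    show "\<exists>r\<in>quadrant. d1 (x, bdry x) r \<le> e \<and> G r \<le> 0"
    proof (cases "x < \<xi>")
      case True
      define y where "y = max 0 (bdry x - e)"
      have y: "0 \<le> y" "y < bdry x" "bdry x - e \<le> y" using bdry_pos[OF x0 True] e by (auto simp: y_def)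
      then have "\<not> 0 \<le> G (x, y)" using right_val_0_iff[of x y] bdry_iff[OF x0 y(1)] x by simp
      then show ?thesis using y x0 by (intro bexI[of _ "(x, y)"]) (auto simp: quadrant_iff d1_def)
    next
      \<comment> \<open>At the end of the support no point of the quadrant lies below the boundary,
        so it is approached along the axis from the left.\<close>
      case False
      then have xi: "x = \<xi>" "bdry x = 0" using x bdry_\<xi> by auto
      define z where "z = max ((xs + \<xi>) / 2) (\<xi> - e)"
      have z: "xs < z" "z < \<xi>" "\<xi> - e \<le> z" using xs_less_\<xi> e by (auto simp: z_def less_max_iff_disj)
      have z0: "0 \<le> z" using z xs_nonneg by simp
      have "\<not> 0 \<le> G (z, 0)" using bdry_pos[OF z0 z(2)] bdry_0_iff[OF z0] right_val_0_iff[of z 0] z by simp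
      then show ?thesis using z z0 xi by (intro bexI[of _ "(z, 0)"]) (auto simp: quadrant_iff d1_def)
    qed
  qed
qed

text \<open>On the curve \<open>G = 0\<close> the vertical slope of \<open>G\<close> is at least 1
  and its horizontal variation is Lipschitz.\<close>

lemma bdry_lipschitz:
  assumes "xs < x" "x \<le> \<xi>" "xs < y" "y \<le> \<xi>"
  shows "\<bar>bdry x - bdry y\<bar> \<le> (1 + mu * ((L0 + L1) * 2)) * \<bar>x - y\<bar>"
proof -
  let ?K = "1 + mu * ((L0 + L1) * 2)"
  have *: "bdry x - bdry y \<le> ?K * (y - x)" if xy: "xs < x" "x \<le> y" "y \<le> \<xi>" for x y
  proof -
    have x0: "0 \<le> x" "0 \<le> y" using xy xs_nonneg by auto
    have b: "0 \<le> bdry x" "0 \<le> bdry y" "bdry y \<le> bdry x" using bdry_nonneg bdry_antimono x0 xy by auto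
    have "bdry x - bdry y \<le> G (y, bdry x) - G (y, bdry y)"
      using G_diff_ge[of "(y, bdry y)" "(y, bdry x)"] b x0 by (simp add: quadrant_iff)
    also have "\<dots> = G (y, bdry x) - G (x, bdry x)" using G_bdry_0[of x] G_bdry_0[of y] xy by simp
    also have "\<dots> \<le> ?K * d1 (y, bdry x) (x, bdry x)"
      using abs_G_diff_le[of "(y, bdry x)" "(x, bdry x)"] b x0 by (simp add: quadrant_iff)
    also have "\<dots> = ?K * (y - x)" using xy by (simp add: d1_def)
    finally show ?thesis .
  qed
  show ?thesis
  proof (cases "x \<le> y")
    case True
    then show ?thesis using *[of x y] bdry_antimono[of x y] assms xs_nonneg by simp
  next
    case False
    then show ?thesis using *[of y x] bdry_antimono[of y x] assms xs_nonneg by simp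
  qed
qed

text \<open>The implicit function theorem for \<open>G = 0\<close> in its strict form, with slope
  \<open>- A / B\<close> and \<open>B >= 1\<close>. Strict differentiability of \<open>G\<close> is
  available because the jump image is no exit point: on the curve \<open>g\<close> is at least
  \<open>G = 0\<close>, whereas \<open>jump_exits_g_neg\<close> would make it negative.\<close>

lemma bdry_strict_deriv_right:
  assumes x: "xs < x" "x \<le> \<xi>"
  shows "\<exists>a. strict_deriv bdry {0..\<xi>} x a"
proof -
  define p where "p = (x, bdry x)"
  have x0: "0 \<le> x" using x xs_nonneg by simp
  have p: "p \<in> quadrant" using x0 bdry_nonneg by (simp add: p_def quadrant_iff)
  have "S p \<notin> exits"
  proof
    assume "S p \<in> exits"
    then have "g p < 0" by (rule jump_exits_g_neg)
    then show False using G_le_g[OF p] G_bdry_0[OF x] by (simp add: p_def)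
  qed
  then obtain a b where "strict_diff val (S p) a b" using val_strict_diff[OF jump_in_quadrant[OF p]] by blast
  from G_strict_diff[OF this p] obtain A B where G: "strict_diff G p A B" by blast
  define h where "h n = inverse (real (Suc n))" for n
  have h: "0 < h n" "h \<longlonglongrightarrow> 0" for n by (simp add: h_def, unfold h_def, rule LIMSEQ_inverse_real_of_nat)
  have B: "1 \<le> B"
  proof (rule tendsto_lowerbound[OF strict_diff_partial(2)[OF G p h]])
    have "1 \<le> (G (p + (0, h n)) - G p) / h n" for n
      using G_diff_ge[OF p, of "p + (0, h n)"] h(1)[of n] by (simp add: less_eq_prod_def pos_le_divide_eq)
    then show "eventually (\<lambda>n. 1 \<le> (G (p + (0, h n)) - G p) / h n) sequentially" by simp
  qed simp
  define C where "C = 1 + mu * ((L0 + L1) * 2)"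
  have C: "0 \<le> C" using mu_gt_1 L0_nonneg L1_nonneg by (simp add: C_def)
  \<comment> \<open>\<open>bdry_lipschitz\<close> is confined to the right of \<open>xs\<close>, so
    the argument runs on \<open>{x0..\<xi>}\<close> and is extended by
    \<open>strict_deriv_local\<close>.\<close>
  define x0 where "x0 = (xs + x) / 2"
  have x0: "xs < x0" "x0 < x" using x by (auto simp: x0_def)
  have lip: "\<bar>bdry u - bdry v\<bar> \<le> C * \<bar>u - v\<bar>" if "u \<in> {x0..\<xi>}" "v \<in> {x0..\<xi>}" for u v
    unfolding C_def by (rule bdry_lipschitz) (use that x0 in auto)
  have "strict_deriv bdry {x0..\<xi>} x (- A / B)"
    unfolding strict_deriv_def
  proof (intro allI impI)
    fix X Y assume XY: "range X \<subseteq> {x0..\<xi>}" "range Y \<subseteq> {x0..\<xi>}" and lim: "X \<longlonglongrightarrow> x" "Y \<longlonglongrightarrow> x"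
    define P where "P Z n = (Z n, bdry (Z n))" for Z :: "nat \<Rightarrow> real" and n
    have I: "X n \<in> {x0..\<xi>}" "Y n \<in> {x0..\<xi>}" for n using XY by blast+
    have PQ: "range (P Z) \<subseteq> quadrant" if "\<And>n. Z n \<in> {x0..\<xi>}" for Z
    proof -
      have "0 \<le> Z n" for n using that[of n] x0 xs_nonneg by simp
      then show ?thesis using bdry_nonneg by (auto simp: P_def quadrant_iff)
    qed
    have Plim: "P Z \<longlonglongrightarrow> p" if Z: "\<And>n. Z n \<in> {x0..\<xi>}" "Z \<longlonglongrightarrow> x" for Z
    proof (rule tendsto_of_d1_le)
      show "d1 (P Z n) p \<le> (1 + C) * \<bar>Z n - x\<bar>" for n
        using lip[OF Z(1)[of n], of x] x0 x by (simp add: P_def p_def d1_def algebra_simps)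
      have "(\<lambda>n. (1 + C) * \<bar>Z n - x\<bar>) \<longlonglongrightarrow> (1 + C) * \<bar>x - x\<bar>"
        by (intro tendsto_mult tendsto_const tendsto_rabs tendsto_diff Z(2))
      then show "(\<lambda>n. (1 + C) * \<bar>Z n - x\<bar>) \<longlonglongrightarrow> 0" by simp
    qed
    let ?N = "\<lambda>n. A * (X n - Y n) + B * (bdry (X n) - bdry (Y n))"
    let ?r = "\<lambda>n. - ?N n / d1 (P X n) (P Y n)"
    have "G (P X n) = 0" "G (P Y n) = 0" for n using G_bdry_0[of "X n"] G_bdry_0[of "Y n"] I[of n] x0 by (auto simp: P_def)
    then have "?r \<longlonglongrightarrow> 0"
      using strict_diffD[OF G PQ[of X] PQ[of Y] Plim[of X] Plim[of Y]] I lim by (simp add: P_def)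
    then have lim0: "(\<lambda>n. (1 + C) / B * \<bar>?r n\<bar>) \<longlonglongrightarrow> 0"
      by (intro tendsto_mult_right_zero tendsto_rabs_zero)
    have "norm ((bdry (X n) - bdry (Y n) - - A / B * (X n - Y n)) / (X n - Y n)) \<le> (1 + C) / B * \<bar>?r n\<bar>" for n
    proof (cases "X n = Y n")
      case False
      define \<delta> where "\<delta> = \<bar>X n - Y n\<bar>"
      have \<delta>: "0 < \<delta>" using False by (simp add: \<delta>_def)
      define D where "D = d1 (P X n) (P Y n)"
      have D: "0 < D" "D \<le> (1 + C) * \<delta>"
        using lip[OF I, of n n] False by (auto simp: D_def P_def d1_def \<delta>_def algebra_simps)
      have "\<bar>(bdry (X n) - bdry (Y n) - - A / B * (X n - Y n)) / (X n - Y n)\<bar> = \<bar>?N n\<bar> / (B * \<delta>)"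
      proof -
        have "bdry (X n) - bdry (Y n) - - A / B * (X n - Y n) = ?N n / B" using B by (simp add: field_simps)
        then show ?thesis using B by (simp add: abs_divide abs_mult \<delta>_def)
      qed
      also have "\<dots> \<le> (1 + C) / B * (\<bar>?N n\<bar> / D)"
      proof -
        have "\<bar>?N n\<bar> * D \<le> \<bar>?N n\<bar> * ((1 + C) * \<delta>)" by (intro mult_left_mono D) simp
        then show ?thesis using B D \<delta> by (simp add: field_simps)
      qed
      also have "\<bar>?N n\<bar> / D = \<bar>?r n\<bar>" using D by (simp add: abs_divide D_def[symmetric])
      finally show ?thesis by simp
    qed (use B C in simp)
    then show "(\<lambda>n. (bdry (X n) - bdry (Y n) - - A / B * (X n - Y n)) / (X n - Y n)) \<longlonglongrightarrow> 0"
      by (intro Lim_null_comparison[OF always_eventually lim0]) blast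
  qed
  then have "strict_deriv bdry {0..\<xi>} x (- A / B)"
  proof (rule strict_deriv_local[where proj = "\<lambda>z. max z x0"])
    show "(\<lambda>n. max (X n) x0) \<longlonglongrightarrow> x" if "X \<longlonglongrightarrow> x" for X
      using tendsto_max[OF that tendsto_const[of x0]] x0 by (simp add: max_def)
    show "eventually (\<lambda>n. max (X n) x0 = X n) sequentially" if "X \<longlonglongrightarrow> x" for X
      using order_tendstoD(1)[OF that x0(2)] by eventually_elim simp
  qed (use x0 x xs_nonneg in auto)
  then show ?thesis by blast
qed

end

section \<open>Smoothness of the boundary and failure of smoothness on the exit boundary\<close>

context poisson_disorder_exit
begin

text \<open>Above the level \<open>phi_d\<close> the discounted cost along the flow is affine in the initial point. The
  averages \<open>F t p / t\<close> extend continuously to \<open>t = 0\<close>, where they equal \<open>g p\<close>.\<close>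

definition coefx :: "real \<Rightarrow> real" where "coefx u = exp (- ((mu - 1) * u))"
definition coefy :: "real \<Rightarrow> real" where "coefy u = exp (- ((mu + 1) * u))"
definition coef1 :: "real \<Rightarrow> real" where
  "coef1 u = k0 * coefx u - \<phi>d * coefy u + (\<phi>d - k0 - cost_shift) * exp (- ((lam + mu) * u))"

definition avg :: "(real \<Rightarrow> real) \<Rightarrow> real \<Rightarrow> real" where
  "avg f t = (if t = 0 then f 0 else integral {0..t} f / t)"

lemma continuous_on_coef: "continuous_on U coefx" "continuous_on U coefy" "continuous_on U coef1"
  unfolding coefx_def[abs_def] coefy_def[abs_def] coef1_def[abs_def] by (intro continuous_intros)+

lemma continuous_on_avg: "continuous_on {0..horizon} (avg coefx)" "continuous_on {0..horizon} (avg coefy)" "continuous_on {0..horizon} (avg coef1)"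
  unfolding avg_def[abs_def] by (intro continuous_on_average continuous_on_coef horizon_pos)+

lemma avg_coefy_pos:
  assumes "0 \<le> t"
  shows "0 < avg coefy t"
proof (cases "t = 0")
  case False
  then have t: "0 < t" using assms by simp
  have "integral {0..t} (\<lambda>u. exp (- ((mu + 1) * t))) \<le> integral {0..t} coefy"
  proof (rule integral_le)
    show "coefy integrable_on {0..t}" by (intro integrable_continuous_interval continuous_on_coef)
    show "exp (- ((mu + 1) * t)) \<le> coefy u" if "u \<in> {0..t}" for u
      using that mu_gt_1 by (simp add: coefy_def)
  qed (rule integrable_const_ivl)
  then have "exp (- ((mu + 1) * t)) * t \<le> integral {0..t} coefy" using t by (simp add: mult.commute)
  moreover have "0 < exp (- ((mu + 1) * t)) * t" using t by simp
  ultimately have "0 < integral {0..t} coefy" by linarith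
  then show ?thesis using t by (simp add: avg_def)
qed (simp add: avg_def coefy_def)

definition avg_cost :: "real \<Rightarrow> real \<times> real \<Rightarrow> real" where
  "avg_cost t p = avg coefx t * fst p + avg coefy t * snd p + avg coef1 t"

lemma discounted_g_flow: "exp (- ((lam + mu) * u)) * g (fl u p) = coefx u * fst p + coefy u * snd p + coef1 u"
proof -
  have "exp (- ((lam + mu) * u)) * exp ((lam + 1) * u) = coefx u"
    unfolding coefx_def mult_exp_exp by (rule arg_cong[where f = exp]) (simp add: algebra_simps)
  moreover have "exp (- ((lam + mu) * u)) * exp (- ((1 - lam) * u)) = coefy u"
    unfolding coefy_def mult_exp_exp by (rule arg_cong[where f = exp]) (simp add: algebra_simps)
  moreover have "e * ((x + k) * a + (y - d) * b + r) = (e * a) * x + (e * b) * y + (k * (e * a) - d * (e * b) + r * e)"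
    for e x k a y d b r :: real by (simp add: algebra_simps)
  ultimately show ?thesis unfolding g_flow coef1_def by simp
qed

lemma avg_cost_0: "avg_cost 0 p = g p"
  using discounted_g_flow[of 0 p] by (simp add: avg_cost_def avg_def)

lemma path_cost_eq_avg:
  assumes p: "p \<in> quadrant" "\<phi>d \<le> snd p" and t: "0 < t"
  shows "F t p = t * avg_cost t p"
proof -
  have i: "coefx integrable_on {0..t}" "coefy integrable_on {0..t}" "coef1 integrable_on {0..t}"
    by (intro integrable_continuous_interval continuous_on_coef)+
  have "F t p = integral {0..t} (\<lambda>u. coefx u * fst p + coefy u * snd p + coef1 u)"
    unfolding path_cost_def
    by (rule Henstock_Kurzweil_Integration.integral_cong) (simp add: G_flow_eq_g[OF p] discounted_g_flow)
  also have "\<dots> = integral {0..t} coefx * fst p + integral {0..t} coefy * snd p + integral {0..t} coef1"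
    using has_integral_add[OF has_integral_add[OF has_integral_mult_left[OF integrable_integral[OF i(1)], of "fst p"]
        has_integral_mult_left[OF integrable_integral[OF i(2)], of "snd p"]] integrable_integral[OF i(3)]]
    by (rule integral_unique)
  also have "\<dots> = t * avg_cost t p" using t by (simp add: avg_cost_def avg_def distrib_left)
  finally show ?thesis .
qed

text \<open>The height at which the affine function \<open>avg_cost t\<close> changes sign above
  \<open>x\<close>.\<close>

definition edge :: "real \<Rightarrow> real \<Rightarrow> real" where
  "edge t x = - (avg coefx t / avg coefy t) * x - avg coef1 t / avg coefy t"

lemma avg_cost_nonneg_iff:
  assumes "0 \<le> t"
  shows "0 \<le> avg_cost t (x, y) \<longleftrightarrow> edge t x \<le> y" "avg_cost t (x, edge t x) = 0"
  using avg_coefy_pos[OF assms] by (auto simp: avg_cost_def edge_def field_simps)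

lemma edge_0: "edge 0 x = cost_shift - x"
  using avg_cost_nonneg_iff(2)[of 0 x] by (simp add: avg_cost_0 g_eq)

text \<open>For positive \<open>t\<close> the conditions say that no path cost is negative. The
  limiting condition \<open>0 <= g\<close> at \<open>t = 0\<close> makes the set of times compact,
  so that a maximum of \<open>edge\<close> is attained.\<close>

lemma high_val_0_iff:
  assumes p: "(x, y) \<in> quadrant" "\<phi>d \<le> y"
  shows "val (x, y) = 0 \<longleftrightarrow> (\<forall>t\<in>{0..horizon}. edge t x \<le> y)"
proof
  assume v: "val (x, y) = 0"
  show "\<forall>t\<in>{0..horizon}. edge t x \<le> y"
  proof
    fix t assume t: "t \<in> {0..horizon}"
    have "0 \<le> avg_cost t (x, y)"
    proof (cases "t = 0")
      case True
      then show ?thesis using g_nonneg_of_val_0[OF p(1) v] G_eq_g[OF p(1)] p by (simp add: avg_cost_0)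
    next
      case False
      then have t0: "0 < t" using t by simp
      have "0 \<le> t * avg_cost t (x, y)"
        using path_cost_nonneg[OF p(1) v, of t] path_cost_eq_avg[OF p(1) _ t0] p t0 by simp
      then show ?thesis using t0 by (simp add: zero_le_mult_iff)
    qed
    then show "edge t x \<le> y" using avg_cost_nonneg_iff(1)[of t] t by simp
  qed
next
  assume e: "\<forall>t\<in>{0..horizon}. edge t x \<le> y"
  obtain t where t: "t \<in> {0..horizon}" "val (x, y) = F t (x, y)" using value_attained[OF p(1)] .
  have "0 \<le> F t (x, y)"
  proof (cases "t = 0")
    case False
    then have t0: "0 < t" using t by simp
    have "0 \<le> avg_cost t (x, y)" using avg_cost_nonneg_iff(1)[of t] t e by simp
    then show ?thesis using path_cost_eq_avg[OF p(1) _ t0] p t0 by simp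
  qed simp
  then show "val (x, y) = 0" using t w_le_0[OF p(1)] by simp
qed

lemma continuous_on_edge_slope: "continuous_on {0..horizon} (\<lambda>t. - (avg coefx t / avg coefy t))"
  by (intro continuous_intros continuous_on_avg) (use avg_coefy_pos in fastforce)

lemma continuous_on_edge: "continuous_on {0..horizon} (\<lambda>t. edge t x)"
  unfolding edge_def by (intro continuous_intros continuous_on_avg) (use avg_coefy_pos in fastforce)+

lemma edge_diff: "edge t x - edge t y = - (avg coefx t / avg coefy t) * (x - y)"
  unfolding edge_def right_diff_distrib by simp

text \<open>At these \<open>x\<close> already \<open>edge 0 x = cost_shift - x\<close> exceeds
  \<open>phi_d\<close>, so the maximum lies in the range where \<open>high_val_0_iff\<close> is
  valid; below \<open>phi_d\<close> the running cost is negative and stopping is not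
  optimal.\<close>

lemma left_bdry_edge:
  assumes x: "0 \<le> x" "x < cost_shift - \<phi>d"
  shows "\<And>t. t \<in> {0..horizon} \<Longrightarrow> edge t x \<le> bdry x" and "\<exists>t\<in>{0..horizon}. edge t x = bdry x" and "\<phi>d < bdry x"
proof -
  obtain s where s: "s \<in> {0..horizon}" "\<forall>t\<in>{0..horizon}. edge t x \<le> edge s x"
    using continuous_attains_sup[OF compact_Icc _ continuous_on_edge[of x]] horizon_pos by auto
  have "edge 0 x \<le> edge s x" using s horizon_pos by auto
  then have gt: "\<phi>d < edge s x" using x by (simp add: edge_0)
  have "bdry x = edge s x"
  proof (rule bdryI[OF x(1)])
    show "0 \<le> edge s x" using gt phi_d_pos by simp
    fix y :: real assume y: "0 \<le> y"
    have p: "(x, y) \<in> quadrant" using x y by (simp add: quadrant_iff)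
    show "val (x, y) = 0 \<longleftrightarrow> edge s x \<le> y"
    proof (cases "\<phi>d \<le> y")
      case True
      then show ?thesis using high_val_0_iff[OF p True] s by fastforce
    next
      case False
      then have "g (x, y) < 0" using x by (simp add: g_eq)
      then have "val (x, y) \<noteq> 0" using val_neg_of_G_neg[OF p] G_le_g[OF p] by force
      then show ?thesis using False gt by simp
    qed
  qed
  then show "\<And>t. t \<in> {0..horizon} \<Longrightarrow> edge t x \<le> bdry x" "\<exists>t\<in>{0..horizon}. edge t x = bdry x" "\<phi>d < bdry x"
    using s gt by auto
qed

lemma left_contact:
  assumes x: "0 \<le> x" "x < cost_shift - \<phi>d" and t: "0 < t" "edge t x = bdry x"
  shows "(x, bdry x) \<in> exits" "F t (x, bdry x) = 0"
proof -
  have p: "(x, bdry x) \<in> quadrant" using x bdry_nonneg by (simp add: quadrant_iff)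
  show F: "F t (x, bdry x) = 0"
    using path_cost_eq_avg[OF p _ t(1)] left_bdry_edge(3)[OF x] avg_cost_nonneg_iff(2)[of t x] t by simp
  show "(x, bdry x) \<in> exits" by (rule exitsI[OF p val_bdry[OF x(1)] t(1) F])
qed

text \<open>Positive maximisers are positive minimisers of the path cost, which are unique. A
  maximiser at 0 means \<open>g = 0\<close> on the boundary, whereas a further one would make the
  point an exit, where \<open>g\<close> is positive.\<close>

lemma left_maximizer_unique:
  assumes x: "0 \<le> x" "x < cost_shift - \<phi>d" and s: "0 \<le> s" "edge s x = bdry x" and t: "0 \<le> t" "edge t x = bdry x"
  shows "s = t"
proof -
  have p: "(x, bdry x) \<in> quadrant" using x bdry_nonneg by (simp add: quadrant_iff)
  have *: False if st: "0 \<le> s" "s < t" "edge s x = bdry x" "edge t x = bdry x" for s t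
  proof (cases "s = 0")
    case True
    then have "g (x, bdry x) = 0" using avg_cost_nonneg_iff(2)[of 0 x] st by (simp add: avg_cost_0)
    moreover have "0 < g (x, bdry x)" using exits_contact(2)[OF left_contact(1)[OF x, of t]] st True by simp
    ultimately show False by simp
  next
    case False
    then have "F s (x, bdry x) = val (x, bdry x)" "F t (x, bdry x) = 0"
      using left_contact(2)[OF x, of s] left_contact(2)[OF x, of t] st val_bdry[OF x(1)] by auto
    then show False using positive_minimizer_unique[OF p, of s t] st False val_bdry[OF x(1)] by simp
  qed
  show ?thesis using *[of s t] *[of t s] s t by (cases s t rule: linorder_cases) auto
qed

lemma abs_diff_between_slopes:
  fixes a b e d r :: real
  assumes "r \<le> a * d" "b * d \<le> r"
  shows "\<bar>r - e * d\<bar> \<le> (\<bar>a - e\<bar> + \<bar>b - e\<bar>) * \<bar>d\<bar>"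
proof -
  have "(a - e) * d \<le> \<bar>a - e\<bar> * \<bar>d\<bar>" "- ((b - e) * d) \<le> \<bar>b - e\<bar> * \<bar>d\<bar>"
    unfolding abs_mult[symmetric] by (rule abs_ge_self, rule abs_ge_minus_self)
  moreover have "0 \<le> \<bar>a - e\<bar> * \<bar>d\<bar>" "0 \<le> \<bar>b - e\<bar> * \<bar>d\<bar>" by simp_all
  ultimately show ?thesis using assms unfolding left_diff_distrib distrib_right by linarith
qed

text \<open>Danskin's argument for a maximum of lines: an increment of \<open>bdry\<close> lies
  between those of the lines that are maximal at the two points, and both slopes tend to that of the
  unique maximal line at \<open>x\<close>.\<close>

lemma bdry_strict_deriv_left:
  assumes x: "0 \<le> x" "x < cost_shift - \<phi>d"
  shows "\<exists>a. strict_deriv bdry {0..\<xi>} x a"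
proof -
  let ?\<alpha> = "\<lambda>t. - (avg coefx t / avg coefy t)"
  obtain ts where ts: "ts \<in> {0..horizon}" "edge ts x = bdry x" using left_bdry_edge(2)[OF x] by blast
  obtain Ms where Ms: "\<And>t. t \<in> {0..horizon} \<Longrightarrow> \<bar>?\<alpha> t\<bar> \<le> Ms"
  proof -
    have "compact ((\<lambda>t. ?\<alpha> t) ` {0..horizon})" by (intro compact_continuous_image continuous_on_edge_slope compact_Icc)
    then have "bounded ((\<lambda>t. ?\<alpha> t) ` {0..horizon})" by (rule compact_imp_bounded)
    then show ?thesis using that unfolding bounded_iff real_norm_def by blast
  qed
  define x1 where "x1 = (x + (cost_shift - \<phi>d)) / 2"
  have x1: "x < x1" "x1 < cost_shift - \<phi>d" using x by (auto simp: x1_def)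
  have maxi: "(\<lambda>n. t n) \<longlonglongrightarrow> ts"
    if X: "\<And>n. X n \<in> {0..x1}" "X \<longlonglongrightarrow> x" and t: "\<And>n. t n \<in> {0..horizon}" "\<And>n. edge (t n) (X n) = bdry (X n)" for X t
  proof (rule unique_minimizer_tendsto[where K = "{0..horizon}" and f = "\<lambda>t. - edge t x"])
    show "continuous_on {0..horizon} (\<lambda>t. - edge t x)" by (intro continuous_on_minus continuous_on_edge)
    show "s = ts" if s: "s \<in> {0..horizon}" "- edge s x \<le> - edge ts x" for s
    proof (rule left_maximizer_unique[OF x])
      show "edge s x = bdry x" using left_bdry_edge(1)[OF x s(1)] s(2) ts(2) by linarith
    qed (use s(1) ts in simp_all)
    have bd: "\<bar>edge s (X n) - edge s x\<bar> \<le> Ms * \<bar>X n - x\<bar>" if "s \<in> {0..horizon}" for s n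
      unfolding edge_diff abs_mult by (intro mult_right_mono Ms that) simp
    have Xn: "0 \<le> X n" "X n < cost_shift - \<phi>d" for n using X(1)[of n] x1 by auto
    have le: "edge ts x - 2 * (Ms * \<bar>X n - x\<bar>) \<le> edge (t n) x" for n
      using bd[OF ts(1), of n] bd[OF t(1)[of n], of n] left_bdry_edge(1)[OF Xn ts(1), of n] t(2)[of n] by linarith
    have "(\<lambda>n. edge ts x - 2 * (Ms * \<bar>X n - x\<bar>)) \<longlonglongrightarrow> edge ts x - 2 * (Ms * \<bar>x - x\<bar>)"
      by (intro tendsto_diff tendsto_mult tendsto_const tendsto_rabs X)
    then have lim: "(\<lambda>n. edge ts x - 2 * (Ms * \<bar>X n - x\<bar>)) \<longlonglongrightarrow> edge ts x" by simp
    have "(\<lambda>n. edge (t n) x) \<longlonglongrightarrow> edge ts x"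
    proof (rule real_tendsto_sandwich[OF _ _ lim tendsto_const])
      show "eventually (\<lambda>n. edge ts x - 2 * (Ms * \<bar>X n - x\<bar>) \<le> edge (t n) x) sequentially" using le by simp
      show "eventually (\<lambda>n. edge (t n) x \<le> edge ts x) sequentially"
        using left_bdry_edge(1)[OF x t(1)] ts(2) by simp
    qed
    then show "(\<lambda>n. - edge (t n) x) \<longlonglongrightarrow> - edge ts x" by (rule tendsto_minus)
  qed (use t in auto)
  have slope_lim: "(\<lambda>n. ?\<alpha> (t n)) \<longlonglongrightarrow> ?\<alpha> ts" if t: "\<And>n. t n \<in> {0..horizon}" "(\<lambda>n. t n) \<longlonglongrightarrow> ts" for t
    by (rule continuous_on_tendsto_compose[OF continuous_on_edge_slope t(2) ts(1)]) (use t(1) in simp)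
  have "strict_deriv bdry {0..x1} x (?\<alpha> ts)"
    unfolding strict_deriv_def
  proof (intro allI impI)
    fix X Y assume XY: "range X \<subseteq> {0..x1}" "range Y \<subseteq> {0..x1}" and lim: "X \<longlonglongrightarrow> x" "Y \<longlonglongrightarrow> x"
    have I: "X n \<in> {0..x1}" "Y n \<in> {0..x1}" for n using XY by blast+
    have X: "0 \<le> X n" "X n < cost_shift - \<phi>d" and Y: "0 \<le> Y n" "Y n < cost_shift - \<phi>d" for n
      using I[of n] x1 by auto
    have "\<exists>s. \<forall>n. s n \<in> {0..horizon} \<and> edge (s n) (X n) = bdry (X n)"
      by (rule choice) (use left_bdry_edge(2)[OF X] in blast)
    then obtain s where s: "\<And>n. s n \<in> {0..horizon}" "\<And>n. edge (s n) (X n) = bdry (X n)" by blast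
    have "\<exists>t. \<forall>n. t n \<in> {0..horizon} \<and> edge (t n) (Y n) = bdry (Y n)"
      by (rule choice) (use left_bdry_edge(2)[OF Y] in blast)
    then obtain t where t: "\<And>n. t n \<in> {0..horizon}" "\<And>n. edge (t n) (Y n) = bdry (Y n)" by blast
    let ?e = "\<lambda>n. \<bar>?\<alpha> (s n) - ?\<alpha> ts\<bar> + \<bar>?\<alpha> (t n) - ?\<alpha> ts\<bar>"
    have "?e \<longlonglongrightarrow> \<bar>?\<alpha> ts - ?\<alpha> ts\<bar> + \<bar>?\<alpha> ts - ?\<alpha> ts\<bar>"
      by (intro tendsto_add tendsto_rabs tendsto_diff tendsto_const slope_lim s(1) t(1)
          maxi[OF I(1) lim(1) s] maxi[OF I(2) lim(2) t])
    then have e0: "?e \<longlonglongrightarrow> 0" by simp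
    have "norm ((bdry (X n) - bdry (Y n) - ?\<alpha> ts * (X n - Y n)) / (X n - Y n)) \<le> ?e n" for n
    proof (cases "X n = Y n")
      case False
      let ?d = "X n - Y n"
      have up: "bdry (X n) - bdry (Y n) \<le> ?\<alpha> (s n) * ?d"
        using left_bdry_edge(1)[OF Y s(1), of n n] s(2)[of n] edge_diff[of "s n" "X n" "Y n"] by linarith
      have low: "?\<alpha> (t n) * ?d \<le> bdry (X n) - bdry (Y n)"
        using left_bdry_edge(1)[OF X t(1), of n n] t(2)[of n] edge_diff[of "t n" "X n" "Y n"] by linarith
      have "\<bar>bdry (X n) - bdry (Y n) - ?\<alpha> ts * ?d\<bar> \<le> ?e n * \<bar>?d\<bar>"
        by (rule abs_diff_between_slopes[OF up low])
      then show ?thesis using False by (simp add: abs_divide pos_divide_le_eq)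
    qed simp
    then show "(\<lambda>n. (bdry (X n) - bdry (Y n) - ?\<alpha> ts * (X n - Y n)) / (X n - Y n)) \<longlonglongrightarrow> 0"
      by (intro Lim_null_comparison[OF always_eventually e0]) blast
  qed
  then have "strict_deriv bdry {0..\<xi>} x (?\<alpha> ts)"
  proof (rule strict_deriv_local[where proj = "\<lambda>z. min z x1"])
    show "(\<lambda>n. min (X n) x1) \<longlonglongrightarrow> x" if "X \<longlonglongrightarrow> x" for X
      using tendsto_min[OF that tendsto_const[of x1]] x1 by (simp add: min_def)
    show "eventually (\<lambda>n. min (X n) x1 = X n) sequentially" if "X \<longlonglongrightarrow> x" for X
      using order_tendstoD(2)[OF that x1(1)] by eventually_elim simp
  qed (use x x1 in auto)
  then show ?thesis by blast
qed

lemma bdry_continuously_differentiable: "continuously_differentiable_on bdry {0..\<xi>} {0..\<xi>}"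
proof -
  have "\<exists>a. strict_deriv bdry {0..\<xi>} x a" if x: "x \<in> {0..\<xi>}" for x
  proof (cases "x < cost_shift - \<phi>d")
    case True
    then show ?thesis using bdry_strict_deriv_left[of x] x by simp
  next
    case False
    \<comment> \<open>The two ranges overlap, since
      \<open>xs = cost_shift - ys < cost_shift - \<phi>d\<close>.\<close>
    then have "xs < x" using star_sum phi_d_less_ys by simp
    then show ?thesis using bdry_strict_deriv_right[of x] x by simp
  qed
  then obtain f' where "\<And>x. x \<in> {0..\<xi>} \<Longrightarrow> strict_deriv bdry {0..\<xi>} x (f' x)" by metis
  moreover have "0 < \<xi>" using xs_less_\<xi> xs_nonneg by simp
  ultimately show ?thesis by (intro strict_deriv_continuously_differentiable_on)
qed

lemma stopping_region_eq: "stopping_region val = {(x, y) \<in> quadrant. bdry x \<le> y}"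
  using bdry_iff by (auto simp: stopping_region_val quadrant_iff)

text \<open>The boundary point above \<open>x = 0\<close> is an exit unless the maximal line belongs
  to the time 0. That would put \<open>(0, cost_shift)\<close> into the stopping region although the
  running cost is 0 there and decreases along the flow.\<close>

lemma exits_nonempty:
  assumes "0 < xs"
  shows "exits \<noteq> {}"
proof -
  have x: "(0::real) \<le> 0" "0 < cost_shift - \<phi>d" using phi_d_less_cost_shift by auto
  obtain t where t: "t \<in> {0..horizon}" "edge t 0 = bdry 0" using left_bdry_edge(2)[OF x] by blast
  have "t \<noteq> 0"
  proof
    assume "t = 0"
    then have b: "bdry 0 = cost_shift" using t by (simp add: edge_0)
    let ?p = "(0::real, cost_shift)"
    have p: "?p \<in> quadrant" "\<phi>d \<le> snd ?p" using cost_shift_pos phi_d_less_cost_shift by (auto simp: quadrant_iff)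
    have v: "val ?p = 0" using val_bdry[of 0] b by simp
    \<comment> \<open>By \<open>star_sum\<close> and \<open>star_slope\<close> the slope at
      \<open>(0, cost_shift)\<close> is \<open>- 2 * xs\<close>.\<close>
    have "(1 - lam) * cost_shift = (1 - lam) * xs + (1 - lam) * ys" by (simp flip: star_sum add: distrib_left)
    also have "\<dots> = 2 * xs + lam * sqrt 2" using star_slope by (simp add: algebra_simps)
    finally have "slope ?p 0 < 0" using assms by (simp add: slope_0)
    from DERIV_neg_dec_right[OF g_flow_deriv[of ?p 0] this]
    obtain d where d: "0 < d" "\<And>h. 0 < h \<Longrightarrow> h < d \<Longrightarrow> g (fl h ?p) < g ?p" by auto
    obtain z where z: "0 < z" "z < d" "F d ?p - F 0 ?p = (d - 0) * (exp (- ((lam + mu) * z)) * G (fl z ?p))"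
      using path_cost_MVT[OF p(1) order_refl d(1)] by blast
    have "g ?p = 0" by (simp add: g_eq)
    then have "G (fl z ?p) < 0" using d(2)[OF z(1,2)] G_flow_eq_g[OF p, of z] z by simp
    then have "F d ?p < 0" using G_sign_of_path_cost(2)[OF z(3)] d(1) by simp
    then show False using path_cost_nonneg[OF p(1) v, of d] d by simp
  qed
  then show ?thesis using left_contact(1)[OF x, of t] t by auto
qed

lemma val_continuously_differentiable: "continuously_differentiable_on val quadrant (quadrant - exits)"
proof -
  have "\<exists>ab. strict_diff val p (fst ab) (snd ab)" if "p \<in> quadrant - exits" for p
    using val_strict_diff[of p] that by auto
  then obtain ab where ab: "\<And>p. p \<in> quadrant - exits \<Longrightarrow> strict_diff val p (fst (ab p)) (snd (ab p))" by metis
  have c: "continuous_on (quadrant - exits) (\<lambda>p. fst (ab p))" "continuous_on (quadrant - exits) (\<lambda>p. snd (ab p))"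
    by (rule strict_diff_continuous_on[OF ab Diff_subset], assumption)+
  show ?thesis
    unfolding continuously_differentiable_on_def
  proof (intro exI[of _ "\<lambda>p. fst (ab p) *\<^sub>R fst_blinfun + snd (ab p) *\<^sub>R snd_blinfun"] conjI ballI)
    show "continuous_on (quadrant - exits) (\<lambda>p. fst (ab p) *\<^sub>R (fst_blinfun :: (real \<times> real) \<Rightarrow>\<^sub>L real) + snd (ab p) *\<^sub>R snd_blinfun)"
      by (intro continuous_on_add continuous_on_scaleR c continuous_on_const)
    fix p assume p: "p \<in> quadrant - exits"
    show "(val has_derivative blinfun_apply (fst (ab p) *\<^sub>R fst_blinfun + snd (ab p) *\<^sub>R snd_blinfun)) (at p within quadrant)"
      by (rule has_derivative_eq_rhs[OF strict_diff_has_derivative[OF ab[OF p]]])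
         (use p in \<open>auto simp: fun_eq_iff blinfun.add_left blinfun.scaleR_left\<close>)
  qed
qed

lemma derivative_along_curve:
  assumes D: "(w has_derivative D) (at p within quadrant)" and \<phi>: "(\<phi> has_vector_derivative v) (at 0 within {0..e})"
    and Q: "\<And>s. s \<in> {0..e} \<Longrightarrow> \<phi> s \<in> quadrant" "\<phi> 0 = p"
  shows "((\<lambda>s. (w (\<phi> s) - w p) / s) \<longlongrightarrow> D v) (at 0 within {0..e})"
proof -
  have "\<phi> ` {0..e} \<subseteq> quadrant" using Q(1) by blast
  then have "(w has_derivative D) (at (\<phi> 0) within \<phi> ` {0..e})"
    using has_derivative_subset[OF D] unfolding Q(2) by blast
  from vector_derivative_diff_chain_within[OF \<phi> this]
  have "((\<lambda>s. w (\<phi> s)) has_real_derivative D v) (at 0 within {0..e})"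
    by (simp add: comp_def has_real_derivative_iff_has_vector_derivative)
  then show ?thesis by (simp add: has_field_derivative_iff Q)
qed

lemma val_not_differentiable:
  assumes E: "p \<in> exits"
  shows "\<not> val differentiable (at p within quadrant)"
proof
  assume "val differentiable (at p within quadrant)"
  then obtain D where D: "(val has_derivative D) (at p within quadrant)" by (auto simp: differentiable_def)
  have p: "p \<in> quadrant" "val p = 0" using exitsD[OF E] by auto
  interpret D: linear D using has_derivative_linear[OF D] .
  have D0: "D v = 0" if v: "v \<in> quadrant" for v
  proof -
    have c: "((\<lambda>s. p + s *\<^sub>R v) has_vector_derivative v) (at 0 within {0..1})"
      by (auto intro!: derivative_eq_intros)
    have Q: "p + s *\<^sub>R v \<in> quadrant" "val (p + s *\<^sub>R v) = 0" if "s \<in> {0..1}" for s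
    proof -
      have le: "p \<le> p + s *\<^sub>R v" using that v by (auto simp: less_eq_prod_def quadrant_iff)
      then show "p + s *\<^sub>R v \<in> quadrant" "val (p + s *\<^sub>R v) = 0" using quadrant_up[OF p(1)] val_0_up[OF p] by auto
    qed
    have "((\<lambda>s. (val (p + s *\<^sub>R v) - val p) / s) \<longlongrightarrow> D v) (at 0 within {0..1})"
      by (rule derivative_along_curve[OF D c Q(1)]) auto
    moreover have "((\<lambda>s. (val (p + s *\<^sub>R v) - val p) / s) \<longlongrightarrow> 0) (at 0 within {0..1})"
      by (rule tendsto_eventually) (use Q(2) p in \<open>auto simp: eventually_at_filter\<close>)
    moreover have "at (0::real) within {0..1} \<noteq> bot" by (simp add: trivial_limit_within islimpt_Icc)
    ultimately show ?thesis using tendsto_unique by blast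
  qed
  \<comment> \<open>The flow at an exit point moves downwards, out of the cone of directions treated
    so far; linearity extends the conclusion to the whole plane, which the quadrant spans.\<close>
  have D0: "D v = 0" for v
  proof -
    have "v = fst v *\<^sub>R (1, 0) + snd v *\<^sub>R (0, 1)" by (simp add: prod_eq_iff)
    then have "D v = fst v *\<^sub>R D (1, 0) + snd v *\<^sub>R D (0, 1)" using D.add D.scaleR by metis
    then show ?thesis using D0[of "(1, 0)"] D0[of "(0, 1)"] by (simp add: quadrant_iff)
  qed
  obtain T where T: "0 < T" "F T p = 0" using exits_contact(1)[OF E] by blast
  have "((\<lambda>s. (fst p + k0) * exp ((lam + 1) * s) - k0) has_vector_derivative (fst p + k0) * (lam + 1)) (at 0 within {0..T})"
    "((\<lambda>s. \<phi>d + (snd p - \<phi>d) * exp (- ((1 - lam) * s))) has_vector_derivative - ((snd p - \<phi>d) * (1 - lam))) (at 0 within {0..T})"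
    unfolding has_real_derivative_iff_has_vector_derivative[symmetric] by (auto intro!: derivative_eq_intros simp: algebra_simps)
  from has_vector_derivative_Pair[OF this] obtain v where v: "((\<lambda>s. fl s p) has_vector_derivative v) (at 0 within {0..T})"
    unfolding fst_flow_k0[symmetric] snd_flow[symmetric] by auto
  have 1: "((\<lambda>s. (val (fl s p) - val p) / s) \<longlongrightarrow> D v) (at 0 within {0..T})"
    by (rule derivative_along_curve[OF D v]) (auto intro: flow_in_quadrant p)
  have "((\<lambda>t. F t p) has_real_derivative exp (- ((lam + mu) * 0)) * G (fl 0 p)) (at 0 within {0..T})"
    using T by (intro path_cost_has_derivative p) auto
  then have 2: "((\<lambda>s. F s p / s) \<longlongrightarrow> G p) (at 0 within {0..T})" by (simp add: has_field_derivative_iff)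
  \<comment> \<open>Splitting \<open>F T p = 0\<close> at \<open>s\<close> leaves a nonpositive
    remainder after \<open>s\<close>, and removing its discount only lowers it. So
    \<open>val (fl s p)\<close> is at most \<open>- F s p\<close>; division by \<open>s\<close> and
    the limit give the claim.\<close>
  have "D v + G p \<le> 0"
  proof (rule tendsto_upperbound[OF tendsto_add[OF 1 2]])
    have "(val (fl s p) - val p) / s + F s p / s \<le> 0" if s: "0 < s" "s \<le> T" for s
    proof -
      have fq: "fl s p \<in> quadrant" using s by (intro flow_in_quadrant p) auto
      have "F (s + (T - s)) p = F s p + exp (- ((lam + mu) * s)) * F (T - s) (fl s p)"
        using s by (intro path_cost_add p) auto
      then have 3: "F s p + exp (- ((lam + mu) * s)) * F (T - s) (fl s p) = 0" using T by simp
      have Fs: "0 \<le> F s p" using path_cost_nonneg[OF p] s by simp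
      then have neg: "F (T - s) (fl s p) \<le> 0" using 3 by (smt (verit) exp_gt_zero mult_pos_pos)
      have "exp (- ((lam + mu) * s)) \<le> 1" using s lam_pos mu_gt_1 by simp
      then have "1 * F (T - s) (fl s p) \<le> exp (- ((lam + mu) * s)) * F (T - s) (fl s p)"
        using neg by (rule mult_right_mono_neg)
      then have "F (T - s) (fl s p) + F s p \<le> 0" using 3 by simp
      moreover have "val (fl s p) \<le> F (T - s) (fl s p)" using s by (intro value_le fq) auto
      ultimately have "val (fl s p) - val p + F s p \<le> 0" using p by simp
      then show ?thesis using s by (simp add: divide_nonpos_pos flip: add_divide_distrib)
    qed
    then show "eventually (\<lambda>s. (val (fl s p) - val p) / s + F s p / s \<le> 0) (at 0 within {0..T})"
      unfolding eventually_at_filter by (intro always_eventually) auto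
    show "at (0::real) within {0..T} \<noteq> bot" using T by (simp add: trivial_limit_within islimpt_Icc)
  qed
  then have "G p \<le> 0" using D0 by simp
  moreover have "G p = g p" using exits_high[OF E] by (intro G_eq_g p) simp
  ultimately show False using exits_contact(2)[OF E] by simp
qed

end

text \<open>The premise in the third conjunct excludes the case \<open>phi0_star lam c = 0\<close>.
  There the exit boundary is empty, because its points lie in the quadrant strictly to the left of
  \<open>phi0_star\<close> (\<open>exits_left\<close>).\<close>

theorem corollary11p23:
  fixes M :: "'a measure"
    and N :: "real \<Rightarrow> 'a \<Rightarrow> nat" and \<sigma> :: "nat \<Rightarrow> 'a \<Rightarrow> real"
    and lam mu c m :: real
    and v :: "real \<times> real \<Rightarrow> real" and \<Gamma> :: "(real \<times> real) set"
    and \<gamma> :: "real \<Rightarrow> real" and \<xi> :: real and exit\<Gamma> :: "(real \<times> real) set"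
  defines "v \<equiv> value_function M N \<sigma> lam mu c m"
    and "\<Gamma> \<equiv> stopping_region v"
    and "\<gamma> \<equiv> boundary_function \<Gamma>"
    and "\<xi> \<equiv> support_end \<gamma>"
    and "exit\<Gamma> \<equiv> exit_boundary lam m \<Gamma>"
  assumes "mu > 1" and "c > 0" and "-1 < m" and "m < 1"
    and "poisson_process M mu N \<sigma>"
    and "0 < lam" and "lam < 1 - (1 + m) * (c / 2)"
    and "(mu + 1) / mu * phi_d lam m > phi1_bar lam c m"
    and "\<forall>(x, y) \<in> {(phi0_star lam c, phi1_star lam c), (0, phi1_bar lam c m)}.
           y < (mu + 1) / mu * a_0 lam c (mu / (mu - 1) * x)"
  shows "\<Gamma> = {(x, y) \<in> quadrant. \<gamma> x \<le> y}
    \<and> continuously_differentiable_on \<gamma> {0..\<xi>} {0..\<xi>}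
    \<and> (phi0_star lam c > 0 \<longrightarrow> exit\<Gamma> \<noteq> {})
    \<and> continuously_differentiable_on v quadrant (quadrant - exit\<Gamma>)
    \<and> (\<forall>p \<in> exit\<Gamma>. \<not> v differentiable (at p within quadrant))"
proof -
  have "0 < (1 + m) * (c / 2)" using \<open>-1 < m\<close> \<open>c > 0\<close> by simp
  then have "lam < 1" using \<open>lam < 1 - (1 + m) * (c / 2)\<close> by linarith
  then interpret ex: poisson_disorder_exit lam mu c m
    by unfold_locales (use assms(6-) in auto)
  \<comment> \<open>The two functions are compared on the quadrant only, which suffices because all
    regions and derivatives are taken within it.\<close>
  have v: "v p = ex.val p" if "p \<in> quadrant" for p
  proof -
    interpret pr: poisson_disorder_process lam mu c m M N \<sigma> p
      by unfold_locales (use that \<open>poisson_process M mu N \<sigma>\<close> in auto)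
    show ?thesis unfolding v_def by (rule pr.value_function_eq_val)
  qed
  have \<Gamma>: "\<Gamma> = stopping_region ex.val"
    using v by (auto simp: \<Gamma>_def stopping_region_def)
  have \<gamma>: "\<gamma> = ex.bdry" by (simp add: \<gamma>_def \<Gamma> ex.bdry_def)
  have \<xi>: "\<xi> = ex.\<xi>" by (simp add: \<xi>_def \<gamma> ex.\<xi>_def)
  have exit: "exit\<Gamma> = ex.exits" by (simp add: exit\<Gamma>_def \<Gamma> ex.exits_def)
  have "continuously_differentiable_on v quadrant (quadrant - ex.exits)"
  proof -
    obtain f' where f': "continuous_on (quadrant - ex.exits) f'"
        "\<And>p. p \<in> quadrant - ex.exits \<Longrightarrow> (ex.val has_derivative blinfun_apply (f' p)) (at p within quadrant)"
      using ex.val_continuously_differentiable unfolding continuously_differentiable_on_def by blast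
    have "(v has_derivative blinfun_apply (f' p)) (at p within quadrant)" if "p \<in> quadrant - ex.exits" for p
      using has_derivative_transform[OF _ v f'(2)[OF that]] that by blast
    then show ?thesis using f'(1) unfolding continuously_differentiable_on_def by blast
  qed
  moreover have "\<not> v differentiable (at p within quadrant)" if p: "p \<in> ex.exits" for p
  proof
    assume "v differentiable (at p within quadrant)"
    then obtain D where "(v has_derivative D) (at p within quadrant)" by (auto simp: differentiable_def)
    then have "(ex.val has_derivative D) (at p within quadrant)"
      by (rule has_derivative_transform[rotated 2]) (use v ex.exitsD(1)[OF p] in auto)
    then show False using ex.val_not_differentiable[OF p] by (auto simp: differentiable_def)
  qed
  ultimately show ?thesis
    unfolding \<Gamma> \<gamma> \<xi> exit
    using ex.stopping_region_eq ex.bdry_continuously_differentiable ex.exits_nonempty by blast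
qed


end
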